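(* Let $\bar\sigma:[0,1]^3\to[-1,1]$ be measurable and assume that for all $p\ge1$, $t>0$, $q\ge1$ and all finite sets $C_1,\dots,C_q\subset\{1,2,\dots\}$, $$\mathbb E\prod_{l\le q}\mathbb E'\prod_{i\in C_l}\bar\sigma_i=\mathbb E\,\frac{\prod_{l\le q}\mathbb E'\prod_{i\in C_l}\bar\sigma_i\,\exp tG_p(\bar\sigma(w,u,\cdot))}{\big(\mathbb E'\exp tG_p(\bar\sigma(w,u,\cdot))\big)^q}.$$ Then the following are equivalent: (1) the Ghirlanda–Guerra identities hold: for all $p\ge1$, all $n\ge1$ and every bounded continuous function $F$ of finitely many multi-overlaps $R^\infty_{l_1,\dots,l_k}$ with $k\ge1$ and $l_1,\dots,l_k\in\{1,\dots,n\}$, $$\mathbb EF(R^\infty_{1,n+1})^p=\frac1n\,\mathbb EF\,\mathbb E(R^\infty_{1,2})^p+\frac1n\sum_{l=2}^n\mathbb EF(R^\infty_{1,l})^p;$$ (2) for all $p\ge1$, the quantity $$\mathbb E\frac{G_p(\bar\sigma(w,u,\cdot))^2\exp tG_p(\bar\sigma(w,u,\cdot))}{\mathbb E'\exp tG_p(\bar\sigma(w,u,\cdot))}-\left(\mathbb E\frac{G_p(\bar\sigma(w,u,\cdot))\exp tG_p(\bar\sigma(w,u,\cdot))}{\mathbb E'\exp tG_p(\bar\sigma(w,u,\cdot))}\right)^2$$ is bounded uniformly over all $t>0$, in which case it is equal to $1$.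
   Context: $w,u,(u_l)_{l\ge1},(v_i)_{i\ge1}$ are i.i.d. uniform on $[0,1]$; $\mathbb E_v$ is the expectation in $v$ (uniform on $[0,1]$) only; $\bar\sigma_i=\bar\sigma(w,u,v_i)$. Multi-overlaps: $R^\infty_{l_1,\dots,l_k}=\mathbb E_v\bar\sigma(w,u_{l_1},v)\cdots\bar\sigma(w,u_{l_k},v)$ for all $k\ge1$ and all $l_1,\dots,l_k\ge1$; in particular $R^\infty_{l,l'}=\mathbb E_v\bar\sigma(w,u_l,v)\bar\sigma(w,u_{l'},v)$. For $w\in[0,1]$ and $p\ge1$, $g_p(\bar\sigma(w,u,\cdot))$ is a centered Gaussian process indexed by $u\in[0,1]$ with covariance $(\mathbb E_v\bar\sigma(w,u,v)\bar\sigma(w,u',v))^p$, and $G_p(\bar\sigma(w,u,\cdot))=g_p(\bar\sigma(w,u,\cdot))+z\big(1-(\mathbb E_v\bar\sigma(w,u,v)^2)^p\big)^{1/2}$ with $z$ standard Gaussian; the Gaussian randomness is independent of $u,(u_l),(v_i)$ (given $w$). $\mathbb E'$ is the expectation in $u$ and $z$ only; $\mathbb E$ is the expectation over all randomness. *)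

theory Defs
  imports "HOL-Probability.Probability"
begin

definition unif :: "real measure" where
  "unif = restrict_space lborel {0..1}"

definition std_gauss :: "real measure" where
  "std_gauss = density lborel std_normal_density"

text \<open>Normal law with mean \<open>m\<close> and standard deviation \<open>s \<ge> 0\<close>; for \<open>s = 0\<close> it is a point mass.\<close>

definition normal_law :: "real \<Rightarrow> real \<Rightarrow> real measure" where
  "normal_law m s = (if s = 0 then return borel m else density lborel (normal_density m s))"

definition gaussian_rv :: "'a measure \<Rightarrow> ('a \<Rightarrow> real) \<Rightarrow> bool" where
  "gaussian_rv M X \<longleftrightarrow>
     X \<in> borel_measurable M \<and> (\<exists>m s. s \<ge> 0 \<and> distr M borel X = normal_law m s)"

definition centered_gaussian_process ::
  "'a measure \<Rightarrow> 'i set \<Rightarrow> ('i \<Rightarrow> 'i \<Rightarrow> real) \<Rightarrow> ('i \<Rightarrow> 'a \<Rightarrow> real) \<Rightarrow> bool" where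
  "centered_gaussian_process M T K X \<longleftrightarrow>
     (\<forall>S a. finite S \<and> S \<subseteq> T \<longrightarrow> gaussian_rv M (\<lambda>\<omega>. \<Sum>i\<in>S. a i * X i \<omega>)) \<and>
     (\<forall>i\<in>T. (\<integral>\<omega>. X i \<omega> \<partial>M) = 0) \<and>
     (\<forall>i\<in>T. \<forall>j\<in>T. (\<integral>\<omega>. X i \<omega> * X j \<omega> \<partial>M) = K i j)"

text \<open>The function \<open>\<sigma>\<close> stands for \<open>\<sigma>(w, u, v)\<close>; only its values on the unit cube matter.\<close>

type_synonym spin_fun = "real \<Rightarrow> real \<Rightarrow> real \<Rightarrow> real"

definition overlap :: "spin_fun \<Rightarrow> real \<Rightarrow> real \<Rightarrow> real \<Rightarrow> real" where
  "overlap \<sigma> w u u' = (\<integral>v. \<sigma> w u v * \<sigma> w u' v \<partial>unif)"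

text \<open>The replica indices are given as a list, in which repetitions are allowed.\<close>

definition multi_overlap :: "spin_fun \<Rightarrow> real \<Rightarrow> (nat \<Rightarrow> real) \<Rightarrow> nat list \<Rightarrow> real" where
  "multi_overlap \<sigma> w us ls = (\<integral>v. (\<Prod>l\<leftarrow>ls. \<sigma> w (us l) v) \<partial>unif)"

text \<open>
  A realisation \<open>g p w u \<omega>\<close> of the processes \<open>g\<^sub>p(\<sigma>(w,u,\<cdot>))\<close> on a probability space \<open>P\<close>.
  The joint measurability is what makes integration over \<open>u\<close> and \<open>w\<close> meaningful.
\<close>

definition overlap_gaussian_family ::
  "spin_fun \<Rightarrow> 'a measure \<Rightarrow> (nat \<Rightarrow> real \<Rightarrow> real \<Rightarrow> 'a \<Rightarrow> real) \<Rightarrow> bool" where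
  "overlap_gaussian_family \<sigma> P g \<longleftrightarrow>
     prob_space P \<and>
     (\<forall>p\<ge>1.
        (\<lambda>(w, u, \<omega>). g p w u \<omega>) \<in> borel_measurable (unif \<Otimes>\<^sub>M unif \<Otimes>\<^sub>M P) \<and>
        (\<forall>w\<in>{0..1}.
           centered_gaussian_process P {0..1} (\<lambda>u u'. overlap \<sigma> w u u' ^ p) (g p w)))"

definition G_field ::
  "spin_fun \<Rightarrow> (nat \<Rightarrow> real \<Rightarrow> real \<Rightarrow> 'a \<Rightarrow> real) \<Rightarrow> nat \<Rightarrow> real \<Rightarrow> 'a \<Rightarrow> real \<Rightarrow> real \<Rightarrow> real"
  where
  "G_field \<sigma> g p w \<omega> u z = g p w u \<omega> + z * sqrt (1 - overlap \<sigma> w u u ^ p)"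

text \<open>
  The joint law of \<open>(w, \<omega>, u, z, (u\<^sub>l)\<^sub>l, (v\<^sub>i)\<^sub>i)\<close>, where \<open>\<omega>\<close> carries the Gaussian
  processes and the sequences are indexed from 1.
\<close>

definition randomness ::
  "'a measure \<Rightarrow> (real \<times> 'a \<times> real \<times> real \<times> (nat \<Rightarrow> real) \<times> (nat \<Rightarrow> real)) measure" where
  "randomness P =
     unif \<Otimes>\<^sub>M P \<Otimes>\<^sub>M unif \<Otimes>\<^sub>M std_gauss \<Otimes>\<^sub>M
     (\<Pi>\<^sub>M l\<in>{1..}. unif) \<Otimes>\<^sub>M (\<Pi>\<^sub>M i\<in>{1..}. unif)"

text \<open>Expectation in \<open>u\<close> and \<open>z\<close> only.\<close>

definition E' :: "(real \<Rightarrow> real \<Rightarrow> real) \<Rightarrow> real" where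
  "E' f = (\<integral>(u, z). f u z \<partial>(unif \<Otimes>\<^sub>M std_gauss))"

definition invariance ::
  "spin_fun \<Rightarrow> 'a measure \<Rightarrow> (nat \<Rightarrow> real \<Rightarrow> real \<Rightarrow> 'a \<Rightarrow> real) \<Rightarrow> bool" where
  "invariance \<sigma> P g \<longleftrightarrow>
     (\<forall>p\<ge>1. \<forall>t>0. \<forall>q\<ge>1. \<forall>C :: nat \<Rightarrow> nat set.
        (\<forall>l\<in>{1..q}. finite (C l) \<and> C l \<subseteq> {1..}) \<longrightarrow>
        (\<integral>(w, \<omega>, _, _, _, vs).
            (\<Prod>l=1..q. E' (\<lambda>u z. \<Prod>i\<in>C l. \<sigma> w u (vs i))) \<partial>randomness P) =
        (\<integral>(w, \<omega>, _, _, _, vs).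
            (\<Prod>l=1..q. E' (\<lambda>u z. (\<Prod>i\<in>C l. \<sigma> w u (vs i)) * exp (t * G_field \<sigma> g p w \<omega> u z))) /
            E' (\<lambda>u z. exp (t * G_field \<sigma> g p w \<omega> u z)) ^ q \<partial>randomness P))"

text \<open>
  A bounded continuous function of \<open>m\<close> multi-overlaps, with index lists \<open>L 0, \<dots>, L (m - 1)\<close>,
  is rendered as a bounded function \<open>F\<close> on real sequences, continuous in the product topology
  and evaluated at a sequence that vanishes from position \<open>m\<close> on.
\<close>

definition ghirlanda_guerra :: "spin_fun \<Rightarrow> 'a measure \<Rightarrow> bool" where
  "ghirlanda_guerra \<sigma> P \<longleftrightarrow>
     (\<forall>p\<ge>1. \<forall>n\<ge>1. \<forall>m. \<forall>L :: nat \<Rightarrow> nat list. \<forall>F :: (nat \<Rightarrow> real) \<Rightarrow> real.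
        (\<forall>j<m. L j \<noteq> [] \<and> set (L j) \<subseteq> {1..n}) \<and> continuous_on UNIV F \<and> bounded (range F) \<longrightarrow>
        (let FR = (\<lambda>w us. F (\<lambda>j. if j < m then multi_overlap \<sigma> w us (L j) else 0));
             R = multi_overlap \<sigma>
         in (\<integral>(w, _, _, _, us, _). FR w us * R w us [1, n + 1] ^ p \<partial>randomness P) =
            1 / real n * (\<integral>(w, _, _, _, us, _). FR w us \<partial>randomness P) *
              (\<integral>(w, _, _, _, us, _). R w us [1, 2] ^ p \<partial>randomness P) +
            1 / real n *
              (\<Sum>l=2..n. \<integral>(w, _, _, _, us, _). FR w us * R w us [1, l] ^ p \<partial>randomness P)))"

definition tilted_moment ::
  "spin_fun \<Rightarrow> 'a measure \<Rightarrow> (nat \<Rightarrow> real \<Rightarrow> real \<Rightarrow> 'a \<Rightarrow> real) \<Rightarrow> nat \<Rightarrow> real \<Rightarrow> nat \<Rightarrow> real"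
  where
  "tilted_moment \<sigma> P g p t k =
     (\<integral>(w, \<omega>, u, z, _, _).
         G_field \<sigma> g p w \<omega> u z ^ k * exp (t * G_field \<sigma> g p w \<omega> u z) /
         E' (\<lambda>u z. exp (t * G_field \<sigma> g p w \<omega> u z)) \<partial>randomness P)"

definition tilted_variance ::
  "spin_fun \<Rightarrow> 'a measure \<Rightarrow> (nat \<Rightarrow> real \<Rightarrow> real \<Rightarrow> 'a \<Rightarrow> real) \<Rightarrow> nat \<Rightarrow> real \<Rightarrow> real" where
  "tilted_variance \<sigma> P g p t = tilted_moment \<sigma> P g p t 2 - (tilted_moment \<sigma> P g p t 1)\<^sup>2"

end

theory Submission
  imports Defs
begin

text \<open>
  Integrating out \<open>z\<close> turns the tilted averages into averages over replicas drawn from a random density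
  proportional to \<open>exp (t * g\<^sub>p + t\<^sup>2 * (1 - R\<^sub>u\<^sub>u\<^sup>p) / 2)\<close>. The invariance hypothesis only concerns products of
  distinct entries of the array \<open>\<sigma>(w, u\<^sub>l, v\<^sub>i)\<close>. With \<open>T\<close> the integral operator with kernel \<open>\<sigma>(w, \<cdot>, \<cdot>)\<close>, the
  residuals \<open>(1 - T' T)\<^sup>m \<sigma>\<close> tend to zero, so a repeated entry is a limit of combinations of products over
  fresh rows and columns. Hence the invariance extends to all products of multi-overlaps.

  Gaussian integration by parts is the derivative of a Cameron--Martin shift. It yields, with \<open>m\<close> the tilted
  mean of \<open>H = g\<^sub>p + t * (1 - R\<^sub>u\<^sub>u\<^sup>p)\<close>, that \<open>E \<Phi> (H - m)\<close> is \<open>- n * t\<close> times the defect in the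
  Ghirlanda--Guerra identity for a product \<open>\<Phi>\<close> of multi-overlaps, and that the tilted variance is
  \<open>1 + t\<^sup>2 * gap\<close> with \<open>gap = 2 E R\<^sub>1\<^sub>2\<^sup>p R\<^sub>1\<^sub>3\<^sup>p - E R\<^sub>1\<^sub>2\<^sup>2\<^sup>p - (E R\<^sub>1\<^sub>2\<^sup>p)\<^sup>2\<close>. So boundedness means \<open>gap = 0\<close>, and then
  the defect is \<open>O(1/t)\<close> for all \<open>t > 0\<close>, i.e. zero; Stone--Weierstrass passes from products to continuous
  functions. Conversely, \<open>gap = 0\<close> is the identity for \<open>n = 2\<close> and \<open>\<Phi> = R\<^sub>1\<^sub>2\<^sup>p\<close>.
\<close>

section \<open>Residuals of bounded kernels\<close>

text \<open>Two obstacles shape the proof. The hypothesis \<open>invariance\<close> only sees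
  products over sets of cells, where no entry \<open>\<sigma>(w, u_l, v_i)\<close> is repeated,
  whereas multi-overlaps may repeat a replica and the self-overlap \<open>R_uu^p\<close> enters both
  the variance of \<open>g_p\<close> and the weight left by \<open>z\<close>. The way out is that
  one application of \<open>T' T\<close> to the entry at \<open>(l, i)\<close> replaces it by
  entries at \<open>(l, k)\<close>, \<open>(k, k)\<close> and \<open>(k, i)\<close> with a new index
  \<open>k\<close>; expanding \<open>(1 - T' T)^m\<close> thus writes a repeated entry as a
  combination of fresh ones plus an error that vanishes in \<open>L^1\<close>. The second obstacle
  is that \<open>g_p\<close> is known through its finite-dimensional laws only, while the Gibbs
  weights contain the partition function, an integral over the index \<open>u\<close>. Hence the
  Cameron--Martin shift is proved for cosines of finite linear combinations and then carried over to
  functionals of the partition function by moments and approximation. The self-overlaps that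
  integration by parts produces finally cancel against the weight left by \<open>z\<close>.\<close>

lemma abs_mult_le_real: "\<bar>a\<bar> \<le> B \<Longrightarrow> \<bar>b\<bar> \<le> C \<Longrightarrow> \<bar>a * b\<bar> \<le> B * C" for a b B C :: real
  using abs_ge_zero[of a] by (auto simp: abs_mult intro!: mult_mono)

lemma (in prob_space) integrable_bounded:
  fixes f :: "'a \<Rightarrow> real"
  assumes "f \<in> borel_measurable M" "\<And>x. x \<in> space M \<Longrightarrow> \<bar>f x\<bar> \<le> B"
  shows "integrable M f"
  using assms by (intro integrable_const_bound[where B=B]) auto

lemma (in prob_space) abs_integral_le:
  fixes f :: "'a \<Rightarrow> real"
  assumes "\<And>x. x \<in> space M \<Longrightarrow> \<bar>f x\<bar> \<le> B" "0 \<le> B"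
  shows "\<bar>\<integral>x. f x \<partial>M\<bar> \<le> B"
proof (cases "integrable M f")
  case True
  have "\<bar>\<integral>x. f x \<partial>M\<bar> \<le> (\<integral>x. \<bar>f x\<bar> \<partial>M)" by (rule integral_abs_bound)
  also have "\<dots> \<le> (\<integral>x. B \<partial>M)" using True assms by (intro integral_mono) auto
  finally show ?thesis by (simp add: prob_space)
qed (simp add: not_integrable_integral_eq assms)

text \<open>Nonnegativity of the variance.\<close>

lemma (in prob_space) square_integral_le:
  fixes f :: "'a \<Rightarrow> real"
  assumes "integrable M f" "integrable M (\<lambda>x. (f x)\<^sup>2)"
  shows "(\<integral>x. f x \<partial>M)\<^sup>2 \<le> (\<integral>x. (f x)\<^sup>2 \<partial>M)"
proof -
  let ?c = "\<integral>x. f x \<partial>M"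
  have "0 \<le> (\<integral>x. (f x - ?c)\<^sup>2 \<partial>M)" by simp
  also have "(\<integral>x. (f x - ?c)\<^sup>2 \<partial>M) = (\<integral>x. ((f x)\<^sup>2 - 2 * ?c * f x) + ?c\<^sup>2 \<partial>M)"
    by (intro Bochner_Integration.integral_cong) (auto simp: power2_eq_square algebra_simps)
  also have "\<dots> = (\<integral>x. (f x)\<^sup>2 \<partial>M) - 2 * ?c * ?c + ?c\<^sup>2"
    using assms by (simp add: prob_space)
  finally show ?thesis by (simp add: power2_eq_square)
qed

locale prob_pair = U: prob_space \<mu> + V: prob_space \<nu>
  for \<mu> :: "'u measure" and \<nu> :: "'v measure"
begin

sublocale pair_prob_space \<mu> \<nu> ..

lemma Fubini_bounded:
  fixes f :: "'u \<Rightarrow> 'v \<Rightarrow> real"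
  assumes "(\<lambda>(u, v). f u v) \<in> borel_measurable (\<mu> \<Otimes>\<^sub>M \<nu>)"
    and "\<And>u v. u \<in> space \<mu> \<Longrightarrow> v \<in> space \<nu> \<Longrightarrow> \<bar>f u v\<bar> \<le> B"
  shows "(\<integral>v. (\<integral>u. f u v \<partial>\<mu>) \<partial>\<nu>) = (\<integral>u. (\<integral>v. f u v \<partial>\<nu>) \<partial>\<mu>)"
    and "(\<integral>z. f (fst z) (snd z) \<partial>(\<mu> \<Otimes>\<^sub>M \<nu>)) = (\<integral>u. (\<integral>v. f u v \<partial>\<nu>) \<partial>\<mu>)"
proof -
  have int: "integrable (\<mu> \<Otimes>\<^sub>M \<nu>) (\<lambda>(u, v). f u v)"
    using assms by (intro integrable_bounded[where B=B]) (auto simp: space_pair_measure)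
  show "(\<integral>v. (\<integral>u. f u v \<partial>\<mu>) \<partial>\<nu>) = (\<integral>u. (\<integral>v. f u v \<partial>\<nu>) \<partial>\<mu>)"
    by (rule Fubini_integral[OF int])
  show "(\<integral>z. f (fst z) (snd z) \<partial>(\<mu> \<Otimes>\<^sub>M \<nu>)) = (\<integral>u. (\<integral>v. f u v \<partial>\<nu>) \<partial>\<mu>)"
    using integral_fst[of f, OF int] by (simp add: case_prod_beta')
qed

end

text \<open>The kernel \<open>s\<close> acts as an operator from functions on \<open>\<mu>\<close> to functions on \<open>\<nu>\<close>;
  \<open>T\<close> and \<open>T'\<close> below are that operator and its adjoint, and \<open>T' T\<close> has the kernel \<open>R\<close>.\<close>

locale kernel = prob_pair \<mu> \<nu> for \<mu> :: "'u measure" and \<nu> :: "'v measure" +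
  fixes s :: "'u \<Rightarrow> 'v \<Rightarrow> real"
  assumes meas [measurable]: "(\<lambda>(u, v). s u v) \<in> borel_measurable (\<mu> \<Otimes>\<^sub>M \<nu>)"
    and bound: "\<And>u v. u \<in> space \<mu> \<Longrightarrow> v \<in> space \<nu> \<Longrightarrow> \<bar>s u v\<bar> \<le> 1"
begin

definition T :: "('u \<Rightarrow> real) \<Rightarrow> 'v \<Rightarrow> real" where "T x v = (\<integral>u. s u v * x u \<partial>\<mu>)"
definition T' :: "('v \<Rightarrow> real) \<Rightarrow> 'u \<Rightarrow> real" where "T' h u = (\<integral>v. s u v * h v \<partial>\<nu>)"
definition R :: "'u \<Rightarrow> 'u \<Rightarrow> real" where "R u u' = (\<integral>v. s u v * s u' v \<partial>\<nu>)"

lemma meas_T [measurable]: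
  assumes [measurable]: "x \<in> borel_measurable \<mu>" shows "T x \<in> borel_measurable \<nu>"
  unfolding T_def by measurable

lemma meas_T' [measurable]:
  assumes [measurable]: "h \<in> borel_measurable \<nu>" shows "T' h \<in> borel_measurable \<mu>"
  unfolding T'_def by measurable

lemma meas_R [measurable]: "(\<lambda>(u, u'). R u u') \<in> borel_measurable (\<mu> \<Otimes>\<^sub>M \<mu>)"
  unfolding R_def by measurable

lemma s_mult_le: "u \<in> space \<mu> \<Longrightarrow> v \<in> space \<nu> \<Longrightarrow> \<bar>a\<bar> \<le> B \<Longrightarrow> \<bar>s u v * a\<bar> \<le> B"
  using mult_mono[OF bound[of u v], of "\<bar>a\<bar>" B] by (simp add: abs_mult)

lemma T_bound: "v \<in> space \<nu> \<Longrightarrow> (\<And>u. u \<in> space \<mu> \<Longrightarrow> \<bar>x u\<bar> \<le> B) \<Longrightarrow> 0 \<le> B \<Longrightarrow> \<bar>T x v\<bar> \<le> B"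
  unfolding T_def by (intro U.abs_integral_le s_mult_le) auto

lemma T'_bound: "u \<in> space \<mu> \<Longrightarrow> (\<And>v. v \<in> space \<nu> \<Longrightarrow> \<bar>h v\<bar> \<le> B) \<Longrightarrow> 0 \<le> B \<Longrightarrow> \<bar>T' h u\<bar> \<le> B"
  unfolding T'_def by (intro V.abs_integral_le s_mult_le) auto

lemma R_bound: "u \<in> space \<mu> \<Longrightarrow> u' \<in> space \<mu> \<Longrightarrow> \<bar>R u u'\<bar> \<le> 1"
  unfolding R_def by (intro V.abs_integral_le s_mult_le bound) auto

lemma adjoint:
  assumes [measurable]: "x \<in> borel_measurable \<mu>" "h \<in> borel_measurable \<nu>"
    and "\<And>u. u \<in> space \<mu> \<Longrightarrow> \<bar>x u\<bar> \<le> B" "\<And>v. v \<in> space \<nu> \<Longrightarrow> \<bar>h v\<bar> \<le> C"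
  shows "(\<integral>v. T x v * h v \<partial>\<nu>) = (\<integral>u. x u * T' h u \<partial>\<mu>)"
proof -
  have *: "\<bar>(s u v * x u) * h v\<bar> \<le> B * C" if "u \<in> space \<mu>" "v \<in> space \<nu>" for u v
  proof -
    have "\<bar>h v\<bar> \<le> C" "\<bar>s u v * x u\<bar> \<le> B" "0 \<le> B"
      using assms that s_mult_le abs_ge_zero order_trans by blast+
    then show ?thesis by (auto simp: abs_mult intro!: mult_mono)
  qed
  have "(\<integral>v. T x v * h v \<partial>\<nu>) = (\<integral>v. (\<integral>u. (s u v * x u) * h v \<partial>\<mu>) \<partial>\<nu>)"
    unfolding T_def by simp
  also have "\<dots> = (\<integral>u. (\<integral>v. (s u v * x u) * h v \<partial>\<nu>) \<partial>\<mu>)"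
    using * by (intro Fubini_bounded(1)[where B="B*C"]) auto
  also have "\<dots> = (\<integral>u. x u * T' h u \<partial>\<mu>)"
    unfolding T'_def by (simp flip: integral_mult_right_zero add: ac_simps)
  finally show ?thesis .
qed

lemma T'_T:
  assumes [measurable]: "x \<in> borel_measurable \<mu>" and "u \<in> space \<mu>"
    and "\<And>u. u \<in> space \<mu> \<Longrightarrow> \<bar>x u\<bar> \<le> B"
  shows "T' (T x) u = (\<integral>u'. R u u' * x u' \<partial>\<mu>)"
proof -
  have [measurable]: "(\<lambda>v. s u v) \<in> borel_measurable \<nu>" using assms(2) by measurable
  have "T' (T x) u = (\<integral>v. (T x v) * s u v \<partial>\<nu>)" unfolding T'_def by (simp add: ac_simps)
  also have "\<dots> = (\<integral>u'. x u' * T' (s u) u' \<partial>\<mu>)"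
    using assms bound by (intro adjoint[where B=B and C=1]) auto
  finally show ?thesis unfolding T'_def R_def by (simp add: ac_simps)
qed

text \<open>Expanding the square gives \<open>|x|^2 - 2 |T x|^2 + |T' T x|^2\<close>, and
  \<open>|s| \<le> 1\<close> makes \<open>T'\<close> a contraction, so one copy of
  \<open>|T x|^2\<close> survives as a gain. Dropping the gain shows that residuals decrease in
  norm; summing it is the core of \<open>d_column\<close>.\<close>

lemma energy:
  assumes [measurable]: "x \<in> borel_measurable \<mu>" and B: "\<And>u. u \<in> space \<mu> \<Longrightarrow> \<bar>x u\<bar> \<le> B"
  shows "(\<integral>u. (x u - T' (T x) u)\<^sup>2 \<partial>\<mu>) \<le> (\<integral>u. (x u)\<^sup>2 \<partial>\<mu>) - (\<integral>v. (T x v)\<^sup>2 \<partial>\<nu>)"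
proof -
  obtain u0 where "u0 \<in> space \<mu>" using U.not_empty by blast
  then have B0: "0 \<le> B" using B abs_ge_zero order_trans by blast
  note TB = T_bound[of _ x B, OF _ B B0] and TTB = T'_bound[of _ "T x" B, OF _ T_bound[of _ x B, OF _ B B0] B0]
  have sq: "\<bar>a\<bar> \<le> B \<Longrightarrow> \<bar>b\<bar> \<le> B \<Longrightarrow> \<bar>a * b\<bar> \<le> B * B" for a b :: real
    using B0 by (auto simp: abs_mult intro!: mult_mono)
  have 1: "(\<integral>u. (T' (T x) u)\<^sup>2 \<partial>\<mu>) \<le> (\<integral>v. (T x v)\<^sup>2 \<partial>\<nu>)"
  proof -
    have "(\<integral>u. (T' (T x) u)\<^sup>2 \<partial>\<mu>) \<le> (\<integral>u. (\<integral>v. (T x v)\<^sup>2 \<partial>\<nu>) \<partial>\<mu>)"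
    proof (intro integral_mono)
      fix u assume u: "u \<in> space \<mu>"
      have [measurable]: "(\<lambda>v. s u v) \<in> borel_measurable \<nu>" using u by measurable
      have i1: "integrable \<nu> (\<lambda>v. s u v * T x v)"
        using u TB s_mult_le by (intro V.integrable_bounded[where B=B]) auto
      have i2: "integrable \<nu> (\<lambda>v. (s u v * T x v)\<^sup>2)"
        unfolding power2_eq_square using u by (intro V.integrable_bounded[where B="B*B"] sq s_mult_le TB) auto
      have i3: "integrable \<nu> (\<lambda>v. (T x v)\<^sup>2)"
        unfolding power2_eq_square by (intro V.integrable_bounded[where B="B*B"] sq TB) auto
      note i = i1 i2 i3
      have "(T' (T x) u)\<^sup>2 \<le> (\<integral>v. (s u v * T x v)\<^sup>2 \<partial>\<nu>)"
        unfolding T'_def using i by (intro V.square_integral_le)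
      also have "\<dots> \<le> (\<integral>v. (T x v)\<^sup>2 \<partial>\<nu>)"
        using i bound u by (intro integral_mono) (auto simp: power_mult_distrib abs_square_le_1 intro!: mult_left_le_one_le)
      finally show "(T' (T x) u)\<^sup>2 \<le> (\<integral>v. (T x v)\<^sup>2 \<partial>\<nu>)" .
    qed (unfold power2_eq_square, auto intro!: U.integrable_bounded[where B="B*B"] sq TTB)
    then show ?thesis by (simp add: U.prob_space)
  qed
  have 2: "(\<integral>u. x u * T' (T x) u \<partial>\<mu>) = (\<integral>v. (T x v)\<^sup>2 \<partial>\<nu>)"
    using B TB by (subst adjoint[where B=B and C=B, symmetric]) (auto simp: power2_eq_square)
  have "(\<integral>u. (x u - T' (T x) u)\<^sup>2 \<partial>\<mu>) = (\<integral>u. ((x u)\<^sup>2 - 2 * (x u * T' (T x) u)) + (T' (T x) u)\<^sup>2 \<partial>\<mu>)"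
    by (intro Bochner_Integration.integral_cong) (auto simp: power2_eq_square algebra_simps)
  also have "\<dots> = (\<integral>u. (x u)\<^sup>2 \<partial>\<mu>) - 2 * (\<integral>u. x u * T' (T x) u \<partial>\<mu>) + (\<integral>u. (T' (T x) u)\<^sup>2 \<partial>\<mu>)"
  proof -
    have "integrable \<mu> (\<lambda>u. (x u)\<^sup>2)" "integrable \<mu> (\<lambda>u. x u * T' (T x) u)" "integrable \<mu> (\<lambda>u. (T' (T x) u)\<^sup>2)"
      unfolding power2_eq_square by (auto intro!: U.integrable_bounded[where B="B*B"] sq TTB B)
    then show ?thesis by simp
  qed
  finally show ?thesis using 1 2 by simp
qed

end

text \<open>Makes \<open>energy\<close> available on the column side, for
  \<open>1 - T T'\<close>.\<close>

lemma kernel_swap: "kernel \<mu> \<nu> s \<Longrightarrow> kernel \<nu> \<mu> (\<lambda>v u. s u v)"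
  unfolding kernel_def kernel_axioms_def prob_pair_def
  by (auto simp: case_prod_beta intro!: measurable_compose[OF measurable_pair_swap'])

context kernel begin

text \<open>\<open>(1 - T' T)^m\<close> applied to the column \<open>u \<mapsto> s u v\<close>. With
  the kernel \<open>R\<close> written out, one step inserts exactly one new row \<open>u'\<close>
  and, inside \<open>R\<close>, one new column; \<open>resid\<close> mirrors this shape on
  cells.\<close>

fun d :: "nat \<Rightarrow> 'u \<Rightarrow> 'v \<Rightarrow> real" where
  "d 0 u v = s u v"
| "d (Suc m) u v = d m u v - (\<integral>u'. R u u' * d m u' v \<partial>\<mu>)"

lemma meas_d [measurable]: "(\<lambda>(u, v). d m u v) \<in> borel_measurable (\<mu> \<Otimes>\<^sub>M \<nu>)"
proof (induction m)
  case (Suc m)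
  note [measurable] = Suc
  show ?case by simp
qed simp

lemma R_mult_le: "u \<in> space \<mu> \<Longrightarrow> u' \<in> space \<mu> \<Longrightarrow> \<bar>a\<bar> \<le> B \<Longrightarrow> \<bar>R u u' * a\<bar> \<le> B"
  using mult_mono[OF R_bound[of u u'], of "\<bar>a\<bar>" B] by (simp add: abs_mult)

lemma d_bound: "u \<in> space \<mu> \<Longrightarrow> v \<in> space \<nu> \<Longrightarrow> \<bar>d m u v\<bar> \<le> 2 ^ m"
proof (induction m arbitrary: u)
  case (Suc m)
  have "\<bar>\<integral>u'. R u u' * d m u' v \<partial>\<mu>\<bar> \<le> 2 ^ m"
    using Suc by (intro U.abs_integral_le R_mult_le) auto
  then show ?case using Suc.IH[OF Suc.prems] by simp
qed (simp add: bound)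

lemma d_Suc_T: "u \<in> space \<mu> \<Longrightarrow> v \<in> space \<nu> \<Longrightarrow>
    d (Suc m) u v = d m u v - T' (T (\<lambda>u. d m u v)) u"
  by (subst T'_T[where B="2^m"]) (auto intro: d_bound)

lemma int_d_sq: "integrable (\<mu> \<Otimes>\<^sub>M \<nu>) (\<lambda>z. (d m (fst z) (snd z))\<^sup>2)"
  unfolding power2_eq_square
  by (intro integrable_bounded[where B="2^m * 2^m"] abs_mult_le_real d_bound) (auto simp: space_pair_measure)

text \<open>\<open>energy\<close> in each column, without its gain; \<open>|s| \<le> 1\<close>
  starts the induction.\<close>

lemma d_norm_le: "(\<integral>z. (d m (fst z) (snd z))\<^sup>2 \<partial>(\<mu> \<Otimes>\<^sub>M \<nu>)) \<le> 1"
proof -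
  have *: "(\<integral>z. (d m (fst z) (snd z))\<^sup>2 \<partial>(\<mu> \<Otimes>\<^sub>M \<nu>)) = (\<integral>v. (\<integral>u. (d m u v)\<^sup>2 \<partial>\<mu>) \<partial>\<nu>)" for m
  proof -
    have "\<bar>(d m u v)\<^sup>2\<bar> \<le> 2^m * 2^m" if "u \<in> space \<mu>" "v \<in> space \<nu>" for u v
      unfolding power2_eq_square using that by (intro abs_mult_le_real d_bound)
    then show ?thesis using Fubini_bounded[of "\<lambda>u v. (d m u v)\<^sup>2" "2^m * 2^m"] by simp
  qed
  have i: "integrable \<nu> (\<lambda>v. (\<integral>u. (d m u v)\<^sup>2 \<partial>\<mu>))" for m
    unfolding power2_eq_square
    by (intro V.integrable_bounded[where B="2^m * 2^m"] U.abs_integral_le abs_mult_le_real d_bound) auto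
  show ?thesis
  proof (induction m)
    case 0
    have "(\<integral>z. (d 0 (fst z) (snd z))\<^sup>2 \<partial>(\<mu> \<Otimes>\<^sub>M \<nu>)) \<le> (\<integral>z. 1 \<partial>(\<mu> \<Otimes>\<^sub>M \<nu>))"
      using int_d_sq[of 0] by (intro integral_mono) (auto simp: space_pair_measure abs_square_le_1 bound)
    then show ?case by (simp add: prob_space)
  next
    case (Suc m)
    have "(\<integral>v. (\<integral>u. (d (Suc m) u v)\<^sup>2 \<partial>\<mu>) \<partial>\<nu>) \<le> (\<integral>v. (\<integral>u. (d m u v)\<^sup>2 \<partial>\<mu>) \<partial>\<nu>)"
    proof (rule integral_mono[OF i i])
      fix v assume v: "v \<in> space \<nu>"
      have [measurable]: "(\<lambda>u. d m u v) \<in> borel_measurable \<mu>" using v by measurable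
      have "(\<integral>u. (d (Suc m) u v)\<^sup>2 \<partial>\<mu>) = (\<integral>u. (d m u v - T' (T (\<lambda>u. d m u v)) u)\<^sup>2 \<partial>\<mu>)"
        using v by (intro Bochner_Integration.integral_cong) (auto simp: d_Suc_T simp del: d.simps)
      also have "\<dots> \<le> (\<integral>u. (d m u v)\<^sup>2 \<partial>\<mu>) - (\<integral>v'. (T (\<lambda>u. d m u v) v')\<^sup>2 \<partial>\<nu>)"
        using v by (intro energy[where B="2^m"]) (auto intro: d_bound)
      also have "\<dots> \<le> (\<integral>u. (d m u v)\<^sup>2 \<partial>\<mu>)" by simp
      finally show "(\<integral>u. (d (Suc m) u v)\<^sup>2 \<partial>\<mu>) \<le> (\<integral>u. (d m u v)\<^sup>2 \<partial>\<mu>)" .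
    qed
    then show ?case using Suc by (simp add: * del: d.simps)
  qed
qed

lemma d_self_adjoint: "(\<integral>z. d (Suc m) (fst z) (snd z) * d k (fst z) (snd z) \<partial>(\<mu> \<Otimes>\<^sub>M \<nu>))
   = (\<integral>z. d m (fst z) (snd z) * d (Suc k) (fst z) (snd z) \<partial>(\<mu> \<Otimes>\<^sub>M \<nu>))"
proof -
  have *: "(\<integral>z. d m (fst z) (snd z) * d k (fst z) (snd z) \<partial>(\<mu> \<Otimes>\<^sub>M \<nu>)) = (\<integral>v. (\<integral>u. d m u v * d k u v \<partial>\<mu>) \<partial>\<nu>)" for m k
    using Fubini_bounded[of "\<lambda>u v. d m u v * d k u v" "2^m * 2^k"]
    by (simp add: abs_mult_le_real d_bound)
  have "(\<integral>u. d (Suc m) u v * d k u v \<partial>\<mu>) = (\<integral>u. d m u v * d (Suc k) u v \<partial>\<mu>)" if v: "v \<in> space \<nu>" for v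
  proof -
    have [measurable]: "(\<lambda>u. d m u v) \<in> borel_measurable \<mu>" for m using v by measurable
    have i: "integrable \<mu> (\<lambda>u. d m u v * d k u v)" for m k
      using v by (intro U.integrable_bounded[where B="2^m * 2^k"] abs_mult_le_real d_bound) auto
    have Tb: "\<bar>T (\<lambda>u. d m u v) v'\<bar> \<le> 2^m" if "v' \<in> space \<nu>" for m v'
      using that v by (intro T_bound d_bound) auto
    have Tb': "\<bar>T' (T (\<lambda>u. d m u v)) u\<bar> \<le> 2^m" if "u \<in> space \<mu>" for m u
      using that v by (intro T'_bound Tb) auto
    have i': "integrable \<mu> (\<lambda>u. d m u v * T' (T (\<lambda>u. d k u v)) u)" for m k
      using v by (intro U.integrable_bounded[where B="2^m * 2^k"] abs_mult_le_real d_bound Tb') auto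
    have e: "(\<integral>u. d m u v * T' (T (\<lambda>u. d k u v)) u \<partial>\<mu>) = (\<integral>v'. T (\<lambda>u. d m u v) v' * T (\<lambda>u. d k u v) v' \<partial>\<nu>)" for m k
      using v by (intro adjoint[where B="2^m" and C="2^k", symmetric] Tb d_bound) auto
    have "(\<integral>u. d m u v * d (Suc k) u v \<partial>\<mu>) = (\<integral>u. d m u v * d k u v - d m u v * T' (T (\<lambda>u. d k u v)) u \<partial>\<mu>)" for m k
      using v by (intro Bochner_Integration.integral_cong) (auto simp: d_Suc_T right_diff_distrib simp del: d.simps)
    then have f: "(\<integral>u. d m u v * d (Suc k) u v \<partial>\<mu>)
        = (\<integral>u. d m u v * d k u v \<partial>\<mu>) - (\<integral>v'. T (\<lambda>u. d m u v) v' * T (\<lambda>u. d k u v) v' \<partial>\<nu>)" for m k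
      using i i' by (simp add: e)
    have "(\<integral>u. d (Suc m) u v * d k u v \<partial>\<mu>) = (\<integral>u. d k u v * d (Suc m) u v \<partial>\<mu>)"
      by (simp add: mult.commute)
    also have "\<dots> = (\<integral>u. d m u v * d (Suc k) u v \<partial>\<mu>)"
      unfolding f by (simp add: mult.commute)
    finally show ?thesis .
  qed
  then show ?thesis unfolding * by (rule Bochner_Integration.integral_cong[OF refl])
qed

text \<open>Self-adjointness of \<open>T' T\<close> moves all steps to one side. For
  \<open>k = m\<close> the squared norm of \<open>d m\<close> becomes the pairing of
  \<open>d (m + m)\<close> with \<open>s\<close>, so weak convergence tested against
  \<open>s\<close> alone already gives convergence in norm.\<close>

lemma d_inner: "(\<integral>z. d m (fst z) (snd z) * d k (fst z) (snd z) \<partial>(\<mu> \<Otimes>\<^sub>M \<nu>))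
   = (\<integral>z. d (m + k) (fst z) (snd z) * s (fst z) (snd z) \<partial>(\<mu> \<Otimes>\<^sub>M \<nu>))"
proof (induction k arbitrary: m)
  case (Suc k)
  then show ?case using d_self_adjoint[of m k] by (simp del: d.simps(2))
qed simp

text \<open>\<open>(1 - T T')^m h\<close>, the counterpart of \<open>d\<close> on the column side;
  \<open>T'\<close> intertwines the two.\<close>

fun hh :: "('v \<Rightarrow> real) \<Rightarrow> nat \<Rightarrow> 'v \<Rightarrow> real" where
  "hh h 0 v = h v"
| "hh h (Suc m) v = hh h m v - T (T' (hh h m)) v"

lemma meas_hh [measurable]:
  assumes [measurable]: "h \<in> borel_measurable \<nu>" shows "hh h m \<in> borel_measurable \<nu>"
proof (induction m)
  case (Suc m)
  note [measurable] = Suc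
  have "hh h (Suc m) = (\<lambda>v. hh h m v - T (T' (hh h m)) v)" by (auto simp: fun_eq_iff)
  then show ?case by simp
qed (simp add: fun_eq_iff[of "hh h 0" h])

text \<open>Pairing \<open>d m\<close> with \<open>h\<close> in \<open>v\<close> gives
  \<open>T' (hh h m)\<close>. By \<open>energy\<close> for the swapped kernel its squared norm is at
  most the drop of \<open>|hh h m|^2\<close> in the next step, and these drops telescope, so they
  are summable.\<close>

lemma d_column:
  assumes [measurable]: "h \<in> borel_measurable \<nu>" and h: "\<And>v. v \<in> space \<nu> \<Longrightarrow> \<bar>h v\<bar> \<le> 1"
  shows "(\<lambda>m. \<integral>u. (\<integral>v. d m u v * h v \<partial>\<nu>)\<^sup>2 \<partial>\<mu>) \<longlonglongrightarrow> 0"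
proof -
  have hb: "\<bar>hh h m v\<bar> \<le> 2 ^ m" if "v \<in> space \<nu>" for m v
    using that
  proof (induction m arbitrary: v)
    case (Suc m)
    have "\<bar>T (T' (hh h m)) v\<bar> \<le> 2 ^ m" using Suc by (intro T_bound T'_bound) auto
    then show ?case using Suc.IH[OF Suc.prems] by simp
  qed (simp add: h)
  have Tb: "\<bar>T' (hh h m) u\<bar> \<le> 2 ^ m" if "u \<in> space \<mu>" for m u
    using that by (intro T'_bound hb) auto
  interpret K: kernel \<nu> \<mu> "\<lambda>v u. s u v"
    by (rule kernel_swap) unfold_locales
  have KT: "K.T = T'" "K.T' = T" unfolding K.T_def K.T'_def T_def T'_def by auto
  define e where "e m = (\<integral>v. (hh h m v)\<^sup>2 \<partial>\<nu>)" for m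
  \<comment> \<open>The relation \<open>(1 - T' T)^m T' = T' (1 - T T')^m\<close>, by induction on
    \<open>m\<close>.\<close>
  have col: "(\<integral>v. d m u v * h v \<partial>\<nu>) = T' (hh h m) u" if "u \<in> space \<mu>" for m u
    using that
  proof (induction m arbitrary: u)
    case (Suc m)
    have [measurable]: "(\<lambda>v. d m u v) \<in> borel_measurable \<nu>" "(\<lambda>v. s u v) \<in> borel_measurable \<nu>"
      "(\<lambda>u'. R u u') \<in> borel_measurable \<mu>" using Suc by measurable
    have b: "\<bar>\<integral>u'. R u u' * d m u' v \<partial>\<mu>\<bar> \<le> 2 ^ m" if "v \<in> space \<nu>" for v
      using that Suc by (intro U.abs_integral_le R_mult_le d_bound) auto
    have bm: "\<bar>R u u' * d m u' v * h v\<bar> \<le> 2 ^ m * 1" if "u' \<in> space \<mu>" "v \<in> space \<nu>" for u' v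
      using that Suc by (intro abs_mult_le_real R_mult_le d_bound h)
    have bm': "\<bar>s u v * hh h m v\<bar> \<le> 2 ^ m" "\<bar>s u v * T (T' (hh h m)) v\<bar> \<le> 2 ^ m" if "v \<in> space \<nu>" for v
      using that Suc by (intro s_mult_le hb T_bound Tb; simp)+
    have "(\<integral>v. d (Suc m) u v * h v \<partial>\<nu>) = (\<integral>v. d m u v * h v - (\<integral>u'. R u u' * d m u' v \<partial>\<mu>) * h v \<partial>\<nu>)"
      by (simp add: left_diff_distrib)
    also have "\<dots> = (\<integral>v. d m u v * h v \<partial>\<nu>) - (\<integral>v. (\<integral>u'. R u u' * d m u' v \<partial>\<mu>) * h v \<partial>\<nu>)"
      using Suc.prems by (intro Bochner_Integration.integral_diff V.integrable_bounded[where B="2^m*1"] abs_mult_le_real h b d_bound) auto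
    also have "(\<integral>v. (\<integral>u'. R u u' * d m u' v \<partial>\<mu>) * h v \<partial>\<nu>) = (\<integral>v. (\<integral>u'. R u u' * d m u' v * h v \<partial>\<mu>) \<partial>\<nu>)"
      by simp
    also have "\<dots> = (\<integral>u'. (\<integral>v. R u u' * d m u' v * h v \<partial>\<nu>) \<partial>\<mu>)"
      using bm by (intro Fubini_bounded(1)[where B="2^m*1"]) auto
    also have "\<dots> = (\<integral>u'. R u u' * T' (hh h m) u' \<partial>\<mu>)"
      using Suc.IH by (intro Bochner_Integration.integral_cong) (auto simp: mult.assoc)
    also have "\<dots> = T' (T (T' (hh h m))) u"
      using Suc.prems Tb by (intro T'_T[symmetric]) auto
    also have "(\<integral>v. d m u v * h v \<partial>\<nu>) = T' (hh h m) u" using Suc by simp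
    also have "T' (hh h m) u - T' (T (T' (hh h m))) u = T' (hh h (Suc m)) u"
      unfolding T'_def[of "hh h m"] T'_def[of "T (T' (hh h m))"] T'_def[of "hh h (Suc m)"]
      using bm' by (subst Bochner_Integration.integral_diff[symmetric])
        (auto simp: right_diff_distrib simp flip: T'_def intro!: V.integrable_bounded[where B="2^m"])
    finally show ?case .
  qed (simp add: T'_def)
  have en: "(\<integral>u. (T' (hh h m) u)\<^sup>2 \<partial>\<mu>) \<le> e m - e (Suc m)" for m
    using K.energy[of "hh h m" "2^m"] hb by (simp add: KT e_def)
  have "summable (\<lambda>m. \<integral>u. (T' (hh h m) u)\<^sup>2 \<partial>\<mu>)"
  proof (rule summableI_nonneg_bounded)
    fix n
    have "(\<Sum>i<n. \<integral>u. (T' (hh h i) u)\<^sup>2 \<partial>\<mu>) \<le> (\<Sum>i<n. e i - e (Suc i))"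
      by (intro sum_mono en)
    also have "\<dots> = e 0 - e n" by (rule sum_lessThan_telescope')
    also have "\<dots> \<le> e 0" by (simp add: e_def)
    finally show "(\<Sum>i<n. \<integral>u. (T' (hh h i) u)\<^sup>2 \<partial>\<mu>) \<le> e 0" .
  qed simp
  then have "(\<lambda>m. \<integral>u. (T' (hh h m) u)\<^sup>2 \<partial>\<mu>) \<longlonglongrightarrow> 0" by (rule summable_LIMSEQ_zero)
  moreover have "(\<integral>u. (\<integral>v. d m u v * h v \<partial>\<nu>)\<^sup>2 \<partial>\<mu>) = (\<integral>u. (T' (hh h m) u)\<^sup>2 \<partial>\<mu>)" for m
    by (intro Bochner_Integration.integral_cong) (auto simp: col)
  ultimately show ?thesis by simp
qed

end

lemma tendsto_zero_of_square:
  fixes f :: "nat \<Rightarrow> real"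
  assumes "(\<lambda>m. (f m)\<^sup>2) \<longlonglongrightarrow> 0" shows "f \<longlonglongrightarrow> 0"
  using tendsto_real_sqrt[OF assms] by (simp add: tendsto_rabs_zero_iff)

section \<open>Weak and strong convergence of the residuals to zero\<close>

context kernel begin

abbreviation "Q \<equiv> \<mu> \<Otimes>\<^sub>M \<nu>"

text \<open>\<open>d m\<close> tends to zero when tested against \<open>f\<close>. As
  \<open>d m\<close> is bounded in \<open>L^2\<close>, such \<open>f\<close> form a subspace closed
  under \<open>L^2\<close> limits, and \<open>s\<close> is reached from indicators of
  rectangles.\<close>

definition weakly :: "('u \<times> 'v \<Rightarrow> real) \<Rightarrow> bool" where
  "weakly f \<longleftrightarrow> (\<lambda>m. \<integral>z. d m (fst z) (snd z) * f z \<partial>Q) \<longlonglongrightarrow> 0"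

lemma d_bound': "z \<in> space Q \<Longrightarrow> \<bar>d m (fst z) (snd z)\<bar> \<le> 2 ^ m"
  by (auto simp: space_pair_measure d_bound)

lemma int_d_mult:
  assumes "f \<in> borel_measurable Q" "\<And>z. z \<in> space Q \<Longrightarrow> \<bar>f z\<bar> \<le> B"
  shows "integrable Q (\<lambda>z. d m (fst z) (snd z) * f z)"
  using assms by (intro integrable_bounded[where B="2^m * B"] abs_mult_le_real d_bound') auto

lemma weakly_add:
  assumes "f \<in> borel_measurable Q" "\<And>z. z \<in> space Q \<Longrightarrow> \<bar>f z\<bar> \<le> B" "weakly f"
    and "g \<in> borel_measurable Q" "\<And>z. z \<in> space Q \<Longrightarrow> \<bar>g z\<bar> \<le> C" "weakly g"
  shows "weakly (\<lambda>z. f z + c * g z)"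
proof -
  have "(\<integral>z. d m (fst z) (snd z) * (f z + c * g z) \<partial>Q)
    = (\<integral>z. d m (fst z) (snd z) * f z \<partial>Q) + c * (\<integral>z. d m (fst z) (snd z) * g z \<partial>Q)" for m
    using int_d_mult[OF assms(1,2), of m] int_d_mult[OF assms(4,5), of m]
    by (simp add: distrib_left mult.left_commute)
  then show ?thesis
    using tendsto_add[OF assms(3)[unfolded weakly_def] tendsto_mult_left[OF assms(6)[unfolded weakly_def], of c]]
    by (simp add: weakly_def)
qed

lemma weakly_closed:
  assumes [measurable]: "f \<in> borel_measurable Q" and fB: "\<And>z. z \<in> space Q \<Longrightarrow> \<bar>f z\<bar> \<le> B"
    and g: "\<And>e. 0 < e \<Longrightarrow> \<exists>g\<in>borel_measurable Q. (\<exists>C. \<forall>z\<in>space Q. \<bar>g z\<bar> \<le> C) \<and> weakly g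
        \<and> (\<integral>z. (f z - g z)\<^sup>2 \<partial>Q) \<le> e\<^sup>2"
  shows "weakly f"
  unfolding weakly_def
proof (rule LIMSEQ_I)
  fix r :: real assume "0 < r"
  then have e: "0 < r / 2" by simp
  obtain g C where [measurable]: "g \<in> borel_measurable Q" and gC: "\<And>z. z \<in> space Q \<Longrightarrow> \<bar>g z\<bar> \<le> C"
    and wg: "weakly g" and fg: "(\<integral>z. (f z - g z)\<^sup>2 \<partial>Q) \<le> (r / 2)\<^sup>2"
    using g[OF e] by blast
  have fgB: "\<bar>f z - g z\<bar> \<le> B + C" if "z \<in> space Q" for z
    using fB[OF that] gC[OF that] by linarith
  have i: "integrable Q (\<lambda>z. (f z - g z)\<^sup>2)"
    unfolding power2_eq_square using fgB
    by (intro integrable_bounded[where B="(B+C)*(B+C)"] abs_mult_le_real) auto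
  obtain N where N: "\<And>m. m \<ge> N \<Longrightarrow> \<bar>\<integral>z. d m (fst z) (snd z) * g z \<partial>Q\<bar> < r / 2"
    using LIMSEQ_D[OF wg[unfolded weakly_def] e] by auto
  show "\<exists>N. \<forall>m\<ge>N. norm ((\<integral>z. d m (fst z) (snd z) * f z \<partial>Q) - 0) < r"
  proof (intro exI allI impI)
    fix m assume "m \<ge> N"
    let ?d = "\<lambda>z. d m (fst z) (snd z)"
    have id: "integrable Q (\<lambda>z. ?d z * (f z - g z))" "integrable Q (\<lambda>z. ?d z * g z)"
      "integrable Q (\<lambda>z. ?d z * f z)"
      using int_d_mult[of "\<lambda>z. f z - g z" "B+C" m] int_d_mult[of g C m] int_d_mult[of f B m] fgB fB gC by auto
    have "\<bar>\<integral>z. ?d z * (f z - g z) \<partial>Q\<bar> \<le> (\<integral>z. \<bar>?d z * (f z - g z)\<bar> \<partial>Q)" by (rule integral_abs_bound)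
    also have "\<dots> \<le> (\<integral>z. (r / 4) * (?d z)\<^sup>2 + (1 / r) * (f z - g z)\<^sup>2 \<partial>Q)"
    proof (intro integral_mono)
      fix z
      \<comment> \<open>Young's inequality with weights \<open>r / 4\<close> and
        \<open>1 / r\<close>: since \<open>|d m|^2 \<le> 1\<close> and
        \<open>|f - g|^2 \<le> (r / 2)^2\<close> in \<open>L^2\<close>, both terms integrate to at
        most \<open>r / 4\<close>.\<close>
      have "0 \<le> (r / 2 * \<bar>?d z\<bar> - \<bar>f z - g z\<bar>)\<^sup>2 / r" using \<open>0 < r\<close> by simp
      also have "\<dots> = (r / 4) * \<bar>?d z\<bar>\<^sup>2 + (1 / r) * \<bar>f z - g z\<bar>\<^sup>2 - \<bar>?d z\<bar> * \<bar>f z - g z\<bar>"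
        using \<open>0 < r\<close> by (simp add: power2_eq_square field_simps)
      finally show "\<bar>?d z * (f z - g z)\<bar> \<le> (r / 4) * (?d z)\<^sup>2 + (1 / r) * (f z - g z)\<^sup>2"
        by (simp add: abs_mult)
    qed (use id i int_d_sq in auto)
    also have "\<dots> = (r / 4) * (\<integral>z. (?d z)\<^sup>2 \<partial>Q) + (1 / r) * (\<integral>z. (f z - g z)\<^sup>2 \<partial>Q)"
      using i int_d_sq by simp
    also have "\<dots> \<le> (r / 4) * 1 + (1 / r) * (r / 2)\<^sup>2"
      using fg d_norm_le \<open>0 < r\<close> by (intro add_mono mult_left_mono) auto
    also have "\<dots> = r / 2" using \<open>0 < r\<close> by (simp add: power2_eq_square)
    finally have "\<bar>\<integral>z. ?d z * (f z - g z) \<partial>Q\<bar> \<le> r / 2" .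
    moreover have "(\<integral>z. ?d z * f z \<partial>Q) = (\<integral>z. ?d z * (f z - g z) \<partial>Q) + (\<integral>z. ?d z * g z \<partial>Q)"
      using id by (subst Bochner_Integration.integral_add[symmetric]) (auto simp: algebra_simps)
    ultimately show "norm ((\<integral>z. ?d z * f z \<partial>Q) - 0) < r"
      using N[OF \<open>m \<ge> N\<close>] by simp
  qed
qed

text \<open>Jensen in \<open>u\<close> reduces the pairing with a rectangle to
  \<open>d_column\<close> for the indicator of \<open>B\<close>.\<close>

lemma weakly_rectangle:
  assumes [measurable]: "A \<in> sets \<mu>" "B \<in> sets \<nu>"
  shows "weakly (indicator (A \<times> B))"
proof -
  have dc: "(\<lambda>m. \<integral>u. (\<integral>v. d m u v * indicator B v \<partial>\<nu>)\<^sup>2 \<partial>\<mu>) \<longlonglongrightarrow> 0"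
    by (rule d_column) (auto simp: indicator_def)
  have b: "\<bar>\<integral>v. d m u v * indicator B v \<partial>\<nu>\<bar> \<le> 2 ^ m" if "u \<in> space \<mu>" for u m
    using that abs_mult_le_real[of "d m u _" "2^m" "indicator B _" 1]
    by (intro V.abs_integral_le) (auto simp: d_bound indicator_def)
  have eq: "(\<integral>z. d m (fst z) (snd z) * indicator (A \<times> B) z \<partial>Q)
     = (\<integral>u. indicator A u * (\<integral>v. d m u v * indicator B v \<partial>\<nu>) \<partial>\<mu>)" for m
  proof -
    have "(\<integral>z. d m (fst z) (snd z) * (indicator A (fst z) * indicator B (snd z)) \<partial>Q)
      = (\<integral>u. (\<integral>v. d m u v * (indicator A u * indicator B v) \<partial>\<nu>) \<partial>\<mu>)"
      by (intro Fubini_bounded(2)[where B="2^m * 1"] abs_mult_le_real) (auto simp: d_bound indicator_def)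
    then show ?thesis by (simp add: indicator_times ac_simps)
  qed
  have le: "(\<integral>z. d m (fst z) (snd z) * indicator (A \<times> B) z \<partial>Q)\<^sup>2 \<le> (\<integral>u. (\<integral>v. d m u v * indicator B v \<partial>\<nu>)\<^sup>2 \<partial>\<mu>)" for m
  proof -
    have b1: "\<bar>indicator A u * (\<integral>v. d m u v * indicator B v \<partial>\<nu>)\<bar> \<le> 1 * 2 ^ m" if "u \<in> space \<mu>" for u
      using that by (intro abs_mult_le_real b) (auto simp: indicator_def)
    have i: "integrable \<mu> (\<lambda>u. (indicator A u * (\<integral>v. d m u v * indicator B v \<partial>\<nu>))\<^sup>2)"
      unfolding power2_eq_square
      by (rule U.integrable_bounded[where B="(1*2^m)*(1*2^m)"], measurable) (intro abs_mult_le_real b1)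
    have i2: "integrable \<mu> (\<lambda>u. (\<integral>v. d m u v * indicator B v \<partial>\<nu>)\<^sup>2)"
      unfolding power2_eq_square
      by (rule U.integrable_bounded[where B="(2^m)*(2^m)"], measurable) (intro abs_mult_le_real b)
    have "(\<integral>z. d m (fst z) (snd z) * indicator (A \<times> B) z \<partial>Q)\<^sup>2
      \<le> (\<integral>u. (indicator A u * (\<integral>v. d m u v * indicator B v \<partial>\<nu>))\<^sup>2 \<partial>\<mu>)"
      unfolding eq using b1
      by (intro U.square_integral_le i U.integrable_bounded[where B="1*2^m"]) auto
    also have "\<dots> \<le> (\<integral>u. (\<integral>v. d m u v * indicator B v \<partial>\<nu>)\<^sup>2 \<partial>\<mu>)"
      by (intro integral_mono i i2) (auto simp: indicator_def)
    finally show ?thesis .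
  qed
  have "(\<lambda>m. (\<integral>z. d m (fst z) (snd z) * indicator (A \<times> B) z \<partial>Q)\<^sup>2) \<longlonglongrightarrow> 0"
    by (rule tendsto_sandwich[OF _ _ tendsto_const dc]) (use le in auto)
  then show ?thesis unfolding weakly_def by (rule tendsto_zero_of_square)
qed

text \<open>Rectangles are stable under intersection and generate the product sigma-algebra, so
  complements and disjoint unions suffice; a countable union is an \<open>L^2\<close> limit of
  finite ones.\<close>

lemma weakly_indicator:
  assumes "E \<in> sets Q" shows "weakly (indicator E)"
proof -
  have one: "weakly (\<lambda>z. indicator (space \<mu> \<times> space \<nu>) z)" by (rule weakly_rectangle) auto
  have zero: "weakly (\<lambda>_. 0)" by (simp add: weakly_def)
  have "E \<in> sigma_sets (space \<mu> \<times> space \<nu>) {a \<times> b |a b. a \<in> sets \<mu> \<and> b \<in> sets \<nu>}"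
    using assms by (simp add: sets_pair_measure)
  then show ?thesis
  proof (rule sigma_sets_induct_disjoint[OF Int_stable_pair_measure_generator pair_measure_closed], goal_cases)
    case (1 A) then show ?case using weakly_rectangle by auto
  next
    case 2 then show ?case using zero by (simp add: indicator_def[abs_def])
  next
    case (3 A)
    then have [measurable]: "A \<in> sets Q" by (simp add: sets_pair_measure)
    have "weakly (\<lambda>z. indicator (space \<mu> \<times> space \<nu>) z + (-1) * indicator A z)"
      using 3 by (intro weakly_add[where B=1 and C=1] one) (auto simp: indicator_def)
    also have "(\<lambda>z. indicator (space \<mu> \<times> space \<nu>) z + (-1) * indicator A z :: real) = indicator (space \<mu> \<times> space \<nu> - A)"
      using sets.sets_into_space[OF \<open>A \<in> sets Q\<close>] by (auto simp: fun_eq_iff indicator_def space_pair_measure)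
    finally show ?case .
  next
    case (4 A)
    then have [measurable]: "A i \<in> sets Q" for i by (auto simp: sets_pair_measure)
    have w: "weakly (indicator (\<Union>i<n. A i))" for n
    proof (induction n)
      case 0 then show ?case using zero by (simp add: indicator_def[abs_def])
    next
      case (Suc n)
      have "weakly (\<lambda>z. indicator (\<Union>i<n. A i) z + 1 * indicator (A n) z)"
        using 4 Suc by (intro weakly_add[where B=1 and C=1]) (auto simp: indicator_def)
      also have "(\<lambda>z. indicator (\<Union>i<n. A i) z + 1 * indicator (A n) z :: real) = indicator (\<Union>i<Suc n. A i)"
      proof -
        have "z \<notin> A n" if "x < n" "z \<in> A x" for x z
          using that \<open>disjoint_family A\<close> unfolding disjoint_family_on_def by (metis IntI UNIV_I empty_iff less_irrefl)
        then show ?thesis by (auto simp: fun_eq_iff indicator_def lessThan_Suc)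
      qed
      finally show ?case .
    qed
    show ?case
    proof (rule weakly_closed[where B=1])
      fix e :: real assume e: "0 < e"
      have "(\<lambda>n. \<integral>z. (indicator (\<Union>i. A i) z - indicator (\<Union>i<n. A i) z :: real)\<^sup>2 \<partial>Q) \<longlonglongrightarrow> (\<integral>z. 0 \<partial>Q)"
      proof (rule integral_dominated_convergence[where w="\<lambda>_. 1"])
        show "AE z in Q. (\<lambda>n. (indicator (\<Union>i. A i) z - indicator (\<Union>i<n. A i) z :: real)\<^sup>2) \<longlonglongrightarrow> 0"
        proof (intro AE_I2)
          fix z
          have "(\<lambda>n. indicator (\<Union>i<n. A i) z :: real) \<longlonglongrightarrow> indicator (\<Union>i. A i) z"
            by (rule LIMSEQ_indicator_UN)
          from tendsto_power[OF tendsto_diff[OF tendsto_const this], of "indicator (\<Union>i. A i) z" 2]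
          show "(\<lambda>n. (indicator (\<Union>i. A i) z - indicator (\<Union>i<n. A i) z :: real)\<^sup>2) \<longlonglongrightarrow> 0" by simp
        qed
      qed (auto simp: indicator_def)
      then have "\<exists>n. (\<integral>z. (indicator (\<Union>i. A i) z - indicator (\<Union>i<n. A i) z :: real)\<^sup>2 \<partial>Q) < e\<^sup>2"
        using e order_tendstoD(2)[of _ 0 sequentially "e\<^sup>2"] by (auto simp: eventually_sequentially)
      then obtain n where "(\<integral>z. (indicator (\<Union>i. A i) z - indicator (\<Union>i<n. A i) z :: real)\<^sup>2 \<partial>Q) < e\<^sup>2" ..
      then show "\<exists>g\<in>borel_measurable Q. (\<exists>C. \<forall>z\<in>space Q. \<bar>g z\<bar> \<le> C) \<and> weakly g
        \<and> (\<integral>z. (indicator (\<Union>i. A i) z - g z)\<^sup>2 \<partial>Q) \<le> e\<^sup>2"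
        using w by (intro bexI[of _ "indicator (\<Union>i<n. A i)"] conjI exI[of _ 1]) (auto simp: indicator_def)
    qed (auto simp: indicator_def)
  qed
qed

lemma weakly_s: "weakly (\<lambda>z. s (fst z) (snd z))"
proof (rule weakly_closed[where B=1])
  fix e :: real assume e: "0 < e"
  obtain n :: nat where n: "1 / real (Suc n) < e" using e nat_approx_posE by blast
  define N where "N = real (Suc n)"
  have N: "0 < N" by (simp add: N_def)
  \<comment> \<open>\<open>s\<close> rounded down to the grid of mesh \<open>1 / N\<close>: a
    combination of indicators of the level sets \<open>E k\<close>, within \<open>1 / N < e\<close>
    of \<open>s\<close>.\<close>
  define g where "g z = of_int \<lfloor>N * s (fst z) (snd z)\<rfloor> / N" for z
  define E where "E k = {z \<in> space Q. \<lfloor>N * s (fst z) (snd z)\<rfloor> = k}" for k :: int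
  have [measurable]: "E k \<in> sets Q" for k unfolding E_def by measurable
  have [measurable]: "g \<in> borel_measurable Q" unfolding g_def by measurable
  have sN: "- N \<le> N * s (fst z) (snd z)" "N * s (fst z) (snd z) \<le> N" if "z \<in> space Q" for z
  proof -
    have "\<bar>N * s (fst z) (snd z)\<bar> \<le> N * 1"
      using that N bound[of "fst z" "snd z"] by (intro abs_mult_le_real) (auto simp: space_pair_measure)
    then show "- N \<le> N * s (fst z) (snd z)" "N * s (fst z) (snd z) \<le> N" by auto
  qed
  let ?K = "{- int (Suc n)..int (Suc n)}"
  have gE: "g z = (\<Sum>k\<in>?K. (of_int k / N) * indicator (E k) z)" if "z \<in> space Q" for z
  proof -
    have "\<lfloor>N * s (fst z) (snd z)\<rfloor> \<in> ?K"
      using sN(1)[OF that] floor_mono[OF sN(2)[OF that]] by (auto simp: N_def le_floor_iff)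
    moreover have "(\<Sum>k\<in>?K. (of_int k / N) * indicator (E k) z)
      = (\<Sum>k\<in>?K. if k = \<lfloor>N * s (fst z) (snd z)\<rfloor> then of_int k / N else 0)"
      using that by (intro sum.cong) (auto simp: E_def indicator_def)
    ultimately show ?thesis by (simp add: g_def sum.delta)
  qed
  have "weakly (\<lambda>z. \<Sum>k\<in>K. (of_int k / N) * indicator (E k) z)" if "finite K" for K
    using that
  proof (induction K)
    case (insert k K)
    have "weakly (\<lambda>z. (\<Sum>k\<in>K. (of_int k / N) * indicator (E k) z) + (of_int k / N) * indicator (E k) z)"
    proof (intro weakly_add[where B="\<Sum>k\<in>K. \<bar>of_int k / N\<bar>" and C=1] insert weakly_indicator)
      fix z
      have "\<bar>\<Sum>k\<in>K. (of_int k / N) * indicator (E k) z\<bar> \<le> (\<Sum>k\<in>K. \<bar>(of_int k / N) * indicator (E k) z\<bar>)"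
        by (rule sum_abs)
      also have "\<dots> \<le> (\<Sum>k\<in>K. \<bar>of_int k / N\<bar>)"
        by (intro sum_mono) (auto simp: indicator_def)
      finally show "\<bar>\<Sum>k\<in>K. (of_int k / N) * indicator (E k) z\<bar> \<le> (\<Sum>k\<in>K. \<bar>of_int k / N\<bar>)" .
    qed (auto simp: indicator_def)
    then show ?case using insert by (simp add: add.commute)
  qed (simp add: weakly_def)
  then have "weakly (\<lambda>z. \<Sum>k\<in>?K. (of_int k / N) * indicator (E k) z)" by simp
  also have "weakly (\<lambda>z. \<Sum>k\<in>?K. (of_int k / N) * indicator (E k) z) \<longleftrightarrow> weakly g"
    unfolding weakly_def using gE by (intro arg_cong[where f="\<lambda>f. f \<longlonglongrightarrow> 0"] ext Bochner_Integration.integral_cong) auto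
  finally have "weakly g" .
  have diff: "0 \<le> s (fst z) (snd z) - g z" "s (fst z) (snd z) - g z \<le> 1 / N" for z
  proof -
    have "0 \<le> N * s (fst z) (snd z) - of_int \<lfloor>N * s (fst z) (snd z)\<rfloor>" "N * s (fst z) (snd z) - of_int \<lfloor>N * s (fst z) (snd z)\<rfloor> \<le> 1"
      by linarith+
    moreover have eq: "s (fst z) (snd z) - g z = (N * s (fst z) (snd z) - of_int \<lfloor>N * s (fst z) (snd z)\<rfloor>) / N"
      using N by (simp add: g_def diff_divide_distrib)
    ultimately show "0 \<le> s (fst z) (snd z) - g z" "s (fst z) (snd z) - g z \<le> 1 / N"
      unfolding eq using N by (simp_all only: zero_le_divide_iff divide_right_mono) auto
  qed
  have sq: "(s (fst z) (snd z) - g z)\<^sup>2 \<le> (1 / N)\<^sup>2" for z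
    using diff[of z] by (intro power_mono) auto
  have "(\<integral>z. (s (fst z) (snd z) - g z)\<^sup>2 \<partial>Q) \<le> (\<integral>z. (1 / N)\<^sup>2 \<partial>Q)"
    using sq by (intro integral_mono integrable_bounded[where B="(1/N)\<^sup>2"]) auto
  also have "\<dots> \<le> e\<^sup>2" using n N e by (auto simp: prob_space N_def intro!: power_mono)
  finally have "(\<integral>z. (s (fst z) (snd z) - g z)\<^sup>2 \<partial>Q) \<le> e\<^sup>2" .
  moreover have "\<bar>g z\<bar> \<le> 3" if "z \<in> space Q" for z
  proof -
    have "1 / N \<le> 1" by (simp add: N_def)
    moreover have "\<bar>s (fst z) (snd z)\<bar> \<le> 1" using that by (auto simp: space_pair_measure bound)
    ultimately show ?thesis using diff[of z] by linarith
  qed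
  ultimately show "\<exists>g\<in>borel_measurable Q. (\<exists>C. \<forall>z\<in>space Q. \<bar>g z\<bar> \<le> C) \<and> weakly g
        \<and> (\<integral>z. (s (fst z) (snd z) - g z)\<^sup>2 \<partial>Q) \<le> e\<^sup>2"
    using \<open>weakly g\<close> by (intro bexI[of _ g] conjI exI[of _ 3]) auto
qed (auto simp: space_pair_measure bound)

text \<open>By \<open>d_inner\<close> the squared \<open>L^2\<close> norm of \<open>d m\<close> is
  the pairing of \<open>d (m + m)\<close> with \<open>s\<close>, which tends to zero by
  \<open>weakly_s\<close>. The \<open>L^1\<close> norm is what controls a residual multiplied by
  entries of absolute value at most 1.\<close>

lemma d_L1:
  "(\<lambda>m. \<integral>z. \<bar>d m (fst z) (snd z)\<bar> \<partial>Q) \<longlonglongrightarrow> 0"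
  "(\<integral>z. \<bar>d m (fst z) (snd z)\<bar> \<partial>Q) \<le> 1"
proof -
  have sq: "(\<integral>z. \<bar>d m (fst z) (snd z)\<bar> \<partial>Q)\<^sup>2 \<le> (\<integral>z. (d m (fst z) (snd z))\<^sup>2 \<partial>Q)" for m
  proof -
    have "integrable Q (\<lambda>z. \<bar>d m (fst z) (snd z)\<bar>)"
      by (rule integrable_bounded[where B="2^m"], measurable) (simp only: abs_idempotent d_bound')
    from square_integral_le[OF this] int_d_sq[of m] show ?thesis by (simp only: power2_abs)
  qed
  have "(\<lambda>m. \<integral>z. d m (fst z) (snd z) * s (fst z) (snd z) \<partial>Q) \<longlonglongrightarrow> 0"
    using weakly_s by (simp add: weakly_def)
  then have "(\<lambda>m. \<integral>z. d (m + m) (fst z) (snd z) * s (fst z) (snd z) \<partial>Q) \<longlonglongrightarrow> 0"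
    using LIMSEQ_subseq_LIMSEQ[of _ 0 "\<lambda>m. m + m"] by (auto simp: strict_mono_def o_def)
  then have "(\<lambda>m. \<integral>z. (d m (fst z) (snd z))\<^sup>2 \<partial>Q) \<longlonglongrightarrow> 0"
    by (simp add: d_inner power2_eq_square)
  note lim = this
  have "(\<lambda>m. (\<integral>z. \<bar>d m (fst z) (snd z)\<bar> \<partial>Q)\<^sup>2) \<longlonglongrightarrow> 0"
    by (rule tendsto_sandwich[OF _ _ tendsto_const lim]) (use sq in auto)
  then show "(\<lambda>m. \<integral>z. \<bar>d m (fst z) (snd z)\<bar> \<partial>Q) \<longlonglongrightarrow> 0"
    by (rule tendsto_zero_of_square)
  have "(\<integral>z. \<bar>d m (fst z) (snd z)\<bar> \<partial>Q)\<^sup>2 \<le> 1" using sq d_norm_le order_trans by blast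
  then show "(\<integral>z. \<bar>d m (fst z) (snd z)\<bar> \<partial>Q) \<le> 1" by (simp add: abs_square_le_1)
qed

end

section \<open>Moments of arrays over multisets of cells\<close>

text \<open>Resampling the coordinate \<open>k\<close> preserves the product law. As
  \<open>F\<close> ignores this coordinate in its first argument, \<open>x k\<close> acts as an
  independent sample and can be integrated out; read backwards, an integral over one variable
  becomes a fresh coordinate.\<close>

lemma PiM_fresh:
  fixes F :: "('i \<Rightarrow> 'a) \<Rightarrow> 'a \<Rightarrow> real"
  assumes M: "prob_space M" and k: "k \<in> I"
    and [measurable]: "(\<lambda>(x, y). F x y) \<in> borel_measurable (PiM I (\<lambda>_. M) \<Otimes>\<^sub>M M)"
    and F: "\<And>x y z. x \<in> space (PiM I (\<lambda>_. M)) \<Longrightarrow> z \<in> space M \<Longrightarrow> F (x(k := z)) y = F x y"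
    and B: "\<And>x y. x \<in> space (PiM I (\<lambda>_. M)) \<Longrightarrow> y \<in> space M \<Longrightarrow> \<bar>F x y\<bar> \<le> B"
  shows "(\<integral>x. F x (x k) \<partial>PiM I (\<lambda>_. M)) = (\<integral>x. (\<integral>y. F x y \<partial>M) \<partial>PiM I (\<lambda>_. M))"
proof -
  let ?P = "PiM I (\<lambda>_. M)"
  interpret M: prob_space M by fact
  interpret PI: prob_space ?P by (intro prob_space_PiM M)
  interpret pair_prob_space M ?P ..
  have I: "insert k I = I" using k by auto
  have D: "distr (M \<Otimes>\<^sub>M ?P) ?P (\<lambda>(x, X). X(k := x)) = ?P"
    using distr_pair_PiM_eq_PiM[of I "\<lambda>_. M" k] M by (simp add: I)
  have [measurable]: "(\<lambda>(x, X). X(k := x)) \<in> measurable (M \<Otimes>\<^sub>M ?P) ?P"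
    using measurable_add_dim[of k I "\<lambda>_. M"] measurable_compose[OF measurable_pair_swap' measurable_add_dim[of k I "\<lambda>_. M"]]
    by (simp add: I case_prod_beta)
  have [measurable]: "(\<lambda>x. x k) \<in> measurable ?P M" using k by measurable
  have "(\<integral>x. F x (x k) \<partial>?P) = (\<integral>z. F ((snd z)(k := fst z)) (fst z) \<partial>(M \<Otimes>\<^sub>M ?P))"
    by (subst D[symmetric], subst integral_distr) (auto simp: case_prod_beta)
  also have "\<dots> = (\<integral>(y, x). F x y \<partial>(M \<Otimes>\<^sub>M ?P))"
    by (intro Bochner_Integration.integral_cong) (auto simp: F space_pair_measure)
  also have "\<dots> = (\<integral>x. (\<integral>y. F x y \<partial>M) \<partial>?P)"
    using B by (intro integral_snd[symmetric] integrable_bounded[where B=B]) (auto simp: space_pair_measure)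
  finally show ?thesis .
qed

type_synonym cells = "(nat \<times> nat) multiset"

text \<open>The entries \<open>u\<close> and \<open>v\<close> of a cell \<open>(l, i)\<close> are row (replica) and column indices.\<close>

definition fresh :: "cells \<Rightarrow> nat \<times> nat \<Rightarrow> nat" where
  "fresh M y = Suc (Max (fst ` set_mset (add_mset y M) \<union> snd ` set_mset (add_mset y M)))"

lemma fresh: "p \<in># add_mset y M \<Longrightarrow> fst p < fresh M y" "p \<in># add_mset y M \<Longrightarrow> snd p < fresh M y"
  unfolding fresh_def by (intro le_imp_less_Suc Max_ge; force)+

definition valid :: "cells \<Rightarrow> bool" where "valid M \<longleftrightarrow> set_mset M \<subseteq> {1..} \<times> {1..}"

lemma valid_simps [simp]: "valid {#}" "valid (add_mset y M) \<longleftrightarrow> 1 \<le> fst y \<and> 1 \<le> snd y \<and> valid M"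
  "valid (M + N) \<longleftrightarrow> valid M \<and> valid N"
  unfolding valid_def by (cases y; force)+

text \<open>If \<open>\<phi> M\<close> is the mean of the product of the entries of a random array over the cells \<open>M\<close>, then
  \<open>resid \<phi> m M y\<close> is the mean of that product times the \<open>m\<close>-th residual \<open>d m\<close> at the cell \<open>y\<close>.\<close>

fun resid :: "(cells \<Rightarrow> real) \<Rightarrow> nat \<Rightarrow> cells \<Rightarrow> nat \<times> nat \<Rightarrow> real" where
  "resid \<phi> 0 M y = \<phi> (add_mset y M)"
| "resid \<phi> (Suc m) M y = resid \<phi> m M y
     - resid \<phi> m (add_mset (fst y, fresh M y) (add_mset (fresh M y, fresh M y) M)) (fresh M y, snd y)"

lemma resid_diff: "resid (\<lambda>M. \<phi> M - \<psi> M) m M y = resid \<phi> m M y - resid \<psi> m M y"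
  by (induction m arbitrary: M y) auto

text \<open>On arrays of distinct cells \<open>\<psi>\<close> vanishes, so \<open>resid \<psi> m\<close> does not depend on \<open>m\<close>.\<close>

lemma determined_by_distinct:
  assumes distinct: "\<And>S. finite S \<Longrightarrow> S \<subseteq> {1..} \<times> {1..} \<Longrightarrow> \<psi> (mset_set S) = 0"
    and lim: "\<And>M y. valid (add_mset y M) \<Longrightarrow> (\<lambda>m. resid \<psi> m M y) \<longlonglongrightarrow> 0"
    and "valid M"
  shows "\<psi> M = 0"
proof -
  \<comment> \<open>Adjoining an arbitrary set \<open>S\<close> of distinct cells makes the
    induction go through: the fresh cells created by \<open>resid\<close> are collected in
    \<open>S\<close>.\<close>
  have "\<psi> (M + mset_set S) = 0" if "finite S" "S \<subseteq> {1..} \<times> {1..}" for S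
    using \<open>valid M\<close> that
  proof (induction M arbitrary: S)
    case empty then show ?case using distinct by simp
  next
    case (add y M)
    \<comment> \<open>A cell \<open>y\<close> outside \<open>S\<close> can itself be put into
      \<open>S\<close>. Every further term of the residual again has its last cell outside the
      enlarged set, so the induction hypothesis for \<open>M\<close> kills all of them.\<close>
    have C: "resid \<psi> m (M + mset_set S) y = 0"
      if "finite S" "S \<subseteq> {1..} \<times> {1..}" "y \<notin> S" "1 \<le> fst y" "1 \<le> snd y" for m S y
      using that
    proof (induction m arbitrary: S y)
      case 0
      have "\<psi> (M + mset_set (insert y S)) = 0" using 0 add by (cases y) (intro add; auto)
      then show ?case using 0 by simp
    next
      case (Suc m)
      define k where "k = fresh (M + mset_set S) y"
      have k: "fst p < k" "snd p < k" if "p \<in> S \<or> p = y" for p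
        using fresh[of p y "M + mset_set S"] that Suc.prems by (auto simp: k_def)
      have k1: "1 \<le> k" by (simp add: k_def fresh_def)
      let ?S = "insert (fst y, k) (insert (k, k) S)"
      have n: "(fst y, k) \<notin> insert (k, k) S" "(k, k) \<notin> S" "(k, snd y) \<notin> ?S"
        using k[of "(fst y, k)"] k[of "(k,k)"] k[of "(k, snd y)"] k[of y] by auto
      have "resid \<psi> m (M + mset_set ?S) (k, snd y) = 0"
        using Suc.prems n k1 by (intro Suc.IH) auto
      moreover have "resid \<psi> m (M + mset_set S) y = 0" using Suc by blast
      ultimately show ?case using n Suc.prems by (simp add: k_def[symmetric])
    qed
    \<comment> \<open>Each subtracted term ends in the cell \<open>(k, snd y)\<close> with
      \<open>k\<close> fresh, which \<open>C\<close> covers; only the term with the possibly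
      repeated cell \<open>y\<close> is left. The sequence in \<open>lim\<close> is therefore
      constant.\<close>
    have const: "resid \<psi> m (M + mset_set S) y = \<psi> (add_mset y (M + mset_set S))" for m
    proof (induction m)
      case (Suc m)
      define k where "k = fresh (M + mset_set S) y"
      have k: "fst p < k" "snd p < k" if "p \<in> S \<or> p = y" for p
        using fresh[of p y "M + mset_set S"] that add.prems by (auto simp: k_def)
      have k1: "1 \<le> k" by (simp add: k_def fresh_def)
      let ?S = "insert (fst y, k) (insert (k, k) S)"
      have n: "(fst y, k) \<notin> insert (k, k) S" "(k, k) \<notin> S" "(k, snd y) \<notin> ?S"
        using k[of "(fst y, k)"] k[of "(k,k)"] k[of "(k, snd y)"] k[of y] by auto
      have "resid \<psi> m (M + mset_set ?S) (k, snd y) = 0"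
        using add.prems n k1 by (intro C) auto
      then show ?case using Suc n add.prems by (simp add: k_def[symmetric])
    qed simp
    have "valid (mset_set S)" using add.prems by (auto simp: valid_def)
    then have "(\<lambda>m. resid \<psi> m (M + mset_set S) y) \<longlonglongrightarrow> 0" using add.prems by (intro lim) auto
    then show ?case unfolding const by (simp add: LIMSEQ_const_iff)
  qed
  from this[of "{}"] show ?thesis by simp
qed

text \<open>Kept opaque so that the simplifier does not rewrite the index set.\<close>

definition pos :: "nat set" where "pos = {1..}"

lemma pos_iff [simp]: "k \<in> pos \<longleftrightarrow> 1 \<le> k" by (simp add: pos_def)

section \<open>Residual moments of a random array of kernel entries\<close>

context kernel begin

abbreviation "rowsM \<equiv> PiM pos (\<lambda>_. \<mu>)"
abbreviation "colsM \<equiv> PiM pos (\<lambda>_. \<nu>)"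

definition cellprod :: "cells \<Rightarrow> (nat \<Rightarrow> 'u) \<Rightarrow> (nat \<Rightarrow> 'v) \<Rightarrow> real" where
  "cellprod M us vs = (\<Prod>(l, i)\<in>#M. s (us l) (vs i))"

definition moment :: "cells \<Rightarrow> real" where
  "moment M = (\<integral>us. (\<integral>vs. cellprod M us vs \<partial>colsM) \<partial>rowsM)"

lemma cellprod_simps [simp]: "cellprod {#} us vs = 1"
  "cellprod (add_mset y M) us vs = s (us (fst y)) (vs (snd y)) * cellprod M us vs"
  by (simp_all add: cellprod_def case_prod_beta)

lemma meas_entry:
  assumes "1 \<le> l" "1 \<le> i" and [measurable]: "(\<lambda>(u, v). f u v) \<in> borel_measurable (\<mu> \<Otimes>\<^sub>M \<nu>)"
  shows "(\<lambda>(us, vs). f (us l) (vs i)) \<in> borel_measurable (rowsM \<Otimes>\<^sub>M colsM)"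
proof -
  have [measurable]: "(\<lambda>us. us l) \<in> measurable rowsM \<mu>" "(\<lambda>vs. vs i) \<in> measurable colsM \<nu>"
    using assms by simp_all
  show ?thesis by measurable
qed

lemma meas_cellprod [measurable (raw)]:
  assumes "valid M" shows "(\<lambda>(us, vs). cellprod M us vs) \<in> borel_measurable (rowsM \<Otimes>\<^sub>M colsM)"
  using assms
proof (induction M)
  case (add y M)
  have "(\<lambda>z. (case z of (us, vs) \<Rightarrow> s (us (fst y)) (vs (snd y))) * (case z of (us, vs) \<Rightarrow> cellprod M us vs))
     \<in> borel_measurable (rowsM \<Otimes>\<^sub>M colsM)"
    using add by (intro borel_measurable_times meas_entry) auto
  then show ?case by (simp add: case_prod_beta)
next
  case empty
  have "cellprod {#} = (\<lambda>us vs. 1)" by (simp add: fun_eq_iff)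
  then show ?case by simp
qed

lemma rowcol_space: "us \<in> space rowsM \<Longrightarrow> 1 \<le> l \<Longrightarrow> us l \<in> space \<mu>"
  "vs \<in> space colsM \<Longrightarrow> 1 \<le> i \<Longrightarrow> vs i \<in> space \<nu>"
  by (auto simp: space_PiM PiE_def Pi_def)

lemma cellprod_bound:
  assumes "valid M" "us \<in> space rowsM" "vs \<in> space colsM" shows "\<bar>cellprod M us vs\<bar> \<le> 1"
  using assms by (induction M) (auto intro!: s_mult_le rowcol_space)

lemma cellprod_upd:
  assumes "\<And>p. p \<in># M \<Longrightarrow> fst p \<noteq> k" shows "cellprod M (us(k := x)) vs = cellprod M us vs"
  using assms by (induction M) auto

lemma cellprod_upd':
  assumes "\<And>p. p \<in># M \<Longrightarrow> snd p \<noteq> k" shows "cellprod M us (vs(k := x)) = cellprod M us vs"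
  using assms by (induction M) auto

sublocale RC: prob_pair rowsM colsM
  by (intro prob_pair.intro prob_space_PiM U.prob_space_axioms V.prob_space_axioms)

text \<open>The analytic side of \<open>resid moment\<close>: the residual is integrated as a
  function instead of being expanded into cells.\<close>

definition dmoment :: "nat \<Rightarrow> cells \<Rightarrow> nat \<times> nat \<Rightarrow> real" where
  "dmoment m M y = (\<integral>us. (\<integral>vs. cellprod M us vs * d m (us (fst y)) (vs (snd y)) \<partial>colsM) \<partial>rowsM)"

lemma dmoment_0: "dmoment 0 M y = moment (add_mset y M)"
  by (simp add: dmoment_def moment_def mult.commute)

text \<open>The correction term of \<open>d\<close> contains an integral over a new row and, through
  \<open>R\<close>, one over a new column. Any \<open>k\<close> above all indices in use lets
  \<open>PiM_fresh\<close> turn both into coordinates \<open>k\<close>; the factors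
  \<open>s (us l) (vs k)\<close> and \<open>s (us k) (vs k)\<close> join the cells and the residual
  moves to \<open>(k, i)\<close>.\<close>

lemma dmoment_Suc:
  assumes y: "valid (add_mset y M)" and k: "\<And>p. p \<in># add_mset y M \<Longrightarrow> fst p < k \<and> snd p < k"
  shows "dmoment (Suc m) M y = dmoment m M y - dmoment m (add_mset (fst y, k) (add_mset (k, k) M)) (k, snd y)"
proof -
  obtain l i where yl: "y = (l, i)" by (cases y)
  have M: "valid M" and l: "1 \<le> l" and i: "1 \<le> i" using y by (auto simp: yl)
  have lk: "l < k" "i < k" "1 \<le> k" using k[of y] l by (auto simp: yl)
  have Mk: "fst p \<noteq> k" "snd p \<noteq> k" if "p \<in># M" for p using k[of p] that by auto
  note [measurable] = meas_cellprod[OF M]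
  have [measurable]: "(\<lambda>us. us j) \<in> measurable rowsM \<mu>" "(\<lambda>vs. vs j) \<in> measurable colsM \<nu>" if "1 \<le> j" for j
    using that by simp_all
  note [measurable] = this[OF l] this[OF i] this[OF lk(3)]
  note sp = rowcol_space(1)[OF _ l] rowcol_space(2)[OF _ i] rowcol_space(1)[OF _ lk(3)] rowcol_space(2)[OF _ lk(3)]
  have ml: "\<bar>cellprod M us vs * a\<bar> \<le> B" if "us \<in> space rowsM" "vs \<in> space colsM" "\<bar>a\<bar> \<le> B" for us vs a B
    using abs_mult_le_real[OF cellprod_bound[OF M that(1,2)] that(3)] by simp
  let ?I = "\<lambda>u v. \<integral>u'. R u u' * d m u' v \<partial>\<mu>"
  have Ib: "\<bar>?I (us l) (vs i)\<bar> \<le> 2 ^ m" if "us \<in> space rowsM" "vs \<in> space colsM" for us vs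
    using that sp by (intro U.abs_integral_le R_mult_le d_bound) auto
  have "dmoment (Suc m) M y = (\<integral>us. (\<integral>vs. cellprod M us vs * d m (us l) (vs i) - cellprod M us vs * ?I (us l) (vs i) \<partial>colsM) \<partial>rowsM)"
    unfolding dmoment_def by (simp add: yl right_diff_distrib)
  also have "\<dots> = dmoment m M y - (\<integral>us. (\<integral>vs. cellprod M us vs * ?I (us l) (vs i) \<partial>colsM) \<partial>rowsM)"
  proof -
    have 1: "integrable colsM (\<lambda>vs. cellprod M us vs * d m (us l) (vs i))" "integrable colsM (\<lambda>vs. cellprod M us vs * ?I (us l) (vs i))"
      if "us \<in> space rowsM" for us
    proof -
      have "(\<lambda>(us, vs). cellprod M us vs * d m (us l) (vs i)) \<in> borel_measurable (rowsM \<Otimes>\<^sub>M colsM)"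
        "(\<lambda>(us, vs). cellprod M us vs * ?I (us l) (vs i)) \<in> borel_measurable (rowsM \<Otimes>\<^sub>M colsM)"
        by measurable
      note m = this[THEN measurable_Pair2, OF that, simplified]
      show "integrable colsM (\<lambda>vs. cellprod M us vs * d m (us l) (vs i))"
        by (rule RC.V.integrable_bounded[where B="2^m", OF m(1)]) (intro ml d_bound sp that)
      show "integrable colsM (\<lambda>vs. cellprod M us vs * ?I (us l) (vs i))"
        by (rule RC.V.integrable_bounded[where B="2^m", OF m(2)]) (intro ml Ib that)
    qed
    have 2: "integrable rowsM (\<lambda>us. \<integral>vs. cellprod M us vs * d m (us l) (vs i) \<partial>colsM)"
      by (intro RC.U.integrable_bounded[where B="2^m"] RC.V.abs_integral_le ml d_bound sp) auto
    have 3: "integrable rowsM (\<lambda>us. \<integral>vs. cellprod M us vs * ?I (us l) (vs i) \<partial>colsM)"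
      by (intro RC.U.integrable_bounded[where B="2^m"] RC.V.abs_integral_le ml Ib sp) auto
    have "(\<integral>us. (\<integral>vs. cellprod M us vs * d m (us l) (vs i) - cellprod M us vs * ?I (us l) (vs i) \<partial>colsM) \<partial>rowsM)
      = (\<integral>us. (\<integral>vs. cellprod M us vs * d m (us l) (vs i) \<partial>colsM) - (\<integral>vs. cellprod M us vs * ?I (us l) (vs i) \<partial>colsM) \<partial>rowsM)"
      by (intro Bochner_Integration.integral_cong Bochner_Integration.integral_diff 1) auto
    then show ?thesis using 2 3 by (simp add: dmoment_def yl)
  qed
  also have "(\<integral>us. (\<integral>vs. cellprod M us vs * ?I (us l) (vs i) \<partial>colsM) \<partial>rowsM)
    = (\<integral>vs. (\<integral>us. cellprod M us vs * ?I (us l) (vs i) \<partial>rowsM) \<partial>colsM)"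
    by (intro RC.Fubini_bounded(1)[where B="2^m", symmetric] ml Ib) auto
  also have "\<dots> = (\<integral>vs. (\<integral>us. (\<integral>u'. cellprod M us vs * (R (us l) u' * d m u' (vs i)) \<partial>\<mu>) \<partial>rowsM) \<partial>colsM)"
    by simp
  also have "\<dots> = (\<integral>vs. (\<integral>us. cellprod M us vs * (R (us l) (us k) * d m (us k) (vs i)) \<partial>rowsM) \<partial>colsM)"
  proof (rule Bochner_Integration.integral_cong[OF refl])
    fix vs assume vs: "vs \<in> space colsM"
    note [measurable] = vs sp(2)[OF vs]
    show "(\<integral>us. (\<integral>u'. cellprod M us vs * (R (us l) u' * d m u' (vs i)) \<partial>\<mu>) \<partial>rowsM)
      = (\<integral>us. cellprod M us vs * (R (us l) (us k) * d m (us k) (vs i)) \<partial>rowsM)"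
    proof (rule PiM_fresh[OF U.prob_space_axioms, where B="2^m", symmetric])
      show "k \<in> pos" using lk by simp
      show "cellprod M (us(k := u)) vs * (R ((us(k := u)) l) u' * d m u' (vs i)) = cellprod M us vs * (R (us l) u' * d m u' (vs i))" for us u u'
        using lk Mk by (simp add: cellprod_upd)
      show "\<bar>cellprod M us vs * (R (us l) u' * d m u' (vs i))\<bar> \<le> 2 ^ m" if "us \<in> space rowsM" "u' \<in> space \<mu>" for us u'
        using that vs sp by (intro ml R_mult_le d_bound) auto
    qed measurable
  qed
  also have "\<dots> = (\<integral>us. (\<integral>vs. cellprod M us vs * (R (us l) (us k) * d m (us k) (vs i)) \<partial>colsM) \<partial>rowsM)"
    by (intro RC.Fubini_bounded(1)[where B="2^m"] ml R_mult_le d_bound sp) auto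
  also have "\<dots> = (\<integral>us. (\<integral>vs. (\<integral>v'. (cellprod M us vs * d m (us k) (vs i)) * (s (us l) v' * s (us k) v') \<partial>\<nu>) \<partial>colsM) \<partial>rowsM)"
    unfolding R_def by (simp only: integral_mult_right_zero) (simp only: ac_simps)
  also have "\<dots> = (\<integral>us. (\<integral>vs. (cellprod M us vs * d m (us k) (vs i)) * (s (us l) (vs k) * s (us k) (vs k)) \<partial>colsM) \<partial>rowsM)"
  proof (rule Bochner_Integration.integral_cong[OF refl])
    fix us assume us: "us \<in> space rowsM"
    note [measurable] = us sp(1)[OF us] sp(3)[OF us]
    show "(\<integral>vs. (\<integral>v'. (cellprod M us vs * d m (us k) (vs i)) * (s (us l) v' * s (us k) v') \<partial>\<nu>) \<partial>colsM)
      = (\<integral>vs. (cellprod M us vs * d m (us k) (vs i)) * (s (us l) (vs k) * s (us k) (vs k)) \<partial>colsM)"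
    proof (rule PiM_fresh[OF V.prob_space_axioms, where B="2^m * (1 * 1)", symmetric])
      show "k \<in> pos" using lk by simp
      show "(cellprod M us (vs(k := v)) * d m (us k) ((vs(k := v)) i)) * (s (us l) v' * s (us k) v')
        = (cellprod M us vs * d m (us k) (vs i)) * (s (us l) v' * s (us k) v')" for vs v v'
        using lk Mk by (simp add: cellprod_upd')
      show "\<bar>(cellprod M us vs * d m (us k) (vs i)) * (s (us l) v' * s (us k) v')\<bar> \<le> 2 ^ m * (1 * 1)" if "vs \<in> space colsM" "v' \<in> space \<nu>" for vs v'
        using that us sp by (intro abs_mult_le_real[of _ "2^m"] abs_mult_le_real[of _ 1] ml d_bound bound) auto
    qed measurable
  qed
  also have "\<dots> = dmoment m (add_mset (fst y, k) (add_mset (k, k) M)) (k, snd y)"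
    by (simp add: dmoment_def yl ac_simps)
  finally show ?thesis .
qed

lemma dmoment_resid: "valid (add_mset y M) \<Longrightarrow> dmoment m M y = resid moment m M y"
proof (induction m arbitrary: M y)
  case (Suc m)
  have "dmoment (Suc m) M y = dmoment m M y
     - dmoment m (add_mset (fst y, fresh M y) (add_mset (fresh M y, fresh M y) M)) (fresh M y, snd y)"
    using Suc.prems fresh by (intro dmoment_Suc) blast+
  also have "\<dots> = resid moment (Suc m) M y"
    using Suc.prems by (subst (1 2) Suc.IH) (auto simp: fresh_def)
  finally show ?case .
qed (simp add: dmoment_0)

text \<open>The product of the other entries is at most 1 in absolute value, so the
  \<open>L^1\<close> norm of \<open>d m\<close> bounds the residual; the coordinates
  \<open>us l\<close> and \<open>vs i\<close> have the joint law
  \<open>\<mu> \<Otimes>\<^sub>M \<nu>\<close>.\<close>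

lemma resid_moment:
  assumes y: "valid (add_mset y M)"
  shows "\<bar>resid moment m M y\<bar> \<le> 1" "(\<lambda>m. resid moment m M y) \<longlonglongrightarrow> 0"
proof -
  obtain l i where yl: "y = (l, i)" by (cases y)
  have M: "valid M" and l: "1 \<le> l" and i: "1 \<le> i" using y by (auto simp: yl)
  note [measurable] = meas_cellprod[OF M]
  have [measurable]: "(\<lambda>us. us l) \<in> measurable rowsM \<mu>" "(\<lambda>vs. vs i) \<in> measurable colsM \<nu>"
    using l i by simp_all
  note sp = rowcol_space(1)[OF _ l] rowcol_space(2)[OF _ i]
  have "\<bar>resid moment m M y\<bar> \<le> (\<integral>z. \<bar>d m (fst z) (snd z)\<bar> \<partial>Q)" for m
  proof -
    have db: "\<bar>\<bar>d m (us l) (vs i)\<bar>\<bar> \<le> 2^m" if "us \<in> space rowsM" "vs \<in> space colsM" for us vs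
      using that by (simp add: d_bound sp)
    have mb: "\<bar>cellprod M us vs * d m (us l) (vs i)\<bar> \<le> \<bar>d m (us l) (vs i)\<bar>" if "us \<in> space rowsM" "vs \<in> space colsM" for us vs
      using abs_mult_le_real[OF cellprod_bound[OF M that] order_refl] by simp
    have mb': "\<bar>cellprod M us vs * d m (us l) (vs i)\<bar> \<le> 2 ^ m" if "us \<in> space rowsM" "vs \<in> space colsM" for us vs
      using mb[OF that] db[OF that] by simp
    let ?RC = "rowsM \<Otimes>\<^sub>M colsM"
    have "\<bar>resid moment m M y\<bar> = \<bar>\<integral>z. cellprod M (fst z) (snd z) * d m (fst z l) (snd z i) \<partial>?RC\<bar>"
      using mb' by (subst dmoment_resid[OF y, symmetric], subst RC.Fubini_bounded(2)[where B="2^m"]) (auto simp: dmoment_def yl)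
    also have "\<dots> \<le> (\<integral>z. \<bar>cellprod M (fst z) (snd z) * d m (fst z l) (snd z i)\<bar> \<partial>?RC)"
      by (rule integral_abs_bound)
    also have "\<dots> \<le> (\<integral>z. \<bar>d m (fst z l) (snd z i)\<bar> \<partial>?RC)"
      by (intro integral_mono RC.integrable_bounded[where B="2^m"]) (use mb mb' db in \<open>auto simp: space_pair_measure\<close>)
    also have "\<dots> = (\<integral>z. \<bar>d m (fst z) (snd z)\<bar> \<partial>Q)"
    proof -
      have "(\<integral>z. \<bar>d m (fst z) (snd z)\<bar> \<partial>Q) = (\<integral>z. \<bar>d m (fst z) (snd z)\<bar> \<partial>(distr rowsM \<mu> (\<lambda>us. us l) \<Otimes>\<^sub>M distr colsM \<nu> (\<lambda>vs. vs i)))"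
        using l i distr_PiM_component[of "pos" "\<lambda>_. \<mu>" l] distr_PiM_component[of "pos" "\<lambda>_. \<nu>" i]
        by (simp add: U.prob_space_axioms V.prob_space_axioms)
      also have "\<dots> = (\<integral>z. \<bar>d m (fst z l) (snd z i)\<bar> \<partial>?RC)"
        using i distr_PiM_component[of "pos" "\<lambda>_. \<nu>" i] V.sigma_finite_measure_axioms
        by (subst pair_measure_distr) (auto simp: integral_distr case_prod_beta V.prob_space_axioms)
      finally show ?thesis by simp
    qed
    finally show ?thesis .
  qed
  note le = this
  show "\<bar>resid moment m M y\<bar> \<le> 1" using le[of m] d_L1(2)[of m] by linarith
  have "(\<lambda>m. \<bar>resid moment m M y\<bar>) \<longlonglongrightarrow> 0"
    by (rule tendsto_sandwich[OF _ _ tendsto_const d_L1(1)]) (use le in auto)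
  then show "(\<lambda>m. resid moment m M y) \<longlonglongrightarrow> 0" by (simp add: tendsto_rabs_zero_iff)
qed

end

section \<open>Gaussian variables and processes\<close>

lemma std_gauss_space [simp]: "space std_gauss = UNIV" "sets std_gauss = sets borel"
  by (simp_all add: std_gauss_def)

lemma measurable_std_gauss [measurable_cong]: "sets std_gauss = sets borel" by simp

interpretation SG: prob_space std_gauss
  unfolding std_gauss_def by (rule prob_space_normal_density) simp

text \<open>Merges the point mass with the density case, so that moments and exponential tilts of
  both are computed from one standard variable.\<close>

lemma normal_law_std_gauss:
  assumes "0 \<le> s" shows "normal_law m s = distr std_gauss borel (\<lambda>x. m + s * x)"
proof (cases "s = 0")
  case True
  then show ?thesis
    using SG.prob_space_axioms by (auto simp: normal_law_def return_def intro!: measure_eqI)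
next
  case False
  with assms have s: "0 < s" by simp
  have "distributed std_gauss lborel (\<lambda>x. x) std_normal_density"
    by (auto simp: distributed_def std_gauss_def intro!: measure_eqI) (auto simp: emeasure_distr)
  from SG.normal_density_affine[OF this, of s m] s
  have "distributed std_gauss lborel (\<lambda>x. m + s * x) (normal_density m s)" by simp
  then have "distr std_gauss lborel (\<lambda>x. m + s * x) = density lborel (normal_density m s)"
    by (simp add: distributed_def)
  moreover have "distr std_gauss lborel (\<lambda>x. m + s * x) = distr std_gauss borel (\<lambda>x. m + s * x)"
    by (intro distr_cong) auto
  ultimately show ?thesis using False by (simp add: normal_law_def)
qed

text \<open>Cameron--Martin in dimension one: completing the square turns the exponential weight
  into a translation of Lebesgue measure.\<close>

lemma integral_std_gauss_shift:
  fixes f :: "real \<Rightarrow> real"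
  assumes [measurable]: "f \<in> borel_measurable borel"
  shows "(\<integral>x. f x * exp (c * x - c\<^sup>2 / 2) \<partial>std_gauss) = (\<integral>x. f (x + c) \<partial>std_gauss)"
proof -
  have "(\<integral>x. f x * exp (c * x - c\<^sup>2 / 2) \<partial>std_gauss) = (\<integral>x. std_normal_density x * (f x * exp (c * x - c\<^sup>2 / 2)) \<partial>lborel)"
    unfolding std_gauss_def by (subst integral_density) auto
  also have "\<dots> = (\<integral>x. std_normal_density (c + 1 * x) * (f (c + 1 * x) * exp (c * (c + 1 * x) - c\<^sup>2 / 2)) \<partial>lborel)"
    by (subst lborel_integral_real_affine[where c=1 and t=c]) simp_all
  also have "\<dots> = (\<integral>x. std_normal_density x * f (x + c) \<partial>lborel)"
  proof (intro Bochner_Integration.integral_cong refl)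
    fix x
    have "std_normal_density (c + x) * exp (c * (c + x) - c\<^sup>2 / 2) = std_normal_density x"
      by (simp add: std_normal_density_def exp_add[symmetric] power2_eq_square field_simps)
    then show "std_normal_density (c + 1 * x) * (f (c + 1 * x) * exp (c * (c + 1 * x) - c\<^sup>2 / 2)) = std_normal_density x * f (x + c)"
      by (simp add: ac_simps)
  qed
  also have "\<dots> = (\<integral>x. f (x + c) \<partial>std_gauss)"
    unfolding std_gauss_def by (subst integral_density) auto
  finally show ?thesis .
qed

lemma std_gauss_exp: "(\<integral>x. exp (c * x) \<partial>std_gauss) = exp (c\<^sup>2 / 2)" "integrable std_gauss (\<lambda>x. exp (c * x))"
proof -
  have 1: "(\<integral>x. exp (c * x - c\<^sup>2 / 2) \<partial>std_gauss) = 1"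
    using integral_std_gauss_shift[of "\<lambda>_. 1" c] by (simp add: SG.prob_space[simplified])
  have "(\<integral>x. exp (c * x) \<partial>std_gauss) = (\<integral>x. exp (c\<^sup>2 / 2) * exp (c * x - c\<^sup>2 / 2) \<partial>std_gauss)"
    by (simp add: exp_add[symmetric])
  also have "\<dots> = exp (c\<^sup>2 / 2)" by (simp only: integral_mult_right_zero 1 mult_1_right)
  finally show *: "(\<integral>x. exp (c * x) \<partial>std_gauss) = exp (c\<^sup>2 / 2)" .
  \<comment> \<open>A non-integrable function has Bochner integral 0, so a nonzero value proves
    integrability.\<close>
  show "integrable std_gauss (\<lambda>x. exp (c * x))"
    using * not_integrable_integral_eq[of std_gauss "\<lambda>x. exp (c * x)"] exp_not_eq_zero[of "c\<^sup>2 / 2"] by argo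
qed

lemma std_gauss_moments:
  "integrable std_gauss (\<lambda>x. x)" "(\<integral>x. x \<partial>std_gauss) = 0"
  "integrable std_gauss (\<lambda>x. x\<^sup>2)" "(\<integral>x. x\<^sup>2 \<partial>std_gauss) = 1"
  using integrable_std_normal_distribution_moment[of 1] integrable_std_normal_distribution_moment[of 2]
    integral_std_normal_distribution_moment_odd[of 1] std_normal_distribution_even_moments[of 1]
  by (simp_all add: std_gauss_def)

text \<open>A cosine with a free phase \<open>b\<close> replaces the characteristic function:
  \<open>b = 0\<close> and \<open>b = - pi / 2\<close> are its real and imaginary part. All
  comparisons of laws below use this real form.\<close>

lemma std_gauss_cos: "(\<integral>x. cos (a * x + b) \<partial>std_gauss) = cos b * exp (- a\<^sup>2 / 2)"
proof -
  have i: "integrable std_gauss (\<lambda>x. cos (a * x))" "integrable std_gauss (\<lambda>x. sin (a * x))"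
    by (auto intro!: SG.integrable_bounded[where B=1])
  have c: "(\<integral>x. iexp (a * x) \<partial>std_gauss) = complex_of_real (exp (- a\<^sup>2 / 2))"
    using fun_cong[OF char_std_normal_distribution, of a] by (simp add: char_def std_gauss_def)
  have ic: "integrable std_gauss (\<lambda>x. iexp (a * x))"
    using SG.integrable_iexp[of "\<lambda>x. a * x"] by simp
  have "(\<integral>x. cos (a * x) \<partial>std_gauss) = exp (- a\<^sup>2 / 2)"
    using arg_cong[OF c, of Re] ic by (simp flip: integral_Re add: Re_exp)
  moreover have "(\<integral>x. sin (a * x) \<partial>std_gauss) = 0"
    using arg_cong[OF c, of Im] ic by (simp flip: integral_Im add: Im_exp)
  ultimately show ?thesis
    using i by (simp add: cos_add)
qed

lemma gaussian_rv_std: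
  assumes "prob_space M" and X: "gaussian_rv M X" and mean: "(\<integral>\<omega>. X \<omega> \<partial>M) = 0"
  obtains s where "distr M borel X = distr std_gauss borel (\<lambda>x. s * x)" "(\<integral>\<omega>. (X \<omega>)\<^sup>2 \<partial>M) = s\<^sup>2"
    "integrable M X" "integrable M (\<lambda>\<omega>. (X \<omega>)\<^sup>2)"
proof -
  interpret M: prob_space M by fact
  have [measurable]: "X \<in> borel_measurable M" using X by (simp add: gaussian_rv_def)
  obtain m s where s: "0 \<le> s" and d: "distr M borel X = distr std_gauss borel (\<lambda>x. m + s * x)"
    using X by (auto simp: gaussian_rv_def normal_law_std_gauss)
  have tr: "(\<integral>\<omega>. f (X \<omega>) \<partial>M) = (\<integral>x. f (m + s * x) \<partial>std_gauss)" if [measurable]: "f \<in> borel_measurable borel" for f :: "real \<Rightarrow> real"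
    using arg_cong[OF d, of "\<lambda>N. integral\<^sup>L N f"] by (simp add: integral_distr)
  have ti: "integrable M (\<lambda>\<omega>. f (X \<omega>)) \<longleftrightarrow> integrable std_gauss (\<lambda>x. f (m + s * x))" if [measurable]: "f \<in> borel_measurable borel" for f :: "real \<Rightarrow> real"
    using arg_cong[OF d, of "\<lambda>N. integrable N f"] by (simp add: integrable_distr_eq)
  have "(\<integral>x. m + s * x \<partial>std_gauss) = (\<integral>x. m \<partial>std_gauss) + (\<integral>x. s * x \<partial>std_gauss)"
    using std_gauss_moments by (intro Bochner_Integration.integral_add) auto
  also have "\<dots> = m" by (simp only: lebesgue_integral_const SG.prob_space integral_mult_right_zero std_gauss_moments) simp
  finally have m: "m = 0" using tr[of "\<lambda>x. x"] mean by simp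
  show ?thesis
  proof (rule that[of s])
    show "distr M borel X = distr std_gauss borel (\<lambda>x. s * x)" using d by (simp only: m add_0)
    have "(\<integral>\<omega>. (X \<omega>)\<^sup>2 \<partial>M) = (\<integral>x. s\<^sup>2 * x\<^sup>2 \<partial>std_gauss)"
      using tr[of "\<lambda>x. x\<^sup>2"] by (simp only: m add_0 power_mult_distrib) simp
    also have "\<dots> = s\<^sup>2 * 1" by (subst integral_mult_right_zero) (simp only: std_gauss_moments)
    finally show "(\<integral>\<omega>. (X \<omega>)\<^sup>2 \<partial>M) = s\<^sup>2" by simp
    have "integrable std_gauss (\<lambda>x. s\<^sup>2 * x\<^sup>2)" "integrable std_gauss (\<lambda>x. s * x)"
      using std_gauss_moments by (auto intro!: integrable_mult_right)
    then show "integrable M (\<lambda>\<omega>. (X \<omega>)\<^sup>2)" "integrable M X"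
      using ti[of "\<lambda>x. x\<^sup>2"] ti[of "\<lambda>x. x"] by (simp_all only: m add_0 power_mult_distrib) simp_all
  qed
qed

lemma gaussian_cos_shift:
  assumes "prob_space M" and X: "gaussian_rv M X" and mean: "(\<integral>\<omega>. X \<omega> \<partial>M) = 0"
  defines "q \<equiv> (\<integral>\<omega>. (X \<omega>)\<^sup>2 \<partial>M)"
  shows "(\<integral>\<omega>. cos (a * X \<omega> + b) \<partial>M) = cos b * exp (- a\<^sup>2 * q / 2)"
    and "(\<integral>\<omega>. cos (a * X \<omega> + b) * exp (c * X \<omega> - c\<^sup>2 * q / 2) \<partial>M) = cos (a * c * q + b) * exp (- a\<^sup>2 * q / 2)"
    and "(\<integral>\<omega>. exp (c * X \<omega>) \<partial>M) = exp (c\<^sup>2 * q / 2)" "integrable M (\<lambda>\<omega>. exp (c * X \<omega>))"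
proof -
  have [measurable]: "X \<in> borel_measurable M" using X by (simp add: gaussian_rv_def)
  obtain s where d: "distr M borel X = distr std_gauss borel (\<lambda>x. s * x)" and q: "q = s\<^sup>2"
    using gaussian_rv_std[OF assms(1-3)] by (metis q_def)
  have tr: "(\<integral>\<omega>. f (X \<omega>) \<partial>M) = (\<integral>x. f (s * x) \<partial>std_gauss)" if [measurable]: "f \<in> borel_measurable borel" for f :: "real \<Rightarrow> real"
    using arg_cong[OF d, of "\<lambda>N. integral\<^sup>L N f"] by (simp add: integral_distr)
  show "(\<integral>\<omega>. cos (a * X \<omega> + b) \<partial>M) = cos b * exp (- a\<^sup>2 * q / 2)"
    using std_gauss_cos[of "a * s" b] by (subst tr) (simp_all add: mult.assoc q power_mult_distrib)
  have "(\<integral>\<omega>. cos (a * X \<omega> + b) * exp (c * X \<omega> - c\<^sup>2 * q / 2) \<partial>M)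
    = (\<integral>x. cos (a * (s * x) + b) * exp ((c * s) * x - (c * s)\<^sup>2 / 2) \<partial>std_gauss)"
    by (subst tr) (simp_all add: q power_mult_distrib mult.assoc)
  also have "\<dots> = (\<integral>x. cos (a * s * x + (a * s * (c * s) + b)) \<partial>std_gauss)"
    by (subst integral_std_gauss_shift) (simp_all add: algebra_simps)
  finally show "(\<integral>\<omega>. cos (a * X \<omega> + b) * exp (c * X \<omega> - c\<^sup>2 * q / 2) \<partial>M) = cos (a * c * q + b) * exp (- a\<^sup>2 * q / 2)"
    unfolding std_gauss_cos by (simp add: q power_mult_distrib power2_eq_square ac_simps)
  show "(\<integral>\<omega>. exp (c * X \<omega>) \<partial>M) = exp (c\<^sup>2 * q / 2)"
    using std_gauss_exp(1)[of "c * s"] by (subst tr) (simp_all add: mult.assoc q power_mult_distrib)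
  then show "integrable M (\<lambda>\<omega>. exp (c * X \<omega>))"
    using not_integrable_integral_eq[of M "\<lambda>\<omega>. exp (c * X \<omega>)"] exp_not_eq_zero[of "c\<^sup>2 * q / 2"] by argo
qed

text \<open>Levy uniqueness for finite measures with densities \<open>W1\<close> and
  \<open>W2\<close>. Taking \<open>\<theta> = \<beta> = 0\<close> shows that they have the same mass
  \<open>c\<close>, by which they are normalised; mass zero is trivial. The weights make it possible
  to identify one coordinate of a process while the others enter through the density.\<close>

lemma weighted_char_uniqueness:
  fixes X1 :: "'a \<Rightarrow> real" and X2 :: "'b \<Rightarrow> real"
  assumes M: "prob_space M1" "prob_space M2"
    and [measurable]: "X1 \<in> borel_measurable M1" "X2 \<in> borel_measurable M2"
    and W: "integrable M1 W1" "integrable M2 W2" "\<And>x. 0 \<le> W1 x" "\<And>x. 0 \<le> W2 x"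
    and eq: "\<And>\<theta> \<beta>. (\<integral>x. W1 x * cos (\<theta> * X1 x + \<beta>) \<partial>M1) = (\<integral>x. W2 x * cos (\<theta> * X2 x + \<beta>) \<partial>M2)"
  shows "distr (density M1 (\<lambda>x. ennreal (W1 x))) borel X1 = distr (density M2 (\<lambda>x. ennreal (W2 x))) borel X2"
proof -
  define c where "c = (\<integral>x. W1 x \<partial>M1)"
  have c: "(\<integral>x. W1 x \<partial>M1) = c" "(\<integral>x. W2 x \<partial>M2) = c" using eq[of 0 0] by (auto simp: c_def)
  have [measurable]: "W1 \<in> borel_measurable M1" "W2 \<in> borel_measurable M2" using W by auto
  show ?thesis
  proof (cases "c = 0")
    case True
    then have "AE x in M1. W1 x = 0" "AE x in M2. W2 x = 0"
      using c W by (simp_all add: integral_nonneg_eq_0_iff_AE)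
    then have "emeasure (distr (density M1 (\<lambda>x. ennreal (W1 x))) borel X1) A = 0"
      "emeasure (distr (density M2 (\<lambda>x. ennreal (W2 x))) borel X2) A = 0" if [measurable]: "A \<in> sets borel" for A
      by (auto simp: emeasure_distr emeasure_density nn_integral_0_iff_AE)
    then show ?thesis by (intro measure_eqI) auto
  next
    case False
    have "0 \<le> c" unfolding c_def using W by simp
    with False have c0: "0 < c" by simp
    have rd: "real_distribution (distr (density M (\<lambda>x. ennreal (W x / c))) borel X)"
      and ch: "char (distr (density M (\<lambda>x. ennreal (W x / c))) borel X) t
         = Complex ((\<integral>x. W x * cos (t * X x + 0) \<partial>M) / c) ((\<integral>x. W x * cos (t * X x + (- pi / 2)) \<partial>M) / c)"
      and sc: "A \<in> sets borel \<Longrightarrow> emeasure (distr (density M (\<lambda>x. ennreal (W x))) borel X) A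
         = ennreal c * emeasure (distr (density M (\<lambda>x. ennreal (W x / c))) borel X) A"
      if "prob_space M" and X [measurable]: "X \<in> borel_measurable M" and i: "integrable M W"
        and nn: "\<And>x. 0 \<le> W x" and ic: "(\<integral>x. W x \<partial>M) = c"
      for M :: "'c measure" and X :: "'c \<Rightarrow> real" and W t A
    proof -
      interpret prob_space M by fact
      have [measurable]: "W \<in> borel_measurable M" using i by auto
      have "emeasure (density M (\<lambda>x. ennreal (W x / c))) (space M) = ennreal (\<integral>x. W x / c \<partial>M)"
        using i c0 nn by (subst emeasure_density) (auto simp: nn_integral_eq_integral cong: nn_integral_cong)
      also have "\<dots> = 1" using ic c0 by simp
      finally have pd: "prob_space (density M (\<lambda>x. ennreal (W x / c)))" by (intro prob_spaceI) simp
      show "real_distribution (distr (density M (\<lambda>x. ennreal (W x / c))) borel X)"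
        unfolding real_distribution_def real_distribution_axioms_def
        by (auto intro!: prob_space.prob_space_distr[OF pd])
      have b: "\<bar>W x * cos y\<bar> \<le> \<bar>W x\<bar>" "\<bar>W x * sin y\<bar> \<le> \<bar>W x\<bar>" for x y
        by (auto simp: abs_mult intro!: mult_left_le)
      have ii: "integrable M (\<lambda>x. W x * cos (t * X x))" "integrable M (\<lambda>x. W x * sin (t * X x))"
        using i by (auto intro!: Bochner_Integration.integrable_bound[OF i] AE_I2 b)
      have "char (distr (density M (\<lambda>x. ennreal (W x / c))) borel X) t = (\<integral>x. (W x / c) *\<^sub>R iexp (t * X x) \<partial>M)"
        using nn c0 by (simp add: char_def integral_distr integral_density)
      also have "(\<lambda>x. (W x / c) *\<^sub>R iexp (t * X x)) = (\<lambda>x. complex_of_real (W x * cos (t * X x) / c) + \<i> * complex_of_real (W x * sin (t * X x) / c))"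
        by (auto simp: fun_eq_iff complex_eq_iff Re_exp Im_exp)
      also have "(\<integral>x. complex_of_real (W x * cos (t * X x) / c) + \<i> * complex_of_real (W x * sin (t * X x) / c) \<partial>M)
        = complex_of_real (\<integral>x. W x * cos (t * X x) / c \<partial>M) + \<i> * complex_of_real (\<integral>x. W x * sin (t * X x) / c \<partial>M)"
        using ii by (subst Bochner_Integration.integral_add) (auto simp del: of_real_divide of_real_mult)
      finally show "char (distr (density M (\<lambda>x. ennreal (W x / c))) borel X) t
         = Complex ((\<integral>x. W x * cos (t * X x + 0) \<partial>M) / c) ((\<integral>x. W x * cos (t * X x + (- pi / 2)) \<partial>M) / c)"
        by (auto simp: complex_eq_iff cos_diff)
      assume [measurable]: "A \<in> sets borel"
      have "(\<integral>\<^sup>+x. ennreal (W x) * indicator (X -` A \<inter> space M) x \<partial>M)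
        = (\<integral>\<^sup>+x. ennreal c * (ennreal (W x / c) * indicator (X -` A \<inter> space M) x) \<partial>M)"
        using c0 nn by (intro nn_integral_cong) (simp add: mult.assoc[symmetric] ennreal_mult[symmetric])
      then show "emeasure (distr (density M (\<lambda>x. ennreal (W x))) borel X) A
         = ennreal c * emeasure (distr (density M (\<lambda>x. ennreal (W x / c))) borel X) A"
        by (simp add: emeasure_distr emeasure_density nn_integral_cmult)
    qed
    have "distr (density M1 (\<lambda>x. ennreal (W1 x / c))) borel X1 = distr (density M2 (\<lambda>x. ennreal (W2 x / c))) borel X2"
      using M W c by (intro Levy_uniqueness rd ext) (simp_all only: ch assms(3,4) eq)
    then show ?thesis
      using sc[OF M(1) _ W(1) W(3) c(1)] sc[OF M(2) _ W(2) W(4) c(2)] by (intro measure_eqI) auto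
  qed
qed

section \<open>Gaussian processes known through their finite linear combinations\<close>

locale gauss_process = P: prob_space P for P :: "'a measure" +
  fixes I :: "'i set" and K :: "'i \<Rightarrow> 'i \<Rightarrow> real" and X :: "'i \<Rightarrow> 'a \<Rightarrow> real"
  assumes process: "centered_gaussian_process P I K X"
begin

definition lin :: "('a \<Rightarrow> real) \<Rightarrow> bool" where
  "lin f \<longleftrightarrow> (\<exists>S c. finite S \<and> S \<subseteq> I \<and> f = (\<lambda>\<omega>. \<Sum>i\<in>S. c i * X i \<omega>))"

lemma lin_X: "i \<in> I \<Longrightarrow> lin (X i)"
  unfolding lin_def by (intro exI[of _ "{i}"] exI[of _ "\<lambda>_. 1"]) auto

lemma lin_0: "lin (\<lambda>_. 0)"
  unfolding lin_def by (intro exI[of _ "{}"]) auto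

lemma lin_comb:
  assumes "lin f" "lin g" shows "lin (\<lambda>\<omega>. a * f \<omega> + b * g \<omega>)"
proof -
  obtain S c S' c' where S: "finite S" "S \<subseteq> I" "f = (\<lambda>\<omega>. \<Sum>i\<in>S. c i * X i \<omega>)"
    "finite S'" "S' \<subseteq> I" "g = (\<lambda>\<omega>. \<Sum>i\<in>S'. c' i * X i \<omega>)"
    using assms by (auto simp: lin_def)
  have f: "f \<omega> = (\<Sum>i\<in>S \<union> S'. (if i \<in> S then c i else 0) * X i \<omega>)" for \<omega>
    unfolding S using S(1,4) by (intro sum.mono_neutral_cong_left) auto
  have g: "g \<omega> = (\<Sum>i\<in>S \<union> S'. (if i \<in> S' then c' i else 0) * X i \<omega>)" for \<omega>
    unfolding S using S(1,4) by (intro sum.mono_neutral_cong_left) auto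
  have "a * f \<omega> + b * g \<omega> = (\<Sum>i\<in>S \<union> S'. (a * (if i \<in> S then c i else 0) + b * (if i \<in> S' then c' i else 0)) * X i \<omega>)" for \<omega>
    unfolding f g by (simp add: sum_distrib_left sum.distrib distrib_right mult.assoc)
  then show ?thesis unfolding lin_def using S(1,2,4,5)
    by (intro exI[of _ "S \<union> S'"] exI[of _ "\<lambda>i. a * (if i \<in> S then c i else 0) + b * (if i \<in> S' then c' i else 0)"]) auto
qed

lemma lin_sum_list: "(\<And>u c. (u, c) \<in> set cs \<Longrightarrow> u \<in> I) \<Longrightarrow> lin (\<lambda>\<omega>. \<Sum>(u, c)\<leftarrow>cs. c * X u \<omega>)"
proof (induction cs)
  case (Cons a cs)
  obtain u c where a: "a = (u, c)" by (cases a)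
  have "lin (\<lambda>\<omega>. c * X u \<omega> + 1 * (\<Sum>(u, c)\<leftarrow>cs. c * X u \<omega>))"
    using Cons by (intro lin_comb lin_X) (auto simp: a)
  then show ?case by (simp add: a)
qed (simp add: lin_0)

lemma lin_gaussian: "lin f \<Longrightarrow> gaussian_rv P f"
  using process by (auto simp: lin_def centered_gaussian_process_def)

lemma meas_lin: "lin f \<Longrightarrow> f \<in> borel_measurable P"
  using lin_gaussian by (auto simp: gaussian_rv_def)

lemma X_integrable:
  assumes i: "i \<in> I" shows "integrable P (X i)" "integrable P (\<lambda>\<omega>. (X i \<omega>)\<^sup>2)" "(\<integral>\<omega>. X i \<omega> \<partial>P) = 0"
proof -
  show 0: "(\<integral>\<omega>. X i \<omega> \<partial>P) = 0" using process i by (auto simp: centered_gaussian_process_def)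
  show "integrable P (X i)" "integrable P (\<lambda>\<omega>. (X i \<omega>)\<^sup>2)"
    using gaussian_rv_std[OF P.prob_space_axioms lin_gaussian[OF lin_X[OF i]] 0] by metis+
qed

lemma lin_integral: assumes "lin f" shows "(\<integral>\<omega>. f \<omega> \<partial>P) = 0"
proof -
  obtain S c where S: "finite S" "S \<subseteq> I" "f = (\<lambda>\<omega>. \<Sum>i\<in>S. c i * X i \<omega>)" using assms by (auto simp: lin_def)
  have "(\<integral>\<omega>. f \<omega> \<partial>P) = (\<Sum>i\<in>S. c i * (\<integral>\<omega>. X i \<omega> \<partial>P))"
    unfolding S(3) using S(2) X_integrable by (subst Bochner_Integration.integral_sum) auto
  also have "\<dots> = 0" using S(2) X_integrable by (intro sum.neutral) auto
  finally show ?thesis .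
qed

lemma lin_square: assumes "lin f" shows "integrable P f" "integrable P (\<lambda>\<omega>. (f \<omega>)\<^sup>2)"
  using gaussian_rv_std[OF P.prob_space_axioms lin_gaussian[OF assms] lin_integral[OF assms]] by metis+

lemma lin_mult: assumes "lin f" "lin g" shows "integrable P (\<lambda>\<omega>. f \<omega> * g \<omega>)"
proof (rule Bochner_Integration.integrable_bound)
  show "integrable P (\<lambda>\<omega>. (f \<omega>)\<^sup>2 + (g \<omega>)\<^sup>2)" using lin_square assms by auto
  show "AE \<omega> in P. norm (f \<omega> * g \<omega>) \<le> norm ((f \<omega>)\<^sup>2 + (g \<omega>)\<^sup>2)"
  proof (rule AE_I2)
    fix \<omega>
    have "2 * (\<bar>f \<omega>\<bar> * \<bar>g \<omega>\<bar>) \<le> (f \<omega>)\<^sup>2 + (g \<omega>)\<^sup>2" using sum_squares_bound[of "\<bar>f \<omega>\<bar>" "\<bar>g \<omega>\<bar>"] by simp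
    moreover have "0 \<le> \<bar>f \<omega>\<bar> * \<bar>g \<omega>\<bar>" by simp
    ultimately show "norm (f \<omega> * g \<omega>) \<le> norm ((f \<omega>)\<^sup>2 + (g \<omega>)\<^sup>2)" unfolding real_norm_def abs_mult by linarith
  qed
qed (use assms meas_lin in measurable)

abbreviation cov :: "('a \<Rightarrow> real) \<Rightarrow> ('a \<Rightarrow> real) \<Rightarrow> real" where
  "cov f g \<equiv> (\<integral>\<omega>. f \<omega> * g \<omega> \<partial>P)"

lemma cov_comb: "lin f \<Longrightarrow> lin g \<Longrightarrow> lin h \<Longrightarrow> cov (\<lambda>\<omega>. a * f \<omega> + b * g \<omega>) h = a * cov f h + b * cov g h"
  using lin_mult[of f h] lin_mult[of g h] by (simp add: distrib_right mult.assoc)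

lemma cov_sq: "cov f f = (\<integral>\<omega>. (f \<omega>)\<^sup>2 \<partial>P)" by (simp add: power2_eq_square)

lemma var_comb: "lin f \<Longrightarrow> lin g \<Longrightarrow>
   (\<integral>\<omega>. (a * f \<omega> + b * g \<omega>)\<^sup>2 \<partial>P) = a\<^sup>2 * cov f f + 2 * a * b * cov f g + b\<^sup>2 * cov g g"
proof -
  assume l: "lin f" "lin g"
  have "(\<integral>\<omega>. (a * f \<omega> + b * g \<omega>)\<^sup>2 \<partial>P) = (\<integral>\<omega>. a\<^sup>2 * (f \<omega> * f \<omega>) + 2 * a * b * (f \<omega> * g \<omega>) + b\<^sup>2 * (g \<omega> * g \<omega>) \<partial>P)"
    by (intro Bochner_Integration.integral_cong refl) (simp add: power2_eq_square algebra_simps)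
  also have "\<dots> = a\<^sup>2 * cov f f + 2 * a * b * cov f g + b\<^sup>2 * cov g g"
    using lin_mult[OF l(1) l(1)] lin_mult[OF l] lin_mult[OF l(2) l(2)] by simp
  finally show ?thesis .
qed

lemma cov_X: "i \<in> I \<Longrightarrow> j \<in> I \<Longrightarrow> cov (X i) (X j) = K i j"
  using process by (auto simp: centered_gaussian_process_def)

lemma cov_sum_list: "(\<And>u c. (u, c) \<in> set cs \<Longrightarrow> u \<in> I) \<Longrightarrow> i \<in> I \<Longrightarrow>
   cov (\<lambda>\<omega>. \<Sum>(u, c)\<leftarrow>cs. c * X u \<omega>) (X i) = (\<Sum>(u, c)\<leftarrow>cs. c * K u i)"
proof (induction cs)
  case (Cons a cs)
  obtain u c where a: "a = (u, c)" by (cases a)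
  have "cov (\<lambda>\<omega>. c * X u \<omega> + 1 * (\<Sum>(u, c)\<leftarrow>cs. c * X u \<omega>)) (X i) = c * cov (X u) (X i) + 1 * cov (\<lambda>\<omega>. \<Sum>(u, c)\<leftarrow>cs. c * X u \<omega>) (X i)"
    using Cons by (intro cov_comb lin_X lin_sum_list) (auto simp: a)
  moreover have "cov (\<lambda>\<omega>. \<Sum>(u, c)\<leftarrow>cs. c * X u \<omega>) (X i) = (\<Sum>(u, c)\<leftarrow>cs. c * K u i)"
    by (rule Cons.IH) (use Cons.prems in auto)
  moreover have "cov (X u) (X i) = K u i"
    by (rule cov_X) (use Cons.prems(1)[of u c] Cons.prems(2) in \<open>auto simp: a\<close>)
  ultimately show ?case by (simp add: a)
qed simp

lemma lin_cos: "lin f \<Longrightarrow> (\<integral>\<omega>. cos (f \<omega> + b) \<partial>P) = cos b * exp (- cov f f / 2)"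
  using gaussian_cos_shift(1)[OF P.prob_space_axioms lin_gaussian lin_integral, of f 1 b] by (simp add: cov_sq)

lemma lin_exp: "lin f \<Longrightarrow> (\<integral>\<omega>. exp (c * f \<omega>) \<partial>P) = exp (c\<^sup>2 * cov f f / 2)" "lin f \<Longrightarrow> integrable P (\<lambda>\<omega>. exp (c * f \<omega>))"
  using gaussian_cos_shift(3,4)[OF P.prob_space_axioms lin_gaussian lin_integral, of f] by (simp_all add: cov_sq)

text \<open>Uncorrelated jointly Gaussian variables are independent. The weights
  \<open>1 + cos (g + b)\<close> and \<open>w\<close> give \<open>f\<close> the same cosine
  transforms, because no mixed covariance appears in the variances of \<open>\<theta> f + g\<close>
  and \<open>\<theta> f - g\<close>; hence functions of \<open>f\<close> have the same mean under
  both.\<close>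

lemma uncorrelated:
  assumes f: "lin f" and g: "lin g" and fg: "cov f g = 0"
    and [measurable]: "\<phi> \<in> borel_measurable borel" and i: "integrable P (\<lambda>\<omega>. \<phi> (f \<omega>))"
  shows "(\<integral>\<omega>. cos (g \<omega> + b) * \<phi> (f \<omega>) \<partial>P) = cos b * exp (- cov g g / 2) * (\<integral>\<omega>. \<phi> (f \<omega>) \<partial>P)"
proof -
  note [measurable] = meas_lin[OF f] meas_lin[OF g]
  \<comment> \<open>The mean of the weight \<open>1 + cos (g + b)\<close>, in which the summand 1
    ensures nonnegativity; its contribution is subtracted again at the end.\<close>
  define w where "w = 1 + cos b * exp (- cov g g / 2)"
  have cb: "integrable P (\<lambda>\<omega>. cos (h \<omega>))" if [measurable]: "h \<in> borel_measurable P" for h :: "'a \<Rightarrow> real"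
    by (intro P.integrable_bounded[where B=1]) auto
  have cbb: "integrable P (\<lambda>\<omega>. cos (h \<omega>) * cos (k \<omega>))" if [measurable]: "h \<in> borel_measurable P" "k \<in> borel_measurable P" for h k :: "'a \<Rightarrow> real"
    by (intro P.integrable_bounded[where B="1 * 1"]) (auto simp: abs_mult intro!: mult_le_one)
  have w: "(\<integral>\<omega>. 1 + cos (g \<omega> + b) \<partial>P) = w"
    using cb[of "\<lambda>\<omega>. g \<omega> + b"] by (simp add: w_def lin_cos[OF g] P.prob_space)
  have w0: "0 \<le> w"
  proof -
    have "0 \<le> 1 + cos x" for x :: real using cos_ge_minus_one[of x] by linarith
    then show ?thesis unfolding w[symmetric] by (intro Bochner_Integration.integral_nonneg) auto
  qed
  have key: "(\<integral>\<omega>. (1 + cos (g \<omega> + b)) * cos (\<theta> * f \<omega> + \<beta>) \<partial>P) = (\<integral>\<omega>. w * cos (\<theta> * f \<omega> + \<beta>) \<partial>P)" for \<theta> \<beta>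
  proof -
    have l: "lin (\<lambda>\<omega>. \<theta> * f \<omega> + a * g \<omega>)" for a by (intro lin_comb f g)
    have v: "cov (\<lambda>\<omega>. \<theta> * f \<omega> + a * g \<omega>) (\<lambda>\<omega>. \<theta> * f \<omega> + a * g \<omega>) = \<theta>\<^sup>2 * cov f f + a\<^sup>2 * cov g g" for a
      using var_comb[OF f g, of \<theta> a] fg unfolding cov_sq[of "\<lambda>\<omega>. \<theta> * f \<omega> + a * g \<omega>"] by simp
    have c: "(\<integral>\<omega>. cos (\<theta> * f \<omega> + a * g \<omega> + c) \<partial>P) = cos c * exp (- (\<theta>\<^sup>2 * cov f f + a\<^sup>2 * cov g g) / 2)" for a c
      using lin_cos[OF l, of a c] by (simp only: v)
    have "(1 + cos (g \<omega> + b)) * cos (\<theta> * f \<omega> + \<beta>) = cos (\<theta> * f \<omega> + 0 * g \<omega> + \<beta>)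
       + (cos (\<theta> * f \<omega> + 1 * g \<omega> + (\<beta> + b)) + cos (\<theta> * f \<omega> + (-1) * g \<omega> + (\<beta> - b))) / 2" for \<omega>
      using cos_times_cos[of "g \<omega> + b" "\<theta> * f \<omega> + \<beta>"] cos_minus[of "g \<omega> + b - (\<theta> * f \<omega> + \<beta>)"]
      by (simp add: algebra_simps)
    then have "(\<integral>\<omega>. (1 + cos (g \<omega> + b)) * cos (\<theta> * f \<omega> + \<beta>) \<partial>P) =
      (\<integral>\<omega>. cos (\<theta> * f \<omega> + 0 * g \<omega> + \<beta>)
       + (cos (\<theta> * f \<omega> + 1 * g \<omega> + (\<beta> + b)) + cos (\<theta> * f \<omega> + (-1) * g \<omega> + (\<beta> - b))) / 2 \<partial>P)" by (simp only:)
    also have "\<dots> = (\<integral>\<omega>. cos (\<theta> * f \<omega> + 0 * g \<omega> + \<beta>) \<partial>P)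
       + ((\<integral>\<omega>. cos (\<theta> * f \<omega> + 1 * g \<omega> + (\<beta> + b)) \<partial>P) + (\<integral>\<omega>. cos (\<theta> * f \<omega> + (-1) * g \<omega> + (\<beta> - b)) \<partial>P)) / 2"
    proof -
      have "integrable P (\<lambda>\<omega>. cos (\<theta> * f \<omega> + a * g \<omega> + c))" for a c by (rule cb) measurable
      then show ?thesis by (simp only: Bochner_Integration.integral_add integral_divide_zero
          Bochner_Integration.integrable_add integrable_divide)
    qed
    also have "\<dots> = w * (cos \<beta> * exp (- (\<theta>\<^sup>2 * cov f f + 0\<^sup>2 * cov g g) / 2))"
    proof -
      have e: "exp (- (\<theta>\<^sup>2 * cov f f + B) / 2) = exp (- \<theta>\<^sup>2 * cov f f / 2) * exp (- B / 2)" for B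
        by (simp add: exp_add[symmetric] add_divide_distrib)
      define E where "E = exp (- cov g g / 2)"
      have E: "exp (- (1\<^sup>2 * cov g g) / 2) = E" "exp (- ((- 1)\<^sup>2 * cov g g) / 2) = E" "exp (- (0\<^sup>2 * cov g g) / 2) = 1" "exp (- cov g g / 2) = E"
        by (simp_all add: E_def)
      show ?thesis unfolding c w_def e E by (simp only: cos_add cos_diff) (simp add: field_simps)
    qed
    also have "\<dots> = (\<integral>\<omega>. w * cos (\<theta> * f \<omega> + \<beta>) \<partial>P)" using c[of 0 \<beta>] by simp
    finally show ?thesis .
  qed
  have "distr (density P (\<lambda>\<omega>. ennreal (1 + cos (g \<omega> + b)))) borel f = distr (density P (\<lambda>\<omega>. ennreal w)) borel f"
  proof (rule weighted_char_uniqueness[OF P.prob_space_axioms P.prob_space_axioms])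
    show "integrable P (\<lambda>\<omega>. 1 + cos (g \<omega> + b))" using cb[of "\<lambda>\<omega>. g \<omega> + b"] by simp
    show "0 \<le> 1 + cos (g \<omega> + b)" for \<omega> using cos_ge_minus_one[of "g \<omega> + b"] by linarith
  qed (use key w0 in auto)
  note eq = this
  have c: "0 \<le> 1 + cos x" for x :: real using cos_ge_minus_one[of x] by linarith
  from arg_cong[OF eq, of "\<lambda>N. \<integral>x. \<phi> x \<partial>N"]
  have "(\<integral>\<omega>. (1 + cos (g \<omega> + b)) * \<phi> (f \<omega>) \<partial>P) = (\<integral>\<omega>. w * \<phi> (f \<omega>) \<partial>P)"
    using w0 c by (simp add: integral_distr integral_density)
  moreover have "integrable P (\<lambda>\<omega>. cos (g \<omega> + b) * \<phi> (f \<omega>))"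
    by (rule Bochner_Integration.integrable_bound[OF i]) (auto simp: abs_mult intro!: mult_left_le_one_le)
  ultimately show ?thesis using i by (simp add: distrib_right w_def)
qed

text \<open>Split \<open>L = Y + a Z\<close> with \<open>Y\<close> uncorrelated to \<open>Z\<close>:
  the exponential weight acts on \<open>Z\<close> alone, where it is the one-dimensional shift. If
  \<open>Z\<close> is degenerate, the coefficient \<open>a\<close> makes no sense, but then
  \<open>Z = 0\<close> almost surely and both sides agree.\<close>

lemma cos_exp_shift:
  assumes L: "lin L" and Z: "lin Z"
  shows "(\<integral>\<omega>. cos (L \<omega> + b) * exp (s * Z \<omega> - s\<^sup>2 * cov Z Z / 2) \<partial>P) = (\<integral>\<omega>. cos (L \<omega> + (s * cov L Z + b)) \<partial>P)"
proof (cases "cov Z Z = 0")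
  case True
  have "AE \<omega> in P. (Z \<omega>)\<^sup>2 = 0"
    using True lin_square[OF Z] by (subst integral_nonneg_eq_0_iff_AE[symmetric]) (auto simp: cov_sq)
  then have ae: "AE \<omega> in P. Z \<omega> = 0" by simp
  have "cov L Z = (\<integral>\<omega>. 0 \<partial>P)" using ae by (intro integral_cong_AE) (use L Z meas_lin in auto)
  then have 0: "cov L Z = 0" by simp
  show ?thesis using ae by (simp only: 0 True) (intro integral_cong_AE; use L Z meas_lin in auto)
next
  case False
  define a where "a = cov L Z / cov Z Z"
  define Y where "Y \<omega> = 1 * L \<omega> + (- a) * Z \<omega>" for \<omega>
  note [measurable] = meas_lin[OF L] meas_lin[OF Z]
  have lY: "lin Y" unfolding Y_def by (intro lin_comb L Z)
  have YZ: "cov Z Y = 0"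
    using cov_comb[OF L Z Z, of 1 "-a"] False by (simp add: Y_def[abs_def] a_def mult.commute)
  have Lv: "cov L L = cov Y Y + a\<^sup>2 * cov Z Z"
  proof -
    have "cov L L = (\<integral>\<omega>. (1 * Y \<omega> + a * Z \<omega>)\<^sup>2 \<partial>P)"
      by (simp add: Y_def power2_eq_square)
    also have "\<dots> = cov Y Y + a\<^sup>2 * cov Z Z"
      using var_comb[OF lY Z, of 1 a] YZ by (simp add: mult.commute)
    finally show ?thesis .
  qed
  let ?e = "\<lambda>x. exp (s * x - s\<^sup>2 * cov Z Z / 2)"
  have ie: "integrable P (\<lambda>\<omega>. ?e (Z \<omega>))"
    using lin_exp(2)[OF Z, of s] by (simp add: exp_diff)
  have i1: "integrable P (\<lambda>\<omega>. cos (a * Z \<omega> + c) * ?e (Z \<omega>))" for c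
    by (rule Bochner_Integration.integrable_bound[OF ie]) (auto simp: abs_mult intro!: mult_left_le_one_le)
  have i2: "integrable P (\<lambda>\<omega>. cos (Y \<omega> + c) * (cos (a * Z \<omega> + c') * ?e (Z \<omega>)))" for c c'
    using meas_lin[OF lY]
    by (intro Bochner_Integration.integrable_bound[OF i1[of c']]) (auto simp: abs_mult intro!: mult_left_le_one_le)
  \<comment> \<open>The addition theorem, with sines written as phase-shifted cosines so that
    \<open>uncorrelated\<close> applies to each summand; the second one vanishes through the factor
    \<open>cos (pi / 2)\<close>.\<close>
  have "cos (L \<omega> + b) * ?e (Z \<omega>) = cos (Y \<omega> + 0) * (cos (a * Z \<omega> + b) * ?e (Z \<omega>))
     + cos (Y \<omega> + pi / 2) * (cos (a * Z \<omega> + (b - pi / 2)) * ?e (Z \<omega>))" for \<omega>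
  proof -
    have "cos (L \<omega> + b) = cos (Y \<omega> + (a * Z \<omega> + b))" by (simp add: Y_def)
    also have "\<dots> = cos (Y \<omega> + 0) * cos (a * Z \<omega> + b) + cos (Y \<omega> + pi / 2) * cos (a * Z \<omega> + (b - pi / 2))"
      using cos_add[of "Y \<omega>" "a * Z \<omega> + b"] cos_diff[of "a * Z \<omega> + b" "pi / 2"]
      by (simp add: cos_add[of "Y \<omega>" "pi / 2"] add_diff_eq)
    finally show ?thesis by (simp add: distrib_right)
  qed
  then have "(\<integral>\<omega>. cos (L \<omega> + b) * ?e (Z \<omega>) \<partial>P) = (\<integral>\<omega>. cos (Y \<omega> + 0) * (cos (a * Z \<omega> + b) * ?e (Z \<omega>)) \<partial>P)
     + (\<integral>\<omega>. cos (Y \<omega> + pi / 2) * (cos (a * Z \<omega> + (b - pi / 2)) * ?e (Z \<omega>)) \<partial>P)"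
    by (simp only: Bochner_Integration.integral_add[OF i2 i2])
  also have "(\<integral>\<omega>. cos (Y \<omega> + 0) * (cos (a * Z \<omega> + b) * ?e (Z \<omega>)) \<partial>P)
    = cos 0 * exp (- cov Y Y / 2) * (\<integral>\<omega>. cos (a * Z \<omega> + b) * ?e (Z \<omega>) \<partial>P)"
    by (rule uncorrelated[OF Z lY YZ _ i1]) measurable
  also have "(\<integral>\<omega>. cos (Y \<omega> + pi / 2) * (cos (a * Z \<omega> + (b - pi / 2)) * ?e (Z \<omega>)) \<partial>P)
    = cos (pi / 2) * exp (- cov Y Y / 2) * (\<integral>\<omega>. cos (a * Z \<omega> + (b - pi / 2)) * ?e (Z \<omega>) \<partial>P)"
    by (rule uncorrelated[OF Z lY YZ _ i1]) measurable
  also have "(\<integral>\<omega>. cos (a * Z \<omega> + b) * ?e (Z \<omega>) \<partial>P) = cos (a * s * cov Z Z + b) * exp (- a\<^sup>2 * cov Z Z / 2)"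
    using gaussian_cos_shift(2)[OF P.prob_space_axioms lin_gaussian[OF Z] lin_integral[OF Z], of a b s] by (simp only: cov_sq)
  also have "cos 0 * exp (- cov Y Y / 2) * (cos (a * s * cov Z Z + b) * exp (- a\<^sup>2 * cov Z Z / 2))
      + cos (pi / 2) * exp (- cov Y Y / 2) * (\<integral>\<omega>. cos (a * Z \<omega> + (b - pi / 2)) * ?e (Z \<omega>) \<partial>P)
    = cos (s * cov L Z + b) * exp (- cov L L / 2)"
  proof -
    have e1: "exp (- cov L L / 2) = exp (- cov Y Y / 2) * exp (- a\<^sup>2 * cov Z Z / 2)"
      by (simp add: Lv exp_add[symmetric] add_divide_distrib)
    have e2: "a * s * cov Z Z = s * cov L Z" using False by (simp add: a_def)
    show ?thesis unfolding e1 e2 by simp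
  qed
  also have "\<dots> = (\<integral>\<omega>. cos (L \<omega> + (s * cov L Z + b)) \<partial>P)" by (rule lin_cos[OF L, symmetric])
  finally show ?thesis .
qed

end

section \<open>Functionals determined by the finite-dimensional laws\<close>

text \<open>Two families over one index space with equal finite-dimensional cosine transforms. In
  the application \<open>M\<close> is \<open>N\<close> reweighted by the Cameron--Martin density,
  \<open>A\<close> is the original and \<open>B\<close> the shifted process. The indices carry the
  law \<open>D\<close> because partition functions integrate over them.\<close>

locale same_law = M: prob_space M + N: prob_space N + D: prob_space D
  for M :: "'a measure" and N :: "'b measure" and D :: "'i measure" +
  fixes A :: "'i \<Rightarrow> 'a \<Rightarrow> real" and B :: "'i \<Rightarrow> 'b \<Rightarrow> real"
  assumes meas_A [measurable]: "(\<lambda>(u, x). A u x) \<in> borel_measurable (D \<Otimes>\<^sub>M M)"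
    and meas_B [measurable]: "(\<lambda>(u, x). B u x) \<in> borel_measurable (D \<Otimes>\<^sub>M N)"
    and char_eq: "\<And>cs b. fst ` set cs \<subseteq> space D \<Longrightarrow>
      (\<integral>x. cos ((\<Sum>(u, c)\<leftarrow>cs. c * A u x) + b) \<partial>M) = (\<integral>x. cos ((\<Sum>(u, c)\<leftarrow>cs. c * B u x) + b) \<partial>N)"
begin

lemma meas_A1: "u \<in> space D \<Longrightarrow> A u \<in> borel_measurable M"
  using measurable_Pair2[OF meas_A, of u] by simp

lemma meas_B1: "u \<in> space D \<Longrightarrow> B u \<in> borel_measurable N"
  using measurable_Pair2[OF meas_B, of u] by simp

definition test :: "('i \<times> (real \<Rightarrow> real)) list \<Rightarrow> bool" where
  "test fs \<longleftrightarrow> (\<forall>(u, f)\<in>set fs. u \<in> space D \<and> f \<in> borel_measurable borel \<and> (\<forall>x. 0 \<le> f x \<and> f x \<le> 1))"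

definition prodf :: "('i \<times> (real \<Rightarrow> real)) list \<Rightarrow> ('i \<Rightarrow> 'c \<Rightarrow> real) \<Rightarrow> 'c \<Rightarrow> real" where
  "prodf fs Z x = (\<Prod>(u, f)\<leftarrow>fs. f (Z u x))"

lemma prodf_simps [simp]: "prodf [] Z x = 1" "prodf ((u, f) # fs) Z x = f (Z u x) * prodf fs Z x"
  by (simp_all add: prodf_def)

lemma test_simps [simp]: "test []" "test ((u, f) # fs) \<longleftrightarrow>
   u \<in> space D \<and> f \<in> borel_measurable borel \<and> (\<forall>x. 0 \<le> f x \<and> f x \<le> 1) \<and> test fs"
  by (auto simp: test_def)

lemma prodf_01: "test fs \<Longrightarrow> 0 \<le> prodf fs Z x \<and> prodf fs Z x \<le> 1"
  by (induction fs) (auto intro!: mult_nonneg_nonneg mult_le_one)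

lemma meas_prodf:
  assumes "test fs" and Z: "\<And>u. u \<in> space D \<Longrightarrow> Z u \<in> borel_measurable R"
  shows "prodf fs Z \<in> borel_measurable R"
  using assms(1)
proof (induction fs)
  case (Cons a fs)
  obtain u f where a: "a = (u, f)" by (cases a)
  have "(\<lambda>x. f (Z u x) * prodf fs Z x) \<in> borel_measurable R"
    using Cons a by (intro borel_measurable_times measurable_compose[OF Z]) auto
  then show ?case by (simp add: a prodf_def cong: measurable_cong)
next
  case Nil
  have "prodf [] Z = (\<lambda>_. 1)" by (simp add: fun_eq_iff)
  then show ?case by simp
qed

lemmas meas_pA = meas_prodf[OF _ meas_A1] and meas_pB = meas_prodf[OF _ meas_B1]

lemma meas_lA:
  assumes "fst ` set cs \<subseteq> space D"
  shows "(\<lambda>x. \<Sum>(u, c)\<leftarrow>cs. c * A u x) \<in> borel_measurable M" "(\<lambda>x. \<Sum>(u, c)\<leftarrow>cs. c * B u x) \<in> borel_measurable N"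
  using assms
proof (induction cs)
  case (Cons a cs)
  obtain u c where a: "a = (u, c)" by (cases a)
  {
    case 1 with Cons.IH a show ?case by (auto intro!: borel_measurable_add borel_measurable_times meas_A1)
  next
    case 2 with Cons.IH a show ?case by (auto intro!: borel_measurable_add borel_measurable_times meas_B1)
  }
qed simp_all

text \<open>Factor by factor, a cosine is traded for an arbitrary bounded function of
  \<open>A u\<close>: the induction hypothesis supplies the cosine transforms of \<open>A u\<close>
  under the weight formed by the remaining factors. One cosine is always kept in the statement to
  feed the next step.\<close>

lemma prodf_cos_eq:
  assumes "test fs" "fst ` set cs \<subseteq> space D"
  shows "(\<integral>x. prodf fs A x * cos ((\<Sum>(u, c)\<leftarrow>cs. c * A u x) + b) \<partial>M)
       = (\<integral>x. prodf fs B x * cos ((\<Sum>(u, c)\<leftarrow>cs. c * B u x) + b) \<partial>N)"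
  using assms
proof (induction fs arbitrary: cs b)
  case Nil then show ?case using char_eq by simp
next
  case (Cons a fs)
  obtain u f where a: "a = (u, f)" by (cases a)
  have u: "u \<in> space D" and f [measurable]: "f \<in> borel_measurable borel" and f01: "\<And>x. 0 \<le> f x" "\<And>x. f x \<le> 1"
    and t: "test fs" using Cons.prems by (auto simp: a)
  note [measurable] = meas_A1[OF u] meas_B1[OF u] meas_pA[OF t] meas_pB[OF t] meas_lA[OF Cons.prems(2)]
  let ?a = "\<lambda>x. \<Sum>(u, c)\<leftarrow>cs. c * A u x" and ?b = "\<lambda>x. \<Sum>(u, c)\<leftarrow>cs. c * B u x"
  have pc: "\<bar>p * cos y\<bar> \<le> 1" if "0 \<le> p \<and> p \<le> 1" for p y :: real
    using that by (auto simp: abs_mult intro!: mult_le_one)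
  have iM: "integrable M (\<lambda>x. prodf fs A x * cos (h x))" if [measurable]: "h \<in> borel_measurable M" for h :: "'a \<Rightarrow> real"
    by (intro M.integrable_bounded[where B=1] pc) (auto simp: prodf_01[OF t])
  have iN: "integrable N (\<lambda>x. prodf fs B x * cos (h x))" if [measurable]: "h \<in> borel_measurable N" for h :: "'b \<Rightarrow> real"
    by (intro N.integrable_bounded[where B=1] pc) (auto simp: prodf_01[OF t])
  have IH: "(\<integral>x. prodf fs A x * cos (\<theta> * A u x + k * ?a x + c) \<partial>M) = (\<integral>x. prodf fs B x * cos (\<theta> * B u x + k * ?b x + c) \<partial>N)" for \<theta> k c
  proof -
    have s: "(\<Sum>(u, c)\<leftarrow>(u, \<theta>) # map (\<lambda>(u, c). (u, k * c)) cs. c * Z u x) = \<theta> * Z u x + k * (\<Sum>(u, c)\<leftarrow>cs. c * Z u x)"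
      for Z :: "'i \<Rightarrow> 'c \<Rightarrow> real" and x
      by (simp, induction cs) (auto simp: algebra_simps)
    have "fst ` set ((u, \<theta>) # map (\<lambda>(u, c). (u, k * c)) cs) \<subseteq> space D"
      using u Cons.prems(2) by force
    from Cons.IH[OF t this, of c] show ?thesis unfolding s .
  qed
  have split: "(p * (1 + cos (y + b))) * cos (\<theta> * z + \<beta>) = p * cos (\<theta> * z + 0 * y + \<beta>)
      + (p * cos (\<theta> * z + 1 * y + (\<beta> + b)) + p * cos (\<theta> * z + (-1) * y + (\<beta> - b))) / 2" for p y z \<theta> \<beta> :: real
  proof -
    have e: "\<theta> * z + 1 * y + (\<beta> + b) = (y + b) + (\<theta> * z + \<beta>)" "\<theta> * z + (-1) * y + (\<beta> - b) = - ((y + b) - (\<theta> * z + \<beta>))"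
      by simp_all
    have k: "cos (y + b) * cos (\<theta> * z + \<beta>) = (cos (\<theta> * z + 1 * y + (\<beta> + b)) + cos (\<theta> * z + (-1) * y + (\<beta> - b))) / 2"
      unfolding e cos_minus by (simp add: cos_times_cos)
    have "(p * (1 + cos (y + b))) * cos (\<theta> * z + \<beta>) = p * cos (\<theta> * z + 0 * y + \<beta>) + p * (cos (y + b) * cos (\<theta> * z + \<beta>))"
      by (simp add: distrib_left distrib_right)
    then show ?thesis unfolding k by (simp only: distrib_left times_divide_eq_right)
  qed
  \<comment> \<open>A bare cosine may be negative, so the laws are compared under the weights
    \<open>prodf * (1 + cos)\<close> here and \<open>prodf\<close> in \<open>d2\<close>; the
    difference of the two restores the cosine.\<close>
  have d1: "distr (density M (\<lambda>x. ennreal (prodf fs A x * (1 + cos (?a x + b))))) borel (A u)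
     = distr (density N (\<lambda>x. ennreal (prodf fs B x * (1 + cos (?b x + b))))) borel (B u)"
  proof (rule weighted_char_uniqueness[OF M.prob_space_axioms N.prob_space_axioms])
    show "integrable M (\<lambda>x. prodf fs A x * (1 + cos (?a x + b)))"
      using iM[of "\<lambda>_. 0"] iM[of "\<lambda>x. ?a x + b"] by (simp add: distrib_left)
    show "integrable N (\<lambda>x. prodf fs B x * (1 + cos (?b x + b)))"
      using iN[of "\<lambda>_. 0"] iN[of "\<lambda>x. ?b x + b"] by (simp add: distrib_left)
    have c: "0 \<le> 1 + cos x" for x :: real using cos_ge_minus_one[of x] by linarith
    show "0 \<le> prodf fs A x * (1 + cos (?a x + b))" for x using prodf_01[OF t, of A x] c by auto
    show "0 \<le> prodf fs B x * (1 + cos (?b x + b))" for x using prodf_01[OF t, of B x] c by auto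
    show "(\<integral>x. prodf fs A x * (1 + cos (?a x + b)) * cos (\<theta> * A u x + \<beta>) \<partial>M) = (\<integral>x. prodf fs B x * (1 + cos (?b x + b)) * cos (\<theta> * B u x + \<beta>) \<partial>N)" for \<theta> \<beta>
    proof -
      have jM: "integrable M (\<lambda>x. prodf fs A x * cos (\<theta> * A u x + k * ?a x + c))" for k c by (rule iM) measurable
      have jN: "integrable N (\<lambda>x. prodf fs B x * cos (\<theta> * B u x + k * ?b x + c))" for k c by (rule iN) measurable
      show ?thesis unfolding split
        by (simp only: Bochner_Integration.integral_add integral_divide_zero
          Bochner_Integration.integrable_add integrable_divide jM jN IH)
    qed
  qed (use meas_A1[OF u] meas_B1[OF u] in auto)
  have d2: "distr (density M (\<lambda>x. ennreal (prodf fs A x))) borel (A u) = distr (density N (\<lambda>x. ennreal (prodf fs B x))) borel (B u)"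
  proof (rule weighted_char_uniqueness[OF M.prob_space_axioms N.prob_space_axioms])
    show "integrable M (prodf fs A)" "integrable N (prodf fs B)" using iM[of "\<lambda>_. 0"] iN[of "\<lambda>_. 0"] by auto
    show "(\<integral>x. prodf fs A x * cos (\<theta> * A u x + \<beta>) \<partial>M) = (\<integral>x. prodf fs B x * cos (\<theta> * B u x + \<beta>) \<partial>N)" for \<theta> \<beta>
      using IH[of \<theta> 0 \<beta>] by simp
  qed (auto simp: prodf_01[OF t])
  have c: "0 \<le> 1 + cos x" for x :: real using cos_ge_minus_one[of x] by linarith
  have e1: "(\<integral>x. prodf fs A x * (1 + cos (?a x + b)) * f (A u x) \<partial>M) = (\<integral>x. prodf fs B x * (1 + cos (?b x + b)) * f (B u x) \<partial>N)"
    using arg_cong[OF d1, of "\<lambda>N. integral\<^sup>L N f"] c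
    by (simp add: integral_distr integral_density prodf_01[OF t])
  have e2: "(\<integral>x. prodf fs A x * f (A u x) \<partial>M) = (\<integral>x. prodf fs B x * f (B u x) \<partial>N)"
    using arg_cong[OF d2, of "\<lambda>N. integral\<^sup>L N f"]
    by (simp add: integral_distr integral_density prodf_01[OF t])
  have fp: "0 \<le> f y * p \<and> f y * p \<le> 1" if "0 \<le> p \<and> p \<le> 1" for p y
    using f01 that by (auto intro!: mult_le_one)
  have fp': "\<bar>p * f y\<bar> \<le> 1" if "0 \<le> p \<and> p \<le> 1" for p y
    using fp[OF that, of y] by (simp add: mult.commute)
  have kM: "integrable M (\<lambda>x. prodf fs A x * f (A u x))" "integrable M (\<lambda>x. (f (A u x) * prodf fs A x) * cos (?a x + b))"
    by (intro M.integrable_bounded[where B=1] fp' pc fp prodf_01[OF t]; measurable)+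
  have kN: "integrable N (\<lambda>x. prodf fs B x * f (B u x))" "integrable N (\<lambda>x. (f (B u x) * prodf fs B x) * cos (?b x + b))"
    by (intro N.integrable_bounded[where B=1] fp' pc fp prodf_01[OF t]; measurable)+
  have sp: "(f z * p) * cos y = p * (1 + cos y) * f z - p * f z" for p y z by (simp add: algebra_simps)
  have "(\<integral>x. (f (A u x) * prodf fs A x) * cos (?a x + b) \<partial>M) = (\<integral>x. prodf fs A x * (1 + cos (?a x + b)) * f (A u x) \<partial>M) - (\<integral>x. prodf fs A x * f (A u x) \<partial>M)"
    using Bochner_Integration.integral_add[OF kM] by (simp add: algebra_simps)
  moreover have "(\<integral>x. (f (B u x) * prodf fs B x) * cos (?b x + b) \<partial>N) = (\<integral>x. prodf fs B x * (1 + cos (?b x + b)) * f (B u x) \<partial>N) - (\<integral>x. prodf fs B x * f (B u x) \<partial>N)"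
    using Bochner_Integration.integral_add[OF kN] by (simp add: algebra_simps)
  ultimately show ?case by (simp add: a e1 e2)
qed

lemma prodf_eq: "test fs \<Longrightarrow> (\<integral>x. prodf fs A x \<partial>M) = (\<integral>x. prodf fs B x \<partial>N)"
  using prodf_cos_eq[of fs "[]" 0] by simp

end

section \<open>From finitely many coordinates to partition functions\<close>

context same_law begin

interpretation DM: prob_pair D M ..
interpretation DN: prob_pair D N ..

text \<open>A partition function with a bounded \<open>\<phi>\<close> in place of the exponential,
  so that its powers can be expanded by Fubini.\<close>

definition zint :: "('i \<Rightarrow> real) \<Rightarrow> (real \<Rightarrow> real) \<Rightarrow> ('i \<Rightarrow> 'c \<Rightarrow> real) \<Rightarrow> 'c \<Rightarrow> real" where
  "zint a \<phi> Z x = (\<integral>u. a u * \<phi> (Z u x) \<partial>D)"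

lemma meas_zint:
  assumes [measurable]: "a \<in> borel_measurable D" "\<phi> \<in> borel_measurable borel"
  shows "zint a \<phi> A \<in> borel_measurable M" "zint a \<phi> B \<in> borel_measurable N"
proof -
  have 1: "(\<lambda>(x, u). A u x) \<in> borel_measurable (M \<Otimes>\<^sub>M D)"
    using measurable_compose[OF measurable_pair_swap' meas_A] by (simp add: case_prod_beta)
  have 2: "(\<lambda>(x, u). B u x) \<in> borel_measurable (N \<Otimes>\<^sub>M D)"
    using measurable_compose[OF measurable_pair_swap' meas_B] by (simp add: case_prod_beta)
  note [measurable] = 1 2
  show "zint a \<phi> A \<in> borel_measurable M" "zint a \<phi> B \<in> borel_measurable N"
    unfolding zint_def by measurable
qed

lemma zint_bound:
  assumes "\<And>u. u \<in> space D \<Longrightarrow> 0 \<le> a u \<and> a u \<le> C" "\<And>y. 0 \<le> \<phi> y \<and> \<phi> y \<le> 1"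
  shows "0 \<le> zint a \<phi> Z x" "zint a \<phi> Z x \<le> C"
proof -
  have b: "\<bar>a u * \<phi> y\<bar> \<le> C" "0 \<le> a u * \<phi> y" if "u \<in> space D" for u y
    using mult_mono[of "a u" C "\<phi> y" 1] assms(1)[OF that] assms(2)[of y] by (auto simp: abs_mult)
  obtain u0 where "u0 \<in> space D" using D.not_empty by blast
  then have C: "0 \<le> C" using assms(1) order_trans by blast
  show "0 \<le> zint a \<phi> Z x" unfolding zint_def using b by (intro Bochner_Integration.integral_nonneg) auto
  have "\<bar>zint a \<phi> Z x\<bar> \<le> C" unfolding zint_def using b C by (intro D.abs_integral_le) auto
  then show "zint a \<phi> Z x \<le> C" by linarith
qed

text \<open>One power of the integral is an average over \<open>u\<close> of one further factor
  \<open>\<phi> (Z u x)\<close>, which joins the list \<open>fs\<close>.\<close>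

lemma prodf_zint_power:
  assumes [measurable]: "a \<in> borel_measurable D" "\<phi> \<in> borel_measurable borel"
    and a: "\<And>u. u \<in> space D \<Longrightarrow> 0 \<le> a u \<and> a u \<le> C" and \<phi>: "\<And>y. 0 \<le> \<phi> y \<and> \<phi> y \<le> 1"
    and "test fs"
  shows "(\<integral>x. prodf fs A x * zint a \<phi> A x ^ k \<partial>M) = (\<integral>x. prodf fs B x * zint a \<phi> B x ^ k \<partial>N)"
  using \<open>test fs\<close>
proof (induction k arbitrary: fs)
  case 0 then show ?case using prodf_eq by simp
next
  case (Suc k)
  note t = \<open>test fs\<close>
  note [measurable] = meas_pA[OF t] meas_pB[OF t] meas_zint[of a \<phi>]
  have b: "\<bar>a u * (f * p * z ^ k)\<bar> \<le> C * (1 * 1 * C ^ k)"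
    if "u \<in> space D" "0 \<le> f \<and> f \<le> 1" "0 \<le> p \<and> p \<le> 1" "0 \<le> z" "z \<le> C" for u f p z
    using a[OF that(1)] that by (intro abs_mult_le_real) (auto simp: power_abs intro: power_mono)
  have zb1: "0 \<le> zint a \<phi> A x" for x by (rule zint_bound(1)[OF a \<phi>])
  have zb2: "zint a \<phi> A x \<le> C" for x by (rule zint_bound(2)[OF a \<phi>])
  have zb3: "0 \<le> zint a \<phi> B x" for x by (rule zint_bound(1)[OF a \<phi>])
  have zb4: "zint a \<phi> B x \<le> C" for x by (rule zint_bound(2)[OF a \<phi>])
  note zb = zb1 zb2 zb3 zb4
  have eA: "prodf fs A x * zint a \<phi> A x ^ Suc k = (\<integral>u. a u * (\<phi> (A u x) * prodf fs A x * zint a \<phi> A x ^ k) \<partial>D)" for x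
  proof -
    have "(\<integral>u. a u * (\<phi> (A u x) * prodf fs A x * zint a \<phi> A x ^ k) \<partial>D) = (\<integral>u. (a u * \<phi> (A u x)) * (prodf fs A x * zint a \<phi> A x ^ k) \<partial>D)"
      by (simp add: mult.assoc)
    also have "\<dots> = zint a \<phi> A x * (prodf fs A x * zint a \<phi> A x ^ k)" by (simp add: zint_def)
    finally show ?thesis by simp
  qed
  have eB: "prodf fs B x * zint a \<phi> B x ^ Suc k = (\<integral>u. a u * (\<phi> (B u x) * prodf fs B x * zint a \<phi> B x ^ k) \<partial>D)" for x
  proof -
    have "(\<integral>u. a u * (\<phi> (B u x) * prodf fs B x * zint a \<phi> B x ^ k) \<partial>D) = (\<integral>u. (a u * \<phi> (B u x)) * (prodf fs B x * zint a \<phi> B x ^ k) \<partial>D)"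
      by (simp add: mult.assoc)
    also have "\<dots> = zint a \<phi> B x * (prodf fs B x * zint a \<phi> B x ^ k)" by (simp add: zint_def)
    finally show ?thesis by simp
  qed
  have "(\<integral>x. prodf fs A x * zint a \<phi> A x ^ Suc k \<partial>M) = (\<integral>u. (\<integral>x. a u * (\<phi> (A u x) * prodf fs A x * zint a \<phi> A x ^ k) \<partial>M) \<partial>D)"
    unfolding eA by (intro DM.Fubini_bounded(1)[where B="C * (1 * 1 * C ^ k)"] b \<phi> prodf_01[OF t] zb) measurable
  also have "\<dots> = (\<integral>u. (\<integral>x. a u * (\<phi> (B u x) * prodf fs B x * zint a \<phi> B x ^ k) \<partial>N) \<partial>D)"
  proof (rule Bochner_Integration.integral_cong[OF refl])
    fix u assume u: "u \<in> space D"
    have "(\<integral>x. prodf ((u, \<phi>) # fs) A x * zint a \<phi> A x ^ k \<partial>M) = (\<integral>x. prodf ((u, \<phi>) # fs) B x * zint a \<phi> B x ^ k \<partial>N)"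
      using u \<phi> t by (intro Suc.IH) auto
    then show "(\<integral>x. a u * (\<phi> (A u x) * prodf fs A x * zint a \<phi> A x ^ k) \<partial>M) = (\<integral>x. a u * (\<phi> (B u x) * prodf fs B x * zint a \<phi> B x ^ k) \<partial>N)"
      by simp
  qed
  also have "\<dots> = (\<integral>x. prodf fs B x * zint a \<phi> B x ^ Suc k \<partial>N)"
    unfolding eB by (intro DN.Fubini_bounded(1)[where B="C * (1 * 1 * C ^ k)", symmetric] b \<phi> prodf_01[OF t] zb) measurable
  finally show ?case .
qed

text \<open>\<open>zint\<close> takes values in the compact interval \<open>{0..C}\<close>, where
  polynomials approximate \<open>H\<close> uniformly.\<close>

lemma prodf_zint_continuous:
  assumes [measurable]: "a \<in> borel_measurable D" "\<phi> \<in> borel_measurable borel" "H \<in> borel_measurable borel"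
    and a: "\<And>u. u \<in> space D \<Longrightarrow> 0 \<le> a u \<and> a u \<le> C" and \<phi>: "\<And>y. 0 \<le> \<phi> y \<and> \<phi> y \<le> 1"
    and t: "test fs" and H: "continuous_on {0..C} H"
  shows "(\<integral>x. prodf fs A x * H (zint a \<phi> A x) \<partial>M) = (\<integral>x. prodf fs B x * H (zint a \<phi> B x) \<partial>N)"
proof -
  note [measurable] = meas_pA[OF t] meas_pB[OF t] meas_zint[of a \<phi>]
  have zb: "zint a \<phi> A x \<in> {0..C}" "zint a \<phi> B y \<in> {0..C}" for x y
    using zint_bound[of a C \<phi>] a \<phi> by auto
  have p01: "\<bar>prodf fs A x\<bar> \<le> 1" "\<bar>prodf fs B y\<bar> \<le> 1" for x y by (auto simp: prodf_01[OF t])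
  have "bounded (H ` {0..C})" by (intro compact_imp_bounded compact_continuous_image H) simp
  then obtain h where "\<forall>z\<in>{0..C}. \<bar>H z\<bar> \<le> h" by (auto simp: bounded_iff)
  then have h: "\<bar>H z\<bar> \<le> h" if "z \<in> {0..C}" for z using that by blast
  have approx: "\<bar>(\<integral>x. prodf fs A x * H (zint a \<phi> A x) \<partial>M) - (\<integral>x. prodf fs B x * H (zint a \<phi> B x) \<partial>N)\<bar> \<le> 2 * e" if "0 < e" for e
  proof -
    obtain p where p: "real_polynomial_function p" "\<And>z. z \<in> {0..C} \<Longrightarrow> \<bar>H z - p z\<bar> < e"
      using Stone_Weierstrass_real_polynomial_function[OF _ H \<open>0 < e\<close>] by auto
    obtain c n where pc: "p = (\<lambda>z. \<Sum>i\<le>n. c i * z ^ i)" using real_polynomial_function_imp_sum[OF p(1)] by auto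
    have [measurable]: "p \<in> borel_measurable borel" unfolding pc by measurable
    have pb: "\<bar>p z\<bar> \<le> h + e" if "z \<in> {0..C}" for z using h[OF that] p(2)[OF that] by linarith
    have iAk: "integrable M (\<lambda>x. prodf fs A x * zint a \<phi> A x ^ i)" for i
      using zb(1) by (intro M.integrable_bounded[where B="1 * C^i"] abs_mult_le_real p01) (auto simp: power_abs intro!: power_mono)
    have iBk: "integrable N (\<lambda>x. prodf fs B x * zint a \<phi> B x ^ i)" for i
      using zb(2) by (intro N.integrable_bounded[where B="1 * C^i"] abs_mult_le_real p01) (auto simp: power_abs intro!: power_mono)
    have eA: "(\<integral>x. prodf fs A x * p (zint a \<phi> A x) \<partial>M) = (\<Sum>i\<le>n. c i * (\<integral>x. prodf fs A x * zint a \<phi> A x ^ i \<partial>M))"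
      unfolding pc using iAk by (simp add: sum_distrib_left mult.left_commute[of "prodf fs A _"])
    have eB: "(\<integral>x. prodf fs B x * p (zint a \<phi> B x) \<partial>N) = (\<Sum>i\<le>n. c i * (\<integral>x. prodf fs B x * zint a \<phi> B x ^ i \<partial>N))"
      unfolding pc using iBk by (simp add: sum_distrib_left mult.left_commute[of "prodf fs B _"])
    have eq: "(\<integral>x. prodf fs A x * p (zint a \<phi> A x) \<partial>M) = (\<integral>x. prodf fs B x * p (zint a \<phi> B x) \<partial>N)"
      unfolding eA eB using prodf_zint_power[OF assms(1,2) a \<phi> t] by simp
    have dA: "\<bar>(\<integral>x. prodf fs A x * H (zint a \<phi> A x) \<partial>M) - (\<integral>x. prodf fs A x * p (zint a \<phi> A x) \<partial>M)\<bar> \<le> e"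
    proof -
      have "(\<integral>x. prodf fs A x * H (zint a \<phi> A x) \<partial>M) - (\<integral>x. prodf fs A x * p (zint a \<phi> A x) \<partial>M)
        = (\<integral>x. prodf fs A x * (H (zint a \<phi> A x) - p (zint a \<phi> A x)) \<partial>M)"
        unfolding right_diff_distrib
        by (intro Bochner_Integration.integral_diff[symmetric] M.integrable_bounded[where B="1 * h"] M.integrable_bounded[where B="1 * (h + e)"]
            abs_mult_le_real p01 h pb zb) measurable
      also have "\<bar>\<dots>\<bar> \<le> 1 * e"
        using p(2)[OF zb(1)] \<open>0 < e\<close> by (intro M.abs_integral_le abs_mult_le_real p01) (auto intro: less_imp_le)
      finally show ?thesis by simp
    qed
    have dB: "\<bar>(\<integral>x. prodf fs B x * H (zint a \<phi> B x) \<partial>N) - (\<integral>x. prodf fs B x * p (zint a \<phi> B x) \<partial>N)\<bar> \<le> e"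
    proof -
      have "(\<integral>x. prodf fs B x * H (zint a \<phi> B x) \<partial>N) - (\<integral>x. prodf fs B x * p (zint a \<phi> B x) \<partial>N)
        = (\<integral>x. prodf fs B x * (H (zint a \<phi> B x) - p (zint a \<phi> B x)) \<partial>N)"
        unfolding right_diff_distrib
        by (intro Bochner_Integration.integral_diff[symmetric] N.integrable_bounded[where B="1 * h"] N.integrable_bounded[where B="1 * (h + e)"]
            abs_mult_le_real p01 h pb zb) measurable
      also have "\<bar>\<dots>\<bar> \<le> 1 * e"
        using p(2)[OF zb(2)] \<open>0 < e\<close> by (intro N.abs_integral_le abs_mult_le_real p01) (auto intro: less_imp_le)
      finally show ?thesis by simp
    qed
    show ?thesis using dA dB eq by linarith
  qed
  show ?thesis
  proof (rule ccontr)
    assume "\<not> ?thesis"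
    then have "0 < \<bar>(\<integral>x. prodf fs A x * H (zint a \<phi> A x) \<partial>M) - (\<integral>x. prodf fs B x * H (zint a \<phi> B x) \<partial>N)\<bar> / 4" by simp
    from approx[OF this] this show False by simp
  qed
qed

definition Zint :: "('i \<Rightarrow> real) \<Rightarrow> real \<Rightarrow> ('i \<Rightarrow> 'c \<Rightarrow> real) \<Rightarrow> 'c \<Rightarrow> real" where
  "Zint a t Z x = (\<integral>u. a u * exp (t * Z u x) \<partial>D)"

lemma meas_Zint:
  assumes "a \<in> borel_measurable D"
  shows "Zint a t A \<in> borel_measurable M" "Zint a t B \<in> borel_measurable N"
  using meas_zint[OF assms, of "\<lambda>y. exp (t * y)"] by (simp_all add: zint_def[abs_def] Zint_def[abs_def])

text \<open>The exponential is cut off at \<open>Suc m\<close>; dominated convergence removes the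
  cut-off, first inside the partition function and then in the outer integrals.\<close>

lemma prodf_Zint:
  assumes [measurable]: "a \<in> borel_measurable D" and Hm [measurable]: "H \<in> borel_measurable borel"
    and a: "\<And>u. u \<in> space D \<Longrightarrow> 0 \<le> a u \<and> a u \<le> C"
    and t: "test fs" and H: "continuous_on {0..} H" "\<And>z. 0 \<le> z \<Longrightarrow> \<bar>H z\<bar> \<le> h"
    and int: "AE x in M. integrable D (\<lambda>u. exp (t * A u x))" "AE x in N. integrable D (\<lambda>u. exp (t * B u x))"
  shows "(\<integral>x. prodf fs A x * H (Zint a t A x) \<partial>M) = (\<integral>x. prodf fs B x * H (Zint a t B x) \<partial>N)"
proof -
  \<comment> \<open>\<open>\<phi> m\<close> has to stay in \<open>[0, 1]\<close>, so the cut-off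
    exponential is divided by \<open>Suc m\<close> and \<open>am\<close> carries this factor
    instead.\<close>
  define \<phi> where "\<phi> m y = min (exp (t * y)) (real (Suc m)) / real (Suc m)" for m y
  define am where "am m u = real (Suc m) * a u" for m u
  have \<phi>: "0 \<le> \<phi> m y \<and> \<phi> m y \<le> 1" for m y by (auto simp: \<phi>_def divide_le_eq)
  have am: "0 \<le> am m u \<and> am m u \<le> real (Suc m) * C" if "u \<in> space D" for m u
    using a[OF that] by (auto simp: am_def intro!: mult_left_mono)
  have [measurable]: "\<phi> m \<in> borel_measurable borel" "am m \<in> borel_measurable D" for m
    unfolding \<phi>_def am_def by measurable
  have prod: "am m u * \<phi> m y = a u * min (exp (t * y)) (real (Suc m))" for m u y
    by (simp add: am_def \<phi>_def)
  note [measurable] = meas_pA[OF t] meas_pB[OF t] meas_zint[of "am _" "\<phi> _"] meas_Zint[of a t]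
  have eq: "(\<integral>x. prodf fs A x * H (zint (am m) (\<phi> m) A x) \<partial>M) = (\<integral>x. prodf fs B x * H (zint (am m) (\<phi> m) B x) \<partial>N)" for m
    by (rule prodf_zint_continuous[where C="real (Suc m) * C"]) (use am \<phi> t H in \<open>auto intro: continuous_on_subset\<close>)
  have conv: "(\<lambda>m. zint (am m) (\<phi> m) Z x) \<longlonglongrightarrow> Zint a t Z x"
    if i: "integrable D (\<lambda>u. exp (t * Z u x))" for Z :: "'i \<Rightarrow> 'c \<Rightarrow> real" and x
    unfolding zint_def Zint_def
  proof (rule integral_dominated_convergence[where w="\<lambda>u. C * exp (t * Z u x)"])
    have [measurable]: "(\<lambda>u. exp (t * Z u x)) \<in> borel_measurable D" using i by auto
    show "(\<lambda>u. a u * exp (t * Z u x)) \<in> borel_measurable D" by measurable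
    show "(\<lambda>u. am m u * \<phi> m (Z u x)) \<in> borel_measurable D" for m unfolding prod by measurable
    show "integrable D (\<lambda>u. C * exp (t * Z u x))" using i by simp
    show "AE u in D. (\<lambda>m. am m u * \<phi> m (Z u x)) \<longlonglongrightarrow> a u * exp (t * Z u x)"
    proof (intro AE_I2)
      fix u
      obtain n where n: "exp (t * Z u x) \<le> real n" using real_arch_simple by blast
      have "\<forall>\<^sub>F m in sequentially. a u * exp (t * Z u x) = am m u * \<phi> m (Z u x)"
        unfolding prod using n by (intro eventually_sequentiallyI[of n]) (simp add: min_def)
      then show "(\<lambda>m. am m u * \<phi> m (Z u x)) \<longlonglongrightarrow> a u * exp (t * Z u x)"
        by (rule Lim_transform_eventually[OF tendsto_const])
    qed
    show "AE u in D. norm (am m u * \<phi> m (Z u x)) \<le> C * exp (t * Z u x)" for m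
    proof (intro AE_I2)
      fix u assume "u \<in> space D"
      then show "norm (am m u * \<phi> m (Z u x)) \<le> C * exp (t * Z u x)"
        unfolding prod using a[of u] by (auto simp: abs_mult intro!: mult_mono)
    qed
  qed
  have zb: "0 \<le> zint (am m) (\<phi> m) Z x" for m and Z :: "'i \<Rightarrow> 'c \<Rightarrow> real" and x
    by (rule zint_bound(1)[OF am \<phi>])
  have Zb: "0 \<le> Zint a t Z x" for Z :: "'i \<Rightarrow> 'c \<Rightarrow> real" and x
    unfolding Zint_def using a by (intro Bochner_Integration.integral_nonneg) auto
  have Hl: "(\<lambda>m. H (z m)) \<longlonglongrightarrow> H l" if "z \<longlonglongrightarrow> l" "\<And>m. 0 \<le> z m" "0 \<le> l" for z l
    using continuous_on_tendsto_compose[OF H(1) that(1)] that by auto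
  have h0: "0 \<le> h" using H(2)[of 0] by simp
  have pb: "\<bar>p * H z\<bar> \<le> h" if "0 \<le> p \<and> p \<le> 1" "0 \<le> z" for p z
    using abs_mult_le_real[of p 1 "H z" h] H(2)[OF that(2)] that by auto
  have lA: "(\<lambda>m. \<integral>x. prodf fs A x * H (zint (am m) (\<phi> m) A x) \<partial>M) \<longlonglongrightarrow> (\<integral>x. prodf fs A x * H (Zint a t A x) \<partial>M)"
  proof (rule integral_dominated_convergence[where w="\<lambda>_. h"])
    show "AE x in M. (\<lambda>m. prodf fs A x * H (zint (am m) (\<phi> m) A x)) \<longlonglongrightarrow> prodf fs A x * H (Zint a t A x)"
      using int(1) by eventually_elim (intro tendsto_mult_left Hl conv zb Zb)
    show "AE x in M. norm (prodf fs A x * H (zint (am m) (\<phi> m) A x)) \<le> h" for m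
      unfolding real_norm_def by (intro AE_I2 pb prodf_01[OF t] zb)
  qed (simp_all, measurable)
  have lB: "(\<lambda>m. \<integral>x. prodf fs B x * H (zint (am m) (\<phi> m) B x) \<partial>N) \<longlonglongrightarrow> (\<integral>x. prodf fs B x * H (Zint a t B x) \<partial>N)"
  proof (rule integral_dominated_convergence[where w="\<lambda>_. h"])
    show "AE x in N. (\<lambda>m. prodf fs B x * H (zint (am m) (\<phi> m) B x)) \<longlonglongrightarrow> prodf fs B x * H (Zint a t B x)"
      using int(2) by eventually_elim (intro tendsto_mult_left Hl conv zb Zb)
    show "AE x in N. norm (prodf fs B x * H (zint (am m) (\<phi> m) B x)) \<le> h" for m
      unfolding real_norm_def by (intro AE_I2 pb prodf_01[OF t] zb)
  qed (simp_all, measurable)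
  show ?thesis using LIMSEQ_unique[OF lA] lB unfolding eq by blast
qed

definition gibbs :: "('i \<Rightarrow> real) \<Rightarrow> real \<Rightarrow> nat \<Rightarrow> 'i list \<Rightarrow> ('i \<Rightarrow> 'c \<Rightarrow> real) \<Rightarrow> 'c \<Rightarrow> real" where
  "gibbs a t n us Z x = (\<Prod>u\<leftarrow>us. exp (t * Z u x)) / Zint a t Z x ^ n"

text \<open>The weight is unbounded in its numerator and singular in its denominator, so the
  exponentials are cut off and \<open>1 / (m + 1)\<close> is added to the partition function; the
  weight itself dominates these approximations. Indicators in place of \<open>F\<close> identify two
  measures, and then every Borel \<open>F\<close> has the same integral.\<close>

lemma gibbs_eq:
  assumes am [measurable]: "a \<in> borel_measurable D" and F [measurable]: "F \<in> borel_measurable borel"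
    and a: "\<And>u. u \<in> space D \<Longrightarrow> 0 \<le> a u \<and> a u \<le> C"
    and us: "set us \<subseteq> space D" and u0: "u0 \<in> space D"
    and int: "AE x in M. integrable D (\<lambda>u. exp (t * A u x))" "AE x in N. integrable D (\<lambda>u. exp (t * B u x))"
    and pos: "AE x in M. 0 < Zint a t A x" "AE x in N. 0 < Zint a t B x"
    and gi: "integrable M (gibbs a t n us A)" "integrable N (gibbs a t n us B)"
  shows "(\<integral>x. F (A u0 x) * gibbs a t n us A x \<partial>M) = (\<integral>x. F (B u0 x) * gibbs a t n us B x \<partial>N)"
proof -
  have Zb: "0 \<le> Zint a t Z x" for Z :: "'i \<Rightarrow> 'c \<Rightarrow> real" and x
    unfolding Zint_def using a by (intro Bochner_Integration.integral_nonneg) auto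
  have gb: "0 \<le> gibbs a t n us Z x" for Z :: "'i \<Rightarrow> 'c \<Rightarrow> real" and x
    unfolding gibbs_def by (intro divide_nonneg_nonneg prod_list_nonneg zero_le_power Zb) auto
  note [measurable] = meas_A1[OF u0] meas_B1[OF u0] meas_Zint[OF am]
  have ind: "(\<integral>x. indicator S (A u0 x) * gibbs a t n us A x \<partial>M) = (\<integral>x. indicator S (B u0 x) * gibbs a t n us B x \<partial>N)"
    if [measurable]: "S \<in> sets borel" for S
  proof -
    define \<phi> where "\<phi> m y = min (exp (t * y)) (real (Suc m)) / real (Suc m)" for m y
    have [measurable]: "\<phi> m \<in> borel_measurable borel" for m unfolding \<phi>_def by measurable
    define fs where "fs m = (u0, indicator S) # map (\<lambda>u. (u, \<phi> m)) us" for m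
    \<comment> \<open>\<open>max z 0\<close> keeps \<open>H m\<close> bounded on the whole line, and
      the power of \<open>Suc m\<close> undoes the division inside \<open>\<phi> m\<close>, once for
      each replica.\<close>
    define H where "H m z = real (Suc m) ^ length us / (max z 0 + 1 / real (Suc m)) ^ n" for m z
    have t: "test (fs m)" for m
      using us u0 unfolding fs_def test_def by (auto simp: \<phi>_def divide_le_eq indicator_def)
    have Hb: "\<bar>H m z\<bar> \<le> real (Suc m) ^ length us * real (Suc m) ^ n" for m z
    proof -
      have "1 / real (Suc m) \<le> max z 0 + 1 / real (Suc m)" by simp
      then have "(1 / real (Suc m)) ^ n \<le> (max z 0 + 1 / real (Suc m)) ^ n" by (intro power_mono) auto
      then have "1 / (max z 0 + 1 / real (Suc m)) ^ n \<le> 1 / (1 / real (Suc m)) ^ n"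
        by (intro divide_left_mono mult_pos_pos zero_less_power) (auto intro!: add_nonneg_pos)
      then have "real (Suc m) ^ length us * (1 / (max z 0 + 1 / real (Suc m)) ^ n) \<le> real (Suc m) ^ length us * real (Suc m) ^ n"
        by (intro mult_left_mono) (auto simp: power_one_over)
      moreover have "0 \<le> H m z" unfolding H_def by (intro divide_nonneg_nonneg zero_le_power add_nonneg_nonneg) auto
      ultimately show ?thesis by (simp add: H_def)
    qed
    have [measurable]: "H m \<in> borel_measurable borel" for m unfolding H_def by measurable
    have Hc: "continuous_on {0..} (H m)" for m
      unfolding H_def by (intro continuous_intros) (auto simp: add_nonneg_eq_0_iff max_def)
    have eq: "(\<integral>x. prodf (fs m) A x * H m (Zint a t A x) \<partial>M) = (\<integral>x. prodf (fs m) B x * H m (Zint a t B x) \<partial>N)" for m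
      by (rule prodf_Zint[OF am _ a t Hc Hb int]) measurable
    have expand: "prodf (fs m) Z x * H m (Zint a t Z x) = indicator S (Z u0 x) * (\<Prod>u\<leftarrow>us. min (exp (t * Z u x)) (real (Suc m)))
       / (Zint a t Z x + 1 / real (Suc m)) ^ n" for m and Z :: "'i \<Rightarrow> 'c \<Rightarrow> real" and x
    proof -
      have "prodf (map (\<lambda>u. (u, \<phi> m)) us) Z x * real (Suc m) ^ length us = (\<Prod>u\<leftarrow>us. min (exp (t * Z u x)) (real (Suc m)))"
      proof (induction us)
        case (Cons u us)
        have "\<phi> m (Z u x) * real (Suc m) = min (exp (t * Z u x)) (real (Suc m))" by (simp add: \<phi>_def)
        with Cons show ?case by (simp add: ac_simps del: of_nat_Suc)
      qed simp
      then show ?thesis using Zb[of Z x] by (simp add: fs_def H_def max_def mult.assoc del: of_nat_Suc)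
    qed
    have le: "\<bar>prodf (fs m) Z x * H m (Zint a t Z x)\<bar> \<le> gibbs a t n us Z x" if "0 < Zint a t Z x" for m and Z :: "'i \<Rightarrow> 'c \<Rightarrow> real" and x
    proof -
      have p: "0 \<le> (\<Prod>u\<leftarrow>us. min (exp (t * Z u x)) (real (Suc m))) \<and> (\<Prod>u\<leftarrow>us. min (exp (t * Z u x)) (real (Suc m))) \<le> (\<Prod>u\<leftarrow>us. exp (t * Z u x))"
        by (induction us) (auto intro!: mult_mono mult_nonneg_nonneg)
      have z: "Zint a t Z x ^ n \<le> (Zint a t Z x + 1 / real (Suc m)) ^ n" using that by (intro power_mono) auto
      have "indicator S (Z u0 x) * (\<Prod>u\<leftarrow>us. min (exp (t * Z u x)) (real (Suc m))) / (Zint a t Z x + 1 / real (Suc m)) ^ n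
        \<le> (\<Prod>u\<leftarrow>us. exp (t * Z u x)) / Zint a t Z x ^ n"
        using p z that by (intro frac_le) (auto simp: indicator_def)
      moreover have "0 \<le> indicator S (Z u0 x) * (\<Prod>u\<leftarrow>us. min (exp (t * Z u x)) (real (Suc m))) / (Zint a t Z x + 1 / real (Suc m)) ^ n"
        using p that by (intro divide_nonneg_nonneg mult_nonneg_nonneg zero_le_power) auto
      ultimately show ?thesis unfolding expand gibbs_def by simp
    qed
    have lim: "(\<lambda>m. prodf (fs m) Z x * H m (Zint a t Z x)) \<longlonglongrightarrow> indicator S (Z u0 x) * gibbs a t n us Z x"
      if "0 < Zint a t Z x" for Z :: "'i \<Rightarrow> 'c \<Rightarrow> real" and x
    proof -
      have "(\<lambda>m. (\<Prod>u\<leftarrow>us. min (exp (t * Z u x)) (real (Suc m)))) \<longlonglongrightarrow> (\<Prod>u\<leftarrow>us. exp (t * Z u x))"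
      proof (induction us)
        case (Cons u us)
        obtain n where n: "exp (t * Z u x) \<le> real n" using real_arch_simple by blast
        have "\<forall>\<^sub>F m in sequentially. exp (t * Z u x) = min (exp (t * Z u x)) (real (Suc m))"
          using n by (intro eventually_sequentiallyI[of n]) (simp add: min_def)
        then have "(\<lambda>m. min (exp (t * Z u x)) (real (Suc m))) \<longlonglongrightarrow> exp (t * Z u x)"
          by (rule Lim_transform_eventually[OF tendsto_const])
        from tendsto_mult[OF this Cons] show ?case by simp
      qed simp
      moreover have "(\<lambda>m. (Zint a t Z x + 1 / real (Suc m)) ^ n) \<longlonglongrightarrow> (Zint a t Z x + 0) ^ n"
        using LIMSEQ_inverse_real_of_nat by (intro tendsto_intros) (simp add: inverse_eq_divide)
      ultimately show ?thesis unfolding expand gibbs_def times_divide_eq_right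
        using that by (intro tendsto_divide tendsto_mult_left) auto
    qed
    note [measurable] = meas_pA[OF t] meas_pB[OF t]
    have lA: "(\<lambda>m. \<integral>x. prodf (fs m) A x * H m (Zint a t A x) \<partial>M) \<longlonglongrightarrow> (\<integral>x. indicator S (A u0 x) * gibbs a t n us A x \<partial>M)"
    proof (rule integral_dominated_convergence[where w="gibbs a t n us A", OF _ _ gi(1)])
      show "(\<lambda>x. indicator S (A u0 x) * gibbs a t n us A x) \<in> borel_measurable M" using gi(1) by (intro borel_measurable_times) auto
      show "AE x in M. (\<lambda>m. prodf (fs m) A x * H m (Zint a t A x)) \<longlonglongrightarrow> indicator S (A u0 x) * gibbs a t n us A x"
        using pos(1) by eventually_elim (rule lim)
      show "AE x in M. norm (prodf (fs m) A x * H m (Zint a t A x)) \<le> gibbs a t n us A x" for m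
        using pos(1) by eventually_elim (simp add: le del: abs_mult)
    qed measurable
    have lB: "(\<lambda>m. \<integral>x. prodf (fs m) B x * H m (Zint a t B x) \<partial>N) \<longlonglongrightarrow> (\<integral>x. indicator S (B u0 x) * gibbs a t n us B x \<partial>N)"
    proof (rule integral_dominated_convergence[where w="gibbs a t n us B", OF _ _ gi(2)])
      show "(\<lambda>x. indicator S (B u0 x) * gibbs a t n us B x) \<in> borel_measurable N" using gi(2) by (intro borel_measurable_times) auto
      show "AE x in N. (\<lambda>m. prodf (fs m) B x * H m (Zint a t B x)) \<longlonglongrightarrow> indicator S (B u0 x) * gibbs a t n us B x"
        using pos(2) by eventually_elim (rule lim)
      show "AE x in N. norm (prodf (fs m) B x * H m (Zint a t B x)) \<le> gibbs a t n us B x" for m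
        using pos(2) by eventually_elim (simp add: le del: abs_mult)
    qed measurable
    show ?thesis using LIMSEQ_unique[OF lA] lB unfolding eq by blast
  qed
  have [measurable]: "gibbs a t n us A \<in> borel_measurable M" "gibbs a t n us B \<in> borel_measurable N" using gi by auto
  have "distr (density M (\<lambda>x. ennreal (gibbs a t n us A x))) borel (A u0) = distr (density N (\<lambda>x. ennreal (gibbs a t n us B x))) borel (B u0)"
  proof (rule measure_eqI)
    fix S assume "S \<in> sets (distr (density M (\<lambda>x. ennreal (gibbs a t n us A x))) borel (A u0))"
    then have [measurable]: "S \<in> sets borel" by simp
    have eM: "emeasure (distr (density M (\<lambda>x. ennreal (gibbs a t n us A x))) borel (A u0)) S = ennreal (\<integral>x. indicator S (A u0 x) * gibbs a t n us A x \<partial>M)"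
    proof -
      have "emeasure (distr (density M (\<lambda>x. ennreal (gibbs a t n us A x))) borel (A u0)) S = (\<integral>\<^sup>+x. ennreal (indicator S (A u0 x) * gibbs a t n us A x) \<partial>M)"
        by (subst emeasure_distr, simp, simp, subst emeasure_density) (auto intro!: nn_integral_cong simp: indicator_def)
      also have "\<dots> = ennreal (\<integral>x. indicator S (A u0 x) * gibbs a t n us A x \<partial>M)"
        using gb by (intro nn_integral_eq_integral Bochner_Integration.integrable_bound[OF gi(1)] AE_I2) (auto simp: indicator_def)
      finally show ?thesis .
    qed
    have eN: "emeasure (distr (density N (\<lambda>x. ennreal (gibbs a t n us B x))) borel (B u0)) S = ennreal (\<integral>x. indicator S (B u0 x) * gibbs a t n us B x \<partial>N)"
    proof -
      have "emeasure (distr (density N (\<lambda>x. ennreal (gibbs a t n us B x))) borel (B u0)) S = (\<integral>\<^sup>+x. ennreal (indicator S (B u0 x) * gibbs a t n us B x) \<partial>N)"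
        by (subst emeasure_distr, simp, simp, subst emeasure_density) (auto intro!: nn_integral_cong simp: indicator_def)
      also have "\<dots> = ennreal (\<integral>x. indicator S (B u0 x) * gibbs a t n us B x \<partial>N)"
        using gb by (intro nn_integral_eq_integral Bochner_Integration.integrable_bound[OF gi(2)] AE_I2) (auto simp: indicator_def)
      finally show ?thesis .
    qed
    show "emeasure (distr (density M (\<lambda>x. ennreal (gibbs a t n us A x))) borel (A u0)) S = emeasure (distr (density N (\<lambda>x. ennreal (gibbs a t n us B x))) borel (B u0)) S"
      unfolding eM eN by (simp add: ind)
  qed simp
  from arg_cong[OF this, of "\<lambda>R. \<integral>y. F y \<partial>R"] show ?thesis
    by (simp add: integral_distr integral_density gb mult.commute)
qed

end

section \<open>Gibbs averages of a Gaussian field\<close>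

lemma sum_list_le_length: "(\<And>x. x \<in> set xs \<Longrightarrow> x \<le> M) \<Longrightarrow> sum_list xs \<le> real (length xs) * M"
  by (induction xs) (auto simp: distrib_right intro!: add_mono)

lemma le_sum_list_map:
  fixes f :: "'b \<Rightarrow> real"
  shows "y \<in> set xs \<Longrightarrow> (\<And>x. 0 \<le> f x) \<Longrightarrow> f y \<le> (\<Sum>x\<leftarrow>xs. f x)"
proof (induction xs)
  case (Cons x xs)
  have "0 \<le> (\<Sum>x\<leftarrow>xs. f x)" using Cons.prems(2) by (intro sum_list_nonneg) auto
  then show ?case using Cons by (cases "y = x") (auto simp: add_increasing)
qed simp

text \<open>The largest entry dominates the mean. This takes the place of the Hoelder inequality: a
  product of exponentials of several Gaussian variables is bounded by a sum of exponentials of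
  single ones.\<close>

lemma exp_sum_list_le:
  assumes "xs \<noteq> []" shows "exp (sum_list xs) \<le> (\<Sum>x\<leftarrow>xs. exp (real (length xs) * x))"
proof -
  have "sum_list xs \<le> real (length xs) * Max (set xs)" by (rule sum_list_le_length) simp
  then have "exp (sum_list xs) \<le> exp (real (length xs) * Max (set xs))" by simp
  also have "\<dots> \<le> (\<Sum>x\<leftarrow>xs. exp (real (length xs) * x))"
    by (rule le_sum_list_map[where f="\<lambda>x. exp (real (length xs) * x)"]) (use assms Max_in[of "set xs"] in auto)
  finally show ?thesis .
qed

text \<open>\<open>a\<close> is the deterministic weight that remains after integrating out
  \<open>z\<close>. Its lower bound 1 lets it be dropped in lower estimates of the partition
  function, and its upper bound gives finiteness.\<close>

locale gauss_field = gauss_process P "space D" K X + D: prob_space D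
  for P :: "'a measure" and D :: "'i measure" and K :: "'i \<Rightarrow> 'i \<Rightarrow> real" and X :: "'i \<Rightarrow> 'a \<Rightarrow> real" +
  fixes a :: "'i \<Rightarrow> real" and C :: real
  assumes meas_X [measurable]: "(\<lambda>(u, x). X u x) \<in> borel_measurable (D \<Otimes>\<^sub>M P)"
    and meas_K [measurable]: "(\<lambda>(u, u'). K u u') \<in> borel_measurable (D \<Otimes>\<^sub>M D)"
    and K_bound: "\<And>u u'. u \<in> space D \<Longrightarrow> u' \<in> space D \<Longrightarrow> \<bar>K u u'\<bar> \<le> 1"
    and meas_a [measurable]: "a \<in> borel_measurable D"
    and a_bounds: "\<And>u. u \<in> space D \<Longrightarrow> 1 \<le> a u \<and> a u \<le> C"
begin

lemma meas_X1: "u \<in> space D \<Longrightarrow> X u \<in> borel_measurable P"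
  using measurable_Pair2[OF meas_X, of u] by simp

lemma nn_exp_abs: "u \<in> space D \<Longrightarrow> (\<integral>\<^sup>+x. ennreal (exp (c * \<bar>X u x\<bar>)) \<partial>P) \<le> ennreal (2 * exp (c\<^sup>2))"
proof -
  assume u: "u \<in> space D"
  note [measurable] = meas_X1[OF u]
  have l: "lin (X u)" using u by (rule lin_X)
  have cv: "cov (X u) (X u) \<le> 1" using cov_X[OF u u] K_bound[OF u u] by simp
  have e: "(\<integral>\<omega>. exp (c * X u \<omega>) \<partial>P) \<le> exp (c\<^sup>2)" for c
  proof -
    have "c\<^sup>2 * cov (X u) (X u) / 2 \<le> c\<^sup>2"
      using mult_left_mono[OF cv, of "c\<^sup>2"] zero_le_power2[of c] by linarith
    then show ?thesis unfolding lin_exp(1)[OF l] by simp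
  qed
  have "(\<integral>\<^sup>+x. ennreal (exp (c * \<bar>X u x\<bar>)) \<partial>P) \<le> (\<integral>\<^sup>+x. ennreal (exp (c * X u x) + exp ((-c) * X u x)) \<partial>P)"
    by (intro nn_integral_mono ennreal_leI) (auto simp: abs_if add_increasing add_increasing2)
  also have "\<dots> = ennreal (\<integral>x. exp (c * X u x) + exp ((-c) * X u x) \<partial>P)"
    using lin_exp(2)[OF l, of c] lin_exp(2)[OF l, of "-c"] by (intro nn_integral_eq_integral) auto
  also have "\<dots> \<le> ennreal (2 * exp (c\<^sup>2))"
    using lin_exp(2)[OF l, of c] lin_exp(2)[OF l, of "-c"] e[of c] e[of "-c"] by (intro ennreal_leI) simp
  finally show ?thesis .
qed

lemma AE_exp_integrable: "AE x in P. integrable D (\<lambda>u. exp (c * \<bar>X u x\<bar>))"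
proof -
  interpret DP: pair_sigma_finite D P ..
  have "(\<integral>\<^sup>+x. (\<integral>\<^sup>+u. ennreal (exp (c * \<bar>X u x\<bar>)) \<partial>D) \<partial>P) = (\<integral>\<^sup>+u. (\<integral>\<^sup>+x. ennreal (exp (c * \<bar>X u x\<bar>)) \<partial>P) \<partial>D)"
    by (rule DP.Fubini') measurable
  also have "\<dots> \<le> (\<integral>\<^sup>+u. ennreal (2 * exp (c\<^sup>2)) \<partial>D)" by (intro nn_integral_mono nn_exp_abs)
  also have "\<dots> < \<infinity>" by (simp add: D.emeasure_space_1)
  finally have "AE x in P. (\<integral>\<^sup>+u. ennreal (exp (c * \<bar>X u x\<bar>)) \<partial>D) \<noteq> \<infinity>"
    by (intro nn_integral_PInf_AE) auto
  then have "AE x in P. x \<in> space P \<longrightarrow> integrable D (\<lambda>u. exp (c * \<bar>X u x\<bar>))"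
  proof (eventually_elim, intro impI)
    fix x assume "(\<integral>\<^sup>+u. ennreal (exp (c * \<bar>X u x\<bar>)) \<partial>D) \<noteq> \<infinity>" and x: "x \<in> space P"
    moreover have "(\<lambda>u. X u x) \<in> borel_measurable D" using x by measurable
    ultimately show "integrable D (\<lambda>u. exp (c * \<bar>X u x\<bar>))"
      by (intro integrableI_nonneg) (auto simp: less_top)
  qed
  then show ?thesis by (rule AE_mp) (auto intro!: AE_I2)
qed

text \<open>A single almost sure event on which the partition functions are finite for all real
  parameters: by monotonicity the countably many natural exponents suffice.\<close>

definition good :: "'a \<Rightarrow> bool" where "good x \<longleftrightarrow> x \<in> space P \<and> (\<forall>c::nat. integrable D (\<lambda>u. exp (real c * \<bar>X u x\<bar>)))"

lemma AE_good: "AE x in P. good x"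
  unfolding good_def using AE_exp_integrable by (auto simp: AE_all_countable AE_conj_iff)

lemma good_exp:
  assumes g: "good x" shows "integrable D (\<lambda>u. exp (c * X u x))" "integrable D (\<lambda>u. a u * exp (c * X u x))"
proof -
  have x [measurable]: "x \<in> space P" using g by (simp add: good_def)
  have [measurable]: "(\<lambda>u. X u x) \<in> borel_measurable D" using x by measurable
  obtain n :: nat where n: "\<bar>c\<bar> \<le> real n" using real_arch_simple by blast
  have i: "integrable D (\<lambda>u. exp (real n * \<bar>X u x\<bar>))" using g by (simp add: good_def)
  have le: "exp (c * X u x) \<le> exp (real n * \<bar>X u x\<bar>)" for u
  proof -
    have "c * X u x \<le> \<bar>c\<bar> * \<bar>X u x\<bar>" using abs_ge_self[of "c * X u x"] by (simp add: abs_mult)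
    also have "\<dots> \<le> real n * \<bar>X u x\<bar>" using n by (intro mult_right_mono) auto
    finally show ?thesis by simp
  qed
  show *: "integrable D (\<lambda>u. exp (c * X u x))"
    by (rule Bochner_Integration.integrable_bound[OF i]) (use le in auto)
  have "integrable D (\<lambda>u. C * exp (c * X u x))" using * by simp
  then show "integrable D (\<lambda>u. a u * exp (c * X u x))"
    by (rule Bochner_Integration.integrable_bound) (use a_bounds in \<open>force intro!: AE_I2 mult_right_mono simp: abs_mult\<close>)+
qed

definition Z :: "real \<Rightarrow> 'a \<Rightarrow> real" where "Z t x = (\<integral>u. a u * exp (t * X u x) \<partial>D)"

lemma meas_Z [measurable]: "Z t \<in> borel_measurable P"
  unfolding Z_def by measurable

lemma Z_pos: assumes g: "good x" shows "0 < Z t x"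
proof -
  have "(\<integral>u. exp (t * X u x) \<partial>D) \<le> Z t x"
    unfolding Z_def using good_exp[OF g] a_bounds by (intro integral_mono) auto
  moreover have "0 < (\<integral>u. exp (t * X u x) \<partial>D)"
  proof -
    have "(\<integral>u. exp (t * X u x) \<partial>D) \<noteq> 0"
      using integral_nonneg_eq_0_iff_AE[OF good_exp(1)[OF g, of t]] by simp
    moreover have "0 \<le> (\<integral>u. exp (t * X u x) \<partial>D)" by simp
    ultimately show ?thesis by linarith
  qed
  ultimately show ?thesis by simp
qed

text \<open>Negative moments of the partition function: Jensen for the convex function
  \<open>y \<mapsto> 1 / y^n\<close>, after which \<open>a u \<ge> 1\<close> removes the factor
  \<open>a\<close>. The bound is again an average of exponentials, over one extra index.\<close>

lemma inverse_Z_le: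
  assumes g: "good x" shows "1 / Z t x ^ n \<le> (\<integral>u. exp (real n * \<bar>t\<bar> * \<bar>X u x\<bar>) \<partial>D)"
    and "integrable D (\<lambda>u. exp (real n * \<bar>t\<bar> * \<bar>X u x\<bar>))"
proof -
  have x [measurable]: "x \<in> space P" using g by (simp add: good_def)
  have [measurable]: "(\<lambda>u. X u x) \<in> borel_measurable D" using x by measurable
  define z where "z = Z t x"
  have z: "0 < z" using Z_pos[OF g] by (simp add: z_def)
  obtain c :: nat where "real n * \<bar>t\<bar> \<le> real c" using real_arch_simple by blast
  then have le: "exp (real n * \<bar>t\<bar> * \<bar>X u x\<bar>) \<le> exp (real c * \<bar>X u x\<bar>)" for u by (simp add: mult_right_mono)
  have "integrable D (\<lambda>u. exp (real c * \<bar>X u x\<bar>))" using g by (simp add: good_def)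
  then show i: "integrable D (\<lambda>u. exp (real n * \<bar>t\<bar> * \<bar>X u x\<bar>))"
    by (rule Bochner_Integration.integrable_bound) (use le in auto)
  \<comment> \<open>The graph of \<open>1 / y^n\<close> lies above its tangent at
    \<open>y = z\<close>, by the Bernoulli inequality for \<open>z / y\<close> and
    \<open>z / y + y / z \<ge> 2\<close>. Integrated over \<open>u\<close> the linear term vanishes,
    because \<open>z\<close> is the mean of \<open>a u * exp (t * X u x)\<close>.\<close>
  have tangent: "1 / z ^ n * (1 - real n * (y / z - 1)) \<le> 1 / y ^ n" if y: "0 < y" for y
  proof -
    have "1 + real n * (z / y - 1) \<le> (1 + (z / y - 1)) ^ n"
      using y z by (intro Bernoulli_inequality) (auto simp: field_simps)
    moreover have "1 - (y / z - 1) \<le> 1 + (z / y - 1)"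
    proof -
      have "0 \<le> (y - z)\<^sup>2 / (y * z)" using y z by simp
      also have "\<dots> = z / y + y / z - 2" using y z by (simp add: power2_eq_square field_simps)
      finally show ?thesis by simp
    qed
    then have "1 - real n * (y / z - 1) \<le> 1 + real n * (z / y - 1)"
      using mult_left_mono[of "- (y / z - 1)" "z / y - 1" "real n"] unfolding mult_minus_right by linarith
    ultimately have "1 - real n * (y / z - 1) \<le> (z / y) ^ n" by simp
    then have "1 / z ^ n * (1 - real n * (y / z - 1)) \<le> 1 / z ^ n * (z / y) ^ n"
      using z by (intro mult_left_mono) auto
    also have "\<dots> = 1 / y ^ n" using z y by (simp add: power_divide)
    finally show ?thesis .
  qed
  have int: "integrable D (\<lambda>u. a u * exp (t * X u x))" by (rule good_exp[OF g])
  have Zi: "(\<integral>u. a u * exp (t * X u x) \<partial>D) = z" by (simp add: z_def Z_def)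
  have "1 / z ^ n = (\<integral>u. 1 / z ^ n * (1 - real n * ((a u * exp (t * X u x)) / z - 1)) \<partial>D)"
    using int z by (simp add: Zi D.prob_space)
  also have "\<dots> \<le> (\<integral>u. exp (real n * \<bar>t\<bar> * \<bar>X u x\<bar>) \<partial>D)"
  proof (intro integral_mono i)
    fix u assume u: "u \<in> space D"
    have ae: "0 < a u * exp (t * X u x)" using a_bounds[OF u] by simp
    have "1 / z ^ n * (1 - real n * ((a u * exp (t * X u x)) / z - 1)) \<le> 1 / (a u * exp (t * X u x)) ^ n"
      by (rule tangent[OF ae])
    also have "\<dots> \<le> 1 / exp (t * X u x) ^ n"
      using a_bounds[OF u] ae by (intro divide_left_mono power_mono mult_pos_pos zero_less_power) auto
    also have "\<dots> = exp (- (real n * (t * X u x)))" by (simp add: exp_minus exp_of_nat_mult inverse_eq_divide)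
    also have "\<dots> \<le> exp (real n * \<bar>t\<bar> * \<bar>X u x\<bar>)"
      using mult_left_mono[of "- (t * X u x)" "\<bar>t\<bar> * \<bar>X u x\<bar>" "real n"] by (simp add: abs_mult[symmetric] mult.assoc)
    finally show "1 / z ^ n * (1 - real n * ((a u * exp (t * X u x)) / z - 1)) \<le> exp (real n * \<bar>t\<bar> * \<bar>X u x\<bar>)" .
  qed (use int in auto)
  finally show "1 / Z t x ^ n \<le> (\<integral>u. exp (real n * \<bar>t\<bar> * \<bar>X u x\<bar>) \<partial>D)" by (simp add: z_def)
qed

text \<open>The joint Gibbs density of the replicas \<open>us\<close> up to the factors
  \<open>a u\<close>, which are bounded and do not depend on the field.\<close>

definition Y :: "real \<Rightarrow> 'i list \<Rightarrow> 'a \<Rightarrow> real" where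
  "Y t us x = (\<Prod>u\<leftarrow>us. exp (t * X u x)) / Z t x ^ length us"

text \<open>Counts \<open>n + 2\<close> exponentials: those of the \<open>n\<close> replicas, of the
  index \<open>u0\<close> of the test function and of the index from \<open>inverse_Z_le\<close>.
  \<open>exp_sum_list_le\<close> multiplies the exponents by \<open>n + 2\<close>, and
  \<open>nn_exp_abs\<close> bounds each term. The result does not depend on the replicas, so it can
  be integrated over them.\<close>

definition Ybound :: "real \<Rightarrow> nat \<Rightarrow> real \<Rightarrow> real" where
  "Ybound t n c = real (n + 2) * (2 * exp ((real (n + 2) * max \<bar>c\<bar> (real (n + 1) * \<bar>t\<bar>))\<^sup>2))"

lemma Y_pos: "good x \<Longrightarrow> 0 < Y t us x"
  unfolding Y_def by (intro divide_pos_pos zero_less_power Z_pos) (induction us, auto)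

lemma meas_Y: assumes "set us \<subseteq> space D" shows "Y t us \<in> borel_measurable P"
proof -
  have "(\<lambda>x. \<Prod>u\<leftarrow>us. exp (t * X u x)) \<in> borel_measurable P"
    using assms by (induction us) (auto intro!: borel_measurable_times borel_measurable_exp measurable_compose[OF meas_X1] simp: borel_measurable_const)
  then show ?thesis unfolding Y_def[abs_def] by measurable
qed

lemma Y_bound:
  assumes us: "set us \<subseteq> space D" and u0: "u0 \<in> space D"
  shows "(\<integral>\<^sup>+x. ennreal (exp (c * \<bar>X u0 x\<bar>) * Y t us x) \<partial>P) \<le> ennreal (Ybound t (length us) c)"
proof -
  interpret DP: pair_sigma_finite D P ..
  note [measurable] = meas_Y[OF us] meas_X1[OF u0]
  define n where "n = length us"
  define m where "m = max \<bar>c\<bar> (real (n + 1) * \<bar>t\<bar>)"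
  let ?xs = "\<lambda>u x. map (\<lambda>u. m * \<bar>X u x\<bar>) (u0 # u # us)"
  have tm: "\<bar>t\<bar> \<le> m" "real n * \<bar>t\<bar> \<le> m" "c \<le> m"
    using mult_right_mono[of 1 "real (n+1)" "\<bar>t\<bar>"] mult_right_mono[of "real n" "real (n+1)" "\<bar>t\<bar>"] by (auto simp: m_def)
  have key: "exp (c * \<bar>X u0 x\<bar>) * Y t us x \<le> (\<integral>u. exp (c * \<bar>X u0 x\<bar>) * (\<Prod>u\<leftarrow>us. exp (t * X u x)) * exp (real n * \<bar>t\<bar> * \<bar>X u x\<bar>) \<partial>D)" if "good x" for x
  proof -
    have p: "0 \<le> exp (c * \<bar>X u0 x\<bar>) * (\<Prod>u\<leftarrow>us. exp (t * X u x))" by (intro mult_nonneg_nonneg prod_list_nonneg) auto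
    have "exp (c * \<bar>X u0 x\<bar>) * Y t us x = exp (c * \<bar>X u0 x\<bar>) * (\<Prod>u\<leftarrow>us. exp (t * X u x)) * (1 / Z t x ^ n)"
      by (simp add: Y_def n_def)
    also have "\<dots> \<le> exp (c * \<bar>X u0 x\<bar>) * (\<Prod>u\<leftarrow>us. exp (t * X u x)) * (\<integral>u. exp (real n * \<bar>t\<bar> * \<bar>X u x\<bar>) \<partial>D)"
      using p by (intro mult_left_mono inverse_Z_le(1)[OF that])
    finally show ?thesis by simp
  qed
  have prod: "exp (c * \<bar>X u0 x\<bar>) * (\<Prod>u\<leftarrow>us. exp (t * X u x)) * exp (real n * \<bar>t\<bar> * \<bar>X u x\<bar>) \<le> (\<Sum>v\<leftarrow>u0 # u # us. exp (real (n + 2) * m * \<bar>X v x\<bar>))" for u x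
  proof -
    have "(\<Prod>u\<leftarrow>us. exp (t * X u x)) \<le> exp (\<Sum>u\<leftarrow>us. m * \<bar>X u x\<bar>)"
    proof (induction us)
      case (Cons v us)
      have "t * X v x \<le> \<bar>t\<bar> * \<bar>X v x\<bar>" using abs_ge_self[of "t * X v x"] by (simp add: abs_mult)
      also have "\<dots> \<le> m * \<bar>X v x\<bar>" using tm by (intro mult_right_mono) auto
      finally show ?case using Cons by (auto simp: exp_add intro!: mult_mono prod_list_nonneg)
    qed simp
    moreover have "exp (c * \<bar>X u0 x\<bar>) \<le> exp (m * \<bar>X u0 x\<bar>)" "exp (real n * \<bar>t\<bar> * \<bar>X u x\<bar>) \<le> exp (m * \<bar>X u x\<bar>)"
      using tm by (auto intro!: mult_right_mono)
    ultimately have "exp (c * \<bar>X u0 x\<bar>) * (\<Prod>u\<leftarrow>us. exp (t * X u x)) * exp (real n * \<bar>t\<bar> * \<bar>X u x\<bar>)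
      \<le> exp (m * \<bar>X u0 x\<bar>) * exp (\<Sum>u\<leftarrow>us. m * \<bar>X u x\<bar>) * exp (m * \<bar>X u x\<bar>)"
      by (intro mult_mono mult_nonneg_nonneg prod_list_nonneg) auto
    also have "\<dots> = exp (sum_list (?xs u x))" by (simp add: exp_add)
    also have "\<dots> \<le> (\<Sum>y\<leftarrow>?xs u x. exp (real (length (?xs u x)) * y))" by (rule exp_sum_list_le) simp
    finally show ?thesis by (simp add: o_def n_def mult.assoc del: of_nat_Suc of_nat_add)
  qed
  have mS: "(\<lambda>x. \<Sum>v\<leftarrow>vs. ennreal (exp (real (n + 2) * m * \<bar>X v x\<bar>))) \<in> borel_measurable P"
    if "set vs \<subseteq> space D" for vs
    using that
  proof (induction vs)
    case (Cons v vs)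
    have "(\<lambda>x. ennreal (exp (real (n + 2) * m * \<bar>X v x\<bar>)) + (\<Sum>v\<leftarrow>vs. ennreal (exp (real (n + 2) * m * \<bar>X v x\<bar>)))) \<in> borel_measurable P"
      using Cons meas_X1[of v] by (intro borel_measurable_add measurable_compose[OF _ measurable_ennreal]) auto
    then show ?case by (simp only: list.map sum_list.Cons)
  qed simp
  have "(\<integral>\<^sup>+x. ennreal (exp (c * \<bar>X u0 x\<bar>) * Y t us x) \<partial>P)
    \<le> (\<integral>\<^sup>+x. (\<integral>\<^sup>+u. (\<Sum>v\<leftarrow>u0 # u # us. ennreal (exp (real (n + 2) * m * \<bar>X v x\<bar>))) \<partial>D) \<partial>P)"
  proof (rule nn_integral_mono_AE, use AE_good in eventually_elim)
    fix x assume g: "good x"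
    then have x: "x \<in> space P" by (simp add: good_def)
    have "ennreal (exp (c * \<bar>X u0 x\<bar>) * Y t us x) \<le> ennreal (\<integral>u. exp (c * \<bar>X u0 x\<bar>) * (\<Prod>u\<leftarrow>us. exp (t * X u x)) * exp (real n * \<bar>t\<bar> * \<bar>X u x\<bar>) \<partial>D)"
      by (intro ennreal_leI key g)
    also have "\<dots> = (\<integral>\<^sup>+u. ennreal (exp (c * \<bar>X u0 x\<bar>) * (\<Prod>u\<leftarrow>us. exp (t * X u x)) * exp (real n * \<bar>t\<bar> * \<bar>X u x\<bar>)) \<partial>D)"
      using inverse_Z_le(2)[OF g]
      by (intro nn_integral_eq_integral[symmetric]) (auto intro!: AE_I2 mult_nonneg_nonneg prod_list_nonneg)
    also have "\<dots> \<le> (\<integral>\<^sup>+u. (\<Sum>v\<leftarrow>u0 # u # us. ennreal (exp (real (n + 2) * m * \<bar>X v x\<bar>))) \<partial>D)"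
    proof (rule nn_integral_mono)
      fix u
      have "ennreal (\<Sum>v\<leftarrow>vs. exp (real (n + 2) * m * \<bar>X v x\<bar>)) = (\<Sum>v\<leftarrow>vs. ennreal (exp (real (n + 2) * m * \<bar>X v x\<bar>)))" for vs
      proof (induction vs)
        case (Cons v vs)
        have "0 \<le> (\<Sum>v\<leftarrow>vs. exp (real (n + 2) * m * \<bar>X v x\<bar>))" by (intro sum_list_nonneg) auto
        with Cons show ?case by (simp add: ennreal_plus del: of_nat_add)
      qed simp
      with prod[of x u] show "ennreal (exp (c * \<bar>X u0 x\<bar>) * (\<Prod>u\<leftarrow>us. exp (t * X u x)) * exp (real n * \<bar>t\<bar> * \<bar>X u x\<bar>))
         \<le> (\<Sum>v\<leftarrow>u0 # u # us. ennreal (exp (real (n + 2) * m * \<bar>X v x\<bar>)))" by (metis ennreal_leI)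
    qed
    finally show "ennreal (exp (c * \<bar>X u0 x\<bar>) * Y t us x) \<le> (\<integral>\<^sup>+u. (\<Sum>v\<leftarrow>u0 # u # us. ennreal (exp (real (n + 2) * m * \<bar>X v x\<bar>))) \<partial>D)" .
  qed
  also have "\<dots> = (\<integral>\<^sup>+u. (\<integral>\<^sup>+x. (\<Sum>v\<leftarrow>u0 # u # us. ennreal (exp (real (n + 2) * m * \<bar>X v x\<bar>))) \<partial>P) \<partial>D)"
  proof (rule DP.Fubini')
    define S where "S x = (\<Sum>v\<leftarrow>us. ennreal (exp (real (n + 2) * m * \<bar>X v x\<bar>)))" for x
    have [measurable]: "S \<in> borel_measurable P" unfolding S_def by (rule mS[OF us])
    show "(\<lambda>(u, x). \<Sum>v\<leftarrow>u0 # u # us. ennreal (exp (real (n + 2) * m * \<bar>X v x\<bar>))) \<in> borel_measurable (D \<Otimes>\<^sub>M P)"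
      by (simp only: list.map sum_list.Cons S_def[symmetric]) measurable
  qed
  also have "\<dots> \<le> (\<integral>\<^sup>+u. ennreal (Ybound t n c) \<partial>D)"
  proof (rule nn_integral_mono)
    fix u assume u: "u \<in> space D"
    have "(\<integral>\<^sup>+x. (\<Sum>v\<leftarrow>vs. ennreal (exp (real (n + 2) * m * \<bar>X v x\<bar>))) \<partial>P) \<le> of_nat (length vs) * ennreal (2 * exp ((real (n + 2) * m)\<^sup>2))"
      if "set vs \<subseteq> space D" for vs
      using that
    proof (induction vs)
      case (Cons v vs)
      have mv: "(\<lambda>x. \<Sum>v\<leftarrow>vs. ennreal (exp (real (n + 2) * m * \<bar>X v x\<bar>))) \<in> borel_measurable P"
        using Cons.prems by (intro mS) auto
      have [measurable]: "X v \<in> borel_measurable P" using Cons by (auto intro: meas_X1)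
      have "(\<integral>\<^sup>+x. (\<Sum>v\<leftarrow>v # vs. ennreal (exp (real (n + 2) * m * \<bar>X v x\<bar>))) \<partial>P)
        = (\<integral>\<^sup>+x. ennreal (exp (real (n + 2) * m * \<bar>X v x\<bar>)) \<partial>P) + (\<integral>\<^sup>+x. (\<Sum>v\<leftarrow>vs. ennreal (exp (real (n + 2) * m * \<bar>X v x\<bar>))) \<partial>P)"
        using mv by (simp add: nn_integral_add)
      also have "\<dots> \<le> ennreal (2 * exp ((real (n + 2) * m)\<^sup>2)) + of_nat (length vs) * ennreal (2 * exp ((real (n + 2) * m)\<^sup>2))"
        using Cons by (intro add_mono nn_exp_abs) auto
      finally show ?case by (simp add: distrib_right)
    qed simp
    from this[of "u0 # u # us"] show "(\<integral>\<^sup>+x. (\<Sum>v\<leftarrow>u0 # u # us. ennreal (exp (real (n + 2) * m * \<bar>X v x\<bar>))) \<partial>P) \<le> ennreal (Ybound t n c)"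
      using us u0 u by (simp add: Ybound_def n_def m_def ennreal_mult ennreal_of_nat_eq_real_of_nat del: of_nat_Suc of_nat_add)
  qed
  also have "\<dots> = ennreal (Ybound t (length us) c)" by (simp add: D.emeasure_space_1 n_def)
  finally show ?thesis .
qed

end

text \<open>\<open>slope f l\<close>: the sequence \<open>f j\<close> behaves like \<open>1 + l / (j + 1)\<close>, i.e. \<open>l\<close> is the
  derivative at 0 along the steps \<open>1 / (j + 1)\<close>.\<close>

definition slope :: "(nat \<Rightarrow> real) \<Rightarrow> real \<Rightarrow> bool" where
  "slope f l \<longleftrightarrow> (\<lambda>j. (f j - 1) * real (Suc j)) \<longlonglongrightarrow> l"

lemma slope_lim: assumes "slope f l" shows "f \<longlonglongrightarrow> 1"
proof -
  have "(\<lambda>j. 1 + (f j - 1) * real (Suc j) * (1 / real (Suc j))) \<longlonglongrightarrow> 1 + l * 0"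
    using assms LIMSEQ_inverse_real_of_nat unfolding slope_def
    by (intro tendsto_intros) (simp_all add: inverse_eq_divide)
  then show ?thesis by (simp del: of_nat_Suc)
qed

lemma slope_mult: assumes "slope f l" "slope g k" shows "slope (\<lambda>j. f j * g j) (l + k)"
proof -
  have "(\<lambda>j. ((f j - 1) * real (Suc j)) * g j + (g j - 1) * real (Suc j)) \<longlonglongrightarrow> l * 1 + k"
    using assms slope_lim[OF assms(2)] unfolding slope_def by (intro tendsto_intros)
  also have "(\<lambda>j. ((f j - 1) * real (Suc j)) * g j + (g j - 1) * real (Suc j)) = (\<lambda>j. (f j * g j - 1) * real (Suc j))"
    by (auto simp: fun_eq_iff algebra_simps)
  finally show ?thesis by (simp add: slope_def)
qed

lemma slope_inverse: assumes "slope f l" "\<And>j. 0 < f j" shows "slope (\<lambda>j. 1 / f j) (- l)"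
proof -
  have "(\<lambda>j. - ((f j - 1) * real (Suc j)) / f j) \<longlonglongrightarrow> - l / 1"
    using assms slope_lim[OF assms(1)] unfolding slope_def by (intro tendsto_intros) auto
  also have "(\<lambda>j. - ((f j - 1) * real (Suc j)) / f j) = (\<lambda>j. (1 / f j - 1) * real (Suc j))"
    using assms(2) by (auto simp: fun_eq_iff field_simps less_imp_neq[THEN not_sym])
  finally show ?thesis by (simp add: slope_def)
qed

lemma slope_1: "slope (\<lambda>_. 1) 0" by (simp add: slope_def)

lemma slope_power: "slope f l \<Longrightarrow> slope (\<lambda>j. f j ^ n) (real n * l)"
proof (induction n)
  case (Suc n) then show ?case using slope_mult[of f l "\<lambda>j. f j ^ n" "real n * l"] by (simp add: algebra_simps)
qed (simp add: slope_1)

lemma slope_prod_list: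
  "(\<And>u. u \<in> set us \<Longrightarrow> slope (\<lambda>j. f u j) (l u)) \<Longrightarrow> slope (\<lambda>j. \<Prod>u\<leftarrow>us. f u j) (\<Sum>u\<leftarrow>us. l u)"
  by (induction us) (auto simp: slope_1 intro!: slope_mult)

lemma slope_deriv:
  assumes "(f has_real_derivative l) (at 0)" "f 0 = 1" shows "slope (\<lambda>j. f (1 / real (Suc j))) l"
proof -
  have "(\<lambda>h. (f h - 1) / h) \<midarrow>0\<rightarrow> l" using assms by (simp add: DERIV_def)
  moreover have "filterlim (\<lambda>j. 1 / real (Suc j)) (at 0) sequentially"
    using LIMSEQ_inverse_real_of_nat by (auto simp: filterlim_at inverse_eq_divide)
  ultimately have "(\<lambda>j. (f (1 / real (Suc j)) - 1) / (1 / real (Suc j))) \<longlonglongrightarrow> l" by (rule filterlim_compose)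
  then show ?thesis by (simp add: slope_def)
qed

lemma slope_exp: "slope (\<lambda>j. exp (b * (1 / real (Suc j)) - c * (1 / real (Suc j))\<^sup>2)) b"
  by (rule slope_deriv[where f="\<lambda>s. exp (b * s - c * s\<^sup>2)"]) (auto intro!: derivative_eq_intros)

lemma abs_exp_minus_1_le: "\<bar>exp y - 1\<bar> \<le> \<bar>y\<bar> * exp \<bar>y\<bar>" for y :: real
proof (cases "0 \<le> y")
  case True
  have "1 - y \<le> exp (- y)" using exp_ge_add_one_self[of "- y"] by simp
  then have "exp y * (1 - y) \<le> exp y * exp (- y)" by (intro mult_left_mono) auto
  then show ?thesis using True by (simp add: exp_minus algebra_simps)
next
  case False
  then have "1 + y \<le> exp y" "exp y \<le> 1" "y \<le> 0" by auto
  then have "\<bar>exp y - 1\<bar> \<le> \<bar>y\<bar> * 1" by linarith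
  also have "\<dots> \<le> \<bar>y\<bar> * exp \<bar>y\<bar>" by (intro mult_left_mono) auto
  finally show ?thesis .
qed

section \<open>The Cameron--Martin shift and its derivative\<close>

context gauss_field begin

abbreviation "step j \<equiv> 1 / real (Suc j)"

definition kbar :: "real \<Rightarrow> 'i \<Rightarrow> 'a \<Rightarrow> real" where
  "kbar t u0 x = (\<integral>u. a u * exp (t * X u x) * K u u0 \<partial>D) / Z t x"

text \<open>The factor by which the partition function changes when every \<open>X u\<close> is
  shifted by \<open>s * K u u0\<close>; \<open>q\<close> is the corresponding factor for the density
  \<open>Y\<close>.\<close>

definition r :: "real \<Rightarrow> 'i \<Rightarrow> real \<Rightarrow> 'a \<Rightarrow> real" where
  "r t u0 s x = (\<integral>u. a u * exp (t * (X u x + s * K u u0)) \<partial>D) / Z t x"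

definition q :: "real \<Rightarrow> 'i \<Rightarrow> 'i list \<Rightarrow> real \<Rightarrow> 'a \<Rightarrow> real" where
  "q t u0 us s x = (\<Prod>u\<leftarrow>us. exp (t * s * K u u0)) / r t u0 s x ^ length us"

lemma r_bounds:
  assumes g: "good x" and u0: "u0 \<in> space D" and s: "0 \<le> s"
  shows "exp (- (\<bar>t\<bar> * s)) \<le> r t u0 s x" "r t u0 s x \<le> exp (\<bar>t\<bar> * s)" "0 < r t u0 s x"
    and "integrable D (\<lambda>u. a u * exp (t * (X u x + s * K u u0)))"
proof -
  have x [measurable]: "x \<in> space P" using g by (simp add: good_def)
  note [measurable] = u0
  have kb: "\<bar>t * (s * K u u0)\<bar> \<le> \<bar>t\<bar> * s" if "u \<in> space D" for u
    using abs_mult_le_real[OF order_refl[of "\<bar>t\<bar>"] abs_mult_le_real[OF _ K_bound[OF that u0], of s s]] s by simp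
  have e: "a u * exp (t * (X u x + s * K u u0)) = a u * exp (t * X u x) * exp (t * (s * K u u0))" for u
    by (simp add: distrib_left exp_add)
  have ap: "0 \<le> a u" if "u \<in> space D" for u using a_bounds[OF that] by simp
  have up: "a u * exp (t * (X u x + s * K u u0)) \<le> a u * exp (t * X u x) * exp (\<bar>t\<bar> * s)" if "u \<in> space D" for u
    unfolding e using kb[OF that] ap[OF that] by (intro mult_left_mono) auto
  have lo: "a u * exp (t * X u x) * exp (- (\<bar>t\<bar> * s)) \<le> a u * exp (t * (X u x + s * K u u0))" if "u \<in> space D" for u
    unfolding e using kb[OF that] ap[OF that] by (intro mult_left_mono) auto
  have i: "integrable D (\<lambda>u. a u * exp (t * X u x))" by (rule good_exp[OF g])
  show i': "integrable D (\<lambda>u. a u * exp (t * (X u x + s * K u u0)))"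
  proof (rule Bochner_Integration.integrable_bound)
    show "integrable D (\<lambda>u. a u * exp (t * X u x) * exp (\<bar>t\<bar> * s))" using i by simp
    show "AE u in D. norm (a u * exp (t * (X u x + s * K u u0))) \<le> norm (a u * exp (t * X u x) * exp (\<bar>t\<bar> * s))"
      using up ap by (intro AE_I2) (auto simp: abs_mult)
  qed measurable
  have z: "0 < Z t x" by (rule Z_pos[OF g])
  have "Z t x * exp (- (\<bar>t\<bar> * s)) = (\<integral>u. a u * exp (t * X u x) * exp (- (\<bar>t\<bar> * s)) \<partial>D)" by (simp add: Z_def)
  also have "\<dots> \<le> (\<integral>u. a u * exp (t * (X u x + s * K u u0)) \<partial>D)"
    using i i' lo by (intro integral_mono) auto
  finally show 1: "exp (- (\<bar>t\<bar> * s)) \<le> r t u0 s x" using z by (simp add: r_def le_divide_eq mult.commute)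
  have "(\<integral>u. a u * exp (t * (X u x + s * K u u0)) \<partial>D) \<le> (\<integral>u. a u * exp (t * X u x) * exp (\<bar>t\<bar> * s) \<partial>D)"
    using i i' up by (intro integral_mono) auto
  also have "\<dots> = Z t x * exp (\<bar>t\<bar> * s)" by (simp add: Z_def)
  finally show "r t u0 s x \<le> exp (\<bar>t\<bar> * s)" using z by (simp add: r_def divide_le_eq mult.commute)
  show "0 < r t u0 s x" using 1 exp_gt_zero less_le_trans by blast
qed

text \<open>Each of the exponentials in the numerator and each factor \<open>r\<close> in the
  denominator lies between \<open>exp (- |t| s)\<close> and \<open>exp (|t| s)\<close>; there are
  \<open>length us\<close> of either kind, whence the 2 in \<open>b\<close>.\<close>

lemma q_bounds:
  fixes t :: real
  assumes g: "good x" and u0: "u0 \<in> space D" and us: "set us \<subseteq> space D" and s: "0 \<le> s"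
  defines "b \<equiv> 2 * real (length us) * \<bar>t\<bar>"
  shows "exp (- (b * s)) \<le> q t u0 us s x" "q t u0 us s x \<le> exp (b * s)"
proof -
  have p: "exp (- (real (length us) * \<bar>t\<bar> * s)) \<le> (\<Prod>u\<leftarrow>us. exp (t * s * K u u0)) \<and>
     (\<Prod>u\<leftarrow>us. exp (t * s * K u u0)) \<le> exp (real (length us) * \<bar>t\<bar> * s)"
    using us
  proof (induction us)
    case (Cons u us)
    have k: "\<bar>t * s * K u u0\<bar> \<le> \<bar>t\<bar> * s"
      using abs_mult_le_real[OF _ K_bound[OF _ u0], of "t * s" "\<bar>t\<bar> * s" u] Cons.prems s by (simp add: abs_mult)
    have e: "real (length (u # us)) * \<bar>t\<bar> * s = \<bar>t\<bar> * s + real (length us) * \<bar>t\<bar> * s" by (simp add: algebra_simps)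
    have "exp (- (\<bar>t\<bar> * s)) * exp (- (real (length us) * \<bar>t\<bar> * s)) \<le> exp (t * s * K u u0) * (\<Prod>u\<leftarrow>us. exp (t * s * K u u0))"
      using k Cons by (intro mult_mono) auto
    moreover have "exp (t * s * K u u0) * (\<Prod>u\<leftarrow>us. exp (t * s * K u u0)) \<le> exp (\<bar>t\<bar> * s) * exp (real (length us) * \<bar>t\<bar> * s)"
      using k Cons by (intro mult_mono) (auto intro!: prod_list_nonneg)
    ultimately show ?case unfolding e by (simp add: exp_add[symmetric])
  qed simp
  note rb = r_bounds[OF g u0 s, of t]
  have rl: "exp (- (real (length us) * \<bar>t\<bar> * s)) \<le> r t u0 s x ^ length us"
    using power_mono[OF rb(1), of "length us"] by (simp add: exp_of_nat_mult[symmetric] mult.assoc)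
  have ru: "r t u0 s x ^ length us \<le> exp (real (length us) * \<bar>t\<bar> * s)"
    using power_mono[OF rb(2), of "length us"] rb(3) by (simp add: exp_of_nat_mult[symmetric] mult.assoc)
  have rp: "0 < r t u0 s x ^ length us" using rb(3) by simp
  have "exp (- (real (length us) * \<bar>t\<bar> * s)) / exp (real (length us) * \<bar>t\<bar> * s) \<le> q t u0 us s x"
    unfolding q_def using p ru rp by (intro frac_le) (auto intro!: prod_list_nonneg)
  then show "exp (- (b * s)) \<le> q t u0 us s x" by (simp add: b_def exp_diff[symmetric] algebra_simps)
  have "q t u0 us s x \<le> exp (real (length us) * \<bar>t\<bar> * s) / exp (- (real (length us) * \<bar>t\<bar> * s))"
    unfolding q_def using p rl rp by (intro frac_le) (auto intro!: prod_list_nonneg)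
  then show "q t u0 us s x \<le> exp (b * s)" by (simp add: b_def exp_diff[symmetric] algebra_simps)
qed

lemma q_minus_1:
  fixes t :: real
  assumes "good x" "u0 \<in> space D" "set us \<subseteq> space D" "0 \<le> s"
  defines "b \<equiv> 2 * real (length us) * \<bar>t\<bar>"
  shows "\<bar>q t u0 us s x - 1\<bar> \<le> b * s * exp (b * s)"
proof -
  have bs: "0 \<le> b * s" using assms by simp
  have "\<bar>exp (b * s) - 1\<bar> \<le> b * s * exp (b * s)" using abs_exp_minus_1_le[of "b * s"] bs by simp
  moreover have "1 - exp (- (b * s)) \<le> b * s * exp (b * s)"
    using abs_exp_minus_1_le[of "- (b * s)"] bs by simp
  ultimately show ?thesis using q_bounds[OF assms(1-4), of t] unfolding b_def by linarith
qed

lemma r_slope: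
  assumes g: "good x" and u0: "u0 \<in> space D"
  shows "slope (\<lambda>j. r t u0 (step j) x) (t * kbar t u0 x)"
proof -
  have x [measurable]: "x \<in> space P" using g by (simp add: good_def)
  note [measurable] = u0
  have z: "0 < Z t x" by (rule Z_pos[OF g])
  have i: "integrable D (\<lambda>u. a u * exp (t * X u x))" by (rule good_exp[OF g])
  let ?f = "\<lambda>j u. a u * exp (t * X u x) * ((exp (t * K u u0 * step j) - 1) * real (Suc j))"
  have lim: "(\<lambda>j. \<integral>u. ?f j u \<partial>D) \<longlonglongrightarrow> (\<integral>u. a u * exp (t * X u x) * (t * K u u0) \<partial>D)"
  proof (rule integral_dominated_convergence[where w="\<lambda>u. a u * exp (t * X u x) * (\<bar>t\<bar> * exp \<bar>t\<bar>)"])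
    show "integrable D (\<lambda>u. a u * exp (t * X u x) * (\<bar>t\<bar> * exp \<bar>t\<bar>))" using i by simp
    show "AE u in D. (\<lambda>j. ?f j u) \<longlonglongrightarrow> a u * exp (t * X u x) * (t * K u u0)"
      using slope_exp[of "t * K _ u0" 0] unfolding slope_def by (intro AE_I2 tendsto_mult_left) simp
    show "AE u in D. norm (?f j u) \<le> a u * exp (t * X u x) * (\<bar>t\<bar> * exp \<bar>t\<bar>)" for j
    proof (rule AE_I2)
      fix u assume u: "u \<in> space D"
      have k: "\<bar>t * K u u0\<bar> \<le> \<bar>t\<bar>" using abs_mult_le_real[OF order_refl[of "\<bar>t\<bar>"] K_bound[OF u u0]] by simp
      have st: "0 < step j" "step j \<le> 1" by auto
      have y: "\<bar>t * K u u0 * step j\<bar> \<le> \<bar>t\<bar> * step j" using k st by (simp add: abs_mult mult_right_mono divide_right_mono)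
      also have "\<dots> \<le> \<bar>t\<bar>" using st by (intro mult_left_le) auto
      finally have y': "\<bar>t * K u u0 * step j\<bar> \<le> \<bar>t\<bar>" .
      have "\<bar>exp (t * K u u0 * step j) - 1\<bar> \<le> (\<bar>t\<bar> * step j) * exp \<bar>t\<bar>"
        using y y' by (intro order_trans[OF abs_exp_minus_1_le] mult_mono) auto
      then have "\<bar>exp (t * K u u0 * step j) - 1\<bar> * real (Suc j) \<le> (\<bar>t\<bar> * step j) * exp \<bar>t\<bar> * real (Suc j)"
        by (intro mult_right_mono) auto
      then have "\<bar>(exp (t * K u u0 * step j) - 1) * real (Suc j)\<bar> \<le> \<bar>t\<bar> * exp \<bar>t\<bar>" by (simp add: abs_mult)
      then show "norm (?f j u) \<le> a u * exp (t * X u x) * (\<bar>t\<bar> * exp \<bar>t\<bar>)"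
        using a_bounds[OF u] unfolding real_norm_def abs_mult[of "a u * exp (t * X u x)"]
        by (intro mult_mono) auto
    qed
  qed measurable
  have "(r t u0 (step j) x - 1) * real (Suc j) = (\<integral>u. ?f j u \<partial>D) / Z t x" for j
  proof -
    have i': "integrable D (\<lambda>u. a u * exp (t * (X u x + step j * K u u0)))" by (rule r_bounds(4)[OF g u0]) simp
    have "(\<integral>u. ?f j u \<partial>D) = (\<integral>u. (a u * exp (t * (X u x + step j * K u u0)) - a u * exp (t * X u x)) * real (Suc j) \<partial>D)"
      by (intro Bochner_Integration.integral_cong refl) (simp add: algebra_simps exp_add[symmetric])
    also have "\<dots> = ((\<integral>u. a u * exp (t * (X u x + step j * K u u0)) \<partial>D) - Z t x) * real (Suc j)"
      using i i' by (simp add: Z_def del: of_nat_Suc)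
    finally show ?thesis using z by (simp add: r_def field_simps)
  qed
  moreover have "(\<lambda>j. (\<integral>u. ?f j u \<partial>D) / Z t x) \<longlonglongrightarrow> (\<integral>u. a u * exp (t * X u x) * (t * K u u0) \<partial>D) / Z t x"
    using z lim by (intro tendsto_divide tendsto_const) auto
  moreover have "(\<integral>u. a u * exp (t * X u x) * (t * K u u0) \<partial>D) / Z t x = t * kbar t u0 x"
  proof -
    have "(\<integral>u. a u * exp (t * X u x) * (t * K u u0) \<partial>D) = (\<integral>u. t * (a u * exp (t * X u x) * K u u0) \<partial>D)" by (simp add: ac_simps)
    then show ?thesis by (simp add: kbar_def)
  qed
  ultimately show ?thesis unfolding slope_def by simp
qed

text \<open>The logarithmic derivative of \<open>Y\<close> in the direction \<open>K u u0\<close>: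
  the numerators contribute the covariances with the replicas, and each partition function subtracts
  one Gibbs average.\<close>

lemma q_slope:
  assumes g: "good x" and u0: "u0 \<in> space D"
  shows "slope (\<lambda>j. q t u0 us (step j) x) (t * ((\<Sum>u\<leftarrow>us. K u u0) - real (length us) * kbar t u0 x))"
proof -
  have "slope (\<lambda>j. (\<Prod>u\<leftarrow>us. exp (t * step j * K u u0)) * (1 / r t u0 (step j) x) ^ length us)
     ((\<Sum>u\<leftarrow>us. t * K u u0) + real (length us) * (- (t * kbar t u0 x)))"
  proof (intro slope_mult slope_prod_list slope_power slope_inverse r_slope g u0)
    fix u show "slope (\<lambda>j. exp (t * step j * K u u0)) (t * K u u0)" using slope_exp[of "t * K u u0" 0] by (simp add: ac_simps)
    show "0 < r t u0 (step j) x" for j by (rule r_bounds(3)[OF g u0]) simp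
  qed
  then show ?thesis by (simp add: q_def power_divide sum_list_const_mult algebra_simps)
qed

text \<open>Cameron--Martin in the direction \<open>K u u0\<close>: the density
  \<open>exp (s X u0 - s^2 K u0 u0 / 2)\<close> shifts every \<open>X u\<close> by
  \<open>s K u u0\<close>. \<open>cos_exp_shift\<close> proves this for finite linear combinations,
  and \<open>same_law\<close> carries it to the ratio that contains the partition function.\<close>

lemma shift:
  assumes u0: "u0 \<in> space D" and us: "set us \<subseteq> space D" and [measurable]: "F \<in> borel_measurable borel" and s: "0 \<le> s"
  shows "(\<integral>x. F (X u0 x) * Y t us x * exp (s * X u0 x - s\<^sup>2 * K u0 u0 / 2) \<partial>P)
       = (\<integral>x. F (X u0 x + s * K u0 u0) * (Y t us x * q t u0 us s x) \<partial>P)"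
proof -
  note [measurable] = meas_X1[OF u0] meas_Y[OF us] u0
  let ?w = "\<lambda>x. exp (s * X u0 x - s\<^sup>2 * K u0 u0 / 2)"
  define M where "M = density P (\<lambda>x. ennreal (?w x))"
  define B where "B u x = X u x + s * K u u0" for u x
  have l: "lin (X u0)" using u0 by (rule lin_X)
  have V: "cov (X u0) (X u0) = K u0 u0" by (rule cov_X[OF u0 u0])
  have wi: "integrable P ?w" and w1: "(\<integral>x. ?w x \<partial>P) = 1"
    using lin_exp[OF l, of s] by (simp_all add: exp_diff V)
  have "emeasure M (space M) = ennreal (\<integral>x. ?w x \<partial>P)"
    unfolding M_def using wi by (simp add: emeasure_density nn_integral_eq_integral cong: nn_integral_cong)
  then have pM: "prob_space M" using w1 by (intro prob_spaceI) simp
  have [measurable_cong]: "sets M = sets P" by (simp add: M_def)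
  have iM: "(\<integral>x. f x \<partial>M) = (\<integral>x. f x * ?w x \<partial>P)" if [measurable]: "f \<in> borel_measurable P" for f :: "'a \<Rightarrow> real"
    unfolding M_def by (subst integral_density) (auto simp: mult.commute)
  have aeM: "(AE x in M. Q x) \<longleftrightarrow> (AE x in P. Q x)" for Q unfolding M_def by (subst AE_density) auto
  have mX: "(\<lambda>(u, x). X u x) \<in> borel_measurable (D \<Otimes>\<^sub>M M)" by measurable
  have mB: "(\<lambda>(u, x). B u x) \<in> borel_measurable (D \<Otimes>\<^sub>M P)" unfolding B_def by measurable
  interpret SL: same_law M P D X B
  proof (intro same_law.intro same_law_axioms.intro pM P.prob_space_axioms D.prob_space_axioms mX mB)
    fix cs :: "('i \<times> real) list" and b :: real assume cs: "fst ` set cs \<subseteq> space D"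
    then have cs': "u \<in> space D" if "(u, c) \<in> set cs" for u c using that by force
    let ?L = "\<lambda>x. \<Sum>(u, c)\<leftarrow>cs. c * X u x"
    have lL: "lin ?L" by (rule lin_sum_list) (rule cs')
    have [measurable]: "?L \<in> borel_measurable P" by (rule meas_lin[OF lL])
    have "(\<integral>x. cos (?L x + b) \<partial>M) = (\<integral>x. cos (?L x + b) * ?w x \<partial>P)" by (rule iM) measurable
    also have "\<dots> = (\<integral>x. cos (?L x + (s * cov ?L (X u0) + b)) \<partial>P)"
      using cos_exp_shift[OF lL l, of b s] by (simp only: V)
    also have "cov ?L (X u0) = (\<Sum>(u, c)\<leftarrow>cs. c * K u u0)" by (rule cov_sum_list[OF cs' u0])
    also have "(\<lambda>x. ?L x + (s * (\<Sum>(u, c)\<leftarrow>cs. c * K u u0) + b)) = (\<lambda>x. (\<Sum>(u, c)\<leftarrow>cs. c * B u x) + b)"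
    proof
      fix x show "?L x + (s * (\<Sum>(u, c)\<leftarrow>cs. c * K u u0) + b) = (\<Sum>(u, c)\<leftarrow>cs. c * B u x) + b"
        by (induction cs) (auto simp: B_def algebra_simps)
    qed
    finally show "(\<integral>x. cos (?L x + b) \<partial>M) = (\<integral>x. cos ((\<Sum>(u, c)\<leftarrow>cs. c * B u x) + b) \<partial>P)" .
  qed
  have ZX: "SL.Zint a t X = Z t" by (simp add: SL.Zint_def[abs_def] Z_def[abs_def])
  have ZB: "SL.Zint a t B x = r t u0 s x * Z t x" if "good x" for x
    using Z_pos[OF that, of t] by (simp add: SL.Zint_def r_def B_def)
  have gX: "SL.gibbs a t (length us) us X = Y t us" by (simp add: SL.gibbs_def[abs_def] Y_def[abs_def] ZX)
  have gB: "SL.gibbs a t (length us) us B x = Y t us x * q t u0 us s x" if "good x" for x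
  proof -
    have "(\<Prod>u\<leftarrow>us. exp (t * B u x)) = (\<Prod>u\<leftarrow>us. exp (t * X u x)) * (\<Prod>u\<leftarrow>us. exp (t * s * K u u0))"
      by (induction us) (auto simp: B_def exp_add algebra_simps)
    then show ?thesis by (simp add: SL.gibbs_def ZB[OF that] Y_def q_def power_mult_distrib)
  qed
  have Yi: "integrable P (\<lambda>x. exp (c * \<bar>X u0 x\<bar>) * Y t us x)" for c
  proof (rule integrableI_nonneg)
    show "AE x in P. 0 \<le> exp (c * \<bar>X u0 x\<bar>) * Y t us x" using AE_good by eventually_elim (simp add: less_imp_le[OF Y_pos])
    show "(\<integral>\<^sup>+x. ennreal (exp (c * \<bar>X u0 x\<bar>) * Y t us x) \<partial>P) < \<infinity>"
      using Y_bound[OF us u0, of c t] by (simp add: le_less_trans)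
  qed measurable
  have "(\<integral>x. F (X u0 x) * SL.gibbs a t (length us) us X x \<partial>M) = (\<integral>x. F (B u0 x) * SL.gibbs a t (length us) us B x \<partial>P)"
  proof (rule SL.gibbs_eq[OF meas_a _ _ us u0])
    show "0 \<le> a u \<and> a u \<le> C" if "u \<in> space D" for u using a_bounds[OF that] by simp
    show "AE x in M. integrable D (\<lambda>u. exp (t * X u x))" unfolding aeM using AE_good by eventually_elim (rule good_exp)
    show "AE x in P. integrable D (\<lambda>u. exp (t * B u x))" using AE_good
    proof eventually_elim
      fix x assume g: "good x"
      then have x [measurable]: "x \<in> space P" by (simp add: good_def)
      show "integrable D (\<lambda>u. exp (t * B u x))"
      proof (rule Bochner_Integration.integrable_bound[OF r_bounds(4)[OF g u0 s, of t]])
        show "AE u in D. norm (exp (t * B u x)) \<le> norm (a u * exp (t * (X u x + s * K u u0)))"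
        proof (rule AE_I2)
          fix u assume "u \<in> space D"
          then have "1 \<le> \<bar>a u\<bar>" using a_bounds[of u] by linarith
          then show "norm (exp (t * B u x)) \<le> norm (a u * exp (t * (X u x + s * K u u0)))"
            by (simp add: B_def abs_mult)
        qed
        show "(\<lambda>u. exp (t * B u x)) \<in> borel_measurable D" using x mB by measurable
      qed
    qed
    show "AE x in M. 0 < SL.Zint a t X x" unfolding aeM ZX using AE_good by eventually_elim (rule Z_pos)
    show "AE x in P. 0 < SL.Zint a t B x" using AE_good
      by eventually_elim (simp add: ZB Z_pos r_bounds(3)[OF _ u0 s])
    show "integrable M (SL.gibbs a t (length us) us X)"
      unfolding gX M_def
    proof (subst integrable_density)
      show "integrable P (\<lambda>x. ?w x *\<^sub>R Y t us x)"
      proof (rule Bochner_Integration.integrable_bound)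
        show "integrable P (\<lambda>x. exp (s\<^sup>2) * (exp (s * \<bar>X u0 x\<bar>) * Y t us x))" using Yi[of s] by simp
        have "?w x \<le> exp (s\<^sup>2) * exp (s * \<bar>X u0 x\<bar>)" for x
        proof -
          have "s * X u0 x \<le> s * \<bar>X u0 x\<bar>" using s by (intro mult_left_mono) auto
          moreover have "- (s\<^sup>2 * K u0 u0 / 2) \<le> s\<^sup>2"
          proof -
            have "- K u0 u0 \<le> 1" using K_bound[OF u0 u0] by (simp add: abs_le_iff)
            from mult_left_mono[OF this zero_le_power2[of s]] have "- (s\<^sup>2 * K u0 u0) \<le> s\<^sup>2" by simp
            then show ?thesis using zero_le_power2[of s] by linarith
          qed
          ultimately show ?thesis unfolding exp_add[symmetric] by simp
        qed
        then have "?w x * \<bar>Y t us x\<bar> \<le> exp (s\<^sup>2) * exp (s * \<bar>X u0 x\<bar>) * \<bar>Y t us x\<bar>" for x by (intro mult_right_mono) auto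
        then show "AE x in P. norm (?w x *\<^sub>R Y t us x) \<le> norm (exp (s\<^sup>2) * (exp (s * \<bar>X u0 x\<bar>) * Y t us x))"
          by (intro AE_I2) (simp add: abs_mult mult.assoc)
      qed measurable
    qed auto
    have mg: "SL.gibbs a t (length us) us B \<in> borel_measurable P"
    proof -
      have "(\<lambda>x. \<Prod>u\<leftarrow>us. exp (t * B u x)) \<in> borel_measurable P"
        using us by (induction us) (auto intro!: borel_measurable_times borel_measurable_exp measurable_compose[OF SL.meas_B1] simp: borel_measurable_const)
      then show ?thesis using SL.meas_Zint(2)[OF meas_a, of t] unfolding SL.gibbs_def[abs_def] by measurable
    qed
    show "integrable P (SL.gibbs a t (length us) us B)"
    proof (rule Bochner_Integration.integrable_bound[OF _ mg])
      show "integrable P (\<lambda>x. exp (2 * real (length us) * \<bar>t\<bar> * s) * (exp (0 * \<bar>X u0 x\<bar>) * Y t us x))" using Yi[of 0] by simp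
      show "AE x in P. norm (SL.gibbs a t (length us) us B x) \<le> norm (exp (2 * real (length us) * \<bar>t\<bar> * s) * (exp (0 * \<bar>X u0 x\<bar>) * Y t us x))"
        using AE_good
      proof eventually_elim
        fix x assume g: "good x"
        have "0 \<le> q t u0 us s x" "q t u0 us s x \<le> exp (2 * real (length us) * \<bar>t\<bar> * s)"
          using q_bounds[OF g u0 us s, of t] exp_ge_zero order_trans by blast+
        then show "norm (SL.gibbs a t (length us) us B x) \<le> norm (exp (2 * real (length us) * \<bar>t\<bar> * s) * (exp (0 * \<bar>X u0 x\<bar>) * Y t us x))"
          unfolding gB[OF g] by (simp add: abs_mult mult.commute[of "\<bar>Y t us x\<bar>"] mult_right_mono)
      qed
    qed
  qed measurable
  also have "(\<integral>x. F (X u0 x) * SL.gibbs a t (length us) us X x \<partial>M) = (\<integral>x. F (X u0 x) * Y t us x * ?w x \<partial>P)"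
    unfolding gX by (rule iM) measurable
  also have "(\<integral>x. F (B u0 x) * SL.gibbs a t (length us) us B x \<partial>P) = (\<integral>x. F (X u0 x + s * K u0 u0) * (Y t us x * q t u0 us s x) \<partial>P)"
  proof (rule integral_cong_AE)
    show "AE x in P. F (B u0 x) * SL.gibbs a t (length us) us B x = F (X u0 x + s * K u0 u0) * (Y t us x * q t u0 us s x)"
      using AE_good by eventually_elim (simp add: gB B_def)
    have [measurable]: "(\<lambda>x. \<Prod>u\<leftarrow>us. exp (t * B u x)) \<in> borel_measurable P"
      using us by (induction us) (auto intro!: borel_measurable_times borel_measurable_exp measurable_compose[OF SL.meas_B1] simp: borel_measurable_const)
    note [measurable] = SL.meas_Zint(2)[OF meas_a, of t] SL.meas_B1[OF u0]
    show "(\<lambda>x. F (B u0 x) * SL.gibbs a t (length us) us B x) \<in> borel_measurable P" unfolding SL.gibbs_def by measurable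
    show "(\<lambda>x. F (X u0 x + s * K u0 u0) * (Y t us x * q t u0 us s x)) \<in> borel_measurable P" unfolding q_def r_def by measurable
  qed
  finally show ?thesis .
qed

lemma Y_integrable:
  assumes u0: "u0 \<in> space D" and us: "set us \<subseteq> space D"
  shows "integrable P (\<lambda>x. exp (c * \<bar>X u0 x\<bar>) * Y t us x)"
    and "(\<integral>x. exp (c * \<bar>X u0 x\<bar>) * Y t us x \<partial>P) \<le> Ybound t (length us) c"
proof -
  note [measurable] = meas_X1[OF u0] meas_Y[OF us]
  have nn: "AE x in P. 0 \<le> exp (c * \<bar>X u0 x\<bar>) * Y t us x"
    using AE_good by eventually_elim (simp add: less_imp_le[OF Y_pos])
  show i: "integrable P (\<lambda>x. exp (c * \<bar>X u0 x\<bar>) * Y t us x)"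
    using nn Y_bound[OF us u0, of c t] by (intro integrableI_nonneg) (auto simp: le_less_trans)
  have "ennreal (\<integral>x. exp (c * \<bar>X u0 x\<bar>) * Y t us x \<partial>P) \<le> ennreal (Ybound t (length us) c)"
    using Y_bound[OF us u0, of c t] nn i by (subst nn_integral_eq_integral[symmetric]) auto
  moreover have "0 \<le> Ybound t (length us) c" by (simp add: Ybound_def)
  ultimately show "(\<integral>x. exp (c * \<bar>X u0 x\<bar>) * Y t us x \<partial>P) \<le> Ybound t (length us) c" by simp
qed

lemma meas_kbar: "u0 \<in> space D \<Longrightarrow> kbar t u0 \<in> borel_measurable P"
proof -
  assume [measurable]: "u0 \<in> space D"
  show ?thesis unfolding kbar_def by measurable
qed

text \<open>The derivative of \<open>shift\<close> at \<open>s = 0\<close>.\<close>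

lemma integration_by_parts:
  assumes u0: "u0 \<in> space D" and us: "set us \<subseteq> space D"
  shows "(\<integral>x. (\<alpha> + \<beta> * X u0 x) * X u0 x * Y t us x \<partial>P)
    = (\<integral>x. (\<beta> * K u0 u0 + (\<alpha> + \<beta> * X u0 x) * (t * ((\<Sum>u\<leftarrow>us. K u u0) - real (length us) * kbar t u0 x))) * Y t us x \<partial>P)"
proof -
  note [measurable] = meas_X1[OF u0] meas_Y[OF us] u0 meas_kbar[OF u0]
  define F where "F y = \<alpha> + \<beta> * y" for y :: real
  have [measurable]: "F \<in> borel_measurable borel" unfolding F_def by measurable
  define V where "V = K u0 u0"
  have V: "\<bar>V\<bar> \<le> 1" using K_bound[OF u0 u0] by (simp add: V_def)
  define b where "b = 2 * real (length us) * \<bar>t\<bar>"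
  have b0: "0 \<le> b" by (simp add: b_def)
  let ?w = "\<lambda>s x. exp (s * X u0 x - s\<^sup>2 * V / 2)"
  have [measurable]: "q t u0 us s \<in> borel_measurable P" for s unfolding q_def r_def by measurable
  have exp_ge: "\<bar>y\<bar> \<le> exp \<bar>y\<bar>" "1 \<le> exp \<bar>y\<bar>" "\<bar>y\<bar> + 1 \<le> exp \<bar>y\<bar>" for y :: real
    using exp_ge_add_one_self[of "\<bar>y\<bar>"] by linarith+
  have Fb: "\<bar>F y\<bar> \<le> (\<bar>\<alpha>\<bar> + \<bar>\<beta>\<bar>) * exp \<bar>y\<bar>" for y
  proof -
    have "\<bar>F y\<bar> \<le> \<bar>\<alpha>\<bar> * 1 + \<bar>\<beta>\<bar> * \<bar>y\<bar>" unfolding F_def by (metis abs_mult abs_triangle_ineq mult.right_neutral)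
    also have "\<dots> \<le> \<bar>\<alpha>\<bar> * exp \<bar>y\<bar> + \<bar>\<beta>\<bar> * exp \<bar>y\<bar>" using exp_ge by (intro add_mono mult_left_mono) auto
    finally show ?thesis by (simp add: distrib_right)
  qed
  have st: "0 \<le> step j" "step j \<le> 1" "0 < step j" "step j * real (Suc j) = 1" for j by (auto simp del: of_nat_Suc)
  have YP: "AE x in P. good x \<and> 0 < Y t us x" using AE_good by eventually_elim (simp add: Y_pos)
  have i3: "integrable P (\<lambda>x. c * (exp (3 * \<bar>X u0 x\<bar>) * Y t us x))" for c using Y_integrable(1)[OF u0 us, of 3 t] by simp
  \<comment> \<open>Up to three exponentials are collected into one dominating function. For
    \<open>L\<close> they come from the affine \<open>F\<close>, from the factor
    \<open>|y| + 1\<close> and from the exponential in \<open>abs_exp_minus_1_le\<close>.\<close>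
  have e3: "exp \<bar>y\<bar> \<le> exp (3 * \<bar>y\<bar>)" "exp \<bar>y\<bar> * exp \<bar>y\<bar> \<le> exp (3 * \<bar>y\<bar>)" "exp \<bar>y\<bar> * exp \<bar>y\<bar> * exp \<bar>y\<bar> \<le> exp (3 * \<bar>y\<bar>)" "1 \<le> exp (3 * \<bar>y\<bar>)" for y :: real
    unfolding exp_add[symmetric] by auto
  \<comment> \<open>Once the common value at \<open>s = 0\<close> is subtracted, \<open>L\<close>
    and \<open>Rr\<close> are the difference quotients of the two integrands in \<open>shift\<close>
    at \<open>s = step j\<close>. \<open>Rr\<close> separates the change of \<open>q\<close> from
    the change \<open>\<beta> s V\<close> of the affine function.\<close>
  define L where "L j x = F (X u0 x) * ((?w (step j) x - 1) * real (Suc j)) * Y t us x" for j x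
  define Rr where "Rr j x = (F (X u0 x) * ((q t u0 us (step j) x - 1) * real (Suc j)) + \<beta> * V * q t u0 us (step j) x) * Y t us x" for j x
  define cL where "cL = (\<bar>\<alpha>\<bar> + \<bar>\<beta>\<bar>) * exp 1"
  define cR where "cR = (\<bar>\<alpha>\<bar> + \<bar>\<beta>\<bar>) * (b * exp b) + \<bar>\<beta>\<bar> * exp b"
  have Lb: "\<bar>L j x\<bar> \<le> cL * (exp (3 * \<bar>X u0 x\<bar>) * Y t us x)" if "0 < Y t us x" for j x
  proof -
    let ?y = "step j * X u0 x - (step j)\<^sup>2 * V / 2"
    have "\<bar>(step j)\<^sup>2 * V / 2\<bar> \<le> step j * 1"
    proof -
      have "\<bar>(step j)\<^sup>2 * V / 2\<bar> = step j * (step j * (\<bar>V\<bar> / 2))" by (simp add: abs_mult power2_eq_square)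
      also have "\<dots> \<le> step j * 1" using st(1,2)[of j] V by (intro mult_left_mono mult_le_one) auto
      finally show ?thesis .
    qed
    moreover have "\<bar>step j * X u0 x\<bar> = step j * \<bar>X u0 x\<bar>" using st(1)[of j] by (simp add: abs_mult)
    ultimately have y: "\<bar>?y\<bar> \<le> step j * (\<bar>X u0 x\<bar> + 1)" unfolding distrib_left by linarith
    also have "\<dots> \<le> 1 * (\<bar>X u0 x\<bar> + 1)" using st(2)[of j] by (intro mult_right_mono) auto
    finally have y': "\<bar>?y\<bar> \<le> \<bar>X u0 x\<bar> + 1" by simp
    have "\<bar>exp ?y - 1\<bar> * real (Suc j) \<le> (step j * (\<bar>X u0 x\<bar> + 1)) * exp (\<bar>X u0 x\<bar> + 1) * real (Suc j)"
      using y y' st(1)[of j] by (intro mult_right_mono order_trans[OF abs_exp_minus_1_le] mult_mono) auto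
    also have "\<dots> = (step j * real (Suc j)) * ((\<bar>X u0 x\<bar> + 1) * exp (\<bar>X u0 x\<bar> + 1))" by (simp only: ac_simps)
    also have "\<dots> \<le> 1 * (exp \<bar>X u0 x\<bar> * (exp \<bar>X u0 x\<bar> * exp 1))"
      unfolding st(4) exp_add using exp_ge(3) by (intro mult_left_mono mult_right_mono) auto
    finally have "\<bar>(?w (step j) x - 1) * real (Suc j)\<bar> \<le> exp \<bar>X u0 x\<bar> * (exp \<bar>X u0 x\<bar> * exp 1)" by (simp add: abs_mult)
    from abs_mult_le_real[OF Fb[of "X u0 x"] this]
    have "\<bar>F (X u0 x) * ((?w (step j) x - 1) * real (Suc j))\<bar> \<le> cL * (exp \<bar>X u0 x\<bar> * exp \<bar>X u0 x\<bar> * exp \<bar>X u0 x\<bar>)"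
      unfolding cL_def by (simp only: ac_simps)
    also have "\<dots> \<le> cL * exp (3 * \<bar>X u0 x\<bar>)" using e3 by (intro mult_left_mono) (auto simp: cL_def)
    finally have "\<bar>F (X u0 x) * ((?w (step j) x - 1) * real (Suc j))\<bar> * Y t us x \<le> cL * exp (3 * \<bar>X u0 x\<bar>) * Y t us x"
      using that by (intro mult_right_mono) auto
    then show ?thesis using that unfolding L_def
      by (subst abs_mult[of _ "Y t us x"]) (simp only: abs_of_pos mult.assoc[of cL])
  qed
  have Rb: "\<bar>Rr j x\<bar> \<le> cR * (exp (3 * \<bar>X u0 x\<bar>) * Y t us x)" if g: "good x" and Yp: "0 < Y t us x" for j x
  proof -
    have bs: "b * step j \<le> b" using b0 st(2)[of j] by (intro mult_left_le) auto
    have "\<bar>q t u0 us (step j) x - 1\<bar> * real (Suc j) \<le> b * step j * exp (b * step j) * real (Suc j)"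
      using q_minus_1[OF g u0 us st(1), of t j] by (intro mult_right_mono) (auto simp: b_def)
    also have "\<dots> = (step j * real (Suc j)) * (b * exp (b * step j))" by (simp only: ac_simps)
    also have "\<dots> \<le> 1 * (b * exp b)" unfolding st(4) using b0 bs by (intro mult_left_mono) auto
    finally have q1: "\<bar>(q t u0 us (step j) x - 1) * real (Suc j)\<bar> \<le> b * exp b" by (simp add: abs_mult)
    have q2: "\<bar>q t u0 us (step j) x\<bar> \<le> exp b"
    proof -
      have "q t u0 us (step j) x \<le> exp (b * step j)" "0 \<le> q t u0 us (step j) x"
        using q_bounds[OF g u0 us st(1), of t j] exp_ge_zero order_trans unfolding b_def by blast+
      moreover have "exp (b * step j) \<le> exp b" using bs by simp
      ultimately show ?thesis by linarith
    qed
    have "\<bar>F (X u0 x) * ((q t u0 us (step j) x - 1) * real (Suc j))\<bar> \<le> (\<bar>\<alpha>\<bar> + \<bar>\<beta>\<bar>) * exp \<bar>X u0 x\<bar> * (b * exp b)"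
      by (rule abs_mult_le_real[OF Fb q1])
    also have "\<dots> \<le> (\<bar>\<alpha>\<bar> + \<bar>\<beta>\<bar>) * exp (3 * \<bar>X u0 x\<bar>) * (b * exp b)"
      using e3(1)[of "X u0 x"] b0 by (intro mult_right_mono mult_left_mono) auto
    finally have 1: "\<bar>F (X u0 x) * ((q t u0 us (step j) x - 1) * real (Suc j))\<bar> \<le> (\<bar>\<alpha>\<bar> + \<bar>\<beta>\<bar>) * (b * exp b) * exp (3 * \<bar>X u0 x\<bar>)"
      by (simp only: ac_simps)
    have "\<bar>\<beta> * V\<bar> \<le> \<bar>\<beta>\<bar> * 1" by (rule abs_mult_le_real) (use V in auto)
    from abs_mult_le_real[OF this q2] have "\<bar>\<beta> * V * q t u0 us (step j) x\<bar> \<le> \<bar>\<beta>\<bar> * exp b * 1" by simp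
    also have "\<dots> \<le> \<bar>\<beta>\<bar> * exp b * exp (3 * \<bar>X u0 x\<bar>)" using e3(4) by (intro mult_left_mono) auto
    finally have "\<bar>F (X u0 x) * ((q t u0 us (step j) x - 1) * real (Suc j)) + \<beta> * V * q t u0 us (step j) x\<bar> \<le> cR * exp (3 * \<bar>X u0 x\<bar>)"
      using 1 unfolding cR_def distrib_right by linarith
    then have "\<bar>F (X u0 x) * ((q t u0 us (step j) x - 1) * real (Suc j)) + \<beta> * V * q t u0 us (step j) x\<bar> * Y t us x \<le> cR * exp (3 * \<bar>X u0 x\<bar>) * Y t us x"
      using Yp by (intro mult_right_mono) auto
    then show ?thesis using Yp unfolding Rr_def
      by (subst abs_mult[of _ "Y t us x"]) (simp only: abs_of_pos mult.assoc[of cR])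
  qed
  have [measurable]: "L j \<in> borel_measurable P" "Rr j \<in> borel_measurable P" for j unfolding L_def Rr_def by measurable
  have FY: "integrable P (\<lambda>x. F (X u0 x) * Y t us x)"
  proof (rule Bochner_Integration.integrable_bound[OF i3[of "\<bar>\<alpha>\<bar> + \<bar>\<beta>\<bar>"]])
    show "AE x in P. norm (F (X u0 x) * Y t us x) \<le> norm ((\<bar>\<alpha>\<bar> + \<bar>\<beta>\<bar>) * (exp (3 * \<bar>X u0 x\<bar>) * Y t us x))"
      using YP
    proof eventually_elim
      fix x assume "good x \<and> 0 < Y t us x"
      moreover have "\<bar>F (X u0 x)\<bar> \<le> (\<bar>\<alpha>\<bar> + \<bar>\<beta>\<bar>) * exp (3 * \<bar>X u0 x\<bar>)"
        using Fb[of "X u0 x"] mult_left_mono[OF e3(1)[of "X u0 x"], of "\<bar>\<alpha>\<bar> + \<bar>\<beta>\<bar>"] by linarith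
      ultimately have "\<bar>F (X u0 x)\<bar> * Y t us x \<le> (\<bar>\<alpha>\<bar> + \<bar>\<beta>\<bar>) * exp (3 * \<bar>X u0 x\<bar>) * Y t us x"
        by (intro mult_right_mono) auto
      then show "norm (F (X u0 x) * Y t us x) \<le> norm ((\<bar>\<alpha>\<bar> + \<bar>\<beta>\<bar>) * (exp (3 * \<bar>X u0 x\<bar>) * Y t us x))"
        using \<open>good x \<and> 0 < Y t us x\<close> by (simp add: abs_mult mult.assoc)
    qed
  qed measurable
  have Li: "integrable P (L j)" for j
  proof (rule Bochner_Integration.integrable_bound[OF i3[of cL]])
    show "AE x in P. norm (L j x) \<le> norm (cL * (exp (3 * \<bar>X u0 x\<bar>) * Y t us x))"
      using YP
    proof eventually_elim
      fix x assume "good x \<and> 0 < Y t us x"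
      then have "\<bar>L j x\<bar> \<le> cL * (exp (3 * \<bar>X u0 x\<bar>) * Y t us x)" using Lb by blast
      then show "norm (L j x) \<le> norm (cL * (exp (3 * \<bar>X u0 x\<bar>) * Y t us x))"
        unfolding real_norm_def by (rule order_trans) (rule abs_ge_self)
    qed
  qed measurable
  have Ri: "integrable P (Rr j)" for j
  proof (rule Bochner_Integration.integrable_bound[OF i3[of cR]])
    show "AE x in P. norm (Rr j x) \<le> norm (cR * (exp (3 * \<bar>X u0 x\<bar>) * Y t us x))"
      using YP
    proof eventually_elim
      fix x assume "good x \<and> 0 < Y t us x"
      then have "\<bar>Rr j x\<bar> \<le> cR * (exp (3 * \<bar>X u0 x\<bar>) * Y t us x)" using Rb by blast
      then show "norm (Rr j x) \<le> norm (cR * (exp (3 * \<bar>X u0 x\<bar>) * Y t us x))"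
        unfolding real_norm_def by (rule order_trans) (rule abs_ge_self)
    qed
  qed measurable
  have LR: "(\<integral>x. L j x \<partial>P) = (\<integral>x. Rr j x \<partial>P)" for j
  proof -
    have n: "step j * real (Suc j) = 1" "real (Suc j) * step j = 1" using st(4) by (simp_all add: mult.commute)
    have 1: "F (X u0 x) * Y t us x * ?w (step j) x = F (X u0 x) * Y t us x + step j * L j x" for x
    proof -
      have "step j * L j x = (step j * real (Suc j)) * (F (X u0 x) * (?w (step j) x - 1) * Y t us x)"
        unfolding L_def by (simp only: ac_simps)
      then show ?thesis unfolding n by (simp add: algebra_simps)
    qed
    have 2: "F (X u0 x + step j * V) * (Y t us x * q t u0 us (step j) x) = F (X u0 x) * Y t us x + step j * Rr j x" for x
    proof -
      have "step j * Rr j x = (step j * real (Suc j)) * (F (X u0 x) * (q t u0 us (step j) x - 1) * Y t us x) + step j * (\<beta> * V * q t u0 us (step j) x * Y t us x)"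
        unfolding Rr_def by (simp only: distrib_right distrib_left ac_simps)
      then show ?thesis unfolding n F_def by (simp add: algebra_simps)
    qed
    have "(\<integral>x. F (X u0 x) * Y t us x + step j * L j x \<partial>P) = (\<integral>x. F (X u0 x) * Y t us x + step j * Rr j x \<partial>P)"
      using shift[OF u0 us _ st(1), of F t j] unfolding V_def[symmetric] 1 2 by simp
    then have "step j * (\<integral>x. L j x \<partial>P) = step j * (\<integral>x. Rr j x \<partial>P)"
      using Bochner_Integration.integral_add[OF FY integrable_mult_right[OF Li, of "step j" j]]
        Bochner_Integration.integral_add[OF FY integrable_mult_right[OF Ri, of "step j" j]]
      by (simp only: integral_mult_right_zero)
    then show ?thesis using st(3)[of j] by simp
  qed
  have limL: "(\<lambda>j. \<integral>x. L j x \<partial>P) \<longlonglongrightarrow> (\<integral>x. F (X u0 x) * X u0 x * Y t us x \<partial>P)"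
  proof (rule integral_dominated_convergence[where w="\<lambda>x. cL * (exp (3 * \<bar>X u0 x\<bar>) * Y t us x)"])
    show "AE x in P. (\<lambda>j. L j x) \<longlonglongrightarrow> F (X u0 x) * X u0 x * Y t us x"
    proof (intro AE_I2)
      fix x
      have "slope (\<lambda>j. ?w (step j) x) (X u0 x)" using slope_exp[of "X u0 x" "V / 2"] by (simp add: ac_simps)
      then show "(\<lambda>j. L j x) \<longlonglongrightarrow> F (X u0 x) * X u0 x * Y t us x" unfolding L_def slope_def by (intro tendsto_intros)
    qed
    show "AE x in P. norm (L j x) \<le> cL * (exp (3 * \<bar>X u0 x\<bar>) * Y t us x)" for j
      using YP by eventually_elim (use Lb in auto)
    show "integrable P (\<lambda>x. cL * (exp (3 * \<bar>X u0 x\<bar>) * Y t us x))" by (rule i3)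
  qed measurable
  let ?S = "\<lambda>x. t * ((\<Sum>u\<leftarrow>us. K u u0) - real (length us) * kbar t u0 x)"
  have limR: "(\<lambda>j. \<integral>x. Rr j x \<partial>P) \<longlonglongrightarrow> (\<integral>x. (F (X u0 x) * ?S x + \<beta> * V * 1) * Y t us x \<partial>P)"
  proof (rule integral_dominated_convergence[where w="\<lambda>x. cR * (exp (3 * \<bar>X u0 x\<bar>) * Y t us x)"])
    show "AE x in P. (\<lambda>j. Rr j x) \<longlonglongrightarrow> (F (X u0 x) * ?S x + \<beta> * V * 1) * Y t us x"
      using AE_good
    proof eventually_elim
      fix x assume g: "good x"
      show "(\<lambda>j. Rr j x) \<longlonglongrightarrow> (F (X u0 x) * ?S x + \<beta> * V * 1) * Y t us x"
        unfolding Rr_def using q_slope[OF g u0, of t us, unfolded slope_def] slope_lim[OF q_slope[OF g u0, of t us]]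
        by (intro tendsto_mult_right tendsto_add tendsto_mult_left)
    qed
    show "AE x in P. norm (Rr j x) \<le> cR * (exp (3 * \<bar>X u0 x\<bar>) * Y t us x)" for j
      using YP by eventually_elim (use Rb in auto)
    show "integrable P (\<lambda>x. cR * (exp (3 * \<bar>X u0 x\<bar>) * Y t us x))" by (rule i3)
  qed measurable
  have "(\<integral>x. F (X u0 x) * X u0 x * Y t us x \<partial>P) = (\<integral>x. (F (X u0 x) * ?S x + \<beta> * V * 1) * Y t us x \<partial>P)"
    using LIMSEQ_unique[OF limL] limR unfolding LR by blast
  then show ?thesis by (simp add: F_def V_def add.commute)
qed

end

section \<open>Replicas\<close>

declare One_nat_def [simp del]

definition preserving :: "'a measure \<Rightarrow> 'b measure \<Rightarrow> ('a \<Rightarrow> 'b) \<Rightarrow> bool" where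
  "preserving M N f \<longleftrightarrow> f \<in> measurable M N \<and> distr M N f = N"

lemma preserving_id: "preserving M M (\<lambda>x. x)" by (simp add: preserving_def)

lemma preserving_compose: "preserving M N f \<Longrightarrow> preserving N R g \<Longrightarrow> preserving M R (\<lambda>x. g (f x))"
  unfolding preserving_def using distr_distr[of g N R f M] by (auto simp: o_def intro: measurable_compose)

lemma preserving_fst: "prob_space N \<Longrightarrow> preserving (M \<Otimes>\<^sub>M N) M fst"
  by (simp add: preserving_def prob_space.distr_pair_fst)

lemma preserving_snd:
  assumes "prob_space M" "prob_space N" shows "preserving (M \<Otimes>\<^sub>M N) N snd"
proof -
  interpret M: prob_space M by fact
  interpret N: prob_space N by fact
  have "distr (M \<Otimes>\<^sub>M N) N snd = N"
  proof (rule measure_eqI)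
    fix A assume "A \<in> sets (distr (M \<Otimes>\<^sub>M N) N snd)"
    then have A: "A \<in> sets N" by simp
    have "snd -` A \<inter> space (M \<Otimes>\<^sub>M N) = space M \<times> A"
      using sets.sets_into_space[OF A] by (auto simp: space_pair_measure)
    then show "emeasure (distr (M \<Otimes>\<^sub>M N) N snd) A = emeasure N A"
      using A by (simp add: emeasure_distr N.emeasure_pair_measure_Times M.emeasure_space_1)
  qed simp
  then show ?thesis by (simp add: preserving_def)
qed

lemma preserving_prod:
  assumes "preserving M M' f" "preserving N N' g" "prob_space N'"
  shows "preserving (M \<Otimes>\<^sub>M N) (M' \<Otimes>\<^sub>M N') (\<lambda>z. (f (fst z), g (snd z)))"
proof -
  have [measurable]: "f \<in> measurable M M'" "g \<in> measurable N N'" using assms by (auto simp: preserving_def)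
  have "distr M M' f \<Otimes>\<^sub>M distr N N' g = distr (M \<Otimes>\<^sub>M N) (M' \<Otimes>\<^sub>M N') (\<lambda>(x, y). (f x, g y))"
    using assms by (intro pair_measure_distr) (auto simp: preserving_def prob_space_imp_sigma_finite)
  then show ?thesis using assms by (simp add: preserving_def case_prod_unfold)
qed

lemma preserving_integral:
  fixes h :: "'b \<Rightarrow> real"
  assumes "preserving M N f" "h \<in> borel_measurable N"
  shows "(\<integral>x. h (f x) \<partial>M) = (\<integral>x. h x \<partial>N)"
  using assms integral_distr[of f M N h] by (simp add: preserving_def)

lemma space_unif [simp]: "space unif = {0..1}"
  by (simp add: unif_def space_restrict_space)

interpretation unif: prob_space unif
proof
  show "emeasure unif (space unif) = 1"
    by (simp add: unif_def emeasure_restrict_space space_restrict_space)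
qed

abbreviation "replicas \<equiv> PiM pos (\<lambda>_. unif)"

lemma measurable_3:
  assumes "(\<lambda>(a, b, c). F a b c) \<in> measurable (A \<Otimes>\<^sub>M B \<Otimes>\<^sub>M C) M"
    and [measurable]: "f \<in> measurable N A" "g \<in> measurable N B" "h \<in> measurable N C"
  shows "(\<lambda>x. F (f x) (g x) (h x)) \<in> measurable N M"
  using measurable_compose[OF _ assms(1), of "\<lambda>x. (f x, g x, h x)" N] by simp

lemma prob_space_replicas: "prob_space replicas"
  by (intro prob_space_PiM unif.prob_space_axioms)

lemma replicas_space: "us \<in> space replicas \<Longrightarrow> 1 \<le> l \<Longrightarrow> us l \<in> {0..1}"
  using measurable_space[of "\<lambda>us. us l" replicas unif us] by simp

lemma product_integral_coordinates:
  fixes f :: "nat \<Rightarrow> 'a \<Rightarrow> real"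
  assumes M: "prob_space M" and J: "finite J" "J \<subseteq> I" and f: "\<And>j. j \<in> J \<Longrightarrow> integrable M (f j)"
  shows "(\<integral>x. (\<Prod>j\<in>J. f j (x j)) \<partial>PiM I (\<lambda>_. M)) = (\<Prod>j\<in>J. \<integral>y. f j y \<partial>M)"
proof -
  interpret M: prob_space M by fact
  interpret product_prob_space "\<lambda>_. M" I by unfold_locales
  interpret F: finite_product_prob_space "\<lambda>_. M" J by unfold_locales (rule J)
  have [measurable]: "f j \<in> borel_measurable M" if "j \<in> J" for j using f[OF that] by auto
  have "(\<integral>x. (\<Prod>j\<in>J. f j (x j)) \<partial>PiM I (\<lambda>_. M)) = (\<integral>x. (\<Prod>j\<in>J. f j (restrict x J j)) \<partial>PiM I (\<lambda>_. M))"
    by (intro Bochner_Integration.integral_cong prod.cong refl) simp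
  also have "\<dots> = (\<integral>x. (\<Prod>j\<in>J. f j (x j)) \<partial>distr (PiM I (\<lambda>_. M)) (PiM J (\<lambda>_. M)) (\<lambda>x. restrict x J))"
    using J by (intro integral_distr[symmetric] measurable_restrict_subset) measurable
  also have "\<dots> = (\<Prod>j\<in>J. \<integral>y. f j y \<partial>M)"
    unfolding distr_PiM_restrict_finite[OF J] using f by (intro product_integral_prod J) auto
  finally show ?thesis .
qed

text \<open>Infinitely many reweighted factors have in general no density against the original
  product, but a function of the coordinates in \<open>J\<close> sees only finitely many of
  them.\<close>

lemma integral_PiM_density:
  fixes \<Phi> :: "(nat \<Rightarrow> 'a) \<Rightarrow> real"
  assumes M: "prob_space M" and [measurable]: "\<rho> \<in> borel_measurable M" and \<rho>0: "\<And>u. 0 \<le> \<rho> u"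
    and D: "prob_space (density M (\<lambda>u. ennreal (\<rho> u)))"
    and J: "finite J" "J \<subseteq> I"
    and [measurable]: "\<Phi> \<in> borel_measurable (PiM I (\<lambda>_. M))"
    and dep: "\<And>x y. (\<And>j. j \<in> J \<Longrightarrow> x j = y j) \<Longrightarrow> \<Phi> x = \<Phi> y"
  shows "(\<integral>x. \<Phi> x \<partial>PiM I (\<lambda>_. density M (\<lambda>u. ennreal (\<rho> u)))) = (\<integral>x. \<Phi> x * (\<Prod>j\<in>J. \<rho> (x j)) \<partial>PiM I (\<lambda>_. M))"
proof -
  interpret M: prob_space M by fact
  let ?D = "density M (\<lambda>u. ennreal (\<rho> u))"
  interpret D: prob_space ?D by fact
  interpret MI: product_prob_space "\<lambda>_. M" I by unfold_locales
  interpret DI: product_prob_space "\<lambda>_. ?D" I by unfold_locales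
  interpret MJ: finite_product_prob_space "\<lambda>_. M" J by unfold_locales (rule J)
  interpret DJ: finite_product_prob_space "\<lambda>_. ?D" J by unfold_locales (rule J)
  have sD: "sets (PiM K (\<lambda>_. ?D)) = sets (PiM K (\<lambda>_. M))" for K :: "nat set" by (intro sets_PiM_cong) auto
  have ren: "(\<Prod>j\<in>J. ennreal (\<rho> (x j))) = ennreal (\<Prod>j\<in>J. \<rho> (x j))" for x using \<rho>0 by (simp add: prod_ennreal)
  have eq: "density (PiM J (\<lambda>_. M)) (\<lambda>x. ennreal (\<Prod>j\<in>J. \<rho> (x j))) = PiM J (\<lambda>_. ?D)"
  proof (rule DI.PiM_eqI[OF J(1)])
    show "sets (density (PiM J (\<lambda>_. M)) (\<lambda>x. ennreal (\<Prod>j\<in>J. \<rho> (x j)))) = sets (PiM J (\<lambda>_. ?D))" by (simp add: sD)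
    fix A assume A: "\<And>i. i \<in> J \<Longrightarrow> A i \<in> sets ?D"
    then have [measurable]: "i \<in> J \<Longrightarrow> A i \<in> sets M" for i by simp
    have AP: "Pi\<^sub>E J A \<in> sets (PiM J (\<lambda>_. M))" using J A by (intro sets_PiM_I_finite) auto
    have "emeasure (density (PiM J (\<lambda>_. M)) (\<lambda>x. ennreal (\<Prod>j\<in>J. \<rho> (x j)))) (Pi\<^sub>E J A)
      = (\<integral>\<^sup>+x. ennreal (\<Prod>j\<in>J. \<rho> (x j)) * indicator (Pi\<^sub>E J A) x \<partial>PiM J (\<lambda>_. M))"
      by (rule emeasure_density[OF _ AP]) measurable
    also have "\<dots> = (\<integral>\<^sup>+x. (\<Prod>j\<in>J. ennreal (\<rho> (x j)) * indicator (A j) (x j)) \<partial>PiM J (\<lambda>_. M))"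
    proof (intro nn_integral_cong)
      fix x assume "x \<in> space (PiM J (\<lambda>_. M))"
      then have ext: "x \<in> extensional J" by (auto simp: space_PiM PiE_def)
      have "indicator (Pi\<^sub>E J A) x = (\<Prod>j\<in>J. indicator (A j) (x j) :: ennreal)"
      proof (cases "\<forall>j\<in>J. x j \<in> A j")
        case True then show ?thesis using ext by (auto simp: PiE_def indicator_def)
      next
        case False
        then obtain j where "j \<in> J" "x j \<notin> A j" by blast
        then have "(\<Prod>j\<in>J. indicator (A j) (x j) :: ennreal) = 0" using J(1) by (intro prod_zero bexI[of _ j]) (auto simp: indicator_def)
        moreover have "x \<notin> Pi\<^sub>E J A" using \<open>j \<in> J\<close> \<open>x j \<notin> A j\<close> by auto
        ultimately show ?thesis by simp
      qed
      then show "ennreal (\<Prod>j\<in>J. \<rho> (x j)) * indicator (Pi\<^sub>E J A) x = (\<Prod>j\<in>J. ennreal (\<rho> (x j)) * indicator (A j) (x j))"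
        by (simp add: prod.distrib ren)
    qed
    also have "\<dots> = (\<Prod>j\<in>J. \<integral>\<^sup>+u. ennreal (\<rho> u) * indicator (A j) u \<partial>M)"
      by (intro MI.product_nn_integral_prod J) measurable
    also have "\<dots> = (\<Prod>j\<in>J. emeasure ?D (A j))"
      by (intro prod.cong refl emeasure_density[symmetric]) auto
    finally show "emeasure (density (PiM J (\<lambda>_. M)) (\<lambda>x. ennreal (\<Prod>j\<in>J. \<rho> (x j)))) (Pi\<^sub>E J A) = (\<Prod>i\<in>J. emeasure ?D (A i))" .
  qed
  obtain u0 where u0: "u0 \<in> space M" using M.not_empty by blast
  \<comment> \<open>\<open>\<Phi>\<close> is read as a function on the finite product by filling the
    other coordinates with a constant point.\<close>
  define ext where "ext x i = (if i \<in> J then x i else if i \<in> I then u0 else undefined)" for x :: "nat \<Rightarrow> 'a" and i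
  have extm: "ext \<in> measurable (PiM J (\<lambda>_. M)) (PiM I (\<lambda>_. M))"
  proof (rule measurable_PiM_single')
    show "(\<lambda>x. ext x i) \<in> measurable (PiM J (\<lambda>_. M)) M" if "i \<in> I" for i
      using that u0 by (cases "i \<in> J") (auto simp: ext_def)
    show "ext \<in> space (PiM J (\<lambda>_. M)) \<rightarrow> (\<Pi>\<^sub>E i\<in>I. space M)"
      using J(2) u0 by (auto simp: space_PiM PiE_iff extensional_def ext_def)
  qed
  define \<Psi> where "\<Psi> x = \<Phi> (ext x)" for x
  have [measurable]: "\<Psi> \<in> borel_measurable (PiM J (\<lambda>_. M))" unfolding \<Psi>_def by (rule measurable_compose[OF extm]) measurable
  have \<Psi>D: "\<Psi> \<in> borel_measurable (PiM J (\<lambda>_. ?D))" using measurable_cong_sets[OF sD refl] by auto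
  have \<Phi>\<Psi>: "\<Phi> x = \<Psi> (restrict x J)" for x unfolding \<Psi>_def by (rule dep) (simp add: ext_def)
  have resM: "(\<lambda>x. restrict x J) \<in> measurable (PiM I (\<lambda>_. M)) (PiM J (\<lambda>_. M))" by (rule measurable_restrict_subset[OF J(2)])
  have resD: "(\<lambda>x. restrict x J) \<in> measurable (PiM I (\<lambda>_. ?D)) (PiM J (\<lambda>_. ?D))" by (rule measurable_restrict_subset[OF J(2)])
  have "(\<integral>x. \<Phi> x \<partial>PiM I (\<lambda>_. ?D)) = (\<integral>x. \<Psi> x \<partial>distr (PiM I (\<lambda>_. ?D)) (PiM J (\<lambda>_. ?D)) (\<lambda>x. restrict x J))"
    unfolding \<Phi>\<Psi> by (rule integral_distr[OF resD \<Psi>D, symmetric])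
  also have "\<dots> = (\<integral>x. \<Psi> x \<partial>density (PiM J (\<lambda>_. M)) (\<lambda>x. ennreal (\<Prod>j\<in>J. \<rho> (x j))))"
    unfolding DI.distr_PiM_restrict_finite[OF J] eq ..
  also have "\<dots> = (\<integral>x. (\<Prod>j\<in>J. \<rho> (x j)) *\<^sub>R \<Psi> x \<partial>PiM J (\<lambda>_. M))"
    by (rule integral_density) (auto intro!: prod_nonneg \<rho>0)
  also have "\<dots> = (\<integral>x. \<Psi> x * (\<Prod>j\<in>J. \<rho> (x j)) \<partial>distr (PiM I (\<lambda>_. M)) (PiM J (\<lambda>_. M)) (\<lambda>x. restrict x J))"
    unfolding MI.distr_PiM_restrict_finite[OF J] by (simp add: mult.commute)
  also have "\<dots> = (\<integral>x. \<Phi> x * (\<Prod>j\<in>J. \<rho> (x j)) \<partial>PiM I (\<lambda>_. M))"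
    by (subst integral_distr[OF resM]) (auto simp: \<Phi>\<Psi>)
  finally show ?thesis .
qed

lemma preserving_under_product:
  assumes "prob_space A" "prob_space R" "prob_space U" and f: "preserving (R \<Otimes>\<^sub>M U) R f"
  shows "preserving ((A \<Otimes>\<^sub>M R) \<Otimes>\<^sub>M U) (A \<Otimes>\<^sub>M R) (\<lambda>z. (fst (fst z), f (snd (fst z), snd z)))"
proof -
  interpret A: prob_space A by fact
  interpret R: prob_space R by fact
  interpret U: prob_space U by fact
  interpret RU: pair_prob_space R U ..
  interpret AR: pair_prob_space A R ..
  have [measurable]: "f \<in> measurable (R \<Otimes>\<^sub>M U) R" and d: "distr (R \<Otimes>\<^sub>M U) R f = R" using f by (auto simp: preserving_def)
  have m: "(\<lambda>z. (fst (fst z), f (snd (fst z), snd z))) \<in> measurable ((A \<Otimes>\<^sub>M R) \<Otimes>\<^sub>M U) (A \<Otimes>\<^sub>M R)" by measurable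
  have "distr ((A \<Otimes>\<^sub>M R) \<Otimes>\<^sub>M U) (A \<Otimes>\<^sub>M R) (\<lambda>z. (fst (fst z), f (snd (fst z), snd z))) = A \<Otimes>\<^sub>M R"
  proof (rule measure_eqI)
    fix E assume "E \<in> sets (distr ((A \<Otimes>\<^sub>M R) \<Otimes>\<^sub>M U) (A \<Otimes>\<^sub>M R) (\<lambda>z. (fst (fst z), f (snd (fst z), snd z))))"
    then have E [measurable]: "E \<in> sets (A \<Otimes>\<^sub>M R)" by simp
    have "emeasure (distr ((A \<Otimes>\<^sub>M R) \<Otimes>\<^sub>M U) (A \<Otimes>\<^sub>M R) (\<lambda>z. (fst (fst z), f (snd (fst z), snd z)))) E
      = (\<integral>\<^sup>+z. indicator E (fst (fst z), f (snd (fst z), snd z)) \<partial>((A \<Otimes>\<^sub>M R) \<Otimes>\<^sub>M U))"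
      by (subst nn_integral_indicator[symmetric], simp, subst nn_integral_distr[OF m]) auto
    also have "\<dots> = (\<integral>\<^sup>+y. (\<integral>\<^sup>+u. indicator E (fst y, f (snd y, u)) \<partial>U) \<partial>(A \<Otimes>\<^sub>M R))"
      by (subst U.nn_integral_fst[symmetric]) auto
    also have "\<dots> = (\<integral>\<^sup>+a. (\<integral>\<^sup>+r. (\<integral>\<^sup>+u. indicator E (a, f (r, u)) \<partial>U) \<partial>R) \<partial>A)"
      by (subst R.nn_integral_fst[symmetric]) auto
    also have "\<dots> = (\<integral>\<^sup>+a. (\<integral>\<^sup>+r. indicator E (a, r) \<partial>R) \<partial>A)"
    proof (rule nn_integral_cong)
      fix a assume [measurable]: "a \<in> space A"
      have "(\<integral>\<^sup>+r. (\<integral>\<^sup>+u. indicator E (a, f (r, u)) \<partial>U) \<partial>R) = (\<integral>\<^sup>+z. indicator E (a, f z) \<partial>(R \<Otimes>\<^sub>M U))"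
        by (subst U.nn_integral_fst[symmetric]) auto
      also have "\<dots> = (\<integral>\<^sup>+r. indicator E (a, r) \<partial>distr (R \<Otimes>\<^sub>M U) R f)"
        by (subst nn_integral_distr) auto
      finally show "(\<integral>\<^sup>+r. (\<integral>\<^sup>+u. indicator E (a, f (r, u)) \<partial>U) \<partial>R) = (\<integral>\<^sup>+r. indicator E (a, r) \<partial>R)" by (simp add: d)
    qed
    also have "\<dots> = emeasure (A \<Otimes>\<^sub>M R) E"
      by (subst R.nn_integral_fst) auto
    finally show "emeasure (distr ((A \<Otimes>\<^sub>M R) \<Otimes>\<^sub>M U) (A \<Otimes>\<^sub>M R) (\<lambda>z. (fst (fst z), f (snd (fst z), snd z)))) E = emeasure (A \<Otimes>\<^sub>M R) E" .
  qed simp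
  with m show ?thesis by (simp add: preserving_def)
qed

text \<open>Resampling of one coordinate, stated as a map so that it can be placed under further
  product factors by \<open>preserving_under_product\<close>.\<close>

lemma preserving_upd:
  assumes M: "prob_space M" and k: "k \<in> I"
  shows "preserving (PiM I (\<lambda>_. M) \<Otimes>\<^sub>M M) (PiM I (\<lambda>_. M)) (\<lambda>z. (fst z)(k := snd z))"
proof -
  let ?P = "PiM I (\<lambda>_. M)"
  interpret M: prob_space M by fact
  interpret PI: prob_space ?P by (intro prob_space_PiM M)
  interpret pair_prob_space M ?P ..
  have I: "insert k I = I" using k by auto
  have D: "distr (M \<Otimes>\<^sub>M ?P) ?P (\<lambda>(x, X). X(k := x)) = ?P"
    using distr_pair_PiM_eq_PiM[of I "\<lambda>_. M" k] M by (simp add: I)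
  have m: "(\<lambda>(x, X). X(k := x)) \<in> measurable (M \<Otimes>\<^sub>M ?P) ?P"
    using measurable_compose[OF measurable_pair_swap' measurable_add_dim[of k I "\<lambda>_. M"]]
    by (simp add: I case_prod_beta)
  have s: "preserving (?P \<Otimes>\<^sub>M M) (M \<Otimes>\<^sub>M ?P) (\<lambda>(x, y). (y, x))"
    unfolding preserving_def using distr_pair_swap by simp
  have "preserving (M \<Otimes>\<^sub>M ?P) ?P (\<lambda>(x, X). X(k := x))" using m D by (simp add: preserving_def)
  from preserving_compose[OF s this] show ?thesis by (simp add: case_prod_unfold)
qed

section \<open>The tilted Gibbs measure\<close>

locale spin =
  fixes \<sigma> :: "real \<Rightarrow> real \<Rightarrow> real \<Rightarrow> real"
    and P :: "'a measure"
    and g :: "nat \<Rightarrow> real \<Rightarrow> real \<Rightarrow> 'a \<Rightarrow> real"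
  assumes meas_\<sigma>: "(\<lambda>(w, u, v). \<sigma> w u v) \<in> borel_measurable (unif \<Otimes>\<^sub>M unif \<Otimes>\<^sub>M unif)"
    and \<sigma>_bound: "\<And>w u v. w \<in> {0..1} \<Longrightarrow> u \<in> {0..1} \<Longrightarrow> v \<in> {0..1} \<Longrightarrow> \<sigma> w u v \<in> {-1..1}"
    and family: "overlap_gaussian_family \<sigma> P g"
begin

sublocale P: prob_space P using family by (simp add: overlap_gaussian_family_def)
sublocale R: prob_space replicas by (rule prob_space_replicas)
sublocale PR: pair_prob_space P replicas ..
sublocale N: pair_prob_space unif "P \<Otimes>\<^sub>M replicas" ..

abbreviation "N3 \<equiv> unif \<Otimes>\<^sub>M (P \<Otimes>\<^sub>M replicas)"

lemmas meas_\<sigma>' [measurable (raw)] = measurable_3[OF meas_\<sigma>]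

lemma \<sigma>_abs: "w \<in> {0..1} \<Longrightarrow> u \<in> {0..1} \<Longrightarrow> v \<in> {0..1} \<Longrightarrow> \<bar>\<sigma> w u v\<bar> \<le> 1"
  using \<sigma>_bound[of w u v] by auto

lemma meas_overlap: "(\<lambda>(w, u, u'). overlap \<sigma> w u u') \<in> borel_measurable (unif \<Otimes>\<^sub>M unif \<Otimes>\<^sub>M unif)"
  unfolding overlap_def by measurable

lemmas meas_overlap' [measurable (raw)] = measurable_3[OF meas_overlap]

lemma overlap_bound:
  assumes "w \<in> {0..1}" "u \<in> {0..1}" "u' \<in> {0..1}" shows "\<bar>overlap \<sigma> w u u'\<bar> \<le> 1"
  unfolding overlap_def using assms abs_mult_le_real[OF \<sigma>_abs \<sigma>_abs, of w u _ w u']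
  by (intro unif.abs_integral_le) auto

lemma overlap_power_bound:
  assumes "w \<in> {0..1}" "u \<in> {0..1}" "u' \<in> {0..1}" shows "\<bar>overlap \<sigma> w u u' ^ p\<bar> \<le> 1"
  using overlap_bound[OF assms] by (simp add: power_abs power_le_one)

lemma overlap_self: assumes "w \<in> {0..1}" "u \<in> {0..1}" shows "0 \<le> overlap \<sigma> w u u ^ p" "overlap \<sigma> w u u ^ p \<le> 1"
proof -
  show "0 \<le> overlap \<sigma> w u u ^ p" unfolding overlap_def by (intro zero_le_power Bochner_Integration.integral_nonneg) auto
  show "overlap \<sigma> w u u ^ p \<le> 1" using overlap_power_bound[OF assms(1,2,2), of p] by linarith
qed

lemma overlap_sym: "overlap \<sigma> w u u' = overlap \<sigma> w u' u"
  by (simp add: overlap_def mult.commute)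

end

locale tilt = spin \<sigma> P g for \<sigma> and P :: "'a measure" and g +
  fixes p :: nat and t :: real
  assumes p: "1 \<le> p"
begin

definition K :: "real \<Rightarrow> real \<Rightarrow> real \<Rightarrow> real" where "K w u u' = overlap \<sigma> w u u' ^ p"
definition G :: "real \<Rightarrow> real \<Rightarrow> 'a \<Rightarrow> real" where "G w u \<omega> = g p w u \<omega>"
definition s2 :: "real \<Rightarrow> real \<Rightarrow> real" where "s2 w u = 1 - K w u u"
text \<open>The mean of \<open>exp (t * z * sqrt (s2 w u))\<close> over the standard Gaussian
  \<open>z\<close>.\<close>

definition a :: "real \<Rightarrow> real \<Rightarrow> real" where "a w u = exp (t\<^sup>2 * s2 w u / 2)"
definition Zf :: "real \<Rightarrow> 'a \<Rightarrow> real" where "Zf w \<omega> = (\<integral>u. a w u * exp (t * G w u \<omega>) \<partial>unif)"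

text \<open>The density of the Gibbs measure tilted by the field, after integrating out \<open>z\<close>. The default
  value makes it a probability density even where the partition function diverges.\<close>

definition \<rho> :: "real \<Rightarrow> 'a \<Rightarrow> real \<Rightarrow> real" where
  "\<rho> w \<omega> u = (if 0 < Zf w \<omega> then a w u * exp (t * G w u \<omega>) / Zf w \<omega> else 1)"

lemma meas_K: "(\<lambda>(w, u, u'). K w u u') \<in> borel_measurable (unif \<Otimes>\<^sub>M unif \<Otimes>\<^sub>M unif)"
  unfolding K_def by measurable

lemmas meas_K' [measurable (raw)] = measurable_3[OF meas_K]

lemma meas_s2 [measurable]: "(\<lambda>(w, u). s2 w u) \<in> borel_measurable (unif \<Otimes>\<^sub>M unif)"
  unfolding s2_def by measurable

lemma meas_a [measurable]: "(\<lambda>(w, u). a w u) \<in> borel_measurable (unif \<Otimes>\<^sub>M unif)"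
  unfolding a_def by measurable

lemma meas_G: "(\<lambda>(w, u, \<omega>). G w u \<omega>) \<in> borel_measurable (unif \<Otimes>\<^sub>M unif \<Otimes>\<^sub>M P)"
  using family p unfolding overlap_gaussian_family_def G_def by blast

lemmas meas_G' [measurable (raw)] = measurable_3[OF meas_G]

lemma meas_Zf [measurable]: "(\<lambda>(w, \<omega>). Zf w \<omega>) \<in> borel_measurable (unif \<Otimes>\<^sub>M P)"
  unfolding Zf_def by measurable

lemma meas_\<rho>: "(\<lambda>(w, \<omega>, u). \<rho> w \<omega> u) \<in> borel_measurable (unif \<Otimes>\<^sub>M P \<Otimes>\<^sub>M unif)"
  unfolding \<rho>_def by measurable

lemmas meas_\<rho>' [measurable (raw)] = measurable_3[OF meas_\<rho>]

lemma K_bound: "w \<in> {0..1} \<Longrightarrow> u \<in> {0..1} \<Longrightarrow> u' \<in> {0..1} \<Longrightarrow> \<bar>K w u u'\<bar> \<le> 1"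
  unfolding K_def by (rule overlap_power_bound)

lemma s2_bounds: "w \<in> {0..1} \<Longrightarrow> u \<in> {0..1} \<Longrightarrow> 0 \<le> s2 w u" "w \<in> {0..1} \<Longrightarrow> u \<in> {0..1} \<Longrightarrow> s2 w u \<le> 1"
  using overlap_self[of w u p] by (auto simp: s2_def K_def)

lemma a_bounds: "w \<in> {0..1} \<Longrightarrow> u \<in> {0..1} \<Longrightarrow> 1 \<le> a w u \<and> a w u \<le> exp (t\<^sup>2 / 2)"
  using s2_bounds[of w u] by (auto simp: a_def mult_left_le)

lemma gauss_field: "w \<in> {0..1} \<Longrightarrow> gauss_field P unif (K w) (G w) (a w) (exp (t\<^sup>2 / 2))"
proof -
  assume w: "w \<in> {0..1}"
  then have [measurable]: "w \<in> space unif" by simp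
  have "centered_gaussian_process P {0..1} (K w) (G w)"
    using family p w unfolding overlap_gaussian_family_def K_def[abs_def] G_def[abs_def] by blast
  then show ?thesis
    by (intro gauss_field.intro gauss_process.intro gauss_process_axioms.intro gauss_field_axioms.intro
        P.prob_space_axioms unif.prob_space_axioms)
      (use w K_bound a_bounds in \<open>simp_all\<close>)
qed

lemma \<rho>_nonneg: "0 \<le> \<rho> w \<omega> u" by (simp add: \<rho>_def a_def)

lemma \<rho>_integral:
  assumes w: "w \<in> {0..1}" and \<omega>: "\<omega> \<in> space P"
  shows "integrable unif (\<rho> w \<omega>)" "(\<integral>u. \<rho> w \<omega> u \<partial>unif) = 1"
proof -
  have "integrable unif (\<lambda>u. a w u * exp (t * G w u \<omega>))" if "0 < Zf w \<omega>"
    using that not_integrable_integral_eq unfolding Zf_def by force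
  then show "integrable unif (\<rho> w \<omega>)" unfolding \<rho>_def by (cases "0 < Zf w \<omega>") simp_all
  show "(\<integral>u. \<rho> w \<omega> u \<partial>unif) = 1"
    unfolding \<rho>_def by (cases "0 < Zf w \<omega>") (simp_all add: Zf_def[symmetric] unif.prob_space[simplified])
qed

definition tw :: "nat \<Rightarrow> real \<Rightarrow> 'a \<Rightarrow> (nat \<Rightarrow> real) \<Rightarrow> real" where
  "tw n w \<omega> us = (\<Prod>l\<in>{1..n}. \<rho> w \<omega> (us l))"

text \<open>The mean of \<open>h\<close> when the first \<open>n\<close> replicas are drawn from the
  tilted Gibbs measure and the remaining ones uniformly. As \<open>\<rho>\<close> is a probability
  density, no normalisation appears.\<close>

definition T :: "nat \<Rightarrow> (real \<Rightarrow> 'a \<Rightarrow> (nat \<Rightarrow> real) \<Rightarrow> real) \<Rightarrow> real" where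
  "T n h = (\<integral>z. h (fst z) (fst (snd z)) (snd (snd z)) * tw n (fst z) (fst (snd z)) (snd (snd z)) \<partial>N3)"

abbreviation hmeas :: "(real \<Rightarrow> 'a \<Rightarrow> (nat \<Rightarrow> real) \<Rightarrow> real) \<Rightarrow> bool" where
  "hmeas h \<equiv> (\<lambda>(w, \<omega>, us). h w \<omega> us) \<in> borel_measurable N3"

lemma tw_nonneg: "0 \<le> tw n w \<omega> us" unfolding tw_def by (intro prod_nonneg) (simp add: \<rho>_nonneg)

lemma meas_coord [measurable (raw)]: "1 \<le> l \<Longrightarrow> (\<lambda>us. us l) \<in> measurable replicas unif"
  by (rule measurable_component_singleton) simp

lemma meas_tw: "hmeas (tw n)"
proof -
  have "(\<lambda>(w, \<omega>, us). \<rho> w \<omega> (us l)) \<in> borel_measurable N3" if "l \<in> {1..n}" for l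
  proof -
    have [measurable]: "(\<lambda>us. us l) \<in> measurable replicas unif" using that by (intro meas_coord) simp
    show ?thesis by measurable
  qed
  then show ?thesis unfolding tw_def case_prod_beta by (intro borel_measurable_prod) (simp add: case_prod_beta)
qed

lemmas meas_tw' [measurable (raw)] = measurable_3[OF meas_tw]

definition A :: "real \<Rightarrow> nat \<Rightarrow> (nat \<Rightarrow> real) \<Rightarrow> real" where "A w n us = (\<Prod>l\<in>{1..n}. a w (us l))"

lemma A_bounds:
  assumes w: "w \<in> {0..1}" and us: "us \<in> space replicas" shows "0 \<le> A w n us" "A w n us \<le> exp (t\<^sup>2 / 2) ^ n"
proof -
  have b: "0 \<le> a w (us l) \<and> a w (us l) \<le> exp (t\<^sup>2 / 2)" if "l \<in> {1..n}" for l
    using a_bounds[OF w replicas_space[OF us]] that by (force simp: a_def)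
  show "0 \<le> A w n us" unfolding A_def using b by (intro prod_nonneg) auto
  have "A w n us \<le> (\<Prod>l\<in>{1..n}. exp (t\<^sup>2 / 2))" unfolding A_def using b by (intro prod_mono) auto
  then show "A w n us \<le> exp (t\<^sup>2 / 2) ^ n" by simp
qed

text \<open>Translates the replica weight into the terms of \<open>gauss_field\<close>, for paths on
  which the partition function is finite and positive.\<close>

lemma tw_Y:
  assumes w: "w \<in> {0..1}" and good: "gauss_field.good P unif (G w) \<omega>"
  shows "tw n w \<omega> us = A w n us * gauss_field.Y unif (G w) (a w) t (map us [1..<Suc n]) \<omega>"
    and "0 < Zf w \<omega>" and "\<rho> w \<omega> u = a w u * exp (t * G w u \<omega>) / gauss_field.Z unif (G w) (a w) t \<omega>"
    and "Zf w \<omega> = gauss_field.Z unif (G w) (a w) t \<omega>"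
proof -
  interpret gauss_field P unif "K w" "G w" "a w" "exp (t\<^sup>2 / 2)" by (rule gauss_field[OF w])
  show Z: "Zf w \<omega> = Z t \<omega>" by (simp add: Zf_def Z_def)
  show Zp: "0 < Zf w \<omega>" using Z_pos[OF good] Z by simp
  show \<rho>: "\<rho> w \<omega> u = a w u * exp (t * G w u \<omega>) / Z t \<omega>" for u using Zp by (simp add: \<rho>_def Z)
  have "(\<Prod>u\<leftarrow>map us [1..<Suc n]. exp (t * G w u \<omega>)) = (\<Prod>l\<in>{1..n}. exp (t * G w (us l) \<omega>))"
    by (simp add: o_def prod.distinct_set_conv_list[symmetric] atLeastLessThanSuc_atLeastAtMost del: upt_Suc)
  then show "tw n w \<omega> us = A w n us * Y t (map us [1..<Suc n]) \<omega>"
    by (simp add: tw_def \<rho> A_def Y_def prod_dividef prod.distrib del: upt_Suc)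
qed

lemma AE_good': "w \<in> {0..1} \<Longrightarrow> AE \<omega> in P. gauss_field.good P unif (G w) \<omega>"
  using gauss_field.AE_good[OF gauss_field] .

text \<open>\<open>Ybound t n 2\<close>, written outside its locale, times the bound on the weights
  \<open>a\<close>. The exponent 2 admits test functions that are quadratic in the field.\<close>

definition Cn :: "nat \<Rightarrow> real" where
  "Cn n = exp (t\<^sup>2 / 2) ^ n * (real (n + 2) * (2 * exp ((real (n + 2) * max \<bar>2\<bar> (real (n + 1) * \<bar>t\<bar>))\<^sup>2)))"

lemma tw_bound:
  assumes w: "w \<in> {0..1}" and us: "us \<in> space replicas"
  shows "(\<integral>\<^sup>+\<omega>. ennreal (exp (2 * \<bar>G w (us 1) \<omega>\<bar>) * tw n w \<omega> us) \<partial>P) \<le> ennreal (Cn n)"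
proof -
  interpret gauss_field P unif "K w" "G w" "a w" "exp (t\<^sup>2 / 2)" by (rule gauss_field[OF w])
  have s: "set (map us [1..<Suc n]) \<subseteq> space unif" "us 1 \<in> space unif" using replicas_space[OF us] by auto
  note [measurable] = meas_X1[OF s(2)] meas_Y[OF s(1)]
  have "(\<integral>\<^sup>+\<omega>. ennreal (exp (2 * \<bar>G w (us 1) \<omega>\<bar>) * tw n w \<omega> us) \<partial>P)
    = (\<integral>\<^sup>+\<omega>. ennreal (A w n us) * ennreal (exp (2 * \<bar>G w (us 1) \<omega>\<bar>) * Y t (map us [1..<Suc n]) \<omega>) \<partial>P)"
  proof (rule nn_integral_cong_AE, use AE_good'[OF w] in eventually_elim)
    fix \<omega> assume "good \<omega>"
    then show "ennreal (exp (2 * \<bar>G w (us 1) \<omega>\<bar>) * tw n w \<omega> us) = ennreal (A w n us) * ennreal (exp (2 * \<bar>G w (us 1) \<omega>\<bar>) * Y t (map us [1..<Suc n]) \<omega>)"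
      using A_bounds(1)[OF w us] by (simp add: tw_Y[OF w] ennreal_mult'[symmetric] ac_simps)
  qed
  also have "\<dots> = ennreal (A w n us) * (\<integral>\<^sup>+\<omega>. ennreal (exp (2 * \<bar>G w (us 1) \<omega>\<bar>) * Y t (map us [1..<Suc n]) \<omega>) \<partial>P)"
    by (rule nn_integral_cmult) measurable
  also have "\<dots> \<le> ennreal (exp (t\<^sup>2 / 2) ^ n) * ennreal (Ybound t (length (map us [1..<Suc n])) 2)"
    using A_bounds[OF w us] by (intro mult_mono Y_bound s ennreal_leI) auto
  also have "\<dots> = ennreal (Cn n)" by (simp add: Cn_def Ybound_def ennreal_mult'[symmetric] del: upt_Suc)
  finally show ?thesis .
qed

lemma nn_integral_N3:
  assumes [measurable]: "f \<in> borel_measurable N3"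
  shows "(\<integral>\<^sup>+z. f z \<partial>N3) = (\<integral>\<^sup>+w. (\<integral>\<^sup>+us. (\<integral>\<^sup>+\<omega>. f (w, \<omega>, us) \<partial>P) \<partial>replicas) \<partial>unif)"
proof -
  have "(\<integral>\<^sup>+z. f z \<partial>N3) = (\<integral>\<^sup>+w. (\<integral>\<^sup>+y. f (w, y) \<partial>(P \<Otimes>\<^sub>M replicas)) \<partial>unif)"
    by (rule PR.nn_integral_fst[symmetric]) measurable
  also have "\<dots> = (\<integral>\<^sup>+w. (\<integral>\<^sup>+us. (\<integral>\<^sup>+\<omega>. f (w, \<omega>, us) \<partial>P) \<partial>replicas) \<partial>unif)"
  proof (rule nn_integral_cong)
    fix w assume [measurable]: "w \<in> space unif"
    show "(\<integral>\<^sup>+y. f (w, y) \<partial>(P \<Otimes>\<^sub>M replicas)) = (\<integral>\<^sup>+us. (\<integral>\<^sup>+\<omega>. f (w, \<omega>, us) \<partial>P) \<partial>replicas)"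
      by (rule PR.nn_integral_snd[symmetric]) measurable
  qed
  finally show ?thesis .
qed

lemma T_integrable:
  assumes h: "hmeas h"
    and b: "\<And>w \<omega> us. w \<in> {0..1} \<Longrightarrow> \<omega> \<in> space P \<Longrightarrow> us \<in> space replicas \<Longrightarrow> \<bar>h w \<omega> us\<bar> \<le> c * exp (2 * \<bar>G w (us 1) \<omega>\<bar>)"
  shows "integrable N3 (\<lambda>z. h (fst z) (fst (snd z)) (snd (snd z)) * tw n (fst z) (fst (snd z)) (snd (snd z)))"
proof -
  note [measurable (raw)] = measurable_3[OF h]
  have c: "\<bar>h w \<omega> us\<bar> \<le> \<bar>c\<bar> * exp (2 * \<bar>G w (us 1) \<omega>\<bar>)" if "w \<in> {0..1}" "\<omega> \<in> space P" "us \<in> space replicas" for w \<omega> us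
    using b[OF that] by (rule order_trans) (intro mult_right_mono, auto)
  let ?e = "\<lambda>z. exp (2 * \<bar>G (fst z) (snd (snd z) 1) (fst (snd z))\<bar>) * tw n (fst z) (fst (snd z)) (snd (snd z))"
  have "integrable N3 ?e"
  proof (rule integrableI_nonneg)
    show "AE z in N3. 0 \<le> ?e z" by (intro AE_I2 mult_nonneg_nonneg tw_nonneg) auto
    have "(\<integral>\<^sup>+z. ennreal (?e z) \<partial>N3) = (\<integral>\<^sup>+w. (\<integral>\<^sup>+us. (\<integral>\<^sup>+\<omega>. ennreal (exp (2 * \<bar>G w (us 1) \<omega>\<bar>) * tw n w \<omega> us) \<partial>P) \<partial>replicas) \<partial>unif)"
      by (subst nn_integral_N3) simp_all
    also have "\<dots> \<le> (\<integral>\<^sup>+w. (\<integral>\<^sup>+us. ennreal (Cn n) \<partial>replicas) \<partial>unif)"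
      by (intro nn_integral_mono tw_bound) auto
    also have "\<dots> < \<infinity>" by (simp add: R.emeasure_space_1 unif.emeasure_space_1[simplified])
    finally show "(\<integral>\<^sup>+z. ennreal (?e z) \<partial>N3) < \<infinity>" .
  qed measurable
  then have "integrable N3 (\<lambda>z. \<bar>c\<bar> * ?e z)" by simp
  then show ?thesis
  proof (rule Bochner_Integration.integrable_bound)
    show "AE z in N3. norm (h (fst z) (fst (snd z)) (snd (snd z)) * tw n (fst z) (fst (snd z)) (snd (snd z))) \<le> norm (\<bar>c\<bar> * ?e z)"
    proof (rule AE_I2)
      fix z assume "z \<in> space N3"
      then have "\<bar>h (fst z) (fst (snd z)) (snd (snd z))\<bar> \<le> \<bar>c\<bar> * exp (2 * \<bar>G (fst z) (snd (snd z) 1) (fst (snd z))\<bar>)"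
        by (intro c) (auto simp: space_pair_measure)
      then have "\<bar>h (fst z) (fst (snd z)) (snd (snd z))\<bar> * tw n (fst z) (fst (snd z)) (snd (snd z)) \<le> \<bar>c\<bar> * ?e z"
        by (subst mult.assoc[symmetric]) (intro mult_right_mono tw_nonneg)
      then show "norm (h (fst z) (fst (snd z)) (snd (snd z)) * tw n (fst z) (fst (snd z)) (snd (snd z))) \<le> norm (\<bar>c\<bar> * ?e z)"
        using tw_nonneg by (simp add: abs_mult)
    qed
  qed measurable
qed

text \<open>The Gaussian integral is placed innermost, since integration by parts is applied for
  fixed \<open>w\<close> and fixed replicas.\<close>

lemma T_iterated:
  assumes h: "hmeas h"
    and b: "\<And>w \<omega> us. w \<in> {0..1} \<Longrightarrow> \<omega> \<in> space P \<Longrightarrow> us \<in> space replicas \<Longrightarrow> \<bar>h w \<omega> us\<bar> \<le> c * exp (2 * \<bar>G w (us 1) \<omega>\<bar>)"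
  shows "T n h = (\<integral>w. (\<integral>us. (\<integral>\<omega>. h w \<omega> us * tw n w \<omega> us \<partial>P) \<partial>replicas) \<partial>unif)"
proof -
  note [measurable (raw)] = measurable_3[OF h]
  let ?f = "\<lambda>z. h (fst z) (fst (snd z)) (snd (snd z)) * tw n (fst z) (fst (snd z)) (snd (snd z))"
  have i: "integrable N3 ?f" using h b by (rule T_integrable)
  have "T n h = (\<integral>w. (\<integral>y. ?f (w, y) \<partial>(P \<Otimes>\<^sub>M replicas)) \<partial>unif)"
    unfolding T_def by (rule N.integral_fst'[OF i, symmetric])
  also have "\<dots> = (\<integral>w. (\<integral>us. (\<integral>\<omega>. h w \<omega> us * tw n w \<omega> us \<partial>P) \<partial>replicas) \<partial>unif)"
  proof (rule integral_cong_AE)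
    show "AE w in unif. (\<integral>y. ?f (w, y) \<partial>(P \<Otimes>\<^sub>M replicas)) = (\<integral>us. (\<integral>\<omega>. h w \<omega> us * tw n w \<omega> us \<partial>P) \<partial>replicas)"
      using N.AE_integrable_fst'[OF i]
    proof eventually_elim
      fix w assume "integrable (P \<Otimes>\<^sub>M replicas) (\<lambda>y. ?f (w, y))"
      then show "(\<integral>y. ?f (w, y) \<partial>(P \<Otimes>\<^sub>M replicas)) = (\<integral>us. (\<integral>\<omega>. h w \<omega> us * tw n w \<omega> us \<partial>P) \<partial>replicas)"
        using PR.integral_snd[of "\<lambda>\<omega> us. h w \<omega> us * tw n w \<omega> us"] by (simp add: case_prod_beta')
    qed
  qed measurable
  finally show ?thesis .
qed

end

lemma measurable_2:
  assumes "(\<lambda>(a, b). F a b) \<in> measurable (A \<Otimes>\<^sub>M B) M"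
    and [measurable]: "f \<in> measurable N A" "g \<in> measurable N B"
  shows "(\<lambda>x. F (f x) (g x)) \<in> measurable N M"
  using measurable_compose[OF _ assms(1), of "\<lambda>x. (f x, g x)" N] by simp

section \<open>Mixed moments under the tilted and the uniform replica law\<close>

context kernel begin

text \<open>For distinct cells the row variables separate into one factor for each row. This is the
  form in which \<open>invariance\<close> states its products, the columns of \<open>S\<close> in
  row \<open>l\<close> being the set \<open>C l\<close>.\<close>

lemma moment_distinct:
  assumes S: "finite S" "S \<subseteq> {1..q} \<times> {1..}"
  shows "moment (mset_set S) = (\<integral>vs. (\<Prod>l\<in>{1..q}. \<integral>u. (\<Prod>i\<in>{i. (l, i) \<in> S}. s u (vs i)) \<partial>\<mu>) \<partial>colsM)"
proof -
  have v: "valid (mset_set S)" using S by (auto simp: valid_def)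
  have C: "finite {i. (l, i) \<in> S}" for l
    using S(1) by (rule finite_subset[rotated, OF finite_imageI[of S snd]]) force
  have eq: "cellprod (mset_set S) us vs = (\<Prod>l\<in>{1..q}. \<Prod>i\<in>{i. (l, i) \<in> S}. s (us l) (vs i))" for us vs
  proof -
    have "S = (SIGMA l:{1..q}. {i. (l, i) \<in> S})" using S(2) by auto
    then have "(\<Prod>(l, i)\<in>S. s (us l) (vs i)) = (\<Prod>l\<in>{1..q}. \<Prod>i\<in>{i. (l, i) \<in> S}. s (us l) (vs i))"
      using prod.Sigma[of "{1..q}" "\<lambda>l. {i. (l, i) \<in> S}" "\<lambda>l i. s (us l) (vs i)"] C by simp
    then show ?thesis by (simp add: cellprod_def prod_unfold_prod_mset)
  qed
  have "moment (mset_set S) = (\<integral>vs. (\<integral>us. cellprod (mset_set S) us vs \<partial>rowsM) \<partial>colsM)"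
    unfolding moment_def using meas_cellprod[OF v] cellprod_bound[OF v]
    by (intro RC.Fubini_bounded(1)[where B=1, symmetric]) auto
  also have "\<dots> = (\<integral>vs. (\<Prod>l\<in>{1..q}. \<integral>u. (\<Prod>i\<in>{i. (l, i) \<in> S}. s u (vs i)) \<partial>\<mu>) \<partial>colsM)"
  proof (rule Bochner_Integration.integral_cong[OF refl])
    fix vs assume vs: "vs \<in> space colsM"
    have "integrable \<mu> (\<lambda>u. \<Prod>i\<in>{i. (l, i) \<in> S}. s u (vs i))" for l
    proof (rule U.integrable_bounded[where B=1])
      have "(\<lambda>u. s u (vs i)) \<in> borel_measurable \<mu>" if "(l, i) \<in> S" for i
      proof -
        have [measurable]: "vs i \<in> space \<nu>" using that S(2) by (intro rowcol_space(2)[OF vs]) auto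
        show ?thesis by measurable
      qed
      then show "(\<lambda>u. \<Prod>i\<in>{i. (l, i) \<in> S}. s u (vs i)) \<in> borel_measurable \<mu>" by (intro borel_measurable_prod) auto
      fix u assume u: "u \<in> space \<mu>"
      have "(\<Prod>i\<in>{i. (l, i) \<in> S}. \<bar>s u (vs i)\<bar>) \<le> (\<Prod>i\<in>{i. (l, i) \<in> S}. 1)"
        using S(2) by (intro prod_mono) (auto intro!: bound[OF u] rowcol_space(2)[OF vs])
      then show "\<bar>\<Prod>i\<in>{i. (l, i) \<in> S}. s u (vs i)\<bar> \<le> 1" by (simp add: abs_prod)
    qed
    then show "(\<integral>us. cellprod (mset_set S) us vs \<partial>rowsM) = (\<Prod>l\<in>{1..q}. \<integral>u. (\<Prod>i\<in>{i. (l, i) \<in> S}. s u (vs i)) \<partial>\<mu>)"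
      unfolding eq by (intro product_integral_coordinates U.prob_space_axioms) auto
  qed
  finally show ?thesis .
qed

end

text \<open>\<open>resid\<close> is linear in the moments, so it commutes with the average over
  \<open>z\<close>, and the uniform bound 1 allows dominated convergence.\<close>

lemma resid_average:
  assumes D: "prob_space D" and meas: "\<And>M. valid M \<Longrightarrow> (\<lambda>z. f z M) \<in> borel_measurable D"
    and bnd: "\<And>z m M y. z \<in> space D \<Longrightarrow> valid (add_mset y M) \<Longrightarrow> \<bar>resid (f z) m M y\<bar> \<le> 1"
    and lim: "\<And>z M y. z \<in> space D \<Longrightarrow> valid (add_mset y M) \<Longrightarrow> (\<lambda>m. resid (f z) m M y) \<longlonglongrightarrow> 0"
    and y: "valid (add_mset y M)"
  shows "(\<lambda>m. resid (\<lambda>M. \<integral>z. f z M \<partial>D) m M y) \<longlonglongrightarrow> 0"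
proof -
  interpret D: prob_space D by fact
  have mr: "(\<lambda>z. resid (f z) m M y) \<in> borel_measurable D" if "valid (add_mset y M)" for m M y
    using that
  proof (induction m arbitrary: M y)
    case 0 then show ?case using meas by simp
  next
    case (Suc m)
    have "valid (add_mset (fresh M y, snd y) (add_mset (fst y, fresh M y) (add_mset (fresh M y, fresh M y) M)))"
      using Suc.prems by (auto simp: fresh_def)
    from Suc.IH[OF Suc.prems] Suc.IH[OF this] show ?case by simp
  qed
  have ir: "integrable D (\<lambda>z. resid (f z) m M y)" if "valid (add_mset y M)" for m M y
    using mr[OF that] bnd[OF _ that] by (rule D.integrable_bounded)
  have eq: "resid (\<lambda>M. \<integral>z. f z M \<partial>D) m M y = (\<integral>z. resid (f z) m M y \<partial>D)" if "valid (add_mset y M)" for m M y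
    using that
  proof (induction m arbitrary: M y)
    case 0 then show ?case by simp
  next
    case (Suc m)
    have v: "valid (add_mset (fresh M y, snd y) (add_mset (fst y, fresh M y) (add_mset (fresh M y, fresh M y) M)))"
      using Suc.prems by (auto simp: fresh_def)
    show ?case using Suc.IH[OF Suc.prems] Suc.IH[OF v] ir[OF Suc.prems, of m] ir[OF v, of m] by simp
  qed
  have "(\<lambda>m. \<integral>z. resid (f z) m M y \<partial>D) \<longlonglongrightarrow> (\<integral>z. 0 \<partial>D)"
    by (rule integral_dominated_convergence[where w="\<lambda>_. 1"]) (use mr[OF y] bnd[OF _ y] lim[OF _ y] in auto)
  then show ?thesis unfolding eq[OF y] by simp
qed

context spin begin

definition cellmean :: "real \<Rightarrow> cells \<Rightarrow> (nat \<Rightarrow> real) \<Rightarrow> real" where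
  "cellmean w M us = (\<integral>vs. (\<Prod>(l, i)\<in>#M. \<sigma> w (us l) (vs i)) \<partial>replicas)"

lemma meas_cells:
  assumes "valid M"
  shows "(\<lambda>(w, us, vs). \<Prod>(l, i)\<in>#M. \<sigma> w (us l) (vs i)) \<in> borel_measurable (unif \<Otimes>\<^sub>M replicas \<Otimes>\<^sub>M replicas)"
  using assms
proof (induction M)
  case (add y M)
  obtain l i where y: "y = (l, i)" by (cases y)
  have li: "1 \<le> l" "1 \<le> i" and M: "valid M" using add.prems by (auto simp: y)
  have [measurable]: "(\<lambda>us. us l) \<in> measurable replicas unif" "(\<lambda>us. us i) \<in> measurable replicas unif"
    using li by auto
  have "(\<lambda>z. \<sigma> (fst z) (fst (snd z) l) (snd (snd z) i)) \<in> borel_measurable (unif \<Otimes>\<^sub>M replicas \<Otimes>\<^sub>M replicas)" by measurable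
  from borel_measurable_times[OF this add.IH[OF M]] show ?case by (simp add: y case_prod_beta')
qed simp

lemmas meas_cells' = measurable_3[OF meas_cells]

lemma meas_cellmean:
  assumes "valid M" shows "(\<lambda>(w, us). cellmean w M us) \<in> borel_measurable (unif \<Otimes>\<^sub>M replicas)"
proof -
  note [measurable (raw)] = meas_cells'[OF assms]
  show ?thesis unfolding cellmean_def by measurable
qed

lemma cells_bound:
  assumes "valid M" "w \<in> {0..1}" "us \<in> space replicas" "vs \<in> space replicas"
  shows "\<bar>\<Prod>(l, i)\<in>#M. \<sigma> w (us l) (vs i)\<bar> \<le> 1"
  using assms(1)
proof (induction M)
  case (add y M)
  obtain l i where y: "y = (l, i)" by (cases y)
  have "1 \<le> l" "1 \<le> i" using add.prems by (auto simp: y)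
  then have "\<bar>\<sigma> w (us l) (vs i)\<bar> \<le> 1"
    by (rule \<sigma>_abs[OF assms(2) replicas_space[OF assms(3)] replicas_space[OF assms(4)]])
  from abs_mult_le_real[OF this add.IH] add.prems show ?case by (simp add: y)
qed simp

lemma cellmean_bound:
  assumes "valid M" "w \<in> {0..1}" "us \<in> space replicas" shows "\<bar>cellmean w M us\<bar> \<le> 1"
  unfolding cellmean_def by (intro R.abs_integral_le cells_bound assms) auto

definition U :: "(real \<Rightarrow> (nat \<Rightarrow> real) \<Rightarrow> real) \<Rightarrow> real" where
  "U \<Phi> = (\<integral>z. \<Phi> (fst z) (snd z) \<partial>(unif \<Otimes>\<^sub>M replicas))"

lemma kernel_unif: assumes w: "w \<in> {0..1}" shows "kernel unif unif (\<sigma> w)"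
proof -
  have [measurable]: "w \<in> space unif" using w by simp
  show ?thesis
    by (intro kernel.intro prob_pair.intro kernel_axioms.intro unif.prob_space_axioms)
      (use w \<sigma>_abs in \<open>auto simp: case_prod_beta\<close>)
qed

lemma moment_unif:
  "w \<in> {0..1} \<Longrightarrow> kernel.moment unif unif (\<sigma> w) M = (\<integral>us. cellmean w M us \<partial>replicas)"
  by (simp add: kernel.moment_def[OF kernel_unif] kernel.cellprod_def[OF kernel_unif] cellmean_def)

end

context tilt begin

lemma prob_density: 
  assumes w: "w \<in> {0..1}" and \<omega>: "\<omega> \<in> space P"
  shows "prob_space (density unif (\<lambda>u. ennreal (\<rho> w \<omega> u)))"
proof (rule prob_spaceI)
  have "emeasure (density unif (\<lambda>u. ennreal (\<rho> w \<omega> u))) (space unif) = ennreal (\<integral>u. \<rho> w \<omega> u \<partial>unif)"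
  proof -
    have [measurable]: "w \<in> space unif" "\<omega> \<in> space P" using w \<omega> by auto
    have "emeasure (density unif (\<lambda>u. ennreal (\<rho> w \<omega> u))) (space unif) = (\<integral>\<^sup>+u. ennreal (\<rho> w \<omega> u) * indicator (space unif) u \<partial>unif)"
      by (rule emeasure_density[OF _ sets.top]) measurable
    also have "\<dots> = (\<integral>\<^sup>+u. ennreal (\<rho> w \<omega> u) \<partial>unif)" by (intro nn_integral_cong) simp
    also have "\<dots> = ennreal (\<integral>u. \<rho> w \<omega> u \<partial>unif)"
      using \<rho>_integral[OF w \<omega>] \<rho>_nonneg by (intro nn_integral_eq_integral) auto
    finally show ?thesis .
  qed
  then show "emeasure (density unif (\<lambda>u. ennreal (\<rho> w \<omega> u))) (space (density unif (\<lambda>u. ennreal (\<rho> w \<omega> u)))) = 1"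
    using \<rho>_integral[OF w \<omega>] by (simp only: space_density) simp
qed

abbreviation "\<mu>t w \<omega> \<equiv> density unif (\<lambda>u. ennreal (\<rho> w \<omega> u))"

lemma kernel_tilt: assumes w: "w \<in> {0..1}" and \<omega>: "\<omega> \<in> space P" shows "kernel (\<mu>t w \<omega>) unif (\<sigma> w)"
proof -
  have [measurable]: "w \<in> space unif" using w by simp
  have "sets (\<mu>t w \<omega> \<Otimes>\<^sub>M unif) = sets (unif \<Otimes>\<^sub>M unif)" by (intro sets_pair_measure_cong) auto
  then have "borel_measurable (\<mu>t w \<omega> \<Otimes>\<^sub>M unif) = (borel_measurable (unif \<Otimes>\<^sub>M unif) :: (_ \<Rightarrow> real) set)" by (intro measurable_cong_sets) auto
  moreover have "(\<lambda>(u, v). \<sigma> w u v) \<in> borel_measurable (unif \<Otimes>\<^sub>M unif)" by (simp add: case_prod_beta)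
  ultimately show ?thesis
    by (intro kernel.intro prob_pair.intro kernel_axioms.intro unif.prob_space_axioms prob_density w \<omega>)
      (use w \<sigma>_abs in auto)
qed

abbreviation "mom w \<omega> \<equiv> kernel.moment (\<mu>t w \<omega>) unif (\<sigma> w)"

lemma moment_tilt:
  assumes w: "w \<in> {0..1}" and \<omega>: "\<omega> \<in> space P" and v: "valid M" and n: "\<And>y. y \<in># M \<Longrightarrow> fst y \<le> n"
  shows "mom w \<omega> M = (\<integral>us. cellmean w M us * tw n w \<omega> us \<partial>replicas)"
proof -
  have [measurable]: "w \<in> space unif" "\<omega> \<in> space P" using w \<omega> by auto
  note [measurable (raw)] = measurable_2[OF meas_cellmean[OF v]]
  have "mom w \<omega> M = (\<integral>us. cellmean w M us \<partial>PiM pos (\<lambda>_. \<mu>t w \<omega>))"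
    by (simp add: kernel.moment_def[OF kernel_tilt[OF w \<omega>]] kernel.cellprod_def[OF kernel_tilt[OF w \<omega>]] cellmean_def)
  also have "\<dots> = (\<integral>us. cellmean w M us * (\<Prod>j\<in>{1..n}. \<rho> w \<omega> (us j)) \<partial>replicas)"
  proof (rule integral_PiM_density[OF unif.prob_space_axioms _ \<rho>_nonneg prob_density[OF w \<omega>]])
    show "cellmean w M x = cellmean w M y" if e: "\<And>j. j \<in> {1..n} \<Longrightarrow> x j = y j" for x y
      unfolding cellmean_def
    proof (intro Bochner_Integration.integral_cong refl arg_cong[where f=prod_mset] image_mset_cong)
      fix vs z assume z: "z \<in># M"
      have "fst z \<in> {1..n}" using n[OF z] v z by (cases z) (auto simp: valid_def)
      from e[OF this] show "(case z of (l, i) \<Rightarrow> \<sigma> w (x l) (vs i)) = (case z of (l, i) \<Rightarrow> \<sigma> w (y l) (vs i))"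
        by (simp add: case_prod_beta)
    qed
    show "cellmean w M \<in> borel_measurable replicas" using measurable_Pair2[OF meas_cellmean[OF v], of w] w by simp
    show "\<rho> w \<omega> \<in> borel_measurable unif" by measurable
  qed auto
  finally show ?thesis by (simp add: tw_def)
qed

definition rowmax :: "cells \<Rightarrow> nat" where "rowmax M = Max (insert 0 (fst ` set_mset M))"

lemma rowmax: "y \<in># M \<Longrightarrow> fst y \<le> rowmax M" unfolding rowmax_def by (intro Max_ge) auto

abbreviation "D2 \<equiv> unif \<Otimes>\<^sub>M P"

sublocale D2: pair_prob_space unif P ..

lemma meas_mom: assumes v: "valid M" shows "(\<lambda>z. mom (fst z) (snd z) M) \<in> borel_measurable D2"
proof -
  note [measurable (raw)] = measurable_2[OF meas_cellmean[OF v]]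
  have "(\<lambda>z. \<integral>us. cellmean (fst z) M us * tw (rowmax M) (fst z) (snd z) us \<partial>replicas) \<in> borel_measurable D2"
    by measurable
  moreover have "(\<lambda>z. mom (fst z) (snd z) M) \<in> borel_measurable D2 \<longleftrightarrow> (\<lambda>z. \<integral>us. cellmean (fst z) M us * tw (rowmax M) (fst z) (snd z) us \<partial>replicas) \<in> borel_measurable D2"
    by (intro measurable_cong) (auto simp: space_pair_measure intro!: moment_tilt v rowmax)
  ultimately show ?thesis by simp
qed

definition \<phi>t :: "cells \<Rightarrow> real" where "\<phi>t M = (\<integral>z. mom (fst z) (snd z) M \<partial>D2)"
definition \<phi>0 :: "cells \<Rightarrow> real" where "\<phi>0 M = (\<integral>w. kernel.moment unif unif (\<sigma> w) M \<partial>unif)"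

lemma T_cellmean:
  assumes v: "valid M" and n: "\<And>y. y \<in># M \<Longrightarrow> fst y \<le> n"
  shows "T n (\<lambda>w \<omega> us. cellmean w M us) = \<phi>t M"
proof -
  note [measurable (raw)] = measurable_2[OF meas_cellmean[OF v]]
  let ?f = "\<lambda>z. cellmean (fst z) M (snd (snd z)) * tw n (fst z) (fst (snd z)) (snd (snd z))"
  have i: "integrable N3 ?f"
  proof (rule T_integrable[where c=1])
    show "\<bar>cellmean w M us\<bar> \<le> 1 * exp (2 * \<bar>G w (us 1) \<omega>\<bar>)" if "w \<in> {0..1}" "us \<in> space replicas" for w \<omega> us
      using cellmean_bound[OF v that] by (rule order_trans) simp
  qed measurable
  have "T n (\<lambda>w \<omega> us. cellmean w M us) = (\<integral>w. (\<integral>y. ?f (w, y) \<partial>(P \<Otimes>\<^sub>M replicas)) \<partial>unif)"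
    unfolding T_def by (rule N.integral_fst'[OF i, symmetric])
  also have "\<dots> = (\<integral>w. (\<integral>\<omega>. mom w \<omega> M \<partial>P) \<partial>unif)"
  proof (rule integral_cong_AE)
    show "AE w in unif. (\<integral>y. ?f (w, y) \<partial>(P \<Otimes>\<^sub>M replicas)) = (\<integral>\<omega>. mom w \<omega> M \<partial>P)"
      using N.AE_integrable_fst'[OF i] AE_space
    proof eventually_elim
      fix w assume iw: "integrable (P \<Otimes>\<^sub>M replicas) (\<lambda>y. ?f (w, y))" and w: "w \<in> space unif"
      have "(\<integral>y. ?f (w, y) \<partial>(P \<Otimes>\<^sub>M replicas)) = (\<integral>\<omega>. (\<integral>us. ?f (w, \<omega>, us) \<partial>replicas) \<partial>P)"
        by (rule PR.integral_fst'[OF iw, symmetric])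
      also have "\<dots> = (\<integral>\<omega>. mom w \<omega> M \<partial>P)"
        using w by (intro Bochner_Integration.integral_cong refl) (simp add: moment_tilt[OF _ _ v n])
      finally show "(\<integral>y. ?f (w, y) \<partial>(P \<Otimes>\<^sub>M replicas)) = (\<integral>\<omega>. mom w \<omega> M \<partial>P)" .
    qed
    show "(\<lambda>w. \<integral>\<omega>. mom w \<omega> M \<partial>P) \<in> borel_measurable unif"
      using meas_mom[OF v] by (intro P.borel_measurable_lebesgue_integral) (simp add: case_prod_beta')
  qed measurable
  also have "\<dots> = \<phi>t M"
    unfolding \<phi>t_def
  proof (subst D2.integral_fst'[symmetric])
    show "integrable D2 (\<lambda>z. mom (fst z) (snd z) M)"
    proof (rule D2.integrable_bounded[where B=1, OF meas_mom[OF v]])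
      fix z assume z: "z \<in> space D2"
      then interpret k: kernel "\<mu>t (fst z) (snd z)" unif "\<sigma> (fst z)" by (intro kernel_tilt) (auto simp: space_pair_measure)
      show "\<bar>mom (fst z) (snd z) M\<bar> \<le> 1"
        unfolding k.moment_def by (intro k.RC.U.abs_integral_le R.abs_integral_le k.cellprod_bound v) auto
    qed
  qed simp
  finally show ?thesis .
qed

lemma U_cellmean:
  assumes v: "valid M" shows "U (\<lambda>w us. cellmean w M us) = \<phi>0 M"
proof -
  interpret UR: prob_pair unif replicas by unfold_locales
  have "U (\<lambda>w us. cellmean w M us) = (\<integral>w. (\<integral>us. cellmean w M us \<partial>replicas) \<partial>unif)"
    unfolding U_def using cellmean_bound[OF v] meas_cellmean[OF v] by (intro UR.Fubini_bounded(2)[where B=1]) auto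
  also have "\<dots> = \<phi>0 M" unfolding \<phi>0_def by (intro Bochner_Integration.integral_cong refl) (simp add: moment_unif)
  finally show ?thesis .
qed

text \<open>The residual estimate holds for every row law, so it applies to uniform rows and, for
  fixed \<open>w\<close> and \<open>\<omega>\<close>, to rows drawn from the tilted law; averaging
  keeps it. The difference \<open>\<phi>t - \<phi>0\<close> then satisfies the hypotheses of
  \<open>determined_by_distinct\<close>.\<close>

lemma moments_determined:
  assumes distinct: "\<And>S. finite S \<Longrightarrow> S \<subseteq> {1..} \<times> {1..} \<Longrightarrow> \<phi>t (mset_set S) = \<phi>0 (mset_set S)"
    and v: "valid M"
  shows "\<phi>t M = \<phi>0 M"
proof -
  have lt: "(\<lambda>m. resid \<phi>t m M y) \<longlonglongrightarrow> 0" if y: "valid (add_mset y M)" for M y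
    unfolding \<phi>t_def[abs_def]
  proof (rule resid_average[OF D2.prob_space_axioms meas_mom _ _ y])
    fix z m M y assume z: "z \<in> space D2" and v: "valid (add_mset y M)"
    then interpret k: kernel "\<mu>t (fst z) (snd z)" unif "\<sigma> (fst z)" by (intro kernel_tilt) (auto simp: space_pair_measure)
    show "\<bar>resid (mom (fst z) (snd z)) m M y\<bar> \<le> 1" by (rule k.resid_moment(1)[OF v])
    show "(\<lambda>m. resid (mom (fst z) (snd z)) m M y) \<longlonglongrightarrow> 0" by (rule k.resid_moment(2)[OF v])
  qed
  have l0: "(\<lambda>m. resid \<phi>0 m M y) \<longlonglongrightarrow> 0" if y: "valid (add_mset y M)" for M y
    unfolding \<phi>0_def[abs_def]
  proof (rule resid_average[OF unif.prob_space_axioms _ _ _ y])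
    fix M assume v: "valid M"
    note [measurable (raw)] = measurable_2[OF meas_cellmean[OF v]]
    have "(\<lambda>w. \<integral>us. cellmean w M us \<partial>replicas) \<in> borel_measurable unif" by measurable
    then show "(\<lambda>w. kernel.moment unif unif (\<sigma> w) M) \<in> borel_measurable unif"
      by (subst measurable_cong[OF moment_unif]) auto
  next
    fix z m M y assume z: "z \<in> space unif" and v: "valid (add_mset y M)"
    then interpret k: kernel unif unif "\<sigma> z" by (intro kernel_unif) simp
    show "\<bar>resid (kernel.moment unif unif (\<sigma> z)) m M y\<bar> \<le> 1" by (rule k.resid_moment(1)[OF v])
    show "(\<lambda>m. resid (kernel.moment unif unif (\<sigma> z)) m M y) \<longlonglongrightarrow> 0" by (rule k.resid_moment(2)[OF v])
  qed
  have "\<phi>t M - \<phi>0 M = 0"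
  proof (rule determined_by_distinct[OF _ _ v])
    show "\<phi>t (mset_set S) - \<phi>0 (mset_set S) = 0" if "finite S" "S \<subseteq> {1..} \<times> {1..}" for S using distinct[OF that] by simp
    show "(\<lambda>m. resid (\<lambda>M. \<phi>t M - \<phi>0 M) m M y) \<longlonglongrightarrow> 0" if "valid (add_mset y M)" for M y
      using tendsto_diff[OF lt[OF that] l0[OF that]] by (simp add: resid_diff)
  qed
  then show ?thesis by simp
qed

end

lemma abs_le_exp: "\<bar>y\<bar> \<le> exp \<bar>y\<bar>" "1 \<le> exp \<bar>y\<bar>" for y :: real
  using exp_ge_add_one_self[of "\<bar>y\<bar>"] by linarith+

section \<open>Integration by parts under the tilted average\<close>

context tilt begin

definition Kb :: "real \<Rightarrow> 'a \<Rightarrow> real \<Rightarrow> real" where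
  "Kb w \<omega> u0 = (\<integral>u. K w u u0 * \<rho> w \<omega> u \<partial>unif)"

lemma K\<rho>_bound:
  assumes w: "w \<in> {0..1}" and \<omega>: "\<omega> \<in> space P" and \<kappa>m: "\<kappa> \<in> borel_measurable unif" and \<kappa>: "\<And>u. u \<in> {0..1} \<Longrightarrow> \<bar>\<kappa> u\<bar> \<le> 1"
  shows "integrable unif (\<lambda>u. \<kappa> u * \<rho> w \<omega> u)" "\<bar>\<integral>u. \<kappa> u * \<rho> w \<omega> u \<partial>unif\<bar> \<le> 1"
proof -
  have [measurable]: "w \<in> space unif" "\<omega> \<in> space P" using w \<omega> by auto
  note [measurable] = \<kappa>m
  have le: "\<bar>\<kappa> u * \<rho> w \<omega> u\<bar> \<le> \<rho> w \<omega> u" if "u \<in> space unif" for u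
    using abs_mult_le_real[OF \<kappa>[of u] order_refl, of "\<rho> w \<omega> u"] that \<rho>_nonneg by simp
  show i: "integrable unif (\<lambda>u. \<kappa> u * \<rho> w \<omega> u)"
  proof (rule Bochner_Integration.integrable_bound[OF \<rho>_integral(1)[OF w \<omega>]])
    show "AE u in unif. norm (\<kappa> u * \<rho> w \<omega> u) \<le> norm (\<rho> w \<omega> u)"
    proof (rule AE_I2)
      fix u assume "u \<in> space unif"
      from le[OF this] show "norm (\<kappa> u * \<rho> w \<omega> u) \<le> norm (\<rho> w \<omega> u)" using \<rho>_nonneg[of w \<omega> u] by simp
    qed
  qed measurable
  have "\<bar>\<integral>u. \<kappa> u * \<rho> w \<omega> u \<partial>unif\<bar> \<le> (\<integral>u. \<bar>\<kappa> u * \<rho> w \<omega> u\<bar> \<partial>unif)" by (rule integral_abs_bound)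
  also have "\<dots> \<le> (\<integral>u. \<rho> w \<omega> u \<partial>unif)" using i \<rho>_integral[OF w \<omega>] le by (intro integral_mono) auto
  finally show "\<bar>\<integral>u. \<kappa> u * \<rho> w \<omega> u \<partial>unif\<bar> \<le> 1" using \<rho>_integral[OF w \<omega>] by simp
qed

lemma meas_Kb: "(\<lambda>(w, \<omega>, u). Kb w \<omega> u) \<in> borel_measurable (unif \<Otimes>\<^sub>M P \<Otimes>\<^sub>M unif)"
  unfolding Kb_def by measurable

lemmas meas_Kb' [measurable (raw)] = measurable_3[OF meas_Kb]

lemma Kb_bound: "w \<in> {0..1} \<Longrightarrow> \<omega> \<in> space P \<Longrightarrow> u0 \<in> {0..1} \<Longrightarrow> \<bar>Kb w \<omega> u0\<bar> \<le> 1"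
  unfolding Kb_def
proof (rule K\<rho>_bound(2))
  assume "w \<in> {0..1}" "u0 \<in> {0..1}"
  then have [measurable]: "w \<in> space unif" "u0 \<in> space unif" by auto
  show "(\<lambda>u. K w u u0) \<in> borel_measurable unif" by measurable
qed (auto intro: K_bound)

definition bounded_test :: "(real \<Rightarrow> (nat \<Rightarrow> real) \<Rightarrow> real) \<Rightarrow> real \<Rightarrow> bool" where
  "bounded_test \<Phi> B \<longleftrightarrow> (\<lambda>(w, us). \<Phi> w us) \<in> borel_measurable (unif \<Otimes>\<^sub>M replicas) \<and> 0 \<le> B \<and>
     (\<forall>w\<in>{0..1}. \<forall>us\<in>space replicas. \<bar>\<Phi> w us\<bar> \<le> B)"

lemma ibp_bound:
  assumes w: "w \<in> {0..1}" and us: "us \<in> space replicas" and \<Phi>: "bounded_test \<Phi> B"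
  shows "\<bar>\<Phi> w us * ((\<alpha> + \<beta> * y) * y)\<bar> \<le> B * (\<bar>\<alpha>\<bar> + \<bar>\<beta>\<bar>) * exp (2 * \<bar>y\<bar>)"
    and "\<bar>\<Phi> w us * (\<alpha> + \<beta> * y)\<bar> \<le> B * (\<bar>\<alpha>\<bar> + \<bar>\<beta>\<bar>) * exp (2 * \<bar>y\<bar>)"
proof -
  have \<Phi>b: "\<bar>\<Phi> w us\<bar> \<le> B" using \<Phi> w us by (auto simp: bounded_test_def)
  have f: "\<bar>\<alpha> + \<beta> * y\<bar> \<le> (\<bar>\<alpha>\<bar> + \<bar>\<beta>\<bar>) * exp \<bar>y\<bar>"
  proof -
    have "\<bar>\<alpha> + \<beta> * y\<bar> \<le> \<bar>\<alpha>\<bar> * 1 + \<bar>\<beta>\<bar> * \<bar>y\<bar>" by (metis abs_mult abs_triangle_ineq mult.right_neutral)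
    also have "\<dots> \<le> \<bar>\<alpha>\<bar> * exp \<bar>y\<bar> + \<bar>\<beta>\<bar> * exp \<bar>y\<bar>" using abs_le_exp by (intro add_mono mult_left_mono) auto
    finally show ?thesis by (simp add: distrib_right)
  qed
  have e2: "exp (2 * \<bar>y\<bar>) = exp \<bar>y\<bar> * exp \<bar>y\<bar>" by (simp add: exp_add[symmetric])
  have "\<bar>(\<alpha> + \<beta> * y) * y\<bar> \<le> (\<bar>\<alpha>\<bar> + \<bar>\<beta>\<bar>) * exp \<bar>y\<bar> * exp \<bar>y\<bar>"
    by (rule abs_mult_le_real[OF f abs_le_exp(1)])
  from abs_mult_le_real[OF \<Phi>b this] show "\<bar>\<Phi> w us * ((\<alpha> + \<beta> * y) * y)\<bar> \<le> B * (\<bar>\<alpha>\<bar> + \<bar>\<beta>\<bar>) * exp (2 * \<bar>y\<bar>)"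
    by (simp add: e2 mult.assoc)
  have "(\<bar>\<alpha>\<bar> + \<bar>\<beta>\<bar>) * exp \<bar>y\<bar> \<le> (\<bar>\<alpha>\<bar> + \<bar>\<beta>\<bar>) * exp (2 * \<bar>y\<bar>)" by (intro mult_left_mono) auto
  with f have "\<bar>\<alpha> + \<beta> * y\<bar> \<le> (\<bar>\<alpha>\<bar> + \<bar>\<beta>\<bar>) * exp (2 * \<bar>y\<bar>)" by linarith
  from abs_mult_le_real[OF \<Phi>b this] show "\<bar>\<Phi> w us * (\<alpha> + \<beta> * y)\<bar> \<le> B * (\<bar>\<alpha>\<bar> + \<bar>\<beta>\<bar>) * exp (2 * \<bar>y\<bar>)"
    by (simp add: mult.assoc)
qed

text \<open>\<open>integration_by_parts\<close> for fixed \<open>w\<close> and replicas, multiplied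
  by the factor \<open>\<Phi> w us * A w n us\<close>, which does not involve the field, and
  integrated. The affine factor serves two cases: \<open>\<alpha> = 1, \<beta> = 0\<close> for means
  linear in the field and \<open>\<alpha> = 0, \<beta> = 1\<close> for quadratic ones.\<close>

lemma T_IBP:
  assumes \<Phi>: "bounded_test \<Phi> B" and n: "1 \<le> n"
  shows "T n (\<lambda>w \<omega> us. \<Phi> w us * ((\<alpha> + \<beta> * G w (us 1) \<omega>) * G w (us 1) \<omega>))
    = T n (\<lambda>w \<omega> us. \<Phi> w us * (\<beta> * K w (us 1) (us 1) +
        (\<alpha> + \<beta> * G w (us 1) \<omega>) * (t * ((\<Sum>l\<in>{1..n}. K w (us l) (us 1)) - real n * Kb w \<omega> (us 1)))))"
    (is "_ = T n ?r")
proof -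
  have \<Phi>m: "(\<lambda>(w, us). \<Phi> w us) \<in> borel_measurable (unif \<Otimes>\<^sub>M replicas)" using \<Phi> by (simp add: bounded_test_def)
  note [measurable (raw)] = measurable_2[OF \<Phi>m]
  have \<Phi>b: "\<bar>\<Phi> w us\<bar> \<le> B" if "w \<in> {0..1}" "us \<in> space replicas" for w us using \<Phi> that by (auto simp: bounded_test_def)
  have B0: "0 \<le> B" using \<Phi> by (simp add: bounded_test_def)
  have mS: "hmeas (\<lambda>w \<omega> us. \<Sum>l\<in>{1..n}. K w (us l) (us 1))"
    unfolding case_prod_beta
  proof (rule borel_measurable_sum)
    fix l assume "l \<in> {1..n}"
    then have [measurable]: "(\<lambda>us. us l) \<in> measurable replicas unif" by (intro meas_coord) simp
    show "(\<lambda>x. K (fst x) (snd (snd x) l) (snd (snd x) 1)) \<in> borel_measurable N3" by measurable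
  qed
  note [measurable (raw)] = measurable_3[OF mS]
  have l: "T n (\<lambda>w \<omega> us. \<Phi> w us * ((\<alpha> + \<beta> * G w (us 1) \<omega>) * G w (us 1) \<omega>))
    = (\<integral>w. (\<integral>us. (\<integral>\<omega>. \<Phi> w us * ((\<alpha> + \<beta> * G w (us 1) \<omega>) * G w (us 1) \<omega>) * tw n w \<omega> us \<partial>P) \<partial>replicas) \<partial>unif)"
    by (rule T_iterated[where c="B * (\<bar>\<alpha>\<bar> + \<bar>\<beta>\<bar>)"], measurable) (rule ibp_bound[OF _ _ \<Phi>])
  have r: "T n ?r = (\<integral>w. (\<integral>us. (\<integral>\<omega>. ?r w \<omega> us * tw n w \<omega> us \<partial>P) \<partial>replicas) \<partial>unif)"
  proof (rule T_iterated[where c="B * (\<bar>\<beta>\<bar> + (\<bar>\<alpha>\<bar> + \<bar>\<beta>\<bar>) * (\<bar>t\<bar> * (real n + real n)))"], measurable)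
    fix w :: real and \<omega> us assume a: "w \<in> {0..1}" "\<omega> \<in> space P" "us \<in> space replicas"
    let ?y = "G w (us 1) \<omega>"
    have u1: "us l \<in> {0..1}" if "1 \<le> l" for l using replicas_space[OF a(3) that] .
    have "\<bar>\<Sum>l\<in>{1..n}. K w (us l) (us 1)\<bar> \<le> (\<Sum>l\<in>{1..n}. \<bar>K w (us l) (us 1)\<bar>)" by (rule sum_abs)
    also have "\<dots> \<le> (\<Sum>l\<in>{1..n}. 1)" using a u1 by (intro sum_mono K_bound) auto
    finally have s: "\<bar>\<Sum>l\<in>{1..n}. K w (us l) (us 1)\<bar> \<le> real n" by simp
    have "\<bar>real n * Kb w \<omega> (us 1)\<bar> \<le> real n * 1" using Kb_bound[OF a(1,2) u1[of 1]] by (intro abs_mult_le_real) auto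
    with s have "\<bar>(\<Sum>l\<in>{1..n}. K w (us l) (us 1)) - real n * Kb w \<omega> (us 1)\<bar> \<le> real n + real n" by linarith
    from abs_mult_le_real[OF order_refl[of "\<bar>t\<bar>"] this]
    have ts: "\<bar>t * ((\<Sum>l\<in>{1..n}. K w (us l) (us 1)) - real n * Kb w \<omega> (us 1))\<bar> \<le> \<bar>t\<bar> * (real n + real n)" .
    have "\<bar>\<Phi> w us * (\<alpha> + \<beta> * ?y)\<bar> \<le> B * (\<bar>\<alpha>\<bar> + \<bar>\<beta>\<bar>) * exp (2 * \<bar>?y\<bar>)" by (rule ibp_bound(2)[OF a(1,3) \<Phi>])
    from abs_mult_le_real[OF this ts]
    have 1: "\<bar>\<Phi> w us * (\<alpha> + \<beta> * ?y) * (t * ((\<Sum>l\<in>{1..n}. K w (us l) (us 1)) - real n * Kb w \<omega> (us 1)))\<bar>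
      \<le> B * (\<bar>\<alpha>\<bar> + \<bar>\<beta>\<bar>) * exp (2 * \<bar>?y\<bar>) * (\<bar>t\<bar> * (real n + real n))" .
    have "\<bar>\<beta> * K w (us 1) (us 1)\<bar> \<le> \<bar>\<beta>\<bar> * 1" using K_bound[OF a(1) u1 u1, of 1 1] by (intro abs_mult_le_real) auto
    from abs_mult_le_real[OF \<Phi>b[OF a(1,3)] this] have 2: "\<bar>\<Phi> w us * (\<beta> * K w (us 1) (us 1))\<bar> \<le> B * \<bar>\<beta>\<bar> * 1" by simp
    also have "\<dots> \<le> B * \<bar>\<beta>\<bar> * exp (2 * \<bar>?y\<bar>)" using B0 by (intro mult_left_mono) auto
    finally have 2: "\<bar>\<Phi> w us * (\<beta> * K w (us 1) (us 1))\<bar> \<le> B * \<bar>\<beta>\<bar> * exp (2 * \<bar>?y\<bar>)" .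
    have "?r w \<omega> us = \<Phi> w us * (\<beta> * K w (us 1) (us 1)) + \<Phi> w us * (\<alpha> + \<beta> * ?y) * (t * ((\<Sum>l\<in>{1..n}. K w (us l) (us 1)) - real n * Kb w \<omega> (us 1)))"
      by (simp only: mult.assoc) (simp only: distrib_left[of "\<Phi> w us"])
    then have "\<bar>?r w \<omega> us\<bar> \<le> B * \<bar>\<beta>\<bar> * exp (2 * \<bar>?y\<bar>) + B * (\<bar>\<alpha>\<bar> + \<bar>\<beta>\<bar>) * exp (2 * \<bar>?y\<bar>) * (\<bar>t\<bar> * (real n + real n))"
      using 1 2 by linarith
    also have "\<dots> = B * (\<bar>\<beta>\<bar> + (\<bar>\<alpha>\<bar> + \<bar>\<beta>\<bar>) * (\<bar>t\<bar> * (real n + real n))) * exp (2 * \<bar>?y\<bar>)" by (simp add: algebra_simps)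
    finally show "\<bar>?r w \<omega> us\<bar> \<le> B * (\<bar>\<beta>\<bar> + (\<bar>\<alpha>\<bar> + \<bar>\<beta>\<bar>) * (\<bar>t\<bar> * (real n + real n))) * exp (2 * \<bar>?y\<bar>)" .
  qed
  show ?thesis unfolding l r
  proof (rule Bochner_Integration.integral_cong[OF refl], rule Bochner_Integration.integral_cong[OF refl])
    fix w us assume w': "w \<in> space unif" and us: "us \<in> space replicas"
    then have w: "w \<in> {0..1}" by simp
    interpret F: gauss_field P unif "K w" "G w" "a w" "exp (t\<^sup>2 / 2)" by (rule gauss_field[OF w])
    define ul where "ul = map us [1..<Suc n]"
    have ul: "set ul \<subseteq> space unif" "us 1 \<in> space unif" using replicas_space[OF us] by (auto simp: ul_def)
    have sK: "(\<Sum>u\<leftarrow>ul. K w u (us 1)) = (\<Sum>l\<in>{1..n}. K w (us l) (us 1))"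
      by (simp add: ul_def o_def sum.distinct_set_conv_list[symmetric] atLeastLessThanSuc_atLeastAtMost del: upt_Suc)
    have len: "length ul = n" by (simp add: ul_def del: upt_Suc)
    have [measurable]: "w \<in> space unif" "us \<in> space replicas" using w' us by auto
    note [measurable] = F.meas_Y[OF ul(1)] F.meas_X1[OF ul(2)] F.meas_kbar[OF ul(2)] ul(2)
    have kb: "Kb w \<omega> (us 1) = F.kbar t (us 1) \<omega>" if "F.good \<omega>" for \<omega>
    proof -
      have "Kb w \<omega> (us 1) = (\<integral>u. (a w u * exp (t * G w u \<omega>) * K w u (us 1)) / F.Z t \<omega> \<partial>unif)"
        unfolding Kb_def by (intro Bochner_Integration.integral_cong refl) (simp add: tw_Y(3)[OF w that])
      then show ?thesis by (simp add: F.kbar_def)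
    qed
    have "(\<integral>\<omega>. \<Phi> w us * ((\<alpha> + \<beta> * G w (us 1) \<omega>) * G w (us 1) \<omega>) * tw n w \<omega> us \<partial>P)
      = (\<integral>\<omega>. \<Phi> w us * A w n us * ((\<alpha> + \<beta> * G w (us 1) \<omega>) * G w (us 1) \<omega> * F.Y t ul \<omega>) \<partial>P)"
    proof (rule integral_cong_AE)
      show "AE \<omega> in P. \<Phi> w us * ((\<alpha> + \<beta> * G w (us 1) \<omega>) * G w (us 1) \<omega>) * tw n w \<omega> us
        = \<Phi> w us * A w n us * ((\<alpha> + \<beta> * G w (us 1) \<omega>) * G w (us 1) \<omega> * F.Y t ul \<omega>)"
        using F.AE_good by eventually_elim (simp add: tw_Y(1)[OF w] ul_def ac_simps del: upt_Suc)
    qed measurable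
    also have "\<dots> = \<Phi> w us * A w n us * (\<integral>\<omega>. (\<alpha> + \<beta> * G w (us 1) \<omega>) * G w (us 1) \<omega> * F.Y t ul \<omega> \<partial>P)" by simp
    also have "\<dots> = \<Phi> w us * A w n us * (\<integral>\<omega>. (\<beta> * K w (us 1) (us 1) +
        (\<alpha> + \<beta> * G w (us 1) \<omega>) * (t * ((\<Sum>l\<in>{1..n}. K w (us l) (us 1)) - real n * F.kbar t (us 1) \<omega>))) * F.Y t ul \<omega> \<partial>P)"
      using F.integration_by_parts[OF ul(2,1), of \<alpha> \<beta> t] by (simp only: sK len)
    also have "\<dots> = (\<integral>\<omega>. \<Phi> w us * A w n us * ((\<beta> * K w (us 1) (us 1) +
        (\<alpha> + \<beta> * G w (us 1) \<omega>) * (t * ((\<Sum>l\<in>{1..n}. K w (us l) (us 1)) - real n * F.kbar t (us 1) \<omega>))) * F.Y t ul \<omega>) \<partial>P)" by simp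
    also have "\<dots> = (\<integral>\<omega>. ?r w \<omega> us * tw n w \<omega> us \<partial>P)"
    proof (rule integral_cong_AE)
      show "AE \<omega> in P. \<Phi> w us * A w n us * ((\<beta> * K w (us 1) (us 1) +
        (\<alpha> + \<beta> * G w (us 1) \<omega>) * (t * ((\<Sum>l\<in>{1..n}. K w (us l) (us 1)) - real n * F.kbar t (us 1) \<omega>))) * F.Y t ul \<omega>)
        = ?r w \<omega> us * tw n w \<omega> us"
        using F.AE_good by eventually_elim (simp add: tw_Y(1)[OF w] kb ul_def ac_simps del: upt_Suc)
    qed measurable
    finally show "(\<integral>\<omega>. \<Phi> w us * ((\<alpha> + \<beta> * G w (us 1) \<omega>) * G w (us 1) \<omega>) * tw n w \<omega> us \<partial>P) = (\<integral>\<omega>. ?r w \<omega> us * tw n w \<omega> us \<partial>P)" .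
  qed
qed

text \<open>A Gibbs average inside the expectation is one more replica: the coordinate
  \<open>Suc n\<close>, which \<open>h\<close> ignores, is resampled, and its weight in
  \<open>tw (Suc n)\<close> supplies \<open>\<rho>\<close>.\<close>

lemma T_fresh:
  assumes h: "hmeas h"
    and b: "\<And>w \<omega> us. w \<in> {0..1} \<Longrightarrow> \<omega> \<in> space P \<Longrightarrow> us \<in> space replicas \<Longrightarrow> \<bar>h w \<omega> us\<bar> \<le> c * exp (2 * \<bar>G w (us 1) \<omega>\<bar>)"
    and dep: "\<And>w \<omega> us u. h w \<omega> (us(Suc n := u)) = h w \<omega> us" and n: "1 \<le> n"
    and \<kappa>: "(\<lambda>(w, u, u'). \<kappa> w u u') \<in> borel_measurable (unif \<Otimes>\<^sub>M unif \<Otimes>\<^sub>M unif)"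
    and \<kappa>b: "\<And>w u u'. w \<in> {0..1} \<Longrightarrow> u \<in> {0..1} \<Longrightarrow> u' \<in> {0..1} \<Longrightarrow> \<bar>\<kappa> w u u'\<bar> \<le> 1"
  shows "T (Suc n) (\<lambda>w \<omega> us. h w \<omega> us * \<kappa> w (us (Suc n)) (us 1))
       = T n (\<lambda>w \<omega> us. h w \<omega> us * (\<integral>u. \<kappa> w u (us 1) * \<rho> w \<omega> u \<partial>unif))"
proof -
  note [measurable (raw)] = measurable_3[OF h] measurable_3[OF \<kappa>]
  have [measurable]: "(\<lambda>us. us (Suc n)) \<in> measurable replicas unif" by (intro meas_coord) simp
  define F where "F z = h (fst z) (fst (snd z)) (snd (snd z)) * \<kappa> (fst z) (snd (snd z) (Suc n)) (snd (snd z) 1) * tw (Suc n) (fst z) (fst (snd z)) (snd (snd z))" for z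
  have [measurable]: "F \<in> borel_measurable N3" unfolding F_def by measurable
  have iF: "integrable N3 F"
    unfolding F_def
  proof (rule T_integrable[where c="\<bar>c\<bar>"], measurable)
    fix w :: real and \<omega> us assume a: "w \<in> {0..1}" "\<omega> \<in> space P" "us \<in> space replicas"
    have "\<bar>h w \<omega> us\<bar> \<le> \<bar>c\<bar> * exp (2 * \<bar>G w (us 1) \<omega>\<bar>)" using b[OF a] by (rule order_trans) (intro mult_right_mono, auto)
    from abs_mult_le_real[OF this \<kappa>b[OF a(1) replicas_space[OF a(3)] replicas_space[OF a(3)], of "Suc n" 1]]
    show "\<bar>h w \<omega> us * \<kappa> w (us (Suc n)) (us 1)\<bar> \<le> \<bar>c\<bar> * exp (2 * \<bar>G w (us 1) \<omega>\<bar>)" by simp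
  qed
  define f where "f z = (fst (fst z), fst (snd (fst z)), (snd (snd (fst z)))(Suc n := snd z))" for z :: "(real \<times> 'a \<times> (nat \<Rightarrow> real)) \<times> real"
  have pf: "preserving (N3 \<Otimes>\<^sub>M unif) N3 f"
  proof -
    have 1: "preserving (replicas \<Otimes>\<^sub>M unif) replicas (\<lambda>z. (fst z)(Suc n := snd z))"
      by (rule preserving_upd[OF unif.prob_space_axioms]) simp
    have 2: "preserving ((P \<Otimes>\<^sub>M replicas) \<Otimes>\<^sub>M unif) (P \<Otimes>\<^sub>M replicas) (\<lambda>z. (fst (fst z), (snd (fst z))(Suc n := snd z)))"
      using preserving_under_product[OF P.prob_space_axioms R.prob_space_axioms unif.prob_space_axioms 1] by simp
    show ?thesis
      using preserving_under_product[OF unif.prob_space_axioms PR.prob_space_axioms unif.prob_space_axioms 2] by (simp add: f_def[abs_def])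
  qed
  interpret NU: pair_prob_space N3 unif ..
  have iFf: "integrable (N3 \<Otimes>\<^sub>M unif) (\<lambda>z. F (f z))"
    using pf iF integrable_distr_eq[of f "N3 \<Otimes>\<^sub>M unif" N3 F] by (simp add: preserving_def)
  have tws: "tw (Suc n) w \<omega> (us(Suc n := u)) = tw n w \<omega> us * \<rho> w \<omega> u" for w \<omega> us u
  proof -
    have "(\<Prod>l\<in>{1..n}. \<rho> w \<omega> ((us(Suc n := u)) l)) = (\<Prod>l\<in>{1..n}. \<rho> w \<omega> (us l))"
      by (intro prod.cong) auto
    then show ?thesis by (simp add: tw_def atLeastAtMostSuc_conv mult.commute)
  qed
  have Ff: "F (f (z, u)) = h (fst z) (fst (snd z)) (snd (snd z)) * tw n (fst z) (fst (snd z)) (snd (snd z)) * (\<kappa> (fst z) u (snd (snd z) 1) * \<rho> (fst z) (fst (snd z)) u)" for z u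
    using n by (simp add: F_def f_def dep tws ac_simps)
  have "T (Suc n) (\<lambda>w \<omega> us. h w \<omega> us * \<kappa> w (us (Suc n)) (us 1)) = (\<integral>z. F z \<partial>N3)" by (simp add: T_def F_def)
  also have "\<dots> = (\<integral>z. F (f z) \<partial>(N3 \<Otimes>\<^sub>M unif))" by (rule preserving_integral[OF pf, symmetric]) measurable
  also have "\<dots> = (\<integral>z. (\<integral>u. F (f (z, u)) \<partial>unif) \<partial>N3)" by (rule NU.integral_fst'[OF iFf, symmetric])
  also have "\<dots> = T n (\<lambda>w \<omega> us. h w \<omega> us * (\<integral>u. \<kappa> w u (us 1) * \<rho> w \<omega> u \<partial>unif))"
    unfolding Ff T_def by (rule Bochner_Integration.integral_cong[OF refl], simp only: integral_mult_right_zero, simp only: ac_simps)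
  finally show ?thesis .
qed

lemma T_Suc:
  assumes h: "hmeas h"
    and b: "\<And>w \<omega> us. w \<in> {0..1} \<Longrightarrow> \<omega> \<in> space P \<Longrightarrow> us \<in> space replicas \<Longrightarrow> \<bar>h w \<omega> us\<bar> \<le> c * exp (2 * \<bar>G w (us 1) \<omega>\<bar>)"
    and dep: "\<And>w \<omega> us u. h w \<omega> (us(Suc n := u)) = h w \<omega> us" and n: "1 \<le> n"
  shows "T (Suc n) h = T n h"
proof -
  have "T (Suc n) (\<lambda>w \<omega> us. h w \<omega> us * (\<lambda>_ _ _. 1) w (us (Suc n)) (us 1)) = T n (\<lambda>w \<omega> us. h w \<omega> us * (\<integral>u. (\<lambda>_ _ _. 1) w u (us 1) * \<rho> w \<omega> u \<partial>unif))"
    by (rule T_fresh[OF h b dep n]) auto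
  also have "\<dots> = T n h"
    unfolding T_def by (intro Bochner_Integration.integral_cong refl) (auto simp: \<rho>_integral space_pair_measure)
  finally show ?thesis by simp
qed

end

section \<open>Rearranging product spaces and integrating out \<open>z\<close>\<close>

lemma preserving_assoc:
  assumes "prob_space A" "prob_space B" "prob_space C"
  shows "preserving (A \<Otimes>\<^sub>M (B \<Otimes>\<^sub>M C)) ((A \<Otimes>\<^sub>M B) \<Otimes>\<^sub>M C) (\<lambda>z. ((fst z, fst (snd z)), snd (snd z)))"
proof -
  interpret A: prob_space A by fact
  interpret B: prob_space B by fact
  interpret C: prob_space C by fact
  interpret BC: pair_prob_space B C ..
  let ?f = "\<lambda>z. ((fst z, fst (snd z)), snd (snd z))"
  have m: "?f \<in> measurable (A \<Otimes>\<^sub>M (B \<Otimes>\<^sub>M C)) ((A \<Otimes>\<^sub>M B) \<Otimes>\<^sub>M C)" by measurable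
  have "distr (A \<Otimes>\<^sub>M (B \<Otimes>\<^sub>M C)) ((A \<Otimes>\<^sub>M B) \<Otimes>\<^sub>M C) ?f = (A \<Otimes>\<^sub>M B) \<Otimes>\<^sub>M C"
  proof (rule measure_eqI)
    fix E assume "E \<in> sets (distr (A \<Otimes>\<^sub>M (B \<Otimes>\<^sub>M C)) ((A \<Otimes>\<^sub>M B) \<Otimes>\<^sub>M C) ?f)"
    then have E [measurable]: "E \<in> sets ((A \<Otimes>\<^sub>M B) \<Otimes>\<^sub>M C)" by simp
    have "emeasure (distr (A \<Otimes>\<^sub>M (B \<Otimes>\<^sub>M C)) ((A \<Otimes>\<^sub>M B) \<Otimes>\<^sub>M C) ?f) E = (\<integral>\<^sup>+z. indicator E (?f z) \<partial>(A \<Otimes>\<^sub>M (B \<Otimes>\<^sub>M C)))"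
      by (subst nn_integral_indicator[symmetric], simp, subst nn_integral_distr[OF m]) auto
    also have "\<dots> = (\<integral>\<^sup>+x. (\<integral>\<^sup>+y. indicator E ((x, fst y), snd y) \<partial>(B \<Otimes>\<^sub>M C)) \<partial>A)"
      by (subst BC.nn_integral_fst[symmetric]) auto
    also have "\<dots> = (\<integral>\<^sup>+x. (\<integral>\<^sup>+y. (\<integral>\<^sup>+z. indicator E ((x, y), z) \<partial>C) \<partial>B) \<partial>A)"
    proof (rule nn_integral_cong)
      fix x assume [measurable]: "x \<in> space A"
      show "(\<integral>\<^sup>+y. indicator E ((x, fst y), snd y) \<partial>(B \<Otimes>\<^sub>M C)) = (\<integral>\<^sup>+y. (\<integral>\<^sup>+z. indicator E ((x, y), z) \<partial>C) \<partial>B)"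
        by (subst C.nn_integral_fst[symmetric]) auto
    qed
    also have "\<dots> = (\<integral>\<^sup>+p. (\<integral>\<^sup>+z. indicator E (p, z) \<partial>C) \<partial>(A \<Otimes>\<^sub>M B))"
      by (subst B.nn_integral_fst[symmetric]) auto
    also have "\<dots> = emeasure ((A \<Otimes>\<^sub>M B) \<Otimes>\<^sub>M C) E"
      by (subst C.nn_integral_fst) auto
    finally show "emeasure (distr (A \<Otimes>\<^sub>M (B \<Otimes>\<^sub>M C)) ((A \<Otimes>\<^sub>M B) \<Otimes>\<^sub>M C) ?f) E = emeasure ((A \<Otimes>\<^sub>M B) \<Otimes>\<^sub>M C) E" .
  qed simp
  with m show ?thesis by (simp add: preserving_def)
qed

lemma preserving_AE: "preserving M N f \<Longrightarrow> AE x in N. Q x \<Longrightarrow> AE x in M. Q (f x)"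
  unfolding preserving_def using AE_distrD[of f M N Q] by metis

lemma preserving_integrable:
  fixes h :: "'b \<Rightarrow> real"
  assumes "preserving M N f" "h \<in> borel_measurable N"
  shows "integrable M (\<lambda>x. h (f x)) \<longleftrightarrow> integrable N h"
  using assms integrable_distr_eq[of f M N h] by (simp add: preserving_def)

lemma integrable_std_gauss_shift:
  fixes f :: "real \<Rightarrow> real"
  assumes [measurable]: "f \<in> borel_measurable borel"
  shows "integrable std_gauss (\<lambda>x. f x * exp (c * x - c\<^sup>2 / 2)) \<longleftrightarrow> integrable std_gauss (\<lambda>x. f (x + c))"
proof -
  have "integrable std_gauss (\<lambda>x. f x * exp (c * x - c\<^sup>2 / 2)) \<longleftrightarrow> integrable lborel (\<lambda>x. std_normal_density x * (f x * exp (c * x - c\<^sup>2 / 2)))"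
    unfolding std_gauss_def by (subst integrable_density) auto
  also have "\<dots> \<longleftrightarrow> integrable lborel (\<lambda>x. std_normal_density (c + 1 * x) * (f (c + 1 * x) * exp (c * (c + 1 * x) - c\<^sup>2 / 2)))"
    by (rule lborel_integrable_real_affine_iff[of 1, symmetric]) simp
  also have "(\<lambda>x. std_normal_density (c + 1 * x) * (f (c + 1 * x) * exp (c * (c + 1 * x) - c\<^sup>2 / 2))) = (\<lambda>x. std_normal_density x * f (x + c))"
  proof
    fix x
    have "std_normal_density (c + x) * exp (c * (c + x) - c\<^sup>2 / 2) = std_normal_density x"
      by (simp add: std_normal_density_def exp_add[symmetric] power2_eq_square field_simps)
    then show "std_normal_density (c + 1 * x) * (f (c + 1 * x) * exp (c * (c + 1 * x) - c\<^sup>2 / 2)) = std_normal_density x * f (x + c)"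
      by (simp add: ac_simps)
  qed
  also have "integrable lborel (\<lambda>x. std_normal_density x * f (x + c)) \<longleftrightarrow> integrable std_gauss (\<lambda>x. f (x + c))"
    unfolding std_gauss_def by (subst integrable_density) auto
  finally show ?thesis .
qed

text \<open>The weight \<open>exp (t * y z)\<close> translates \<open>z\<close> by
  \<open>t * sqrt s\<close>, so under it \<open>y\<close> has mean \<open>x + t * s\<close> and
  variance \<open>s\<close>. This is the origin of the field \<open>H = G + t * s2\<close> and of
  the summand \<open>s2\<close> in the second moment.\<close>

lemma std_gauss_tilted_moments:
  fixes t x s :: real
  assumes s: "0 \<le> s"
  defines "e \<equiv> exp (t * x) * exp (t\<^sup>2 * s / 2)" and "y \<equiv> \<lambda>z. x + z * sqrt s"
  shows "(\<integral>z. exp (t * y z) \<partial>std_gauss) = e" "integrable std_gauss (\<lambda>z. exp (t * y z))"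
    and "(\<integral>z. y z * exp (t * y z) \<partial>std_gauss) = e * (x + t * s)" "integrable std_gauss (\<lambda>z. y z * exp (t * y z))"
    and "(\<integral>z. (y z)\<^sup>2 * exp (t * y z) \<partial>std_gauss) = e * ((x + t * s)\<^sup>2 + s)" "integrable std_gauss (\<lambda>z. (y z)\<^sup>2 * exp (t * y z))"
proof -
  define c where "c = t * sqrt s"
  have c2: "c\<^sup>2 = t\<^sup>2 * s" using s by (simp add: c_def power_mult_distrib)
  have sc: "c * sqrt s = t * s" using s by (simp add: c_def mult.assoc)
  have ex: "exp (t * y z) = e * exp (c * z - c\<^sup>2 / 2)" for z
    unfolding e_def y_def c2 by (simp add: c_def exp_add[symmetric] algebra_simps)
  have sh: "y (z + c) = (x + t * s) + sqrt s * z" for z using sc by (simp add: y_def algebra_simps)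
  have gen: "(\<integral>z. f z * exp (t * y z) \<partial>std_gauss) = e * (\<integral>z. f (z + c) \<partial>std_gauss)"
    "integrable std_gauss (\<lambda>z. f z * exp (t * y z)) \<longleftrightarrow> integrable std_gauss (\<lambda>z. f (z + c))"
    if [measurable]: "f \<in> borel_measurable borel" for f :: "real \<Rightarrow> real"
  proof -
    have r: "f z * exp (t * y z) = e * (f z * exp (c * z - c\<^sup>2 / 2))" for z unfolding ex by (simp add: ac_simps)
    have e0: "e \<noteq> 0" by (simp add: e_def)
    show "(\<integral>z. f z * exp (t * y z) \<partial>std_gauss) = e * (\<integral>z. f (z + c) \<partial>std_gauss)"
      unfolding r using integral_std_gauss_shift[of f c] by simp
    show "integrable std_gauss (\<lambda>z. f z * exp (t * y z)) \<longleftrightarrow> integrable std_gauss (\<lambda>z. f (z + c))"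
      unfolding r using integrable_std_gauss_shift[of f c] e0 by simp
  qed
  have [measurable]: "y \<in> borel_measurable borel" unfolding y_def by measurable
  note mo = std_gauss_moments
  have one: "(\<integral>z. k \<partial>std_gauss) = k" for k :: real using SG.prob_space by simp
  show "(\<integral>z. exp (t * y z) \<partial>std_gauss) = e" "integrable std_gauss (\<lambda>z. exp (t * y z))"
    using gen[of "\<lambda>_. 1"] one[of 1] by simp_all
  have i1: "integrable std_gauss (\<lambda>z. (x + t * s) + sqrt s * z)" using mo by auto
  have "(\<integral>z. (x + t * s) + sqrt s * z \<partial>std_gauss) = (x + t * s) + sqrt s * 0"
    using mo one by (subst Bochner_Integration.integral_add) auto
  then show "(\<integral>z. y z * exp (t * y z) \<partial>std_gauss) = e * (x + t * s)" "integrable std_gauss (\<lambda>z. y z * exp (t * y z))"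
    using gen[of y] i1 by (simp_all only: sh) auto
  have sq: "((x + t * s) + sqrt s * z)\<^sup>2 = (x + t * s)\<^sup>2 + (2 * (x + t * s) * sqrt s) * z + s * z\<^sup>2" for z
    using s by (simp add: power2_sum power_mult_distrib)
  have i2: "integrable std_gauss (\<lambda>z. (x + t * s)\<^sup>2 + (2 * (x + t * s) * sqrt s) * z + s * z\<^sup>2)"
    using mo by (intro Bochner_Integration.integrable_add integrable_mult_right) auto
  have "(\<integral>z. (x + t * s)\<^sup>2 + (2 * (x + t * s) * sqrt s) * z + s * z\<^sup>2 \<partial>std_gauss) = (x + t * s)\<^sup>2 + (2 * (x + t * s) * sqrt s) * 0 + s * 1"
  proof -
    have j: "integrable std_gauss (\<lambda>z. (x + t * s)\<^sup>2)" "integrable std_gauss (\<lambda>z. (2 * (x + t * s) * sqrt s) * z)" "integrable std_gauss (\<lambda>z. s * z\<^sup>2)"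
      using mo by (auto intro!: integrable_mult_right)
    show ?thesis
      by (simp only: Bochner_Integration.integral_add[OF Bochner_Integration.integrable_add[OF j(1,2)] j(3)]
          Bochner_Integration.integral_add[OF j(1,2)] one integral_mult_right_zero mo)
  qed
  then show "(\<integral>z. (y z)\<^sup>2 * exp (t * y z) \<partial>std_gauss) = e * ((x + t * s)\<^sup>2 + s)" "integrable std_gauss (\<lambda>z. (y z)\<^sup>2 * exp (t * y z))"
    using gen[of "\<lambda>z. (y z)\<^sup>2"] i2 by (simp_all only: sh sq) auto
qed

context spin begin

lemma randomness_pos: "randomness P = unif \<Otimes>\<^sub>M P \<Otimes>\<^sub>M unif \<Otimes>\<^sub>M std_gauss \<Otimes>\<^sub>M replicas \<Otimes>\<^sub>M replicas"
  by (simp add: randomness_def pos_def)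

lemmas prob_spaces = unif.prob_space_axioms P.prob_space_axioms SG.prob_space_axioms R.prob_space_axioms prob_space_pair

lemma proj_wus: "preserving (randomness P) (unif \<Otimes>\<^sub>M replicas) (\<lambda>(w, \<omega>, u, z, us, vs). (w, us))"
proof -
  have "preserving (P \<Otimes>\<^sub>M unif \<Otimes>\<^sub>M std_gauss \<Otimes>\<^sub>M replicas \<Otimes>\<^sub>M replicas) replicas (\<lambda>y. fst (snd (snd (snd y))))"
    by (rule preserving_compose[OF preserving_snd preserving_compose[OF preserving_snd preserving_compose[OF preserving_snd preserving_fst]]]; intro prob_spaces)
  from preserving_prod[OF preserving_id this R.prob_space_axioms] show ?thesis
    by (simp add: randomness_pos case_prod_unfold)
qed

lemma proj_w\<omega>vs: "preserving (randomness P) N3 (\<lambda>(w, \<omega>, u, z, us, vs). (w, \<omega>, vs))"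
proof -
  have "preserving (unif \<Otimes>\<^sub>M std_gauss \<Otimes>\<^sub>M replicas \<Otimes>\<^sub>M replicas) replicas (\<lambda>y. snd (snd (snd y)))"
    by (rule preserving_compose[OF preserving_snd preserving_compose[OF preserving_snd preserving_snd]]; intro prob_spaces)
  from preserving_prod[OF preserving_id preserving_prod[OF preserving_id this R.prob_space_axioms] PR.prob_space_axioms] show ?thesis
    by (simp add: randomness_pos case_prod_unfold)
qed

lemma proj_w\<omega>uz: "preserving (randomness P) ((unif \<Otimes>\<^sub>M P \<Otimes>\<^sub>M unif) \<Otimes>\<^sub>M std_gauss) (\<lambda>(w, \<omega>, u, z, us, vs). ((w, \<omega>, u), z))"
proof -
  have 1: "preserving (std_gauss \<Otimes>\<^sub>M replicas \<Otimes>\<^sub>M replicas) std_gauss fst" by (intro preserving_fst prob_spaces)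
  have 2: "preserving (unif \<Otimes>\<^sub>M std_gauss \<Otimes>\<^sub>M replicas \<Otimes>\<^sub>M replicas) (unif \<Otimes>\<^sub>M std_gauss) (\<lambda>y. (fst y, fst (snd y)))"
    by (rule preserving_prod[OF preserving_id 1]) (intro prob_spaces)
  have 3: "preserving (P \<Otimes>\<^sub>M unif \<Otimes>\<^sub>M std_gauss \<Otimes>\<^sub>M replicas \<Otimes>\<^sub>M replicas) (P \<Otimes>\<^sub>M unif \<Otimes>\<^sub>M std_gauss) (\<lambda>y. (fst y, fst (snd y), fst (snd (snd y))))"
    using preserving_prod[OF preserving_id 2, of P] by (simp add: prob_spaces)
  have 4: "preserving (P \<Otimes>\<^sub>M unif \<Otimes>\<^sub>M std_gauss \<Otimes>\<^sub>M replicas \<Otimes>\<^sub>M replicas) ((P \<Otimes>\<^sub>M unif) \<Otimes>\<^sub>M std_gauss) (\<lambda>y. ((fst y, fst (snd y)), fst (snd (snd y))))"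
    using preserving_compose[OF 3 preserving_assoc[OF P.prob_space_axioms unif.prob_space_axioms SG.prob_space_axioms]] by simp
  have 5: "preserving (randomness P) (unif \<Otimes>\<^sub>M (P \<Otimes>\<^sub>M unif) \<Otimes>\<^sub>M std_gauss) (\<lambda>x. (fst x, (fst (snd x), fst (snd (snd x))), fst (snd (snd (snd x)))))"
    using preserving_prod[OF preserving_id 4, of unif] by (simp add: prob_spaces randomness_pos)
  show ?thesis
    using preserving_compose[OF 5 preserving_assoc[OF unif.prob_space_axioms prob_space_pair[OF P.prob_space_axioms unif.prob_space_axioms] SG.prob_space_axioms]]
    by (simp add: case_prod_unfold)
qed

lemma proj_N3: "preserving N3 (unif \<Otimes>\<^sub>M P \<Otimes>\<^sub>M unif) (\<lambda>z. (fst z, fst (snd z), snd (snd z) 1))"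
proof -
  have "preserving replicas unif (\<lambda>us. us 1)"
    unfolding preserving_def using distr_PiM_component[of pos "\<lambda>_. unif" 1] by (simp add: prob_spaces)
  from preserving_prod[OF preserving_id preserving_prod[OF preserving_id this unif.prob_space_axioms] prob_space_pair[OF P.prob_space_axioms unif.prob_space_axioms], of unif]
  show ?thesis by (simp add: prob_spaces)
qed

end

lemma Fubini_nonneg:
  fixes b :: "'a \<times> 'b \<Rightarrow> real"
  assumes "prob_space M" "prob_space N" and b [measurable]: "b \<in> borel_measurable (M \<Otimes>\<^sub>M N)"
    and nn: "\<And>x y. 0 \<le> b (x, y)"
    and sec: "AE x in M. integrable N (\<lambda>y. b (x, y)) \<and> (\<integral>y. b (x, y) \<partial>N) = m x" and m: "integrable M m"
  shows "integrable (M \<Otimes>\<^sub>M N) b"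
proof -
  interpret M: prob_space M by fact
  interpret N: prob_space N by fact
  interpret pair_prob_space M N ..
  have [measurable]: "m \<in> borel_measurable M" using m by simp
  show ?thesis
  proof (rule Fubini_integrable[OF b])
    have "integrable M (\<lambda>x. \<integral>y. b (x, y) \<partial>N) \<longleftrightarrow> integrable M m"
      using sec by (intro integrable_cong_AE) auto
    then show "integrable M (\<lambda>x. \<integral>y. norm (b (x, y)) \<partial>N)" using m nn by simp
    show "AE x in M. integrable N (\<lambda>y. b (x, y))" using sec by auto
  qed
qed

context tilt begin

definition H :: "real \<Rightarrow> real \<Rightarrow> 'a \<Rightarrow> real" where "H w u \<omega> = G w u \<omega> + t * s2 w u"

lemma G_field_eq: "G_field \<sigma> g p w \<omega> u z = G w u \<omega> + z * sqrt (s2 w u)"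
  by (simp add: G_field_def G_def s2_def K_def)

text \<open>For fixed \<open>u\<close> the integral over \<open>z\<close> turns the weight into
  \<open>a w u * exp (t * G w u \<omega>)\<close>, that is, \<open>\<rho>\<close> times the
  partition function.\<close>

lemma E'_weighted:
  assumes w: "w \<in> {0..1}" and \<omega>: "\<omega> \<in> space P" and Zf: "0 < Zf w \<omega>"
    and \<psi> [measurable]: "\<psi> \<in> borel_measurable unif" and b: "\<And>u. u \<in> {0..1} \<Longrightarrow> \<bar>\<psi> u\<bar> \<le> 1"
  shows "E' (\<lambda>u z. \<psi> u * exp (t * G_field \<sigma> g p w \<omega> u z)) = (\<integral>u. \<psi> u * \<rho> w \<omega> u \<partial>unif) * Zf w \<omega>"
proof -
  interpret US: pair_prob_space unif std_gauss ..
  have [measurable]: "w \<in> space unif" "\<omega> \<in> space P" using w \<omega> by auto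
  let ?e = "\<lambda>v. exp (t * (G w (fst v) \<omega> + snd v * sqrt (s2 w (fst v))))"
  have sec: "integrable std_gauss (\<lambda>z. ?e (u, z))" "(\<integral>z. ?e (u, z) \<partial>std_gauss) = a w u * exp (t * G w u \<omega>)" if "u \<in> {0..1}" for u
    using std_gauss_tilted_moments(1,2)[OF s2_bounds(1)[OF w that], of t "G w u \<omega>"] by (simp_all add: a_def mult.commute)
  have iZ: "integrable unif (\<lambda>u. a w u * exp (t * G w u \<omega>))"
    using Zf not_integrable_integral_eq unfolding Zf_def by force
  have ie: "integrable (unif \<Otimes>\<^sub>M std_gauss) ?e"
  proof (rule Fubini_nonneg[OF unif.prob_space_axioms SG.prob_space_axioms _ _ _ iZ])
    show "AE u in unif. integrable std_gauss (\<lambda>z. ?e (u, z)) \<and> (\<integral>z. ?e (u, z) \<partial>std_gauss) = a w u * exp (t * G w u \<omega>)"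
      by (intro AE_I2 conjI sec) auto
  qed auto
  have i: "integrable (unif \<Otimes>\<^sub>M std_gauss) (\<lambda>v. \<psi> (fst v) * ?e v)"
  proof (rule Bochner_Integration.integrable_bound[OF ie])
    show "AE v in unif \<Otimes>\<^sub>M std_gauss. norm (\<psi> (fst v) * ?e v) \<le> norm (?e v)"
      using b by (intro AE_I2) (auto simp: space_pair_measure abs_mult intro!: mult_left_le_one_le)
  qed measurable
  have "E' (\<lambda>u z. \<psi> u * exp (t * G_field \<sigma> g p w \<omega> u z)) = (\<integral>v. \<psi> (fst v) * ?e v \<partial>(unif \<Otimes>\<^sub>M std_gauss))"
    by (simp add: E'_def G_field_eq case_prod_unfold)
  also have "\<dots> = (\<integral>u. (\<integral>z. \<psi> u * ?e (u, z) \<partial>std_gauss) \<partial>unif)"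
    using US.integral_fst'[OF i] by simp
  also have "\<dots> = (\<integral>u. \<psi> u * \<rho> w \<omega> u * Zf w \<omega> \<partial>unif)"
    using Zf by (intro Bochner_Integration.integral_cong[OF refl]) (simp only: integral_mult_right_zero, simp add: sec(2)[simplified] \<rho>_def)
  finally show ?thesis by simp
qed

lemma E'_plain:
  assumes "\<psi> \<in> borel_measurable unif" shows "E' (\<lambda>u z. \<psi> u) = (\<integral>u. \<psi> u \<partial>unif)"
  using preserving_integral[OF preserving_fst[OF SG.prob_space_axioms] assms] by (simp add: E'_def case_prod_unfold)

lemma E'_partition:
  assumes "w \<in> {0..1}" "\<omega> \<in> space P" "0 < Zf w \<omega>"
  shows "E' (\<lambda>u z. exp (t * G_field \<sigma> g p w \<omega> u z)) = Zf w \<omega>"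
  using E'_weighted[OF assms, of "\<lambda>_. 1"] \<rho>_integral(2)[OF assms(1,2)] by simp

lemma AE_Zf: "AE x in D2. 0 < Zf (fst x) (snd x)"
proof (rule D2.AE_pair_measure)
  show "AE w in unif. AE \<omega> in P. 0 < Zf (fst (w, \<omega>)) (snd (w, \<omega>))"
  proof (rule AE_I2)
    fix w assume "w \<in> space unif"
    then have w: "w \<in> {0..1}" by simp
    show "AE \<omega> in P. 0 < Zf (fst (w, \<omega>)) (snd (w, \<omega>))" using AE_good'[OF w] by eventually_elim (simp add: tw_Y(2)[OF w])
  qed
qed measurable

lemma H_bound:
  assumes "w \<in> {0..1}" "u \<in> {0..1}"
  shows "\<bar>H w u \<omega>\<bar> \<le> (1 + \<bar>t\<bar>) * exp (2 * \<bar>G w u \<omega>\<bar>)"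
    and "\<bar>(H w u \<omega>)\<^sup>2 + s2 w u\<bar> \<le> ((1 + \<bar>t\<bar>)\<^sup>2 + 1) * exp (2 * \<bar>G w u \<omega>\<bar>)"
proof -
  let ?e = "exp \<bar>G w u \<omega>\<bar>"
  have s: "0 \<le> s2 w u" "s2 w u \<le> 1" using s2_bounds[OF assms] by auto
  have e: "1 \<le> ?e" "\<bar>G w u \<omega>\<bar> \<le> ?e" by (rule abs_le_exp)+
  have e2: "exp (2 * \<bar>G w u \<omega>\<bar>) = ?e\<^sup>2" by (simp add: power2_eq_square exp_add[symmetric])
  have le: "?e \<le> ?e\<^sup>2" "1 \<le> ?e\<^sup>2" using e(1) by (simp_all add: self_le_power)
  have "\<bar>t * s2 w u\<bar> \<le> \<bar>t\<bar> * ?e" using s order_trans[OF s(2) e(1)] by (auto simp: abs_mult intro!: mult_left_mono)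
  then have 1: "\<bar>H w u \<omega>\<bar> \<le> (1 + \<bar>t\<bar>) * ?e" using e(2) unfolding H_def by (simp add: algebra_simps)
  also have "\<dots> \<le> (1 + \<bar>t\<bar>) * ?e\<^sup>2" using le by (intro mult_left_mono) auto
  finally show "\<bar>H w u \<omega>\<bar> \<le> (1 + \<bar>t\<bar>) * exp (2 * \<bar>G w u \<omega>\<bar>)" by (simp add: e2)
  have "(H w u \<omega>)\<^sup>2 \<le> (1 + \<bar>t\<bar>)\<^sup>2 * ?e\<^sup>2" using 1 by (metis abs_ge_zero power2_abs power_mono power_mult_distrib)
  moreover have "s2 w u \<le> ?e\<^sup>2" using s le by linarith
  ultimately show "\<bar>(H w u \<omega>)\<^sup>2 + s2 w u\<bar> \<le> ((1 + \<bar>t\<bar>)\<^sup>2 + 1) * exp (2 * \<bar>G w u \<omega>\<bar>)"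
    using s unfolding e2 distrib_right by simp
qed

lemma meas_H: "(\<lambda>(w, u, \<omega>). H w u \<omega>) \<in> borel_measurable (unif \<Otimes>\<^sub>M unif \<Otimes>\<^sub>M P)"
  unfolding H_def by measurable

lemmas meas_H' [measurable (raw)] = measurable_3[OF meas_H]

text \<open>For \<open>k \<le> 2\<close>, the mean over \<open>z\<close> of the \<open>k\<close>-th
  power of the field under the tilted weight. The case \<open>k = 0\<close> is included because the
  even powers together dominate the first one.\<close>

definition tilted :: "nat \<Rightarrow> real \<Rightarrow> 'a \<Rightarrow> real \<Rightarrow> real" where
  "tilted k w \<omega> u = (if k = 0 then 1 else if k = 1 then H w u \<omega> else (H w u \<omega>)\<^sup>2 + s2 w u)"

lemma meas_tilted: "(\<lambda>(w, \<omega>, u). tilted k w \<omega> u) \<in> borel_measurable (unif \<Otimes>\<^sub>M P \<Otimes>\<^sub>M unif)"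
  unfolding tilted_def by measurable

lemmas meas_tilted' [measurable (raw)] = measurable_3[OF meas_tilted]

lemma tilted_T:
  defines "F k \<equiv> \<lambda>x. tilted k (fst x) (fst (snd x)) (snd (snd x)) * \<rho> (fst x) (fst (snd x)) (snd (snd x))"
  shows "integrable (unif \<Otimes>\<^sub>M P \<Otimes>\<^sub>M unif) (F k)"
    and "(\<integral>x. F k x \<partial>(unif \<Otimes>\<^sub>M P \<Otimes>\<^sub>M unif)) = T 1 (\<lambda>w \<omega> us. tilted k w \<omega> (us 1))"
proof -
  have [measurable]: "F k \<in> borel_measurable (unif \<Otimes>\<^sub>M P \<Otimes>\<^sub>M unif)" unfolding F_def by measurable
  have eq: "F k (fst z, fst (snd z), snd (snd z) 1) = tilted k (fst z) (fst (snd z)) (snd (snd z) 1) * tw 1 (fst z) (fst (snd z)) (snd (snd z))" for z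
    by (simp add: F_def tw_def)
  have b: "\<bar>tilted k w \<omega> u\<bar> \<le> ((1 + \<bar>t\<bar>)\<^sup>2 + 1) * exp (2 * \<bar>G w u \<omega>\<bar>)" if "w \<in> {0..1}" "u \<in> {0..1}" for w \<omega> u
  proof -
    have c: "1 + \<bar>t\<bar> \<le> (1 + \<bar>t\<bar>)\<^sup>2" by (rule self_le_power) auto
    have "\<bar>H w u \<omega>\<bar> \<le> ((1 + \<bar>t\<bar>)\<^sup>2 + 1) * exp (2 * \<bar>G w u \<omega>\<bar>)"
      using H_bound(1)[OF that, of \<omega>] c by (elim order_trans) (intro mult_right_mono, auto)
    moreover have "1 * 1 \<le> ((1 + \<bar>t\<bar>)\<^sup>2 + 1) * exp (2 * \<bar>G w u \<omega>\<bar>)" by (intro mult_mono) auto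
    ultimately show ?thesis using H_bound(2)[OF that, of \<omega>] by (simp add: tilted_def)
  qed
  have "integrable N3 (\<lambda>z. F k (fst z, fst (snd z), snd (snd z) 1))"
    unfolding eq
  proof (rule T_integrable[where h="\<lambda>w \<omega> us. tilted k w \<omega> (us 1)"])
    show "\<bar>tilted k w \<omega> (us 1)\<bar> \<le> ((1 + \<bar>t\<bar>)\<^sup>2 + 1) * exp (2 * \<bar>G w (us 1) \<omega>\<bar>)" if "w \<in> {0..1}" "us \<in> space replicas" for w \<omega> us
      by (rule b[OF that(1) replicas_space[OF that(2)]]) simp
  qed measurable
  then show "integrable (unif \<Otimes>\<^sub>M P \<Otimes>\<^sub>M unif) (F k)" using preserving_integrable[OF proj_N3, of "F k"] by simp
  show "(\<integral>x. F k x \<partial>(unif \<Otimes>\<^sub>M P \<Otimes>\<^sub>M unif)) = T 1 (\<lambda>w \<omega> us. tilted k w \<omega> (us 1))"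
    using preserving_integral[OF proj_N3, of "F k"] by (simp add: eq T_def)
qed

text \<open>Almost surely the denominator is the positive number \<open>Zf\<close>; integrating
  \<open>z\<close> first then leaves \<open>tilted\<close> weighted by \<open>\<rho>\<close>, which
  is the average over a single replica.\<close>

lemma tilted_moment_T:
  assumes k: "k \<le> 2" shows "tilted_moment \<sigma> P g p t k = T 1 (\<lambda>w \<omega> us. tilted k w \<omega> (us 1))"
proof -
  let ?X = "unif \<Otimes>\<^sub>M P \<Otimes>\<^sub>M unif"
  interpret X: prob_space ?X by (intro prob_spaces)
  interpret XS: pair_prob_space ?X std_gauss ..
  interpret US: pair_prob_space unif std_gauss ..
  define y where "y v = G (fst (fst v)) (snd (snd (fst v))) (fst (snd (fst v))) + snd v * sqrt (s2 (fst (fst v)) (snd (snd (fst v))))" for v :: "(real \<times> 'a \<times> real) \<times> real"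
  define q where "q x = E' (\<lambda>u z. exp (t * G_field \<sigma> g p (fst x) (snd x) u z))" for x
  define b where "b k v = y v ^ k * exp (t * y v) / Zf (fst (fst v)) (fst (snd (fst v)))" for k v
  have [measurable]: "y \<in> borel_measurable (?X \<Otimes>\<^sub>M std_gauss)" unfolding y_def by measurable
  have [measurable]: "q \<in> borel_measurable D2" unfolding q_def E'_def G_field_eq case_prod_unfold by measurable
  have [measurable]: "b k \<in> borel_measurable (?X \<Otimes>\<^sub>M std_gauss)" for k unfolding b_def by measurable
  have Zf0: "0 \<le> Zf w \<omega>" for w \<omega> unfolding Zf_def by (simp add: a_def)
  have pX: "preserving ?X D2 (\<lambda>x. (fst x, fst (snd x)))"
    by (rule preserving_prod[OF preserving_id preserving_fst]; intro prob_spaces)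
  have AEX: "AE x in ?X. 0 < Zf (fst x) (fst (snd x))" using preserving_AE[OF pX AE_Zf] by simp
  have AEXS: "AE v in ?X \<Otimes>\<^sub>M std_gauss. 0 < Zf (fst (fst v)) (fst (snd (fst v)))"
    by (rule preserving_AE[OF preserving_fst[OF SG.prob_space_axioms] AEX])
  have "tilted_moment \<sigma> P g p t k = (\<integral>v. y v ^ k * exp (t * y v) / q (fst (fst v), fst (snd (fst v))) \<partial>(?X \<Otimes>\<^sub>M std_gauss))"
  proof (subst preserving_integral[OF proj_w\<omega>uz, symmetric])
    show "tilted_moment \<sigma> P g p t k = (\<integral>x. (\<lambda>v. y v ^ k * exp (t * y v) / q (fst (fst v), fst (snd (fst v)))) ((\<lambda>(w, \<omega>, u, z, us, vs). ((w, \<omega>, u), z)) x) \<partial>randomness P)"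
      unfolding tilted_moment_def y_def q_def G_field_eq by (simp add: case_prod_unfold)
  qed measurable
  also have "\<dots> = (\<integral>v. b k v \<partial>(?X \<Otimes>\<^sub>M std_gauss))"
  proof (rule integral_cong_AE)
    show "AE v in ?X \<Otimes>\<^sub>M std_gauss. y v ^ k * exp (t * y v) / q (fst (fst v), fst (snd (fst v))) = b k v"
      using AEXS AE_space by eventually_elim (auto simp: b_def q_def space_pair_measure E'_partition)
  qed measurable
  also have "\<dots> = T 1 (\<lambda>w \<omega> us. tilted k w \<omega> (us 1))"
  proof -
    have sec: "integrable std_gauss (\<lambda>z. b k (x, z)) \<and> (\<integral>z. b k (x, z) \<partial>std_gauss) = tilted k (fst x) (fst (snd x)) (snd (snd x)) * \<rho> (fst x) (fst (snd x)) (snd (snd x))"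
      if "0 < Zf (fst x) (fst (snd x))" "x \<in> space ?X" "k \<le> 2" for x k
    proof -
      have s: "0 \<le> s2 (fst x) (snd (snd x))" using that by (intro s2_bounds) (auto simp: space_pair_measure)
      have "k = 0 \<or> k = 1 \<or> k = 2" using that(3) by linarith
      then show ?thesis
        using std_gauss_tilted_moments[OF s, where t=t and x="G (fst x) (snd (snd x)) (fst (snd x))"] that(1)
        by (elim disjE) (auto simp: b_def y_def tilted_def \<rho>_def H_def a_def)
    qed
    have AEsec: "AE x in ?X. integrable std_gauss (\<lambda>z. b k (x, z)) \<and> (\<integral>z. b k (x, z) \<partial>std_gauss) = tilted k (fst x) (fst (snd x)) (snd (snd x)) * \<rho> (fst x) (fst (snd x)) (snd (snd x))"
      if "k \<le> 2" for k
      using AEX AE_space by eventually_elim (rule sec[OF _ _ that])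
    \<comment> \<open>The even powers are nonnegative, so their integrability follows from the
      iterated integral; the first power is then dominated through
      \<open>|y| \<le> 1 + y^2\<close>.\<close>
    have nn: "integrable (?X \<Otimes>\<^sub>M std_gauss) (b k)" if "k = 0 \<or> k = 2" for k
    proof (rule Fubini_nonneg[OF X.prob_space_axioms SG.prob_space_axioms _ _ AEsec tilted_T(1)])
      show "0 \<le> b k (x, z)" for x z using that Zf0 by (auto simp: b_def intro!: divide_nonneg_nonneg)
    qed (use that in auto)
    have ib: "integrable (?X \<Otimes>\<^sub>M std_gauss) (b k)"
    proof (cases "k = 1")
      case True
      have "integrable (?X \<Otimes>\<^sub>M std_gauss) (\<lambda>v. b 0 v + b 2 v)" by (intro Bochner_Integration.integrable_add nn) auto
      then show ?thesis
      proof (rule Bochner_Integration.integrable_bound)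
        show "AE v in ?X \<Otimes>\<^sub>M std_gauss. norm (b k v) \<le> norm (b 0 v + b 2 v)"
        proof (rule AE_I2)
          fix v
          have "\<bar>y v\<bar> \<le> 1 + (y v)\<^sup>2" using zero_le_power2[of "\<bar>y v\<bar> - 1"] by (simp add: power2_diff)
          then have "\<bar>y v\<bar> * (exp (t * y v) / Zf (fst (fst v)) (fst (snd (fst v)))) \<le> (1 + (y v)\<^sup>2) * (exp (t * y v) / Zf (fst (fst v)) (fst (snd (fst v))))"
            using Zf0 by (intro mult_right_mono) auto
          also have "\<dots> = b 0 v + b 2 v" by (simp add: b_def distrib_right add_divide_distrib)
          finally show "norm (b k v) \<le> norm (b 0 v + b 2 v)"
            using Zf0 by (simp add: b_def True abs_mult)
        qed
      qed measurable
    next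
      case False
      then show ?thesis using k by (intro nn) auto
    qed
    have "(\<integral>v. b k v \<partial>(?X \<Otimes>\<^sub>M std_gauss)) = (\<integral>x. (\<integral>z. b k (x, z) \<partial>std_gauss) \<partial>?X)"
      by (rule XS.integral_fst'[OF ib, symmetric])
    also have "\<dots> = (\<integral>x. tilted k (fst x) (fst (snd x)) (snd (snd x)) * \<rho> (fst x) (fst (snd x)) (snd (snd x)) \<partial>?X)"
      using AEsec[OF k] by (intro integral_cong_AE) auto
    finally show ?thesis by (simp only: tilted_T(2))
  qed
  finally show ?thesis .
qed

end

section \<open>Invariance of the multi-overlaps\<close>

context spin begin

definition row :: "nat set \<Rightarrow> real \<Rightarrow> real \<Rightarrow> (nat \<Rightarrow> real) \<Rightarrow> real" where
  "row C w u vs = (\<Prod>i\<in>C. \<sigma> w u (vs i))"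

lemma meas_row:
  assumes "C \<subseteq> {1..}"
  shows "(\<lambda>(w, u, vs). row C w u vs) \<in> borel_measurable (unif \<Otimes>\<^sub>M unif \<Otimes>\<^sub>M replicas)"
  unfolding row_def case_prod_unfold
proof (rule borel_measurable_prod)
  fix i assume "i \<in> C"
  then have [measurable]: "(\<lambda>vs. vs i) \<in> measurable replicas unif" using assms by auto
  show "(\<lambda>x. \<sigma> (fst x) (fst (snd x)) (snd (snd x) i)) \<in> borel_measurable (unif \<Otimes>\<^sub>M unif \<Otimes>\<^sub>M replicas)" by measurable
qed

lemma row_bound:
  assumes "C \<subseteq> {1..}" "w \<in> {0..1}" "u \<in> {0..1}" "vs \<in> space replicas" shows "\<bar>row C w u vs\<bar> \<le> 1"
  unfolding row_def abs_prod using \<sigma>_abs[OF assms(2,3)] replicas_space[OF assms(4)] assms(1)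
  by (intro prod_le_1) (auto simp: subset_iff)

lemma proj_wvs: "preserving N3 (unif \<Otimes>\<^sub>M replicas) (\<lambda>z. (fst z, snd (snd z)))"
  by (rule preserving_prod[OF preserving_id preserving_snd]; intro prob_spaces)

lemma multi_overlap_pair: "multi_overlap \<sigma> w us [l, l'] = overlap \<sigma> w (us l) (us l')"
  by (simp add: multi_overlap_def overlap_def)

lemma prod_list_\<sigma>:
  assumes w: "w \<in> {0..1}" and us: "us \<in> space replicas" and ls: "set ls \<subseteq> {1..}"
  shows "(\<lambda>v. \<Prod>l\<leftarrow>ls. \<sigma> w (us l) v) \<in> borel_measurable unif"
    and "v \<in> {0..1} \<Longrightarrow> \<bar>\<Prod>l\<leftarrow>ls. \<sigma> w (us l) v\<bar> \<le> 1"
proof -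
  have "(\<lambda>v. \<Prod>l\<leftarrow>ls. \<sigma> w (us l) v) \<in> borel_measurable unif \<and> (v \<in> {0..1} \<longrightarrow> \<bar>\<Prod>l\<leftarrow>ls. \<sigma> w (us l) v\<bar> \<le> 1)"
    using ls
  proof (induction ls)
    case (Cons l ls)
    have [measurable]: "w \<in> space unif" "us l \<in> space unif" using w replicas_space[OF us, of l] Cons.prems by auto
    have [measurable]: "(\<lambda>v. \<Prod>l\<leftarrow>ls. \<sigma> w (us l) v) \<in> borel_measurable unif" using Cons by auto
    have "(\<lambda>v. \<sigma> w (us l) v * (\<Prod>l\<leftarrow>ls. \<sigma> w (us l) v)) \<in> borel_measurable unif" by measurable
    moreover have "\<bar>\<sigma> w (us l) v * (\<Prod>l\<leftarrow>ls. \<sigma> w (us l) v)\<bar> \<le> 1" if "v \<in> {0..1}"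
      using abs_mult_le_real[OF \<sigma>_abs[OF w _ that], of "us l" "\<Prod>l\<leftarrow>ls. \<sigma> w (us l) v" 1] replicas_space[OF us, of l] Cons that by auto
    ultimately show ?case by simp
  qed simp
  then show "(\<lambda>v. \<Prod>l\<leftarrow>ls. \<sigma> w (us l) v) \<in> borel_measurable unif" "v \<in> {0..1} \<Longrightarrow> \<bar>\<Prod>l\<leftarrow>ls. \<sigma> w (us l) v\<bar> \<le> 1"
    by auto
qed

definition monomial :: "nat list list \<Rightarrow> real \<Rightarrow> (nat \<Rightarrow> real) \<Rightarrow> real" where
  "monomial Ls w us = (\<Prod>L\<leftarrow>Ls. multi_overlap \<sigma> w us L)"

lemma monomial_append: "monomial (Ls @ Ls') w us = monomial Ls w us * monomial Ls' w us"
  by (simp add: monomial_def)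

lemma monomial_overlap_power: "monomial (replicate k [l, l']) w us = overlap \<sigma> w (us l) (us l') ^ k"
  by (simp add: monomial_def multi_overlap_pair prod_list_replicate)

text \<open>The multi-overlap of the \<open>j\<close>-th list is an average over the single coordinate \<open>v\<^sub>j\<close>, so a product of
  multi-overlaps is an average of a product of spins over the cells with column index \<open>j\<close>.\<close>

definition cells_of :: "(nat \<Rightarrow> nat list) \<Rightarrow> nat \<Rightarrow> cells" where
  "cells_of L m = (\<Sum>j\<in>{1..m}. image_mset (\<lambda>l. (l, j)) (mset (L j)))"

lemma prod_cells_of:
  fixes f :: "nat \<Rightarrow> nat \<Rightarrow> real"
  shows "(\<Prod>(l, i)\<in>#cells_of L m. f l i) = (\<Prod>j\<in>{1..m}. \<Prod>l\<leftarrow>L j. f l j)"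
proof (induction m)
  case (Suc m)
  have "(\<Prod>(l, i)\<in>#image_mset (\<lambda>l. (l, Suc m)) (mset (L (Suc m))). f l i) = (\<Prod>l\<leftarrow>L (Suc m). f l (Suc m))"
    by (simp add: image_mset.compositionality o_def prod_mset_prod_list[symmetric])
  with Suc show ?case by (simp add: cells_of_def)
qed (simp add: cells_of_def)

lemma cells_of_mem: "y \<in># cells_of L m \<Longrightarrow> snd y \<in> {1..m} \<and> fst y \<in> set (L (snd y))"
proof (induction m)
  case (Suc m)
  then show ?case by (fastforce simp: cells_of_def)
qed (simp add: cells_of_def)

lemma monomial_cells:
  assumes "\<And>L. L \<in> set Ls \<Longrightarrow> set L \<subseteq> {1..n}"
  obtains M where "valid M" "\<And>y. y \<in># M \<Longrightarrow> fst y \<le> n"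
    "\<And>w us. w \<in> {0..1} \<Longrightarrow> us \<in> space replicas \<Longrightarrow> monomial Ls w us = cellmean w M us"
proof
  \<comment> \<open>Columns are numbered from 1, list positions from 0.\<close>
  let ?L = "\<lambda>j. Ls ! (j - 1)"
  let ?M = "cells_of ?L (length Ls)"
  have Lj: "set (?L j) \<subseteq> {1..n}" if "j \<in> {1..length Ls}" for j using that by (intro assms) auto
  show "valid ?M" using cells_of_mem[of _ ?L "length Ls"] Lj by (fastforce simp: valid_def)
  show "fst y \<le> n" if "y \<in># ?M" for y using cells_of_mem[OF that] Lj by fastforce
  show "monomial Ls w us = cellmean w ?M us" if w: "w \<in> {0..1}" and us: "us \<in> space replicas" for w us
  proof -
    have "cellmean w ?M us = (\<integral>vs. (\<Prod>j\<in>{1..length Ls}. \<Prod>l\<leftarrow>?L j. \<sigma> w (us l) (vs j)) \<partial>replicas)"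
      unfolding cellmean_def prod_cells_of ..
    also have "\<dots> = (\<Prod>j\<in>{1..length Ls}. multi_overlap \<sigma> w us (?L j))"
      unfolding multi_overlap_def
    proof (rule product_integral_coordinates[OF unif.prob_space_axioms])
      fix j assume "j \<in> {1..length Ls}"
      from Lj[OF this] have "set (?L j) \<subseteq> {1..}" by auto
      from prod_list_\<sigma>[OF w us this] show "integrable unif (\<lambda>v. \<Prod>l\<leftarrow>?L j. \<sigma> w (us l) v)"
        by (intro unif.integrable_bounded[where B=1]) auto
    qed auto
    also have "\<dots> = monomial Ls w us"
    proof -
      have "(\<Prod>j\<in>{1..length Ls}. multi_overlap \<sigma> w us (?L j)) = (\<Prod>i\<in>{0..<length Ls}. multi_overlap \<sigma> w us (Ls ! i))"
        by (rule prod.reindex_bij_witness[of _ Suc "\<lambda>j. j - 1"]) auto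
      then show ?thesis by (simp add: monomial_def prod.list_conv_set_nth)
    qed
    finally show ?thesis by simp
  qed
qed

lemma monomial_test:
  assumes "\<And>L. L \<in> set Ls \<Longrightarrow> set L \<subseteq> {1..}"
  shows "(\<lambda>(w, us). monomial Ls w us) \<in> borel_measurable (unif \<Otimes>\<^sub>M replicas)"
    and "w \<in> {0..1} \<Longrightarrow> us \<in> space replicas \<Longrightarrow> \<bar>monomial Ls w us\<bar> \<le> 1"
proof -
  define n where "n = Max (insert 0 (\<Union>L\<in>set Ls. set L))"
  have "set L \<subseteq> {1..n}" if "L \<in> set Ls" for L
    using assms[OF that] that unfolding n_def by (auto intro!: Max_ge)
  from monomial_cells[OF this] obtain M where M: "valid M" and eq: "\<And>w us. w \<in> {0..1} \<Longrightarrow> us \<in> space replicas \<Longrightarrow> monomial Ls w us = cellmean w M us"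
    by metis
  show "(\<lambda>(w, us). monomial Ls w us) \<in> borel_measurable (unif \<Otimes>\<^sub>M replicas)"
    using meas_cellmean[OF M] by (rule measurable_cong[THEN iffD2, rotated]) (auto simp: space_pair_measure eq)
  show "w \<in> {0..1} \<Longrightarrow> us \<in> space replicas \<Longrightarrow> \<bar>monomial Ls w us\<bar> \<le> 1"
    using cellmean_bound[OF M] by (simp add: eq)
qed

end

context tilt begin

text \<open>The hypothesis \<open>invariance\<close> with \<open>C l\<close> the set of columns of
  \<open>S\<close> in row \<open>l\<close>; rows without cells contribute the factor 1. Almost
  surely the partition function is positive, and dividing by its \<open>q\<close>-th power turns
  each factor into an integral against \<open>\<rho>\<close>.\<close>

lemma moments_invariant:
  assumes inv: "invariance \<sigma> P g" and t: "0 < t" and S: "finite S" "S \<subseteq> {1..} \<times> {1..}"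
  shows "\<phi>t (mset_set S) = \<phi>0 (mset_set S)"
proof -
  interpret UR: prob_pair unif replicas by unfold_locales
  interpret DR: prob_pair D2 replicas by unfold_locales
  interpret US: pair_prob_space unif std_gauss ..
  \<comment> \<open>The largest row index, but at least 1 also for empty \<open>S\<close>, because
    \<open>invariance\<close> asks for \<open>q \<ge> 1\<close>.\<close>
  define q where "q = Max (insert 1 (fst ` S))"
  have q: "1 \<le> q" unfolding q_def using S by (intro Max_ge) auto
  have Sq: "S \<subseteq> {1..q} \<times> {1..}"
  proof
    fix y assume y: "y \<in> S"
    then have "fst y \<le> q" unfolding q_def using S by (intro Max_ge) auto
    then show "y \<in> {1..q} \<times> {1..}" using y S by (cases y) auto
  qed
  define C where "C l = {i. (l, i) \<in> S}" for l
  have C: "finite (C l)" "C l \<subseteq> {1..}" for l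
  proof -
    show "finite (C l)" unfolding C_def using S(1) by (rule finite_subset[rotated, OF finite_imageI[of S snd]]) force
    show "C l \<subseteq> {1..}" using S(2) by (auto simp: C_def)
  qed
  note [measurable (raw)] = measurable_3[OF meas_row[OF C(2)]]
  define f0 where "f0 w vs = (\<Prod>l\<in>{1..q}. \<integral>u. row (C l) w u vs \<partial>unif)" for w vs
  define ft where "ft x vs = (\<Prod>l\<in>{1..q}. \<integral>u. row (C l) (fst x) u vs * \<rho> (fst x) (snd x) u \<partial>unif)" for x vs
  have [measurable]: "(\<lambda>x. f0 (fst x) (snd x)) \<in> borel_measurable (unif \<Otimes>\<^sub>M replicas)" unfolding f0_def by measurable
  have [measurable]: "(\<lambda>x. ft (fst x) (snd x)) \<in> borel_measurable (D2 \<Otimes>\<^sub>M replicas)" unfolding ft_def by measurable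
  have row_sec: "(\<lambda>u. row (C l) w u vs) \<in> borel_measurable unif" if "w \<in> {0..1}" "vs \<in> space replicas" for l w vs
  proof -
    have [measurable]: "w \<in> space unif" "vs \<in> space replicas" using that by auto
    show ?thesis by measurable
  qed
  have f0b: "\<bar>f0 w vs\<bar> \<le> 1" if "w \<in> space unif" "vs \<in> space replicas" for w vs
    unfolding f0_def abs_prod using that row_bound[OF C(2)] row_sec by (intro prod_le_1 conjI unif.abs_integral_le) auto
  have ftb: "\<bar>ft x vs\<bar> \<le> 1" if "x \<in> space D2" "vs \<in> space replicas" for x vs
    unfolding ft_def abs_prod using that row_bound[OF C(2)] row_sec
    by (intro prod_le_1 conjI K\<rho>_bound(2)) (auto simp: space_pair_measure)
  have m0: "kernel.moment unif unif (\<sigma> w) (mset_set S) = (\<integral>vs. f0 w vs \<partial>replicas)" if "w \<in> {0..1}" for w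
    using kernel.moment_distinct[OF kernel_unif[OF that] S(1) Sq] by (simp add: f0_def row_def C_def)
  have mt: "mom (fst x) (snd x) (mset_set S) = (\<integral>vs. ft x vs \<partial>replicas)" if x: "x \<in> space D2" for x
  proof -
    have w: "fst x \<in> {0..1}" and \<omega>: "snd x \<in> space P" using x by (auto simp: space_pair_measure)
    have [measurable]: "fst x \<in> space unif" "snd x \<in> space P" using w \<omega> by auto
    have "mom (fst x) (snd x) (mset_set S) = (\<integral>vs. (\<Prod>l\<in>{1..q}. \<integral>u. row (C l) (fst x) u vs \<partial>\<mu>t (fst x) (snd x)) \<partial>replicas)"
      using kernel.moment_distinct[OF kernel_tilt[OF w \<omega>] S(1) Sq] by (simp add: row_def C_def)
    also have "\<dots> = (\<integral>vs. ft x vs \<partial>replicas)"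
    proof (rule Bochner_Integration.integral_cong[OF refl])
      fix vs assume vs: "vs \<in> space replicas"
      show "(\<Prod>l\<in>{1..q}. \<integral>u. row (C l) (fst x) u vs \<partial>\<mu>t (fst x) (snd x)) = ft x vs"
        unfolding ft_def using row_sec[OF w vs] \<rho>_nonneg by (intro prod.cong refl, subst integral_density) (auto simp: mult.commute)
    qed
    finally show ?thesis .
  qed
  have pD: "preserving N3 (D2 \<Otimes>\<^sub>M replicas) (\<lambda>z. ((fst z, fst (snd z)), snd (snd z)))"
    by (rule preserving_assoc) (intro prob_spaces)+
  have pDr: "preserving (randomness P) (D2 \<Otimes>\<^sub>M replicas) (\<lambda>(w, \<omega>, u, z, us, vs). ((w, \<omega>), vs))"
    using preserving_compose[OF proj_w\<omega>vs pD] by (simp add: case_prod_unfold)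
  have pUr: "preserving (randomness P) (unif \<Otimes>\<^sub>M replicas) (\<lambda>(w, \<omega>, u, z, us, vs). (w, vs))"
    using preserving_compose[OF proj_w\<omega>vs proj_wvs] by (simp add: case_prod_unfold)
  define E0 where "E0 = (\<lambda>x. \<Prod>l=1..q. E' (\<lambda>u z. \<Prod>i\<in>C l. \<sigma> (fst x) u (snd x i)))"
  define Et where "Et = (\<lambda>x. (\<Prod>l=1..q. E' (\<lambda>u z. (\<Prod>i\<in>C l. \<sigma> (fst (fst x)) u (snd x i)) * exp (t * G_field \<sigma> g p (fst (fst x)) (snd (fst x)) u z))) /
            E' (\<lambda>u z. exp (t * G_field \<sigma> g p (fst (fst x)) (snd (fst x)) u z)) ^ q)"
  have "\<forall>l\<in>{1..q}. finite (C l) \<and> C l \<subseteq> {1..}" using C by simp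
  then have "(\<integral>(w, \<omega>, _, _, _, vs).
            (\<Prod>l=1..q. E' (\<lambda>u z. \<Prod>i\<in>C l. \<sigma> w u (vs i))) \<partial>randomness P) =
        (\<integral>(w, \<omega>, _, _, _, vs).
            (\<Prod>l=1..q. E' (\<lambda>u z. (\<Prod>i\<in>C l. \<sigma> w u (vs i)) * exp (t * G_field \<sigma> g p w \<omega> u z))) /
            E' (\<lambda>u z. exp (t * G_field \<sigma> g p w \<omega> u z)) ^ q \<partial>randomness P)"
    using inv p t q unfolding invariance_def by blast
  then have main: "(\<integral>x. E0 ((\<lambda>(w, \<omega>, u, z, us, vs). (w, vs)) x) \<partial>randomness P) = (\<integral>x. Et ((\<lambda>(w, \<omega>, u, z, us, vs). ((w, \<omega>), vs)) x) \<partial>randomness P)"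
    by (simp add: E0_def Et_def case_prod_unfold)
  have r0: "E0 x = f0 (fst x) (snd x)" if x: "x \<in> space (unif \<Otimes>\<^sub>M replicas)" for x
    using x unfolding E0_def f0_def row_def[symmetric] by (intro prod.cong refl E'_plain row_sec) (auto simp: space_pair_measure)
  have rt: "Et x = ft (fst x) (snd x)" if x: "x \<in> space (D2 \<Otimes>\<^sub>M replicas)" and Z: "0 < Zf (fst (fst x)) (snd (fst x))" for x
  proof -
    have x': "fst (fst x) \<in> {0..1}" "snd (fst x) \<in> space P" "snd x \<in> space replicas" using x by (auto simp: space_pair_measure)
    have "E' (\<lambda>u z. row (C l) (fst (fst x)) u (snd x) * exp (t * G_field \<sigma> g p (fst (fst x)) (snd (fst x)) u z))
      = (\<integral>u. row (C l) (fst (fst x)) u (snd x) * \<rho> (fst (fst x)) (snd (fst x)) u \<partial>unif) * Zf (fst (fst x)) (snd (fst x))" for l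
      by (rule E'_weighted[OF x'(1,2) Z row_sec[OF x'(1,3)] row_bound[OF C(2) x'(1) _ x'(3)]])
    then show ?thesis using Z
      by (simp add: Et_def ft_def row_def[symmetric] E'_partition[OF x'(1,2) Z] prod.distrib)
  qed
  have AEZ: "AE x in D2 \<Otimes>\<^sub>M replicas. 0 < Zf (fst (fst x)) (snd (fst x))"
    by (rule preserving_AE[OF preserving_fst[OF R.prob_space_axioms] AE_Zf])
  have "(\<integral>x. E0 ((\<lambda>(w, \<omega>, u, z, us, vs). (w, vs)) x) \<partial>randomness P) = (\<integral>x. f0 (fst ((\<lambda>(w, \<omega>, u, z, us, vs). (w, vs)) x)) (snd ((\<lambda>(w, \<omega>, u, z, us, vs). (w, vs)) x)) \<partial>randomness P)"
    using pUr by (intro Bochner_Integration.integral_cong refl r0) (auto simp: preserving_def dest: measurable_space)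
  also have "\<dots> = (\<integral>x. f0 (fst x) (snd x) \<partial>(unif \<Otimes>\<^sub>M replicas))"
    by (rule preserving_integral[OF pUr]) measurable
  also have "\<dots> = (\<integral>w. (\<integral>vs. f0 w vs \<partial>replicas) \<partial>unif)"
    using f0b by (intro UR.Fubini_bounded(2)[where B=1]) (auto simp: case_prod_unfold)
  also have "\<dots> = \<phi>0 (mset_set S)" unfolding \<phi>0_def by (rule Bochner_Integration.integral_cong[OF refl]) (simp add: m0)
  finally have lhs: "(\<integral>x. E0 ((\<lambda>(w, \<omega>, u, z, us, vs). (w, vs)) x) \<partial>randomness P) = \<phi>0 (mset_set S)" .
  have [measurable]: "Et \<in> borel_measurable (D2 \<Otimes>\<^sub>M replicas)"
    unfolding Et_def row_def[symmetric] E'_def G_field_eq case_prod_unfold by measurable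
  have "(\<integral>x. Et ((\<lambda>(w, \<omega>, u, z, us, vs). ((w, \<omega>), vs)) x) \<partial>randomness P) = (\<integral>x. Et x \<partial>(D2 \<Otimes>\<^sub>M replicas))"
    by (rule preserving_integral[OF pDr]) measurable
  also have "\<dots> = (\<integral>x. ft (fst x) (snd x) \<partial>(D2 \<Otimes>\<^sub>M replicas))"
  proof (rule integral_cong_AE)
    show "AE x in D2 \<Otimes>\<^sub>M replicas. Et x = ft (fst x) (snd x)" using AEZ AE_space by eventually_elim (rule rt)
  qed measurable
  also have "\<dots> = (\<integral>x. (\<integral>vs. ft x vs \<partial>replicas) \<partial>D2)"
    using ftb by (intro DR.Fubini_bounded(2)[where B=1]) (auto simp: case_prod_unfold)
  also have "\<dots> = \<phi>t (mset_set S)" unfolding \<phi>t_def by (rule Bochner_Integration.integral_cong[OF refl]) (simp add: mt)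
  finally show ?thesis using lhs main by simp
qed

lemma T_monomial:
  assumes inv: "invariance \<sigma> P g" and t: "0 < t" and Ls: "\<And>L. L \<in> set Ls \<Longrightarrow> set L \<subseteq> {1..n}"
  shows "T n (\<lambda>w \<omega> us. monomial Ls w us) = U (monomial Ls)"
proof -
  obtain M where M: "valid M" "\<And>y. y \<in># M \<Longrightarrow> fst y \<le> n"
    and eq: "\<And>w us. w \<in> {0..1} \<Longrightarrow> us \<in> space replicas \<Longrightarrow> monomial Ls w us = cellmean w M us"
    using monomial_cells[OF Ls] by blast
  have "T n (\<lambda>w \<omega> us. monomial Ls w us) = T n (\<lambda>w \<omega> us. cellmean w M us)"
    unfolding T_def by (rule Bochner_Integration.integral_cong[OF refl]) (auto simp: space_pair_measure eq)
  also have "\<dots> = \<phi>t M" by (rule T_cellmean[OF M])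
  also have "\<dots> = \<phi>0 M" by (rule moments_determined[OF moments_invariant[OF inv t] M(1)])
  also have "\<dots> = U (\<lambda>w us. cellmean w M us)" by (rule U_cellmean[OF M(1), symmetric])
  also have "\<dots> = U (monomial Ls)"
    unfolding U_def by (rule Bochner_Integration.integral_cong[OF refl]) (auto simp: space_pair_measure eq)
  finally show ?thesis .
qed

end

lemma (in spin) monomial_upd:
  assumes "\<And>L. L \<in> set Ls \<Longrightarrow> k \<notin> set L"
  shows "monomial Ls w (us(k := u)) = monomial Ls w us"
  unfolding monomial_def multi_overlap_def using assms
  by (intro arg_cong[where f=prod_list] map_cong refl Bochner_Integration.integral_cong) auto

section \<open>Linearity and consistency of tilted averages\<close>

context tilt begin

text \<open>The exponent \<open>k\<close> bounds the degree in the field of the first replica.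
  Degrees add under products, and degree 2 is what \<open>T_integrable\<close> accepts.\<close>

definition adm :: "nat \<Rightarrow> (real \<Rightarrow> 'a \<Rightarrow> (nat \<Rightarrow> real) \<Rightarrow> real) \<Rightarrow> bool" where
  "adm k h \<longleftrightarrow> hmeas h \<and> (\<exists>c. \<forall>w\<in>{0..1}. \<forall>\<omega>\<in>space P. \<forall>us\<in>space replicas.
     \<bar>h w \<omega> us\<bar> \<le> c * exp (real k * \<bar>G w (us 1) \<omega>\<bar>))"

lemma admI:
  assumes "hmeas h" "\<And>w \<omega> us. w \<in> {0..1} \<Longrightarrow> \<omega> \<in> space P \<Longrightarrow> us \<in> space replicas \<Longrightarrow> \<bar>h w \<omega> us\<bar> \<le> c * exp (real k * \<bar>G w (us 1) \<omega>\<bar>)"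
  shows "adm k h"
  using assms unfolding adm_def by blast

lemma admE:
  assumes "adm k h"
  obtains c where "hmeas h" "\<And>w \<omega> us. w \<in> {0..1} \<Longrightarrow> \<omega> \<in> space P \<Longrightarrow> us \<in> space replicas \<Longrightarrow> \<bar>h w \<omega> us\<bar> \<le> c * exp (real k * \<bar>G w (us 1) \<omega>\<bar>)"
  using assms unfolding adm_def by blast

lemma adm_mult: "adm i f \<Longrightarrow> adm j h \<Longrightarrow> adm (i + j) (\<lambda>w \<omega> us. f w \<omega> us * h w \<omega> us)"
proof (elim admE)
  fix c d
  assume f: "hmeas f" and h: "hmeas h"
    and fb: "\<And>w \<omega> us. w \<in> {0..1} \<Longrightarrow> \<omega> \<in> space P \<Longrightarrow> us \<in> space replicas \<Longrightarrow> \<bar>f w \<omega> us\<bar> \<le> c * exp (real i * \<bar>G w (us 1) \<omega>\<bar>)"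
    and hb: "\<And>w \<omega> us. w \<in> {0..1} \<Longrightarrow> \<omega> \<in> space P \<Longrightarrow> us \<in> space replicas \<Longrightarrow> \<bar>h w \<omega> us\<bar> \<le> d * exp (real j * \<bar>G w (us 1) \<omega>\<bar>)"
  note [measurable (raw)] = measurable_3[OF f] measurable_3[OF h]
  show ?thesis
  proof (rule admI[where c="c * d"])
    fix w :: real and \<omega> us assume a: "w \<in> {0..1}" "\<omega> \<in> space P" "us \<in> space replicas"
    show "\<bar>f w \<omega> us * h w \<omega> us\<bar> \<le> c * d * exp (real (i + j) * \<bar>G w (us 1) \<omega>\<bar>)"
      using abs_mult_le_real[OF fb[OF a] hb[OF a]] by (simp add: exp_add distrib_right ac_simps)
  qed measurable
qed

lemma adm_mono: "adm i f \<Longrightarrow> i \<le> j \<Longrightarrow> adm j f"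
proof (elim admE)
  fix c assume ij: "i \<le> j" and f: "hmeas f"
    and fb: "\<And>w \<omega> us. w \<in> {0..1} \<Longrightarrow> \<omega> \<in> space P \<Longrightarrow> us \<in> space replicas \<Longrightarrow> \<bar>f w \<omega> us\<bar> \<le> c * exp (real i * \<bar>G w (us 1) \<omega>\<bar>)"
  show "adm j f"
  proof (rule admI[OF f, where c="\<bar>c\<bar>"])
    fix w :: real and \<omega> us assume a: "w \<in> {0..1}" "\<omega> \<in> space P" "us \<in> space replicas"
    have "c * exp (real i * \<bar>G w (us 1) \<omega>\<bar>) \<le> \<bar>c\<bar> * exp (real j * \<bar>G w (us 1) \<omega>\<bar>)"
      using ij by (intro mult_mono) (auto intro!: mult_right_mono)
    with fb[OF a] show "\<bar>f w \<omega> us\<bar> \<le> \<bar>c\<bar> * exp (real j * \<bar>G w (us 1) \<omega>\<bar>)" by (rule order_trans)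
  qed
qed

lemma adm_add: "adm k f \<Longrightarrow> adm k h \<Longrightarrow> adm k (\<lambda>w \<omega> us. f w \<omega> us + h w \<omega> us)"
proof (elim admE)
  fix c d
  assume f: "hmeas f" and h: "hmeas h"
    and fb: "\<And>w \<omega> us. w \<in> {0..1} \<Longrightarrow> \<omega> \<in> space P \<Longrightarrow> us \<in> space replicas \<Longrightarrow> \<bar>f w \<omega> us\<bar> \<le> c * exp (real k * \<bar>G w (us 1) \<omega>\<bar>)"
    and hb: "\<And>w \<omega> us. w \<in> {0..1} \<Longrightarrow> \<omega> \<in> space P \<Longrightarrow> us \<in> space replicas \<Longrightarrow> \<bar>h w \<omega> us\<bar> \<le> d * exp (real k * \<bar>G w (us 1) \<omega>\<bar>)"
  note [measurable (raw)] = measurable_3[OF f] measurable_3[OF h]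
  show ?thesis
  proof (rule admI[where c="c + d"])
    fix w :: real and \<omega> us assume a: "w \<in> {0..1}" "\<omega> \<in> space P" "us \<in> space replicas"
    show "\<bar>f w \<omega> us + h w \<omega> us\<bar> \<le> (c + d) * exp (real k * \<bar>G w (us 1) \<omega>\<bar>)"
      unfolding distrib_right by (rule order_trans[OF abs_triangle_ineq add_mono[OF fb[OF a] hb[OF a]]])
  qed measurable
qed

lemma adm_const: "adm 0 (\<lambda>w \<omega> us. c)"
  by (rule admI[where c="\<bar>c\<bar>"]) auto

lemma adm_cmult: "adm k f \<Longrightarrow> adm k (\<lambda>w \<omega> us. c * f w \<omega> us)"
  using adm_mult[OF adm_const[of c], of k f] by simp

lemma adm_sum:
  assumes "finite I" "\<And>i. i \<in> I \<Longrightarrow> adm k (f i)" shows "adm k (\<lambda>w \<omega> us. \<Sum>i\<in>I. f i w \<omega> us)"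
  using assms by (induction I) (auto intro: adm_add adm_mono[OF adm_const[of 0]])

lemma adm_G: "adm 1 (\<lambda>w \<omega> us. G w (us 1) \<omega>)"
  by (rule admI[where c=1]) (auto intro: abs_le_exp)

lemma adm_Kb: "adm 0 (\<lambda>w \<omega> us. Kb w \<omega> (us 1))"
  by (rule admI[where c=1]) (auto intro: Kb_bound replicas_space)

lemma adm_s2: "adm 0 (\<lambda>w \<omega> us. s2 w (us 1))"
proof (rule admI[where c=1])
  show "\<bar>s2 w (us 1)\<bar> \<le> 1 * exp (real 0 * \<bar>G w (us 1) \<omega>\<bar>)" if "w \<in> {0..1}" "us \<in> space replicas" for w \<omega> us
    using s2_bounds[OF that(1) replicas_space[OF that(2)], of 1] by simp
qed measurable

lemma adm_monomial: assumes "\<And>L. L \<in> set Ls \<Longrightarrow> set L \<subseteq> {1..}" shows "adm 0 (\<lambda>w \<omega> us. monomial Ls w us)"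
proof (rule admI[where c=1])
  note [measurable (raw)] = measurable_2[OF monomial_test(1)[OF assms]]
  show "hmeas (\<lambda>w \<omega> us. monomial Ls w us)" by measurable
qed (use monomial_test(2)[OF assms] in auto)

lemma adm_integrable:
  "adm 2 h \<Longrightarrow> integrable N3 (\<lambda>z. h (fst z) (fst (snd z)) (snd (snd z)) * tw n (fst z) (fst (snd z)) (snd (snd z)))"
  by (elim admE, rule T_integrable) auto

lemma T_add: "adm 2 f \<Longrightarrow> adm 2 h \<Longrightarrow> T n (\<lambda>w \<omega> us. f w \<omega> us + h w \<omega> us) = T n f + T n h"
  unfolding T_def distrib_right by (intro Bochner_Integration.integral_add adm_integrable)

lemma T_cmult: "T n (\<lambda>w \<omega> us. c * f w \<omega> us) = c * T n f"
  unfolding T_def by (simp add: mult.assoc)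

lemma T_sum:
  assumes "finite I" "\<And>i. i \<in> I \<Longrightarrow> adm 2 (f i)" shows "T n (\<lambda>w \<omega> us. \<Sum>i\<in>I. f i w \<omega> us) = (\<Sum>i\<in>I. T n (f i))"
  unfolding T_def sum_distrib_right by (intro Bochner_Integration.integral_sum adm_integrable assms)

lemma T_mono:
  assumes "adm 2 f" "adm 2 h" "\<And>w \<omega> us. w \<in> {0..1} \<Longrightarrow> \<omega> \<in> space P \<Longrightarrow> us \<in> space replicas \<Longrightarrow> f w \<omega> us \<le> h w \<omega> us"
  shows "T n f \<le> T n h"
  unfolding T_def using assms
  by (intro integral_mono[OF adm_integrable adm_integrable]) (auto simp: space_pair_measure intro!: mult_right_mono tw_nonneg)

lemma adm_T_Suc:
  assumes "adm 2 h" "\<And>w \<omega> us u. h w \<omega> (us(Suc n := u)) = h w \<omega> us" "1 \<le> n"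
  shows "T (Suc n) h = T n h"
  using assms(1) by (elim admE, intro T_Suc[OF _ _ assms(2,3)]) auto

lemma adm_T_first:
  assumes "adm 2 h" "\<And>w \<omega> us k u. k \<noteq> 1 \<Longrightarrow> h w \<omega> (us(k := u)) = h w \<omega> us" "1 \<le> n"
  shows "T n h = T 1 h"
  using assms(3)
proof (induction n rule: dec_induct)
  case (step n)
  then show ?case using adm_T_Suc[of h n] assms(1,2) by simp
qed simp

lemma adm_T_fresh:
  assumes "adm 2 h" "\<And>w \<omega> us u. h w \<omega> (us(Suc n := u)) = h w \<omega> us" "1 \<le> n"
  shows "T n (\<lambda>w \<omega> us. h w \<omega> us * Kb w \<omega> (us 1)) = T (Suc n) (\<lambda>w \<omega> us. h w \<omega> us * K w (us (Suc n)) (us 1))"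
  using assms(1) unfolding Kb_def
  by (elim admE, intro T_fresh[OF _ _ assms(2,3) meas_K K_bound, symmetric]) auto

abbreviation "rp l \<equiv> replicate p [l, 1]"

lemma monomial_rp: "monomial (Ls @ rp l) w us = monomial Ls w us * K w (us l) (us 1)"
  by (simp add: monomial_append monomial_overlap_power K_def)

end

section \<open>Tilted averages of the field in terms of untilted moments\<close>

locale invariant_tilt = tilt +
  assumes inv: "invariance \<sigma> P g" and tpos: "0 < t"
begin

abbreviation UM :: "nat list list \<Rightarrow> real" where "UM Ls \<equiv> U (monomial Ls)"

lemma T_UM: "(\<And>L. L \<in> set Ls \<Longrightarrow> set L \<subseteq> {1..n}) \<Longrightarrow> T n (\<lambda>w \<omega> us. monomial Ls w us) = UM Ls"
  by (rule T_monomial[OF inv tpos])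

context
  fixes Ls :: "nat list list" and n :: nat assumes Ls: "\<And>L. L \<in> set Ls \<Longrightarrow> set L \<subseteq> {1..n}" and n: "1 \<le> n"
begin

lemma Ls': "L \<in> set Ls \<Longrightarrow> set L \<subseteq> {1..}"
  using Ls[of L] by auto

lemma Ls_test: "bounded_test (monomial Ls) 1"
  unfolding bounded_test_def using monomial_test[OF Ls'] by auto

lemma Ls_rp: "l \<in> {1..k} \<Longrightarrow> n \<le> k \<Longrightarrow> L \<in> set (Ls @ rp l) \<Longrightarrow> set L \<subseteq> {1..k}"
  using Ls[of L] p by fastforce

lemma Ls_rp': "1 \<le> l \<Longrightarrow> L \<in> set (Ls @ rp l) \<Longrightarrow> set L \<subseteq> {1..}"
  using Ls'[of L] by fastforce

lemma Ls_upd: "monomial Ls w (us(Suc n := u)) = monomial Ls w us"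
  by (rule monomial_upd) (use Ls in fastforce)

text \<open>The linear case of \<open>T_IBP\<close>. The Gibbs average \<open>Kb\<close> becomes
  replica \<open>Suc n\<close>; after that only monomials are left, whose tilted means equal the
  untilted ones.\<close>

lemma T_G: "T n (\<lambda>w \<omega> us. monomial Ls w us * G w (us 1) \<omega>)
  = t * ((\<Sum>l\<in>{1..n}. UM (Ls @ rp l)) - real n * UM (Ls @ rp (Suc n)))"
proof -
  have "T n (\<lambda>w \<omega> us. monomial Ls w us * G w (us 1) \<omega>)
    = T n (\<lambda>w \<omega> us. (\<Sum>l\<in>{1..n}. t * monomial (Ls @ rp l) w us) + (- t * real n) * (monomial Ls w us * Kb w \<omega> (us 1)))"
    using T_IBP[OF Ls_test n, of 1 0] by (simp add: monomial_rp sum_distrib_left algebra_simps)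
  also have "\<dots> = (\<Sum>l\<in>{1..n}. T n (\<lambda>w \<omega> us. t * monomial (Ls @ rp l) w us)) + T n (\<lambda>w \<omega> us. (- t * real n) * (monomial Ls w us * Kb w \<omega> (us 1)))"
  proof -
    have i: "adm 2 (\<lambda>w \<omega> us. t * monomial (Ls @ rp l) w us)" if "l \<in> {1..n}" for l
      using that by (intro adm_cmult adm_mono[OF adm_monomial[OF Ls_rp']]) auto
    have k: "adm 2 (\<lambda>w \<omega> us. (- t * real n) * (monomial Ls w us * Kb w \<omega> (us 1)))"
      by (intro adm_cmult adm_mono[OF adm_mult[OF adm_monomial[OF Ls'] adm_Kb]]) auto
    show ?thesis
      by (simp only: T_add[OF adm_sum[OF finite_atLeastAtMost i] k] T_sum[OF finite_atLeastAtMost i])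
  qed
  also have "T n (\<lambda>w \<omega> us. (- t * real n) * (monomial Ls w us * Kb w \<omega> (us 1))) = (- t * real n) * T (Suc n) (\<lambda>w \<omega> us. monomial (Ls @ rp (Suc n)) w us)"
    unfolding T_cmult monomial_rp
    using adm_T_fresh[of "\<lambda>w \<omega> us. monomial Ls w us" n, OF adm_mono[OF adm_monomial[OF Ls']] Ls_upd n] by simp
  also have "T (Suc n) (\<lambda>w \<omega> us. monomial (Ls @ rp (Suc n)) w us) = UM (Ls @ rp (Suc n))"
    by (rule T_UM, rule Ls_rp) auto
  also have "(\<Sum>l\<in>{1..n}. T n (\<lambda>w \<omega> us. t * monomial (Ls @ rp l) w us)) = (\<Sum>l\<in>{1..n}. t * UM (Ls @ rp l))"
    unfolding T_cmult by (intro sum.cong refl arg_cong[where f="\<lambda>x. t * x"] T_UM, rule Ls_rp) auto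
  finally show ?thesis by (simp add: sum_distrib_left algebra_simps)
qed

text \<open>The quadratic case of \<open>T_IBP\<close>. The right-hand side is again linear in the
  field, so it falls to \<open>T_G\<close> with \<open>n\<close> and \<open>Suc n\<close>
  replicas.\<close>

lemma T_G2: "T n (\<lambda>w \<omega> us. monomial Ls w us * (G w (us 1) \<omega>)\<^sup>2)
  = UM (Ls @ rp 1) + t * ((\<Sum>l\<in>{1..n}. T n (\<lambda>w \<omega> us. monomial (Ls @ rp l) w us * G w (us 1) \<omega>))
      - real n * T (Suc n) (\<lambda>w \<omega> us. monomial (Ls @ rp (Suc n)) w us * G w (us 1) \<omega>))"
proof -
  have aG: "adm 2 (\<lambda>w \<omega> us. t * (monomial (Ls @ rp l) w us * G w (us 1) \<omega>))" if "l \<in> {1..n}" for l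
    using that by (intro adm_cmult adm_mono[OF adm_mult[OF adm_monomial[OF Ls_rp'] adm_G]]) auto
  have aLG: "adm 1 (\<lambda>w \<omega> us. monomial Ls w us * G w (us 1) \<omega>)"
    using adm_mult[OF adm_monomial[OF Ls'] adm_G] by simp
  have aK: "adm 2 (\<lambda>w \<omega> us. (- t * real n) * ((monomial Ls w us * G w (us 1) \<omega>) * Kb w \<omega> (us 1)))"
    by (intro adm_cmult adm_mono[OF adm_mult[OF aLG adm_Kb]]) auto
  have a1: "adm 2 (\<lambda>w \<omega> us. monomial (Ls @ rp 1) w us)"
    by (intro adm_mono[OF adm_monomial[OF Ls_rp']]) auto
  have "T n (\<lambda>w \<omega> us. monomial Ls w us * (G w (us 1) \<omega>)\<^sup>2)
    = T n (\<lambda>w \<omega> us. monomial (Ls @ rp 1) w us + ((\<Sum>l\<in>{1..n}. t * (monomial (Ls @ rp l) w us * G w (us 1) \<omega>))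
        + (- t * real n) * ((monomial Ls w us * G w (us 1) \<omega>) * Kb w \<omega> (us 1))))"
    using T_IBP[OF Ls_test n, of 0 1] by (simp add: monomial_rp sum_distrib_left sum_distrib_right algebra_simps power2_eq_square)
  also have "\<dots> = T n (\<lambda>w \<omega> us. monomial (Ls @ rp 1) w us) + ((\<Sum>l\<in>{1..n}. T n (\<lambda>w \<omega> us. t * (monomial (Ls @ rp l) w us * G w (us 1) \<omega>)))
        + T n (\<lambda>w \<omega> us. (- t * real n) * ((monomial Ls w us * G w (us 1) \<omega>) * Kb w \<omega> (us 1))))"
    by (simp only: T_add[OF a1 adm_add[OF adm_sum[OF finite_atLeastAtMost aG] aK]]
        T_add[OF adm_sum[OF finite_atLeastAtMost aG] aK] T_sum[OF finite_atLeastAtMost aG])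
  also have "T n (\<lambda>w \<omega> us. (- t * real n) * ((monomial Ls w us * G w (us 1) \<omega>) * Kb w \<omega> (us 1)))
    = (- t * real n) * T (Suc n) (\<lambda>w \<omega> us. monomial (Ls @ rp (Suc n)) w us * G w (us 1) \<omega>)"
    unfolding T_cmult monomial_rp
    using adm_T_fresh[of "\<lambda>w \<omega> us. monomial Ls w us * G w (us 1) \<omega>" n, OF adm_mono[OF aLG]] n Ls_upd by (simp add: ac_simps)
  also have "T n (\<lambda>w \<omega> us. monomial (Ls @ rp 1) w us) = UM (Ls @ rp 1)"
    using n by (intro T_UM, intro Ls_rp) auto
  finally show ?thesis by (simp add: T_cmult sum_distrib_left algebra_simps)
qed

end

end

section \<open>The tilted variance\<close>

lemma (in spin) monomial_commute: "monomial (Ls @ Ls') = monomial (Ls' @ Ls)"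
  by (intro ext) (simp add: monomial_append mult.commute)

lemma (in spin) U_monomial_Nil: "U (monomial []) = 1"
proof -
  interpret UR: prob_space "unif \<Otimes>\<^sub>M replicas" by (intro prob_spaces)
  show ?thesis unfolding U_def monomial_def by (simp add: UR.prob_space)
qed

context invariant_tilt begin

lemma s2_monomial: "s2 w (us 1) = 1 - monomial (rp 1) w us"
  by (simp add: s2_def K_def monomial_overlap_power)

text \<open>The summand \<open>t * s2\<close> of \<open>H\<close> is \<open>t * (1 - R_11^p)\<close>
  and cancels the self-overlap term \<open>l = 1\<close> of \<open>T_G\<close>, so the sum starts at
  2.\<close>

lemma T_H:
  assumes Ls: "\<And>L. L \<in> set Ls \<Longrightarrow> set L \<subseteq> {1..n}" and n: "1 \<le> n"
  shows "T n (\<lambda>w \<omega> us. monomial Ls w us * H w (us 1) \<omega>)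
    = t * ((\<Sum>l\<in>{2..n}. UM (Ls @ rp l)) - real n * UM (Ls @ rp (Suc n)) + UM Ls)"
proof -
  have aL: "adm 2 (\<lambda>w \<omega> us. t * monomial Ls w us)"
    by (intro adm_cmult adm_mono[OF adm_monomial[OF Ls'[OF Ls n]]]) auto
  have a1: "adm 2 (\<lambda>w \<omega> us. (- t) * monomial (Ls @ rp 1) w us)"
    by (intro adm_cmult adm_mono[OF adm_monomial[OF Ls_rp'[OF Ls n]]]) auto
  have aG: "adm 2 (\<lambda>w \<omega> us. monomial Ls w us * G w (us 1) \<omega>)"
    by (intro adm_mono[OF adm_mult[OF adm_monomial[OF Ls'[OF Ls n]] adm_G]]) auto
  have "T n (\<lambda>w \<omega> us. monomial Ls w us * H w (us 1) \<omega>)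
    = T n (\<lambda>w \<omega> us. monomial Ls w us * G w (us 1) \<omega> + (t * monomial Ls w us + (- t) * monomial (Ls @ rp 1) w us))"
    by (simp add: H_def s2_monomial monomial_append algebra_simps)
  also have "\<dots> = T n (\<lambda>w \<omega> us. monomial Ls w us * G w (us 1) \<omega>) + (t * UM Ls + (- t) * UM (Ls @ rp 1))"
  proof -
    have "T n (\<lambda>w \<omega> us. monomial Ls w us) = UM Ls" by (rule T_UM[OF Ls])
    moreover have "T n (\<lambda>w \<omega> us. monomial (Ls @ rp 1) w us) = UM (Ls @ rp 1)"
      using n by (intro T_UM Ls_rp[OF Ls n]) auto
    ultimately show ?thesis by (simp only: T_add[OF aG adm_add[OF aL a1]] T_add[OF aL a1] T_cmult)
  qed
  also have "T n (\<lambda>w \<omega> us. monomial Ls w us * G w (us 1) \<omega>) = t * ((\<Sum>l\<in>{1..n}. UM (Ls @ rp l)) - real n * UM (Ls @ rp (Suc n)))"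
    by (rule T_G[OF Ls n])
  also have "(\<Sum>l\<in>{1..n}. UM (Ls @ rp l)) = UM (Ls @ rp 1) + (\<Sum>l\<in>{2..n}. UM (Ls @ rp l))"
    using sum.atLeast_Suc_atMost[OF n, of "\<lambda>l. UM (Ls @ rp l)"] by simp
  finally show ?thesis by (simp add: algebra_simps)
qed

lemma tilted_mean: "tilted_moment \<sigma> P g p t 1 = t * (1 - UM (rp 2))"
proof -
  have nil: "monomial [] w us = 1" for w us by (simp add: monomial_def)
  show ?thesis using tilted_moment_T[of 1] T_H[of "[]" 1] by (simp add: tilted_def nil U_monomial_Nil)
qed

text \<open>The second moment is the tilted mean of \<open>H^2 + s2\<close>. After expanding
  \<open>H\<close> in \<open>G\<close> and \<open>rp 1\<close>, all terms with the self-overlap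
  \<open>rp 1\<close> cancel; replicas 2 and 3 come from integrating by parts twice.\<close>

lemma tilted_variance_formula:
  "tilted_variance \<sigma> P g p t = 1 + t\<^sup>2 * (2 * UM (rp 2 @ rp 3) - UM (rp 2 @ rp 2) - (UM (rp 2))\<^sup>2)"
proof -
  have two: "{1..2} = {1, 2::nat}" by auto
  have nil: "monomial [] w us = 1" for w us by (simp add: monomial_def)
  have aG2: "adm 2 (\<lambda>w \<omega> us. monomial [] w us * (G w (us 1) \<omega>)\<^sup>2)"
    using adm_mult[OF adm_G adm_G] by (simp add: nil power2_eq_square)
  have aG: "adm 2 (\<lambda>w \<omega> us. c * (monomial Ls w us * G w (us 1) \<omega>))" if "Ls \<in> {[], rp 1}" for c Ls
    using that by (intro adm_cmult adm_mono[OF adm_mult[OF adm_monomial adm_G]]) auto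
  have aM: "adm 2 (\<lambda>w \<omega> us. c * monomial Ls w us)" if "Ls \<in> {[], rp 1, rp 1 @ rp 1}" for c Ls
    using that by (intro adm_cmult adm_mono[OF adm_monomial]) auto
  have TM: "T 1 (\<lambda>w \<omega> us. monomial Ls w us) = UM Ls" if "Ls \<in> {[], rp 1, rp 1 @ rp 1}" for Ls
    using that by (intro T_UM) auto
  have a1: "adm 2 (\<lambda>w \<omega> us. (- 2 * t\<^sup>2 - 1) * monomial (rp 1) w us)" "adm 2 (\<lambda>w \<omega> us. t\<^sup>2 * monomial (rp 1 @ rp 1) w us)"
    by (intro aM; simp)+
  have a2: "adm 2 (\<lambda>w \<omega> us. (t\<^sup>2 + 1) * monomial [] w us)" by (intro aM) simp
  note a2 = a2 adm_add[OF a1]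
  have a3: "adm 2 (\<lambda>w \<omega> us. (- 2 * t) * (monomial (rp 1) w us * G w (us 1) \<omega>))" by (intro aG) simp
  note a3 = a3 adm_add[OF a2]
  have a4: "adm 2 (\<lambda>w \<omega> us. (2 * t) * (monomial [] w us * G w (us 1) \<omega>))" by (intro aG) simp
  note a4 = a4 adm_add[OF a3]
  note a5 = adm_add[OF a4]
  have "tilted_moment \<sigma> P g p t 2 = T 1 (\<lambda>w \<omega> us. monomial [] w us * (G w (us 1) \<omega>)\<^sup>2
      + ((2 * t) * (monomial [] w us * G w (us 1) \<omega>) + ((- 2 * t) * (monomial (rp 1) w us * G w (us 1) \<omega>)
      + ((t\<^sup>2 + 1) * monomial [] w us + ((- 2 * t\<^sup>2 - 1) * monomial (rp 1) w us + t\<^sup>2 * monomial (rp 1 @ rp 1) w us)))))"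
    unfolding tilted_moment_T[OF order_refl] 
    by (rule arg_cong[where f="T 1"], intro ext) (simp add: tilted_def H_def s2_monomial monomial_append nil power2_eq_square algebra_simps)
  also have "\<dots> = T 1 (\<lambda>w \<omega> us. monomial [] w us * (G w (us 1) \<omega>)\<^sup>2)
      + ((2 * t) * T 1 (\<lambda>w \<omega> us. monomial [] w us * G w (us 1) \<omega>) + ((- 2 * t) * T 1 (\<lambda>w \<omega> us. monomial (rp 1) w us * G w (us 1) \<omega>)
      + ((t\<^sup>2 + 1) * UM [] + ((- 2 * t\<^sup>2 - 1) * UM (rp 1) + t\<^sup>2 * UM (rp 1 @ rp 1)))))"
    using T_add[OF aG2 a5, of 1] T_add[OF a4(1) a4(2), of 1] T_add[OF a3(1) a3(2), of 1] T_add[OF a2(1) a2(2), of 1] T_add[OF a1, of 1] TM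
    by (simp only: T_cmult insert_iff simp_thms)
  also have "T 1 (\<lambda>w \<omega> us. monomial [] w us * (G w (us 1) \<omega>)\<^sup>2)
    = UM (rp 1) + t * (T 1 (\<lambda>w \<omega> us. monomial (rp 1) w us * G w (us 1) \<omega>) - T 2 (\<lambda>w \<omega> us. monomial (rp 2) w us * G w (us 1) \<omega>))"
    using T_G2[of "[]" 1] by simp
  also have "T 1 (\<lambda>w \<omega> us. monomial (rp 1) w us * G w (us 1) \<omega>) = t * (UM (rp 1 @ rp 1) - UM (rp 1 @ rp 2))"
    using T_G[of "rp 1" 1] by simp
  also have "T 2 (\<lambda>w \<omega> us. monomial (rp 2) w us * G w (us 1) \<omega>) = t * (UM (rp 1 @ rp 2) + UM (rp 2 @ rp 2) - 2 * UM (rp 2 @ rp 3))"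
    using T_G[of "rp 2" 2] by (simp add: two monomial_commute[of "rp 2" "rp 1"])
  also have "T 1 (\<lambda>w \<omega> us. monomial [] w us * G w (us 1) \<omega>) = t * (UM (rp 1) - UM (rp 2))"
    using T_G[of "[]" 1] by simp
  finally show ?thesis
    unfolding tilted_variance_def tilted_mean U_monomial_Nil by (simp add: power2_eq_square algebra_simps)
qed

text \<open>\<open>h\<close> is \<open>(H - m)^2 + s2 + 1\<close> written out. Integrating out
  \<open>z\<close> splits the tilted variance into the variance of \<open>H\<close> and the mean of
  \<open>s2\<close>; the 1 comes from the inequality \<open>|y| \<le> (y^2 + 1) / 2\<close> used in
  \<open>discrepancy_bound\<close>. As \<open>h\<close> involves only the first replica, its mean
  does not depend on \<open>n\<close>.\<close>

lemma first_replica_second_moment: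
  fixes m :: real
  defines "h \<equiv> \<lambda>w \<omega> us. ((H w (us 1) \<omega>)\<^sup>2 + s2 w (us 1)) + ((- 2 * m) * H w (us 1) \<omega> + (m\<^sup>2 + 1))"
  assumes "1 \<le> n" and m: "m = tilted_moment \<sigma> P g p t 1"
  shows "adm 2 h" "T n h = tilted_variance \<sigma> P g p t + 1"
proof -
  have H: "adm 1 (\<lambda>w \<omega> us. H w (us 1) \<omega>)"
    unfolding H_def by (intro adm_add adm_G adm_cmult adm_mono[OF adm_s2]) auto
  have HH: "adm 2 (\<lambda>w \<omega> us. (H w (us 1) \<omega>)\<^sup>2 + s2 w (us 1))"
    using adm_mult[OF H H] by (intro adm_add adm_mono[OF adm_s2]) (auto simp: power2_eq_square)
  have H1: "adm 2 (\<lambda>w \<omega> us. (- 2 * m) * H w (us 1) \<omega>)" by (intro adm_cmult adm_mono[OF H]) auto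
  have c: "adm 2 (\<lambda>w \<omega> us. m\<^sup>2 + 1)" by (intro adm_mono[OF adm_const]) auto
  show adm: "adm 2 h" unfolding h_def by (intro adm_add HH H1 c)
  have "T n h = T 1 h" by (rule adm_T_first[OF adm _ assms(2)]) (simp add: h_def)
  also have "\<dots> = T 1 (\<lambda>w \<omega> us. (H w (us 1) \<omega>)\<^sup>2 + s2 w (us 1)) + ((- 2 * m) * T 1 (\<lambda>w \<omega> us. H w (us 1) \<omega>) + T 1 (\<lambda>w \<omega> us. m\<^sup>2 + 1))"
    unfolding h_def by (simp only: T_add[OF HH adm_add[OF H1 c]] T_add[OF H1 c] T_cmult)
  also have "T 1 (\<lambda>w \<omega> us. m\<^sup>2 + 1) = (m\<^sup>2 + 1) * T 1 (\<lambda>w \<omega> us. monomial [] w us)"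
    using T_cmult[of 1 "m\<^sup>2 + 1" "\<lambda>w \<omega> us. monomial [] w us"] by (simp add: monomial_def)
  also have "T 1 (\<lambda>w \<omega> us. monomial [] w us) = 1" using T_UM[of "[]" 1] by (simp add: U_monomial_Nil)
  also have "T 1 (\<lambda>w \<omega> us. (H w (us 1) \<omega>)\<^sup>2 + s2 w (us 1)) = tilted_moment \<sigma> P g p t 2"
    by (simp add: tilted_moment_T tilted_def)
  also have "T 1 (\<lambda>w \<omega> us. H w (us 1) \<omega>) = m" by (simp add: m tilted_moment_T tilted_def)
  finally show "T n h = tilted_variance \<sigma> P g p t + 1" by (simp add: tilted_variance_def m power2_eq_square)
qed

text \<open>The tilted mean of \<open>monomial Ls * (H - m)\<close> is \<open>t * D\<close>: in
  \<open>T_H\<close>, subtracting \<open>m = t * (1 - UM (rp 2))\<close> exchanges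
  \<open>UM Ls\<close> for \<open>UM Ls * UM (rp 2)\<close>. By
  \<open>|y| \<le> (y^2 + 1) / 2\<close> and \<open>|monomial Ls| \<le> 1\<close> it is at most half
  of the mean computed in \<open>first_replica_second_moment\<close>.\<close>

lemma discrepancy_bound:
  assumes Ls: "\<And>L. L \<in> set Ls \<Longrightarrow> set L \<subseteq> {1..n}" and n: "1 \<le> n"
  defines "D \<equiv> UM Ls * UM (rp 2) + (\<Sum>l\<in>{2..n}. UM (Ls @ rp l)) - real n * UM (Ls @ rp (Suc n))"
  shows "t * \<bar>D\<bar> \<le> (tilted_variance \<sigma> P g p t + 1) / 2"
proof -
  define m where "m = tilted_moment \<sigma> P g p t 1"
  have H: "adm 1 (\<lambda>w \<omega> us. H w (us 1) \<omega>)"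
    unfolding H_def by (intro adm_add adm_G adm_cmult adm_mono[OF adm_s2]) auto
  have aL: "adm 0 (\<lambda>w \<omega> us. monomial Ls w us)" by (rule adm_monomial[OF Ls'[OF Ls n]])
  have aLH: "adm 2 (\<lambda>w \<omega> us. monomial Ls w us * H w (us 1) \<omega>)" by (rule adm_mono[OF adm_mult[OF aL H]]) simp
  have aL2: "adm 2 (\<lambda>w \<omega> us. (- m) * monomial Ls w us)" by (intro adm_cmult adm_mono[OF aL]) simp
  let ?f = "\<lambda>w \<omega> us. monomial Ls w us * H w (us 1) \<omega> + (- m) * monomial Ls w us"
  let ?h = "\<lambda>w \<omega> us. ((H w (us 1) \<omega>)\<^sup>2 + s2 w (us 1)) + ((- 2 * m) * H w (us 1) \<omega> + (m\<^sup>2 + 1))"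
  note h = first_replica_second_moment[OF n m_def]
  have "T n ?f = T n (\<lambda>w \<omega> us. monomial Ls w us * H w (us 1) \<omega>) + (- m) * UM Ls"
    using T_UM[OF Ls] by (simp only: T_add[OF aLH aL2] T_cmult)
  also have "\<dots> = t * D"
  proof -
    have e: "T n (\<lambda>w \<omega> us. monomial Ls w us * H w (us 1) \<omega>) = t * ((\<Sum>l\<in>{2..n}. UM (Ls @ rp l)) - real n * UM (Ls @ rp (Suc n)) + UM Ls)"
      using Ls n by (rule T_H)
    show ?thesis unfolding e m_def tilted_mean D_def by (simp add: algebra_simps)
  qed
  finally have f: "T n ?f = t * D" .
  \<comment> \<open>Used with \<open>c = 1\<close> and \<open>c = - 1\<close>, which together bound
    the absolute value.\<close>
  have "T n (\<lambda>w \<omega> us. c * ?f w \<omega> us) \<le> T n (\<lambda>w \<omega> us. (1 / 2) * ?h w \<omega> us)" if c: "\<bar>c\<bar> \<le> 1" for c :: real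
  proof (rule T_mono)
    show "adm 2 (\<lambda>w \<omega> us. c * ?f w \<omega> us)" by (intro adm_cmult adm_add aLH aL2)
    show "adm 2 (\<lambda>w \<omega> us. (1 / 2) * ?h w \<omega> us)" by (intro adm_cmult h(1))
    fix w :: real and \<omega> us assume a: "w \<in> {0..1}" "\<omega> \<in> space P" "us \<in> space replicas"
    let ?y = "H w (us 1) \<omega> - m"
    have "\<bar>monomial Ls w us\<bar> \<le> 1" by (rule monomial_test(2)[OF Ls'[OF Ls n] a(1,3)])
    from abs_mult_le_real[OF abs_mult_le_real[OF c this] order_refl, of ?y]
    have "c * ?f w \<omega> us \<le> \<bar>?y\<bar>" by (simp add: algebra_simps)
    also have "\<bar>?y\<bar> \<le> (1 / 2) * (?y\<^sup>2 + 1)" using zero_le_power2[of "\<bar>?y\<bar> - 1"] by (simp add: power2_diff)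
    also have "\<dots> \<le> (1 / 2) * ?h w \<omega> us"
      using s2_bounds(1)[OF a(1) replicas_space[OF a(3)], of 1] by (simp add: power2_diff)
    finally show "c * ?f w \<omega> us \<le> (1 / 2) * ?h w \<omega> us" .
  qed
  from this[of 1] this[of "- 1"] have "\<bar>t * D\<bar> \<le> (1 / 2) * T n ?h" unfolding T_cmult f by simp
  then show ?thesis using tpos unfolding h(2) by (simp add: abs_mult)
qed

end

section \<open>The Ghirlanda--Guerra identities\<close>

text \<open>Tychonoff, since the test functions \<open>F\<close> live on real sequences and not on a
  finite-dimensional space.\<close>

lemma compact_cube: "compact {x :: nat \<Rightarrow> real. \<forall>j. x j \<in> {-1..1}}"
proof -
  have "compactin (product_topology (\<lambda>_. euclidean) UNIV) (PiE UNIV (\<lambda>_::nat. {-1..1::real}))"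
    by (simp add: compactin_PiE)
  then show ?thesis by (simp add: euclidean_product_topology compactin_euclidean_iff PiE_def Pi_def)
qed

context spin begin

definition test :: "(real \<Rightarrow> (nat \<Rightarrow> real) \<Rightarrow> real) \<Rightarrow> bool" where
  "test \<Phi> \<longleftrightarrow> (\<lambda>(w, us). \<Phi> w us) \<in> borel_measurable (unif \<Otimes>\<^sub>M replicas) \<and>
     (\<exists>B. \<forall>w\<in>{0..1}. \<forall>us\<in>space replicas. \<bar>\<Phi> w us\<bar> \<le> B)"

lemma testI:
  assumes "(\<lambda>(w, us). \<Phi> w us) \<in> borel_measurable (unif \<Otimes>\<^sub>M replicas)"
    and "\<And>w us. w \<in> {0..1} \<Longrightarrow> us \<in> space replicas \<Longrightarrow> \<bar>\<Phi> w us\<bar> \<le> B"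
  shows "test \<Phi>"
  using assms unfolding test_def by blast

lemma testE:
  assumes "test \<Phi>"
  obtains B where "(\<lambda>(w, us). \<Phi> w us) \<in> borel_measurable (unif \<Otimes>\<^sub>M replicas)"
    and "\<And>w us. w \<in> {0..1} \<Longrightarrow> us \<in> space replicas \<Longrightarrow> \<bar>\<Phi> w us\<bar> \<le> B"
  using assms unfolding test_def by blast

lemma test_mult: "test \<Phi> \<Longrightarrow> test \<Psi> \<Longrightarrow> test (\<lambda>w us. \<Phi> w us * \<Psi> w us)"
proof (elim testE)
  fix B C
  assume m: "(\<lambda>(w, us). \<Phi> w us) \<in> borel_measurable (unif \<Otimes>\<^sub>M replicas)" "(\<lambda>(w, us). \<Psi> w us) \<in> borel_measurable (unif \<Otimes>\<^sub>M replicas)"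
    and b: "\<And>w us. w \<in> {0..1} \<Longrightarrow> us \<in> space replicas \<Longrightarrow> \<bar>\<Phi> w us\<bar> \<le> B"
      "\<And>w us. w \<in> {0..1} \<Longrightarrow> us \<in> space replicas \<Longrightarrow> \<bar>\<Psi> w us\<bar> \<le> C"
  note [measurable (raw)] = measurable_2[OF m(1)] measurable_2[OF m(2)]
  show ?thesis by (rule testI[OF _ abs_mult_le_real[OF b(1) b(2)]]) measurable
qed

lemma test_add: "test \<Phi> \<Longrightarrow> test \<Psi> \<Longrightarrow> test (\<lambda>w us. \<Phi> w us + \<Psi> w us)"
proof (elim testE)
  fix B C
  assume m: "(\<lambda>(w, us). \<Phi> w us) \<in> borel_measurable (unif \<Otimes>\<^sub>M replicas)" "(\<lambda>(w, us). \<Psi> w us) \<in> borel_measurable (unif \<Otimes>\<^sub>M replicas)"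
    and b: "\<And>w us. w \<in> {0..1} \<Longrightarrow> us \<in> space replicas \<Longrightarrow> \<bar>\<Phi> w us\<bar> \<le> B"
      "\<And>w us. w \<in> {0..1} \<Longrightarrow> us \<in> space replicas \<Longrightarrow> \<bar>\<Psi> w us\<bar> \<le> C"
  note [measurable (raw)] = measurable_2[OF m(1)] measurable_2[OF m(2)]
  show ?thesis by (rule testI[OF _ order_trans[OF abs_triangle_ineq add_mono[OF b(1) b(2)]]]) measurable
qed

lemma test_const: "test (\<lambda>w us. c)"
  by (rule testI[where B="\<bar>c\<bar>"]) auto

lemma test_sum: "finite I \<Longrightarrow> (\<And>i. i \<in> I \<Longrightarrow> test (\<Phi> i)) \<Longrightarrow> test (\<lambda>w us. \<Sum>i\<in>I. \<Phi> i w us)"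
  by (induction I rule: finite_induct) (auto intro: test_add test_const)

lemma test_monomial: "(\<And>L. L \<in> set Ls \<Longrightarrow> set L \<subseteq> {1..}) \<Longrightarrow> test (monomial Ls)"
  by (rule testI[OF monomial_test])

sublocale UR: pair_prob_space unif replicas ..

lemma U_integrable: "test \<Phi> \<Longrightarrow> integrable (unif \<Otimes>\<^sub>M replicas) (\<lambda>z. \<Phi> (fst z) (snd z))"
proof (elim testE)
  fix B assume "(\<lambda>(w, us). \<Phi> w us) \<in> borel_measurable (unif \<Otimes>\<^sub>M replicas)"
    and "\<And>w us. w \<in> {0..1} \<Longrightarrow> us \<in> space replicas \<Longrightarrow> \<bar>\<Phi> w us\<bar> \<le> B"
  then show ?thesis by (intro UR.integrable_bounded[where B=B]) (auto simp: case_prod_unfold space_pair_measure)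
qed

lemma U_add: "test \<Phi> \<Longrightarrow> test \<Psi> \<Longrightarrow> U (\<lambda>w us. \<Phi> w us + \<Psi> w us) = U \<Phi> + U \<Psi>"
  unfolding U_def by (intro Bochner_Integration.integral_add U_integrable)

lemma U_cmult: "U (\<lambda>w us. c * \<Phi> w us) = c * U \<Phi>"
  unfolding U_def by simp

lemma U_sum: "finite I \<Longrightarrow> (\<And>i. i \<in> I \<Longrightarrow> test (\<Phi> i)) \<Longrightarrow> U (\<lambda>w us. \<Sum>i\<in>I. \<Phi> i w us) = (\<Sum>i\<in>I. U (\<Phi> i))"
  unfolding U_def by (intro Bochner_Integration.integral_sum U_integrable)

lemma U_bound: "test \<Phi> \<Longrightarrow> (\<And>w us. w \<in> {0..1} \<Longrightarrow> us \<in> space replicas \<Longrightarrow> \<bar>\<Phi> w us\<bar> \<le> B) \<Longrightarrow> \<bar>U \<Phi>\<bar> \<le> B"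
proof -
  assume t: "test \<Phi>" and b: "\<And>w us. w \<in> {0..1} \<Longrightarrow> us \<in> space replicas \<Longrightarrow> \<bar>\<Phi> w us\<bar> \<le> B"
  obtain us where "us \<in> space replicas" using R.not_empty by blast
  from order_trans[OF abs_ge_zero b[OF _ this, of 0]] have "0 \<le> B" by simp
  then show ?thesis
    unfolding U_def using t b by (intro UR.abs_integral_le) (auto simp: case_prod_unfold space_pair_measure test_def)
qed

lemma randomness_U:
  assumes "test \<Phi>" shows "(\<integral>(w, _, _, _, us, _). \<Phi> w us \<partial>randomness P) = U \<Phi>"
  using preserving_integral[OF proj_wus, of "\<lambda>z. \<Phi> (fst z) (snd z)"] assms
  by (simp add: U_def test_def case_prod_unfold)

definition Kp :: "nat \<Rightarrow> nat \<Rightarrow> real \<Rightarrow> (nat \<Rightarrow> real) \<Rightarrow> real" where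
  "Kp p l w us = overlap \<sigma> w (us l) (us 1) ^ p"

lemma Kp_monomial: "Kp p l = monomial (replicate p [l, 1])"
  by (intro ext) (simp add: Kp_def monomial_overlap_power)

lemma test_Kp: "1 \<le> l \<Longrightarrow> test (Kp p l)"
  unfolding Kp_monomial by (rule test_monomial) auto

text \<open>The Ghirlanda--Guerra identity for \<open>\<Phi>\<close> says that \<open>\<Phi>\<close>
  is orthogonal to \<open>W\<close>. In this form it is visibly linear in \<open>\<Phi>\<close>, as
  the approximation argument requires.\<close>

definition W :: "nat \<Rightarrow> nat \<Rightarrow> real \<Rightarrow> (nat \<Rightarrow> real) \<Rightarrow> real" where
  "W p n w us = Kp p (Suc n) w us + (- (1 / real n) * U (Kp p 2) + (\<Sum>l\<in>{2..n}. - (1 / real n) * Kp p l w us))"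

lemma test_cmult: "test \<Phi> \<Longrightarrow> test (\<lambda>w us. c * \<Phi> w us)"
  by (rule test_mult[OF test_const])

lemma test_W: "test (W p n)"
  unfolding W_def by (intro test_add test_sum test_cmult test_Kp test_const) auto

lemma U_W:
  assumes \<Phi>: "test \<Phi>"
  shows "U (\<lambda>w us. \<Phi> w us * W p n w us) = U (\<lambda>w us. \<Phi> w us * Kp p (Suc n) w us)
    - (1 / real n * U \<Phi> * U (Kp p 2) + 1 / real n * (\<Sum>l=2..n. U (\<lambda>w us. \<Phi> w us * Kp p l w us)))"
proof -
  have a: "test (\<lambda>w us. \<Phi> w us * Kp p (Suc n) w us)" by (intro test_mult \<Phi> test_Kp) auto
  have b: "test (\<lambda>w us. (- (1 / real n) * U (Kp p 2)) * \<Phi> w us)" by (intro test_cmult \<Phi>)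
  have c: "test (\<lambda>w us. - (1 / real n) * (\<Phi> w us * Kp p l w us))" if "l \<in> {2..n}" for l
    using that by (intro test_cmult test_mult \<Phi> test_Kp) auto
  have "U (\<lambda>w us. \<Phi> w us * W p n w us) = U (\<lambda>w us. \<Phi> w us * Kp p (Suc n) w us
      + ((- (1 / real n) * U (Kp p 2)) * \<Phi> w us + (\<Sum>l\<in>{2..n}. - (1 / real n) * (\<Phi> w us * Kp p l w us))))"
    by (rule arg_cong[where f=U], intro ext) (simp add: W_def algebra_simps sum_distrib_left sum_negf)
  also have "\<dots> = U (\<lambda>w us. \<Phi> w us * Kp p (Suc n) w us)
      + ((- (1 / real n) * U (Kp p 2)) * U \<Phi> + (\<Sum>l\<in>{2..n}. - (1 / real n) * U (\<lambda>w us. \<Phi> w us * Kp p l w us)))"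
    by (simp only: U_add[OF a test_add[OF b test_sum[OF finite_atLeastAtMost c]]] U_add[OF b test_sum[OF finite_atLeastAtMost c]]
      U_sum[OF finite_atLeastAtMost c] U_cmult)
  finally show ?thesis by (simp add: sum_distrib_left sum_negf)
qed

definition overlaps :: "nat \<Rightarrow> (nat \<Rightarrow> nat list) \<Rightarrow> real \<Rightarrow> (nat \<Rightarrow> real) \<Rightarrow> nat \<Rightarrow> real" where
  "overlaps m L w us = (\<lambda>j. if j < m then multi_overlap \<sigma> w us (L j) else 0)"

lemma overlaps_cube:
  assumes L: "\<And>j. j < m \<Longrightarrow> set (L j) \<subseteq> {1..}" and w: "w \<in> {0..1}" and us: "us \<in> space replicas"
  shows "overlaps m L w us \<in> {x. \<forall>j. x j \<in> {-1..1}}"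
proof -
  have "\<bar>multi_overlap \<sigma> w us (L j)\<bar> \<le> 1" if "j < m" for j
    using monomial_test(2)[of "[L j]" w us] L[OF that] w us by (simp add: monomial_def)
  then show ?thesis unfolding overlaps_def by (auto simp: abs_le_iff minus_le_iff)
qed

lemma test_continuous:
  assumes L: "\<And>j. j < m \<Longrightarrow> set (L j) \<subseteq> {1..}" and F: "continuous_on UNIV F"
  shows "test (\<lambda>w us. F (overlaps m L w us))"
proof -
  let ?S = "{x :: nat \<Rightarrow> real. \<forall>j. x j \<in> {-1..1}}"
  have "bounded (F ` ?S)"
    by (intro compact_imp_bounded compact_continuous_image compact_cube continuous_on_subset[OF F]) auto
  then obtain B where B: "\<bar>F x\<bar> \<le> B" if "x \<in> ?S" for x unfolding bounded_iff by auto
  have [measurable]: "(\<lambda>z. overlaps m L (fst z) (snd z)) \<in> borel_measurable (unif \<Otimes>\<^sub>M replicas)"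
  proof (rule measurable_coordinatewise_then_product)
    fix j show "(\<lambda>z. overlaps m L (fst z) (snd z) j) \<in> borel_measurable (unif \<Otimes>\<^sub>M replicas)"
      using monomial_test(1)[of "[L j]"] L[of j] by (cases "j < m") (auto simp: overlaps_def monomial_def case_prod_unfold)
  qed
  have [measurable]: "F \<in> borel_measurable borel" by (rule borel_measurable_continuous_onI[OF F])
  show ?thesis
  proof (rule testI[OF _ B[OF overlaps_cube[OF L]]])
    show "(\<lambda>(w, us). F (overlaps m L w us)) \<in> borel_measurable (unif \<Otimes>\<^sub>M replicas)"
      unfolding case_prod_unfold by measurable
  qed auto
qed

text \<open>Stone--Weierstrass, applied to the multiplier ring of the continuous functions that annihilate \<open>W\<close>
  together with all their products with monomials.\<close>

lemma annihilation:
  assumes mono: "\<And>Ls. (\<And>L. L \<in> set Ls \<Longrightarrow> set L \<subseteq> {1..n}) \<Longrightarrow> U (\<lambda>w us. monomial Ls w us * W p n w us) = 0"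
    and L: "\<And>j. j < m \<Longrightarrow> set (L j) \<subseteq> {1..n}" and F: "continuous_on UNIV F"
  shows "U (\<lambda>w us. F (overlaps m L w us) * W p n w us) = 0"
proof -
  let ?S = "{x :: nat \<Rightarrow> real. \<forall>j. x j \<in> {-1..1}}"
  let ?V = "\<lambda>f. U (\<lambda>w us. f (overlaps m L w us) * W p n w us)"
  have L': "set (L j) \<subseteq> {1..}" if "j < m" for j using L[OF that] by auto
  have tF: "test (\<lambda>w us. f (overlaps m L w us) * W p n w us)" if "continuous_on UNIV f" for f
    by (rule test_mult[OF test_continuous[OF L' that] test_W])
  have cprod: "continuous_on UNIV (\<lambda>x. \<Prod>j\<leftarrow>js. x j :: real)" for js :: "nat list"
    by (induction js) (auto intro!: continuous_on_mult)
  define A where "A = {f. continuous_on UNIV f \<and> (\<forall>js. ?V (\<lambda>x. (\<Prod>j\<leftarrow>js. x j) * f x) = 0)}"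
  \<comment> \<open>\<open>A\<close> is a vector space stable under multiplication by coordinates,
    but not evidently under products. Its multipliers form a ring by construction, contain the
    constants and the coordinates, and lie in \<open>A\<close> because \<open>1\<close>
    does.\<close>
  define R where "R = {f. continuous_on UNIV f \<and> (\<forall>h\<in>A. (\<lambda>x. f x * h x) \<in> A)}"
  have one: "(\<lambda>_. 1) \<in> A"
  proof -
    have "?V (\<lambda>x. (\<Prod>j\<leftarrow>js. x j)) = 0" for js
    proof (cases "\<forall>j\<in>set js. j < m")
      case True
      then have "(\<Prod>j\<leftarrow>js. overlaps m L w us j) = monomial (map L js) w us" for w us
        unfolding overlaps_def monomial_def by (auto simp: o_def intro!: arg_cong[where f=prod_list])
      moreover have "U (\<lambda>w us. monomial (map L js) w us * W p n w us) = 0"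
        by (rule mono) (use True L in auto)
      ultimately show ?thesis by simp
    next
      \<comment> \<open>Coordinates from \<open>m\<close> on vanish in \<open>overlaps\<close>, and
        with them the whole product.\<close>
      case False
      then obtain j where "j \<in> set js" "\<not> j < m" by auto
      then have "(\<Prod>j\<leftarrow>js. overlaps m L w us j) = 0" for w us
        by (force simp: prod_list_zero_iff overlaps_def)
      then show ?thesis by (simp add: U_def)
    qed
    then show ?thesis by (simp add: A_def)
  qed
  have A_add: "(\<lambda>x. f x + h x) \<in> A" if "f \<in> A" "h \<in> A" for f h
  proof -
    have "?V (\<lambda>x. (\<Prod>j\<leftarrow>js. x j) * (f x + h x)) = 0" for js
    proof -
      have c: "continuous_on UNIV (\<lambda>x. (\<Prod>j\<leftarrow>js. x j) * f x)" "continuous_on UNIV (\<lambda>x. (\<Prod>j\<leftarrow>js. x j) * h x)"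
        using that cprod by (auto simp: A_def intro!: continuous_on_mult)
      show ?thesis using U_add[OF tF[OF c(1)] tF[OF c(2)]] that by (simp add: A_def algebra_simps)
    qed
    then show ?thesis using that by (auto simp: A_def intro!: continuous_on_add)
  qed
  have A_cmult: "(\<lambda>x. c * f x) \<in> A" if "f \<in> A" for c f
  proof -
    have "?V (\<lambda>x. (\<Prod>j\<leftarrow>js. x j) * (c * f x)) = c * ?V (\<lambda>x. (\<Prod>j\<leftarrow>js. x j) * f x)" for js
      unfolding U_cmult[symmetric] by (simp add: ac_simps)
    then show ?thesis using that by (auto simp: A_def intro!: continuous_on_mult)
  qed
  have A_coord: "(\<lambda>x. x j * f x) \<in> A" if "f \<in> A" for j f
  proof -
    have "?V (\<lambda>x. (\<Prod>j\<leftarrow>js. x j) * (x j * f x)) = ?V (\<lambda>x. (\<Prod>j\<leftarrow>j # js. x j) * f x)" for js by (simp add: ac_simps)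
    then show ?thesis using that unfolding A_def by (auto intro!: continuous_on_mult simp del: list.map)
  qed
  interpret R: function_ring_on R ?S
  proof
    show "compact ?S" by (rule compact_cube)
    show "continuous_on ?S f" if "f \<in> R" for f using that by (auto simp: R_def intro: continuous_on_subset)
    show "(\<lambda>x. f x + h x) \<in> R" if "f \<in> R" "h \<in> R" for f h
      using that A_add by (auto simp: R_def distrib_right intro!: continuous_on_add)
    show "(\<lambda>x. f x * h x) \<in> R" if "f \<in> R" "h \<in> R" for f h
      using that by (auto simp: R_def mult.assoc intro!: continuous_on_mult)
    show "(\<lambda>_. c) \<in> R" for c using A_cmult by (auto simp: R_def)
    show "\<exists>f\<in>R. f x \<noteq> f y" if "x \<noteq> y" for x y
    proof -
      obtain j where "x j \<noteq> y j" using \<open>x \<noteq> y\<close> by auto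
      moreover have "(\<lambda>x. x j) \<in> R" using A_coord by (auto simp: R_def)
      ultimately show ?thesis by (intro bexI[of _ "\<lambda>x. x j"])
    qed
  qed
  have VR: "?V f = 0" if "f \<in> R" for f
  proof -
    have "(\<lambda>x. f x * 1) \<in> A" using that one unfolding R_def by fast
    then show ?thesis unfolding A_def by (auto dest: spec[of _ "[]"])
  qed
  obtain B where B: "\<And>w us. w \<in> {0..1} \<Longrightarrow> us \<in> space replicas \<Longrightarrow> \<bar>W p n w us\<bar> \<le> B"
    using test_W[of p n] by (elim testE) blast
  have le: "\<bar>?V F\<bar> \<le> e * B" if e: "0 < e" for e
  proof -
    obtain f where f: "f \<in> R" and close: "\<And>x. x \<in> ?S \<Longrightarrow> \<bar>F x - f x\<bar> < e"
      using R.Stone_Weierstrass_basic[OF continuous_on_subset[OF F] e] by auto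
    have cf: "continuous_on UNIV (\<lambda>x. - f x)" using f by (auto simp: R_def intro: continuous_on_minus)
    have V_minus: "?V (\<lambda>x. - f x) = 0"
      using U_cmult[of "-1" "\<lambda>w us. f (overlaps m L w us) * W p n w us"] VR[OF f] by simp
    have eq: "?V F = U (\<lambda>w us. (F (overlaps m L w us) - f (overlaps m L w us)) * W p n w us)"
      using U_add[OF tF[OF F] tF[OF cf]] V_minus by (simp add: algebra_simps)
    show ?thesis unfolding eq
    proof (rule U_bound)
      show "test (\<lambda>w us. (F (overlaps m L w us) - f (overlaps m L w us)) * W p n w us)"
        using tF[of "\<lambda>x. F x - f x"] F f by (auto simp: R_def intro: continuous_on_diff)
      fix w :: real and us assume a: "w \<in> {0..1}" "us \<in> space replicas"
      have "overlaps m L w us \<in> ?S" by (rule overlaps_cube[OF L' a])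
      from abs_mult_le_real[OF less_imp_le[OF close[OF this]] B[OF a]]
      show "\<bar>(F (overlaps m L w us) - f (overlaps m L w us)) * W p n w us\<bar> \<le> e * B" .
    qed
  qed
  show ?thesis
  proof (rule ccontr)
    assume n0: "?V F \<noteq> 0"
    have "0 \<le> B" using le[of 1] by linarith
    \<comment> \<open>The tolerance is chosen so that \<open>e * B\<close> stays strictly below
      \<open>|?V F|\<close>, also when \<open>B = 0\<close>.\<close>
    have "\<bar>?V F\<bar> \<le> \<bar>?V F\<bar> / (2 * (B + 1)) * B" using n0 \<open>0 \<le> B\<close> by (intro le) auto
    also have "\<dots> = \<bar>?V F\<bar> * (B / (2 * (B + 1)))" by simp
    also have "\<dots> < \<bar>?V F\<bar> * 1" using n0 \<open>0 \<le> B\<close> by (intro mult_strict_left_mono) (auto simp: divide_simps)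
    finally show False by simp
  qed
qed

lemma ghirlanda_guerra_iff:
  "ghirlanda_guerra \<sigma> P \<longleftrightarrow> (\<forall>p\<ge>1. \<forall>n\<ge>1. \<forall>m L F.
     (\<forall>j<m. L j \<noteq> [] \<and> set (L j) \<subseteq> {1..n}) \<and> continuous_on UNIV F \<and> bounded (range F) \<longrightarrow>
     U (\<lambda>w us. F (overlaps m L w us) * W p n w us) = 0)"
  unfolding ghirlanda_guerra_def Let_def
proof (intro all_cong1 imp_cong refl)
  fix p n m :: nat and L :: "nat \<Rightarrow> nat list" and F :: "(nat \<Rightarrow> real) \<Rightarrow> real"
  assume a: "(\<forall>j<m. L j \<noteq> [] \<and> set (L j) \<subseteq> {1..n}) \<and> continuous_on UNIV F \<and> bounded (range F)"
  have L: "set (L j) \<subseteq> {1..}" if "j < m" for j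
  proof -
    have "set (L j) \<subseteq> {1..n}" using a that by blast
    then show ?thesis by auto
  qed
  have tF: "test (\<lambda>w us. F (overlaps m L w us))" using a by (intro test_continuous L) auto
  have R: "multi_overlap \<sigma> w us [1, l] ^ p = Kp p l w us" for w us l
    by (simp add: Kp_def multi_overlap_pair overlap_sym)
  have FK: "(\<integral>(w, _, _, _, us, _). F (overlaps m L w us) * Kp p l w us \<partial>randomness P) = U (\<lambda>w us. F (overlaps m L w us) * Kp p l w us)"
    if "1 \<le> l" for l by (rule randomness_U[OF test_mult[OF tF test_Kp[OF that]]])
  have "((\<integral>(w, _, _, _, us, _). F (overlaps m L w us) * Kp p (n + 1) w us \<partial>randomness P) =
        1 / real n * (\<integral>(w, _, _, _, us, _). F (overlaps m L w us) \<partial>randomness P) *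
          (\<integral>(w, _, _, _, us, _). Kp p 2 w us \<partial>randomness P) +
        1 / real n * (\<Sum>l=2..n. \<integral>(w, _, _, _, us, _). F (overlaps m L w us) * Kp p l w us \<partial>randomness P))
    \<longleftrightarrow> U (\<lambda>w us. F (overlaps m L w us) * W p n w us) = 0"
    unfolding randomness_U[OF tF] U_W[OF tF] using FK[of "n + 1"] randomness_U[OF test_Kp[of 2 p]] FK by (simp add: Suc_eq_plus1)
  then show "((\<integral>(w, _, _, _, us, _). F (\<lambda>j. if j < m then multi_overlap \<sigma> w us (L j) else 0) * multi_overlap \<sigma> w us [1, n + 1] ^ p \<partial>randomness P) =
        1 / real n * (\<integral>(w, _, _, _, us, _). F (\<lambda>j. if j < m then multi_overlap \<sigma> w us (L j) else 0) \<partial>randomness P) *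
          (\<integral>(w, _, _, _, us, _). multi_overlap \<sigma> w us [1, 2] ^ p \<partial>randomness P) +
        1 / real n * (\<Sum>l=2..n. \<integral>(w, _, _, _, us, _). F (\<lambda>j. if j < m then multi_overlap \<sigma> w us (L j) else 0) * multi_overlap \<sigma> w us [1, l] ^ p \<partial>randomness P))
    \<longleftrightarrow> U (\<lambda>w us. F (overlaps m L w us) * W p n w us) = 0"
    unfolding R overlaps_def .
qed

definition gap :: "nat \<Rightarrow> real" where
  "gap p = 2 * U (\<lambda>w us. Kp p 2 w us * Kp p 3 w us) - U (\<lambda>w us. Kp p 2 w us * Kp p 2 w us) - (U (Kp p 2))\<^sup>2"

lemma invariant_tilt: "invariance \<sigma> P g \<Longrightarrow> 1 \<le> p \<Longrightarrow> 0 < t \<Longrightarrow> invariant_tilt \<sigma> P g p t"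
  by (intro invariant_tilt.intro tilt.intro tilt_axioms.intro invariant_tilt_axioms.intro spin_axioms)

lemma monomial_Kp: "monomial (Ls @ replicate p [l, 1]) w us = monomial Ls w us * Kp p l w us"
  by (simp add: monomial_append Kp_monomial)

lemma tilted_variance_gap:
  assumes "invariance \<sigma> P g" "1 \<le> p" "0 < t"
  shows "tilted_variance \<sigma> P g p t = 1 + t\<^sup>2 * gap p"
proof -
  have "monomial (replicate p [k, 1] @ replicate p [l, 1]) = (\<lambda>w us. Kp p k w us * Kp p l w us)" for k l
    by (intro ext) (simp add: monomial_append Kp_monomial)
  then show ?thesis
    using invariant_tilt.tilted_variance_formula[OF invariant_tilt[OF assms]] by (simp add: gap_def Kp_monomial[symmetric])
qed

lemma bounded_imp_gap_zero:
  assumes "invariance \<sigma> P g" "1 \<le> p" and b: "bounded ((\<lambda>t. tilted_variance \<sigma> P g p t) ` {0<..})"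
  shows "gap p = 0"
proof (rule ccontr)
  assume g: "gap p \<noteq> 0"
  obtain B where B: "\<And>t. 0 < t \<Longrightarrow> \<bar>tilted_variance \<sigma> P g p t\<bar> \<le> B" using b by (auto simp: bounded_iff)
  \<comment> \<open>Chosen such that \<open>t^2 * |gap p| = B + 2\<close>, one more than the bound
    \<open>B\<close> on the variance permits.\<close>
  define t where "t = sqrt ((B + 2) / \<bar>gap p\<bar>)"
  have B0: "0 \<le> B" using B[of 1] by linarith
  then have t: "0 < t" "t\<^sup>2 * \<bar>gap p\<bar> = B + 2" using g by (simp_all add: t_def)
  have "B + 2 = \<bar>t\<^sup>2 * gap p\<bar>" using t by (simp add: abs_mult)
  also have "\<dots> \<le> B + 1" using B[OF t(1)] tilted_variance_gap[OF assms(1,2) t(1)] by linarith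
  finally show False by simp
qed

lemma gap_zero_imp_annihilation:
  assumes inv: "invariance \<sigma> P g" and p: "1 \<le> p" and gap: "gap p = 0" and n: "1 \<le> n"
    and Ls: "\<And>L. L \<in> set Ls \<Longrightarrow> set L \<subseteq> {1..n}"
  shows "U (\<lambda>w us. monomial Ls w us * W p n w us) = 0"
proof -
  have mK: "monomial (Ls @ replicate p [l, 1]) = (\<lambda>w us. monomial Ls w us * Kp p l w us)" for l
    by (intro ext) (rule monomial_Kp)
  have tL: "test (monomial Ls)"
  proof (rule test_monomial)
    show "set L \<subseteq> {1..}" if "L \<in> set Ls" for L using Ls[OF that] by auto
  qed
  define D where "D = U (monomial Ls) * U (Kp p 2) + (\<Sum>l\<in>{2..n}. U (\<lambda>w us. monomial Ls w us * Kp p l w us))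
    - real n * U (\<lambda>w us. monomial Ls w us * Kp p (Suc n) w us)"
  have D: "t * \<bar>D\<bar> \<le> 1" if t: "0 < t" for t
    using invariant_tilt.discrepancy_bound[OF invariant_tilt[OF inv p t], where Ls=Ls and n=n, OF Ls n] tilted_variance_gap[OF inv p t] gap
    by (simp add: D_def mK Kp_monomial[symmetric])
  \<comment> \<open>The bound holds for every \<open>t > 0\<close>; at \<open>t = 2 / |D|\<close> it
    would read \<open>2 \<le> 1\<close>.\<close>
  have "D = 0"
  proof (rule ccontr)
    assume "D \<noteq> 0"
    then show False using D[of "2 / \<bar>D\<bar>"] by simp
  qed
  \<comment> \<open>\<open>D\<close> is \<open>- n\<close> times the mean in question.\<close>
  then show ?thesis unfolding U_W[OF tL] D_def using n by (simp add: field_simps)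
qed

lemma ghirlanda_guerra_imp_gap_zero:
  assumes gg: "ghirlanda_guerra \<sigma> P" and p: "1 \<le> p" shows "gap p = 0"
proof -
  \<comment> \<open>A power of a coordinate is unbounded on real sequences. Clipping to
    \<open>[-1, 1]\<close> does not change it at overlaps and gives a function that
    \<open>ghirlanda_guerra\<close> admits.\<close>
  define F where "F x = (max (- 1) (min 1 (x 0))) ^ p" for x :: "nat \<Rightarrow> real"
  have cF: "continuous_on UNIV F" unfolding F_def by (intro continuous_intros continuous_on_product_coordinates)
  have bF: "bounded (range F)"
  proof -
    have "\<bar>F x\<bar> \<le> 1" for x unfolding F_def power_abs by (rule power_le_one) auto
    then show ?thesis by (auto simp: bounded_iff)
  qed
  have "U (\<lambda>w us. F (overlaps 1 (\<lambda>_. [2, 1]) w us) * W p 2 w us) = 0"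
    using gg[unfolded ghirlanda_guerra_iff, rule_format, of p 2 1 "\<lambda>_. [2, 1]" F] p cF bF by simp
  moreover have "F (overlaps 1 (\<lambda>_. [2, 1]) w us) = Kp p 2 w us" if "w \<in> {0..1}" "us \<in> space replicas" for w us
    using overlap_bound[OF that(1) replicas_space[OF that(2), of 2] replicas_space[OF that(2), of 1]]
    by (simp add: F_def overlaps_def multi_overlap_pair Kp_def abs_le_iff minus_le_iff)
  then have "U (\<lambda>w us. F (overlaps 1 (\<lambda>_. [2, 1]) w us) * W p 2 w us) = U (\<lambda>w us. Kp p 2 w us * W p 2 w us)"
    unfolding U_def by (intro Bochner_Integration.integral_cong refl) (auto simp: space_pair_measure)
  ultimately have "U (\<lambda>w us. Kp p 2 w us * W p 2 w us) = 0" by simp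
  \<comment> \<open>By \<open>U_W\<close> this mean is \<open>gap p / 2\<close>.\<close>
  then show ?thesis
    using U_W[OF test_Kp[of 2 p], of p 2] by (simp add: gap_def power2_eq_square)
qed

end

theorem theorem7:
  fixes \<sigma> :: "real \<Rightarrow> real \<Rightarrow> real \<Rightarrow> real"
    and P :: "'a measure"
    and g :: "nat \<Rightarrow> real \<Rightarrow> real \<Rightarrow> 'a \<Rightarrow> real"
  assumes "(\<lambda>(w, u, v). \<sigma> w u v) \<in> borel_measurable (unif \<Otimes>\<^sub>M unif \<Otimes>\<^sub>M unif)"
    and "\<And>w u v. w \<in> {0..1} \<Longrightarrow> u \<in> {0..1} \<Longrightarrow> v \<in> {0..1} \<Longrightarrow> \<sigma> w u v \<in> {-1..1}"
    and "overlap_gaussian_family \<sigma> P g"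
    and "invariance \<sigma> P g"
  shows "(ghirlanda_guerra \<sigma> P \<longleftrightarrow>
            (\<forall>p\<ge>1. bounded ((\<lambda>t. tilted_variance \<sigma> P g p t) ` {0<..}))) \<and>
         (\<forall>p\<ge>1. bounded ((\<lambda>t. tilted_variance \<sigma> P g p t) ` {0<..}) \<longrightarrow>
            (\<forall>t>0. tilted_variance \<sigma> P g p t = 1))"
proof -
  interpret spin \<sigma> P g using assms(1-3) by unfold_locales
  note inv = assms(4)
  have one: "tilted_variance \<sigma> P g p t = 1" if "1 \<le> p" "gap p = 0" "0 < t" for p t
    using tilted_variance_gap[OF inv that(1,3)] that(2) by simp
  have bounded: "bounded ((\<lambda>t. tilted_variance \<sigma> P g p t) ` {0<..}) \<longleftrightarrow> gap p = 0" if p: "1 \<le> p" for p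
  proof
    assume "gap p = 0"
    then show "bounded ((\<lambda>t. tilted_variance \<sigma> P g p t) ` {0<..})" using one[OF p] by (auto simp: bounded_iff)
  qed (rule bounded_imp_gap_zero[OF inv p])
  have "ghirlanda_guerra \<sigma> P" if gap: "\<And>p. 1 \<le> p \<Longrightarrow> gap p = 0"
    unfolding ghirlanda_guerra_iff
  proof (intro allI impI, elim conjE)
    fix p n m :: nat and L :: "nat \<Rightarrow> nat list" and F :: "(nat \<Rightarrow> real) \<Rightarrow> real"
    assume p: "1 \<le> p" and n: "1 \<le> n" and L: "\<forall>j<m. L j \<noteq> [] \<and> set (L j) \<subseteq> {1..n}" and F: "continuous_on UNIV F"
    show "U (\<lambda>w us. F (overlaps m L w us) * W p n w us) = 0"
      using L by (intro annihilation[OF gap_zero_imp_annihilation[OF inv p gap[OF p] n] _ F]) auto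
  qed
  then show ?thesis using bounded one ghirlanda_guerra_imp_gap_zero by blast
qed

end
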